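(* If there exists a relaxed compensator $(H(\cdot),K(\cdot))\in\Lambda[0,T]\times\Lambda[0,T]$ for Problem (MF-LQ), then the system of Riccati equations (argument $t$ suppressed) $$\left\{\begin{aligned}&\dot P+PA+A^\top P+C^\top PC+Q-\Gamma(P)^\top[D^\top PD+R]\Gamma(P)=0,\quad t\in[0,T],\\&P(T)=G,\\&D^\top PD+R\gg0\end{aligned}\right.$$ and $$\left\{\begin{aligned}&\dot{\widehat P}+\widehat P\widehat A+\widehat A^\top\widehat P+\widehat C^\top P\widehat C+\widehat Q-\widehat\Gamma(P,\widehat P)^\top[\widehat D^\top P\widehat D+\widehat R]\widehat\Gamma(P,\widehat P)=0,\quad t\in[0,T],\\&\widehat P(T)=\widehat G,\\&\widehat D^\top P\widehat D+\widehat R\gg0\end{aligned}\right.$$ admits a unique pair of solutions $(P(\cdot),\widehat P(\cdot))$ taking values in $\mathbb S^n\times\mathbb S^n$. Moreover, for the initial state $x\in\mathbb R^n$, the unique optimal pair $(X^*(\cdot),u^*(\cdot))$ of Problem (MF-LQ) admits the feedback form $$u^*=\Gamma(P)\big(X^*-\mathbb E[X^*]\big)+\widehat\Gamma(P,\widehat P)\,\mathbb E[X^*],\quad t\in[0,T],$$ where $X^*(\cdot)$ is determined by $$\left\{\begin{aligned}dX^*=&\big\{(A+B\Gamma(P))(X^*-\mathbb E[X^*])+(\widehat A+\widehat B\widehat\Gamma(P,\widehat P))\mathbb E[X^*]\big\}dt\\&+\big\{(C+D\Gamma(P))(X^*-\mathbb E[X^*])+(\widehat C+\widehat D\widehat\Gamma(P,\widehat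 P))\mathbb E[X^*]\big\}dW(t),\quad t\in[0,T],\\ X^*(0)=&\,x.\end{aligned}\right.$$
   Context: Setting. Fix $T>0$ and positive integers $n,m$. $(\Omega,\mathcal F,\mathbb P,\mathbb F)$ is a complete filtered probability space carrying a one-dimensional standard Brownian motion $W(\cdot)$, with $\mathbb F=\{\mathcal F_t\}$ its natural filtration augmented by all $\mathbb P$-null sets. $\mathbb S^n$ is the set of symmetric $n\times n$ real matrices. For a Euclidean or matrix space $\mathbb H$: $L^\infty(0,T;\mathbb H)$ is the space of $\mathbb H$-valued (deterministic) continuous functions $\varphi$ with $\mathrm{esssup}_{t\in[0,T]}|\varphi(t)|<\infty$; $L^2_{\mathbb F}(0,T;\mathbb H)$ is the space of $\mathbb F$-progressively measurable $\mathbb H$-valued processes with $\mathbb E\int_0^T|\varphi(t)|^2dt<\infty$; $L^2_{\mathbb F}(\Omega;C([0,T];\mathbb H))$ is the space of $\mathbb F$-progressively measurable processes with a.s. continuous paths and $\mathbb E[\sup_{t\in[0,T]}|\varphi(t)|^2]<\infty$. Equalities of processes in $L^2_{\mathbb F}(0,T;\mathbb H)$ are understood $dt\otimes\mathbb P$-a.e. Admissible controls: $\mathscr U[0,T]=L^2_{\mathbb F}(0,T;\mathbb R^m)$. Coefficients: $A,\widetilde A,C,\widetilde C\in L^\infty(0,T;\mathbb R^{n\times n})$, $B,\widetilde B,D,\widetilde D\in L^\infty(0,T;\mathbb R^{n\times m})$, $Q,\widetilde Q\in L^\infty(0,T;\mathbb S^n)$, $S,\widetilde S\in L^\infty(0,T;\mathbb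 R^{n\times m})$, $R,\widetilde R\in L^\infty(0,T;\mathbb S^m)$, $G,\widetilde G\in\mathbb S^n$ (no definiteness is assumed). Write $\widehat F=F+\widetilde F$ for each $F\in\{A,B,C,D,Q,S,R,G\}$. State equation: for $x\in\mathbb R^n$, $u\in\mathscr U[0,T]$, $X(\cdot)=X(\cdot;x,u(\cdot))\in L^2_{\mathbb F}(\Omega;C([0,T];\mathbb R^n))$ is the unique solution of $$dX=\{AX+\widetilde A\,\mathbb E[X]+Bu+\widetilde B\,\mathbb E[u]\}dt+\{CX+\widetilde C\,\mathbb E[X]+Du+\widetilde D\,\mathbb E[u]\}dW(t),\quad X(0)=x.$$ Cost functional: $$\begin{aligned}J(x;u(\cdot))=\mathbb E\Big\{&\int_0^T\big[\langle QX,X\rangle+\langle\widetilde Q\,\mathbb E[X],\mathbb E[X]\rangle+2\langle Su,X\rangle+2\langle\widetilde S\,\mathbb E[u],\mathbb E[X]\rangle+\langle Ru,u\rangle+\langle\widetilde R\,\mathbb E[u],\mathbb E[u]\rangle\big]dt\\&+\langle GX(T),X(T)\rangle+\langle\widetilde G\,\mathbb E[X(T)],\mathbb E[X(T)]\rangle\Big\}.\end{aligned}$$ Problem (MF-LQ): find $u^*\in\mathscr U[0,T]$ with $J(x;u^*(\cdot))=\inf_{u\in\mathscr U[0,T]}J(x;u(\cdot))$ (finite). Such $u^*$ is an optimal control, and $(X^*,u^* )$ with $X^*=X(\cdot;x,u^*(\cdot))$ is an optimal pair. Feedback maps: for $P,\widehat P\in\mathbb S^n$, $$\begin{aligned}\Gamma(t,P)&=-[D^\top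 PD+R]^{-1}[PB+C^\top PD+S]^\top,\\ \widehat\Gamma(t,P,\widehat P)&=-[\widehat D^\top P\widehat D+\widehat R]^{-1}[\widehat P\widehat B+\widehat C^\top P\widehat D+\widehat S]^\top,\end{aligned}$$ with coefficients evaluated at $t$; $\Gamma(P)$, $\widehat\Gamma(P,\widehat P)$ denote $\Gamma(t,P(t))$, $\widehat\Gamma(t,P(t),\widehat P(t))$. Solutions of Riccati equations are continuously differentiable functions on $[0,T]$. Relaxed compensator: $\Lambda[0,T]$ is the set of functions $F:[0,T]\to\mathbb S^n$ of the form $F(t)=F(0)+\int_0^tf(s)ds$ with $f\in L^\infty(0,T;\mathbb S^n)$. For $(H,K)\in\Lambda[0,T]\times\Lambda[0,T]$ let $$\begin{aligned}&Q^{H,K}=\dot H+HA+A^\top H+C^\top HC+Q,&&\widehat Q^{H,K}=\dot K+K\widehat A+\widehat A^\top K+\widehat C^\top H\widehat C+\widehat Q,\\&S^{H,K}=HB+C^\top HD+S,&&\widehat S^{H,K}=K\widehat B+\widehat C^\top H\widehat D+\widehat S,\\&R^{H,K}=D^\top HD+R,&&\widehat R^{H,K}=\widehat D^\top H\widehat D+\widehat R,\\&G^{H,K}=G-H(T),&&\widehat G^{H,K}=\widehat G-K(T),\end{aligned}$$ and $\mathbf Q^{H,K}=\begin{pmatrix}Q^{H,K}&O\\O&\widehat Q^{H,K}\end{pmatrix}$, and likewise $\mathbf S^{H,K},\mathbf R^{H,K},\mathbf G^{H,K}$ (block diagonal with the unhatted and hatted entries). For a symmetric-matrix-valued function $f$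 on $[0,T]$, $f(\cdot)\ge0$ means $f(t)$ is positive semidefinite for a.e. $t$, and $f(\cdot)\gg0$ means there is a constant $\delta>0$ with $f(\cdot)-\delta I\ge0$. $(H,K)$ is called a relaxed compensator for Problem (MF-LQ) if $$\begin{pmatrix}\mathbf Q^{H,K}(\cdot)&\mathbf S^{H,K}(\cdot)\\\mathbf S^{H,K}(\cdot)^\top&\mathbf R^{H,K}(\cdot)\end{pmatrix}\ge0,\quad\mathbf R^{H,K}(\cdot)\gg0,\quad\mathbf G^{H,K}\ge0.$$ *)

theory Defs
  imports "HOL-Probability.Probability"
begin

section \<open>Deterministic functions and matrices\<close>

text \<open>
  Functions on \<open>[0,T]\<close> are represented by total functions on the reals; their values outside
  \<open>[0,T]\<close> are irrelevant. \<open>Linf\<close> follows the convention that the members of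
  \<open>L\<^sup>\<infinity>(0,T;H)\<close> are continuous; the bound is then automatic and is kept only
  because it is part of the definition.
\<close>

definition Linf :: "real \<Rightarrow> (real \<Rightarrow> 'a::real_normed_vector) \<Rightarrow> bool" where
  "Linf T f \<longleftrightarrow> continuous_on {0..T} f \<and>
     esssup (restrict_space lborel {0..T}) (\<lambda>t. ereal (norm (f t))) < \<infinity>"

definition symm :: "real^'a^'a \<Rightarrow> bool" where
  "symm N \<longleftrightarrow> transpose N = N"

definition Linf_symm :: "real \<Rightarrow> (real \<Rightarrow> real^'a^'a) \<Rightarrow> bool" where
  "Linf_symm T f \<longleftrightarrow> Linf T f \<and> (\<forall>t\<in>{0..T}. symm (f t))"

definition psd :: "real^'a^'a \<Rightarrow> bool" where
  "psd N \<longleftrightarrow> symm N \<and> (\<forall>v. 0 \<le> v \<bullet> (N *v v))"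

definition psd_on :: "real \<Rightarrow> (real \<Rightarrow> real^'a^'a) \<Rightarrow> bool" where
  "psd_on T f \<longleftrightarrow> (AE t in lborel. t \<in> {0..T} \<longrightarrow> psd (f t))"

text \<open>Note that \<open>mat \<delta>\<close> is \<open>\<delta>\<close> times the identity matrix.\<close>

definition uniformly_pd_on :: "real \<Rightarrow> (real \<Rightarrow> real^'a^'a) \<Rightarrow> bool" where
  "uniformly_pd_on T f \<longleftrightarrow> (\<exists>\<delta>>0. psd_on T (\<lambda>t. f t - mat \<delta>))"

text \<open>
  \<open>block_mat N11 N12 N21 N22\<close> is the 2-by-2 block matrix with these blocks; rows and columns are
  indexed by disjoint sums. A \<open>p\<close>-by-\<open>q\<close> matrix has type \<open>real^'q^'p\<close>.
\<close>

definition block_mat ::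
  "real^'c^'a \<Rightarrow> real^'d^'a \<Rightarrow> real^'c^'b \<Rightarrow> real^'d^'b \<Rightarrow> real^('c + 'd)^('a + 'b)" where
  "block_mat N11 N12 N21 N22 = (\<chi> i j.
     case i of
       Inl a \<Rightarrow> (case j of Inl c \<Rightarrow> N11 $ a $ c | Inr d \<Rightarrow> N12 $ a $ d)
     | Inr b \<Rightarrow> (case j of Inl c \<Rightarrow> N21 $ b $ c | Inr d \<Rightarrow> N22 $ b $ d))"

definition diag_block :: "real^'c^'a \<Rightarrow> real^'d^'b \<Rightarrow> real^('c + 'd)^('a + 'b)" where
  "diag_block N1 N2 = block_mat N1 0 0 N2"

text \<open>Derivative of a function on \<open>[0,T]\<close>, one-sided at the end points.\<close>

definition Dt :: "real \<Rightarrow> (real \<Rightarrow> 'a::real_normed_vector) \<Rightarrow> real \<Rightarrow> 'a" where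
  "Dt T f t = vector_derivative f (at t within {0..T})"

definition C1_on :: "real \<Rightarrow> (real \<Rightarrow> 'a::real_normed_vector) \<Rightarrow> bool" where
  "C1_on T f \<longleftrightarrow> (\<forall>t\<in>{0..T}. f differentiable (at t within {0..T})) \<and>
     continuous_on {0..T} (Dt T f)"


section \<open>Stochastic processes and the Ito integral\<close>

text \<open>Processes have type \<open>real \<Rightarrow> 'w \<Rightarrow> 'a\<close> (time first). Standard Brownian motion on \<open>[0,T]\<close>:\<close>

definition brownian_motion :: "'w measure \<Rightarrow> real \<Rightarrow> (real \<Rightarrow> 'w \<Rightarrow> real) \<Rightarrow> bool" where
  "brownian_motion M T W \<longleftrightarrow>
     (\<forall>t\<in>{0..T}. W t \<in> borel_measurable M) \<and>
     (AE \<omega> in M. W 0 \<omega> = 0) \<and>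
     (AE \<omega> in M. continuous_on {0..T} (\<lambda>t. W t \<omega>)) \<and>
     (\<forall>s t. 0 \<le> s \<and> s < t \<and> t \<le> T \<longrightarrow>
        distributed M lborel (\<lambda>\<omega>. W t \<omega> - W s \<omega>) (\<lambda>y. ennreal (normal_density 0 (sqrt (t - s)) y))) \<and>
     (\<forall>(k::nat) \<tau>. (\<forall>i\<le>k. \<tau> i \<in> {0..T}) \<and> (\<forall>i<k. \<tau> i \<le> \<tau> (Suc i)) \<longrightarrow>
        prob_space.indep_vars M (\<lambda>_. borel) (\<lambda>i \<omega>. W (\<tau> (Suc i)) \<omega> - W (\<tau> i) \<omega>) {..<k})"

text \<open>
  Natural filtration augmented by all null sets. As \<open>M\<close> will be complete, \<open>null_sets M\<close> contains
  all subsets of measurable null sets. Only the \<sigma>-algebra of \<open>filt M W t\<close> is ever used.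
\<close>

definition filt :: "'w measure \<Rightarrow> (real \<Rightarrow> 'w \<Rightarrow> real) \<Rightarrow> real \<Rightarrow> 'w measure" where
  "filt M W t = sigma (space M)
     ({W s -` B \<inter> space M | s B. s \<in> {0..t} \<and> B \<in> sets borel} \<union> null_sets M)"

definition progressive ::
  "'w measure \<Rightarrow> real \<Rightarrow> (real \<Rightarrow> 'w \<Rightarrow> real) \<Rightarrow> (real \<Rightarrow> 'w \<Rightarrow> 'a::topological_space) \<Rightarrow> bool" where
  "progressive M T W \<phi> \<longleftrightarrow>
     (\<forall>t\<in>{0..T}. (\<lambda>(s, \<omega>). \<phi> s \<omega>) \<in> borel_measurable (restrict_space borel {0..t} \<Otimes>\<^sub>M filt M W t))"

definition L2F ::
  "'w measure \<Rightarrow> real \<Rightarrow> (real \<Rightarrow> 'w \<Rightarrow> real) \<Rightarrow> (real \<Rightarrow> 'w \<Rightarrow> 'a::real_normed_vector) set" where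
  "L2F M T W = {\<phi>. progressive M T W \<phi> \<and>
     (\<integral>\<^sup>+\<omega>. (\<integral>\<^sup>+t\<in>{0..T}. ennreal ((norm (\<phi> t \<omega>))\<^sup>2) \<partial>lborel) \<partial>M) < \<infinity>}"

definition L2FC ::
  "'w measure \<Rightarrow> real \<Rightarrow> (real \<Rightarrow> 'w \<Rightarrow> real) \<Rightarrow> (real \<Rightarrow> 'w \<Rightarrow> 'a::real_normed_vector) set" where
  "L2FC M T W = {\<phi>. progressive M T W \<phi> \<and>
     (AE \<omega> in M. continuous_on {0..T} (\<lambda>t. \<phi> t \<omega>)) \<and>
     (\<integral>\<^sup>+\<omega>. (SUP t\<in>{0..T}. ennreal ((norm (\<phi> t \<omega>))\<^sup>2)) \<partial>M) < \<infinity>}"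

text \<open>
  A simple process is given by \<open>(N, \<tau>, \<xi>)\<close> and has the value \<open>\<xi> i\<close>, which is bounded and
  measurable at time \<open>\<tau> i\<close>, on the interval \<open>(\<tau> i, \<tau> (i+1)]\<close> for \<open>i < N\<close>.
\<close>

definition is_simple ::
  "'w measure \<Rightarrow> real \<Rightarrow> (real \<Rightarrow> 'w \<Rightarrow> real) \<Rightarrow>
     nat \<times> (nat \<Rightarrow> real) \<times> (nat \<Rightarrow> 'w \<Rightarrow> 'a::real_normed_vector) \<Rightarrow> bool" where
  "is_simple M T W = (\<lambda>(N, \<tau>, \<xi>).
     (\<forall>i\<le>N. \<tau> i \<in> {0..T}) \<and> (\<forall>i<N. \<tau> i \<le> \<tau> (Suc i)) \<and>
     (\<forall>i<N. \<xi> i \<in> borel_measurable (filt M W (\<tau> i))) \<and>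
     (\<exists>b. \<forall>i<N. \<forall>\<omega>\<in>space M. norm (\<xi> i \<omega>) \<le> b))"

definition simple_val ::
  "nat \<times> (nat \<Rightarrow> real) \<times> (nat \<Rightarrow> 'w \<Rightarrow> 'a::real_normed_vector) \<Rightarrow> real \<Rightarrow> 'w \<Rightarrow> 'a" where
  "simple_val = (\<lambda>(N, \<tau>, \<xi>) t \<omega>. \<Sum>i<N. indicat_real {\<tau> i <.. \<tau> (Suc i)} t *\<^sub>R \<xi> i \<omega>)"

definition simple_integral ::
  "(real \<Rightarrow> 'w \<Rightarrow> real) \<Rightarrow> nat \<times> (nat \<Rightarrow> real) \<times> (nat \<Rightarrow> 'w \<Rightarrow> 'a::real_normed_vector) \<Rightarrow>
     real \<Rightarrow> 'w \<Rightarrow> 'a" where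
  "simple_integral W = (\<lambda>(N, \<tau>, \<xi>) t \<omega>.
     \<Sum>i<N. (W (min t (\<tau> (Suc i))) \<omega> - W (min t (\<tau> i)) \<omega>) *\<^sub>R \<xi> i \<omega>)"

text \<open>
  \<open>has_ito_integral M T W Z I\<close>: the process \<open>I\<close> is (a continuous version of) the Ito integral
  of \<open>Z\<close> in \<open>L2F\<close> against \<open>W\<close>, \<open>I t\<close> being the integral over \<open>[0,t]\<close>. It is the usual
  mean-square limit of integrals of simple processes approximating \<open>Z\<close>; by the Ito isometry it does
  not depend on the approximating sequence, and \<open>I\<close> is unique up to indistinguishability.
\<close>

definition has_ito_integral ::
  "'w measure \<Rightarrow> real \<Rightarrow> (real \<Rightarrow> 'w \<Rightarrow> real) \<Rightarrow>
     (real \<Rightarrow> 'w \<Rightarrow> 'a::real_normed_vector) \<Rightarrow> (real \<Rightarrow> 'w \<Rightarrow> 'a) \<Rightarrow> bool" where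
  "has_ito_integral M T W Z I \<longleftrightarrow> Z \<in> L2F M T W \<and> I \<in> L2FC M T W \<and>
     (\<exists>\<phi>. (\<forall>k::nat. is_simple M T W (\<phi> k)) \<and>
        (\<lambda>k. \<integral>\<^sup>+\<omega>. (\<integral>\<^sup>+t\<in>{0..T}. ennreal ((norm (simple_val (\<phi> k) t \<omega> - Z t \<omega>))\<^sup>2) \<partial>lborel) \<partial>M)
          \<longlonglongrightarrow> 0 \<and>
        (\<forall>t\<in>{0..T}.
          (\<lambda>k. \<integral>\<^sup>+\<omega>. ennreal ((norm (simple_integral W (\<phi> k) t \<omega> - I t \<omega>))\<^sup>2) \<partial>M) \<longlonglongrightarrow> 0))"

text \<open>\<open>X\<close> solves \<open>dX = b dt + Z dW\<close>, \<open>X(0) = x\<close>; the processes \<open>b\<close> and \<open>Z\<close> may involve \<open>X\<close>.\<close>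

definition solves_sde ::
  "'w measure \<Rightarrow> real \<Rightarrow> (real \<Rightarrow> 'w \<Rightarrow> real) \<Rightarrow> real^'n \<Rightarrow>
     (real \<Rightarrow> 'w \<Rightarrow> real^'n) \<Rightarrow> (real \<Rightarrow> 'w \<Rightarrow> real^'n) \<Rightarrow> (real \<Rightarrow> 'w \<Rightarrow> real^'n) \<Rightarrow> bool" where
  "solves_sde M T W x b Z X \<longleftrightarrow> X \<in> L2FC M T W \<and>
     (\<exists>I. has_ito_integral M T W Z I \<and>
        (AE \<omega> in M. \<forall>t\<in>{0..T}. X t \<omega> = x + (LINT s:{0..t}|lborel. b s \<omega>) + I t \<omega>))"

definition mean :: "'w measure \<Rightarrow> (real \<Rightarrow> 'w \<Rightarrow> 'a::{banach, second_countable_topology}) \<Rightarrow> real \<Rightarrow> 'a" where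
  "mean M X t = (LINT \<omega>|M. X t \<omega>)"

definition indistinguishable ::
  "'w measure \<Rightarrow> real \<Rightarrow> (real \<Rightarrow> 'w \<Rightarrow> 'a) \<Rightarrow> (real \<Rightarrow> 'w \<Rightarrow> 'a) \<Rightarrow> bool" where
  "indistinguishable M T X Y \<longleftrightarrow> (AE \<omega> in M. \<forall>t\<in>{0..T}. X t \<omega> = Y t \<omega>)"

definition eq_dtdP ::
  "'w measure \<Rightarrow> real \<Rightarrow> (real \<Rightarrow> 'w \<Rightarrow> 'a) \<Rightarrow> (real \<Rightarrow> 'w \<Rightarrow> 'a) \<Rightarrow> bool" where
  "eq_dtdP M T u v \<longleftrightarrow>
     (AE z in lborel \<Otimes>\<^sub>M M. fst z \<in> {0..T} \<longrightarrow> u (fst z) (snd z) = v (fst z) (snd z))"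


section \<open>The mean-field linear-quadratic problem\<close>

text \<open>The prefix \<open>c\<close> marks the plain coefficients, \<open>t\<close> those with a tilde, \<open>h\<close> those with a hat.\<close>

record ('n, 'm) mflq =
  cA :: "real \<Rightarrow> real^('n::finite)^'n"   tA :: "real \<Rightarrow> real^'n^'n"
  cB :: "real \<Rightarrow> real^('m::finite)^'n"   tB :: "real \<Rightarrow> real^'m^'n"
  cC :: "real \<Rightarrow> real^'n^'n"   tC :: "real \<Rightarrow> real^'n^'n"
  cD :: "real \<Rightarrow> real^'m^'n"   tD :: "real \<Rightarrow> real^'m^'n"
  cQ :: "real \<Rightarrow> real^'n^'n"   tQ :: "real \<Rightarrow> real^'n^'n"
  cS :: "real \<Rightarrow> real^'m^'n"   tS :: "real \<Rightarrow> real^'m^'n"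
  cR :: "real \<Rightarrow> real^'m^'m"   tR :: "real \<Rightarrow> real^'m^'m"
  cG :: "real^'n^'n"   tG :: "real^'n^'n"

definition hA :: "('n::finite, 'm::finite) mflq \<Rightarrow> real \<Rightarrow> real^'n^'n" where "hA c t = cA c t + tA c t"
definition hB :: "('n::finite, 'm::finite) mflq \<Rightarrow> real \<Rightarrow> real^'m^'n" where "hB c t = cB c t + tB c t"
definition hC :: "('n::finite, 'm::finite) mflq \<Rightarrow> real \<Rightarrow> real^'n^'n" where "hC c t = cC c t + tC c t"
definition hD :: "('n::finite, 'm::finite) mflq \<Rightarrow> real \<Rightarrow> real^'m^'n" where "hD c t = cD c t + tD c t"
definition hQ :: "('n::finite, 'm::finite) mflq \<Rightarrow> real \<Rightarrow> real^'n^'n" where "hQ c t = cQ c t + tQ c t"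
definition hS :: "('n::finite, 'm::finite) mflq \<Rightarrow> real \<Rightarrow> real^'m^'n" where "hS c t = cS c t + tS c t"
definition hR :: "('n::finite, 'm::finite) mflq \<Rightarrow> real \<Rightarrow> real^'m^'m" where "hR c t = cR c t + tR c t"
definition hG :: "('n::finite, 'm::finite) mflq \<Rightarrow> real^'n^'n" where "hG c = cG c + tG c"

definition admissible_coeffs :: "real \<Rightarrow> ('n::finite, 'm::finite) mflq \<Rightarrow> bool" where
  "admissible_coeffs T c \<longleftrightarrow>
     Linf T (cA c) \<and> Linf T (tA c) \<and> Linf T (cC c) \<and> Linf T (tC c) \<and>
     Linf T (cB c) \<and> Linf T (tB c) \<and> Linf T (cD c) \<and> Linf T (tD c) \<and>
     Linf_symm T (cQ c) \<and> Linf_symm T (tQ c) \<and> Linf T (cS c) \<and> Linf T (tS c) \<and>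
     Linf_symm T (cR c) \<and> Linf_symm T (tR c) \<and> symm (cG c) \<and> symm (tG c)"

definition is_state ::
  "'w measure \<Rightarrow> real \<Rightarrow> (real \<Rightarrow> 'w \<Rightarrow> real) \<Rightarrow> ('n::finite, 'm::finite) mflq \<Rightarrow> real^'n \<Rightarrow>
     (real \<Rightarrow> 'w \<Rightarrow> real^'m) \<Rightarrow> (real \<Rightarrow> 'w \<Rightarrow> real^'n) \<Rightarrow> bool" where
  "is_state M T W c x u X \<longleftrightarrow> solves_sde M T W x
     (\<lambda>t \<omega>. cA c t *v X t \<omega> + tA c t *v mean M X t + cB c t *v u t \<omega> + tB c t *v mean M u t)
     (\<lambda>t \<omega>. cC c t *v X t \<omega> + tC c t *v mean M X t + cD c t *v u t \<omega> + tD c t *v mean M u t)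
     X"

text \<open>
  The state equation is well posed: for an admissible control there is a solution, unique up to
  indistinguishability. \<open>state\<close> picks a representative; the cost does not depend on which.
\<close>

definition state ::
  "'w measure \<Rightarrow> real \<Rightarrow> (real \<Rightarrow> 'w \<Rightarrow> real) \<Rightarrow> ('n::finite, 'm::finite) mflq \<Rightarrow> real^'n \<Rightarrow>
     (real \<Rightarrow> 'w \<Rightarrow> real^'m) \<Rightarrow> real \<Rightarrow> 'w \<Rightarrow> real^'n" where
  "state M T W c x u = (SOME X. is_state M T W c x u X)"

definition cost ::
  "'w measure \<Rightarrow> real \<Rightarrow> (real \<Rightarrow> 'w \<Rightarrow> real) \<Rightarrow> ('n::finite, 'm::finite) mflq \<Rightarrow> real^'n \<Rightarrow>
     (real \<Rightarrow> 'w \<Rightarrow> real^'m) \<Rightarrow> real" where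
  "cost M T W c x u = (let X = state M T W c x u; mX = mean M X; mu = mean M u in
     LINT \<omega>|M.
       (LINT t:{0..T}|lborel.
            (cQ c t *v X t \<omega>) \<bullet> X t \<omega> + (tQ c t *v mX t) \<bullet> mX t
          + 2 * ((cS c t *v u t \<omega>) \<bullet> X t \<omega>) + 2 * ((tS c t *v mu t) \<bullet> mX t)
          + (cR c t *v u t \<omega>) \<bullet> u t \<omega> + (tR c t *v mu t) \<bullet> mu t)
       + (cG c *v X T \<omega>) \<bullet> X T \<omega> + (tG c *v mX T) \<bullet> mX T)"

text \<open>Boundedness below expresses that the infimum over the admissible controls is finite.\<close>

definition optimal_control ::
  "'w measure \<Rightarrow> real \<Rightarrow> (real \<Rightarrow> 'w \<Rightarrow> real) \<Rightarrow> ('n::finite, 'm::finite) mflq \<Rightarrow> real^'n \<Rightarrow>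
     (real \<Rightarrow> 'w \<Rightarrow> real^'m) \<Rightarrow> bool" where
  "optimal_control M T W c x u \<longleftrightarrow> u \<in> L2F M T W \<and>
     bdd_below (cost M T W c x ` L2F M T W) \<and>
     cost M T W c x u = (INF v\<in>L2F M T W. cost M T W c x v)"

definition optimal_pair ::
  "'w measure \<Rightarrow> real \<Rightarrow> (real \<Rightarrow> 'w \<Rightarrow> real) \<Rightarrow> ('n::finite, 'm::finite) mflq \<Rightarrow> real^'n \<Rightarrow>
     (real \<Rightarrow> 'w \<Rightarrow> real^'n) \<Rightarrow> (real \<Rightarrow> 'w \<Rightarrow> real^'m) \<Rightarrow> bool" where
  "optimal_pair M T W c x X u \<longleftrightarrow> optimal_control M T W c x u \<and> is_state M T W c x u X"


section \<open>Riccati equations and feedback\<close>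

definition Gam :: "('n::finite, 'm::finite) mflq \<Rightarrow> real \<Rightarrow> real^'n^'n \<Rightarrow> real^'n^'m" where
  "Gam c t P =
     - (matrix_inv (transpose (cD c t) ** P ** cD c t + cR c t)
        ** transpose (P ** cB c t + transpose (cC c t) ** P ** cD c t + cS c t))"

definition hGam :: "('n::finite, 'm::finite) mflq \<Rightarrow> real \<Rightarrow> real^'n^'n \<Rightarrow> real^'n^'n \<Rightarrow> real^'n^'m" where
  "hGam c t P Ph =
     - (matrix_inv (transpose (hD c t) ** P ** hD c t + hR c t)
        ** transpose (Ph ** hB c t + transpose (hC c t) ** P ** hD c t + hS c t))"

definition riccati_P :: "real \<Rightarrow> ('n::finite, 'm::finite) mflq \<Rightarrow> (real \<Rightarrow> real^'n^'n) \<Rightarrow> bool" where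
  "riccati_P T c P \<longleftrightarrow>
     C1_on T P \<and> (\<forall>t\<in>{0..T}. symm (P t)) \<and>
     (\<forall>t\<in>{0..T}.
        Dt T P t + P t ** cA c t + transpose (cA c t) ** P t
        + transpose (cC c t) ** P t ** cC c t + cQ c t
        - transpose (Gam c t (P t)) ** (transpose (cD c t) ** P t ** cD c t + cR c t)
            ** Gam c t (P t) = 0) \<and>
     P T = cG c \<and>
     uniformly_pd_on T (\<lambda>t. transpose (cD c t) ** P t ** cD c t + cR c t)"

definition riccati_Ph ::
  "real \<Rightarrow> ('n::finite, 'm::finite) mflq \<Rightarrow> (real \<Rightarrow> real^'n^'n) \<Rightarrow> (real \<Rightarrow> real^'n^'n) \<Rightarrow> bool" where
  "riccati_Ph T c P Ph \<longleftrightarrow>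
     C1_on T Ph \<and> (\<forall>t\<in>{0..T}. symm (Ph t)) \<and>
     (\<forall>t\<in>{0..T}.
        Dt T Ph t + Ph t ** hA c t + transpose (hA c t) ** Ph t
        + transpose (hC c t) ** P t ** hC c t + hQ c t
        - transpose (hGam c t (P t) (Ph t)) ** (transpose (hD c t) ** P t ** hD c t + hR c t)
            ** hGam c t (P t) (Ph t) = 0) \<and>
     Ph T = hG c \<and>
     uniformly_pd_on T (\<lambda>t. transpose (hD c t) ** P t ** hD c t + hR c t)"

definition riccati_system ::
  "real \<Rightarrow> ('n::finite, 'm::finite) mflq \<Rightarrow> (real \<Rightarrow> real^'n^'n) \<Rightarrow> (real \<Rightarrow> real^'n^'n) \<Rightarrow> bool" where
  "riccati_system T c P Ph \<longleftrightarrow> riccati_P T c P \<and> riccati_Ph T c P Ph"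

definition closed_loop_state ::
  "'w measure \<Rightarrow> real \<Rightarrow> (real \<Rightarrow> 'w \<Rightarrow> real) \<Rightarrow> ('n::finite, 'm::finite) mflq \<Rightarrow>
     (real \<Rightarrow> real^'n^'n) \<Rightarrow> (real \<Rightarrow> real^'n^'n) \<Rightarrow> real^'n \<Rightarrow> (real \<Rightarrow> 'w \<Rightarrow> real^'n) \<Rightarrow> bool" where
  "closed_loop_state M T W c P Ph x X \<longleftrightarrow> solves_sde M T W x
     (\<lambda>t \<omega>. (cA c t + cB c t ** Gam c t (P t)) *v (X t \<omega> - mean M X t)
          + (hA c t + hB c t ** hGam c t (P t) (Ph t)) *v mean M X t)
     (\<lambda>t \<omega>. (cC c t + cD c t ** Gam c t (P t)) *v (X t \<omega> - mean M X t)
          + (hC c t + hD c t ** hGam c t (P t) (Ph t)) *v mean M X t)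
     X"


section \<open>Relaxed compensators\<close>

definition Lam :: "real \<Rightarrow> (real \<Rightarrow> real^'n^'n) set" where
  "Lam T = {F. (\<forall>t\<in>{0..T}. symm (F t)) \<and>
     (\<exists>f. Linf_symm T f \<and> (\<forall>t\<in>{0..T}. F t = F 0 + (LINT s:{0..t}|lborel. f s)))}"

context
  fixes T :: real and c :: "('n::finite, 'm::finite) mflq" and H K :: "real \<Rightarrow> real^'n^'n"
begin

definition "Q_HK t = Dt T H t + H t ** cA c t + transpose (cA c t) ** H t
  + transpose (cC c t) ** H t ** cC c t + cQ c t"
definition "hQ_HK t = Dt T K t + K t ** hA c t + transpose (hA c t) ** K t
  + transpose (hC c t) ** H t ** hC c t + hQ c t"
definition "S_HK t = H t ** cB c t + transpose (cC c t) ** H t ** cD c t + cS c t"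
definition "hS_HK t = K t ** hB c t + transpose (hC c t) ** H t ** hD c t + hS c t"
definition "R_HK t = transpose (cD c t) ** H t ** cD c t + cR c t"
definition "hR_HK t = transpose (hD c t) ** H t ** hD c t + hR c t"
definition "G_HK = cG c - H T"
definition "hG_HK = hG c - K T"

definition relaxed_compensator :: bool where
  "relaxed_compensator \<longleftrightarrow> H \<in> Lam T \<and> K \<in> Lam T \<and>
     psd_on T (\<lambda>t. block_mat
       (diag_block (Q_HK t) (hQ_HK t))             (diag_block (S_HK t) (hS_HK t))
       (transpose (diag_block (S_HK t) (hS_HK t))) (diag_block (R_HK t) (hR_HK t))) \<and>
     uniformly_pd_on T (\<lambda>t. diag_block (R_HK t) (hR_HK t)) \<and>
     psd (diag_block G_HK hG_HK)"

end

end

theory Submission imports Defs begin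

text \<open>The equation for \<open>P\<close>, and given \<open>P\<close> that for the second unknown, are Riccati equations of
deterministic type. A compensator bounds Kleinman's policy iteration, a decreasing sequence of solutions
of linear Lyapunov equations, from below; its limit solves the Riccati equation. Uniqueness follows from
comparison. For the second equation \<open>K\<close> is a compensator because \<open>P \<ge> H\<close>.

For the control problem, split \<open>X = (X - E X) + E X\<close>. Differentiating \<open>E \<langle>P (X - E X), X - E X\<rangle>\<close> and the
corresponding form of \<open>E X\<close>, and using that \<open>X - E X\<close> is orthogonal to deterministic processes, turns the
cost into \<open>\<langle>Ph(0) x, x\<rangle>\<close> plus the integral of two nonnegative squares, which vanish exactly along the
feedback. Instead of the Ito formula only second moments are used, and these follow from the
isometry and the martingale property of the Ito integral.\<close>


section \<open>Deterministic preliminaries\<close>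

lemma iterated_integral_bound:
  fixes d :: "nat => real => real"
  assumes K: "0 \<le> K"
    and int: "\<And>k. set_integrable lborel {0..T} (d k)"
    and d0: "\<And>t. t \<in> {0..T} ==> d 0 t \<le> C"
    and dS: "\<And>k t. t \<in> {0..T} ==> d (Suc k) t \<le> K * (LINT s:{0..t}|lborel. d k s)"
    and t: "t \<in> {0..T}"
  shows "d k t \<le> C * (K * t) ^ k / fact k"
  using t
proof (induction k arbitrary: t)
  case 0
  then show ?case using d0 by simp
next
  case (Suc k)
  then have t: "0 \<le> t" "t \<le> T" by auto
  have "(LINT s:{0..t}|lborel. d k s) \<le> (LINT s:{0..t}|lborel. C * (K * s) ^ k / fact k)"
  proof (rule set_integral_mono)
    show "set_integrable lborel {0..t} (d k)"
    by (rule set_integrable_subset[OF int[of k]]) (use t in auto)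
    show "set_integrable lborel {0..t} (%s. C * (K * s) ^ k / fact k)"
    by (intro borel_integrable_atLeastAtMost') (intro continuous_intros; simp)
    show "d k s \<le> C * (K * s) ^ k / fact k" if "s \<in> {0..t}" for s
    using Suc.IH[of s] that t by auto
  qed
  also have "\<dots> = (C * K ^ k / fact k) * (LINT s:{0..t}|lborel. s ^ k)"
    by (subst set_integral_mult_right[symmetric])
    (auto simp: power_mult_distrib intro!: set_lebesgue_integral_cong)
  also have "(LINT s:{0..t}|lborel. s ^ k) = t ^ Suc k / Suc k"
    using integral_power[of 0 t k] t by (simp add: set_lebesgue_integral_def mult.commute)
  finally have "K * (LINT s:{0..t}|lborel. d k s) \<le> K * ((C * K ^ k / fact k) * (t ^ Suc k / Suc k))"
    using K by (rule mult_left_mono)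
  also have "\<dots> = C * (K * t) ^ Suc k / fact (Suc k)"
    by (simp add: power_mult_distrib field_simps)
  finally show ?case using dS[OF Suc.prems, of k] by simp
qed

lemma gronwall_zero:
  fixes d :: "real => real"
  assumes K: "0 \<le> K"
    and int: "set_integrable lborel {0..T} d"
    and bd: "\<And>t. t \<in> {0..T} ==> d t \<le> C"
    and d: "\<And>t. t \<in> {0..T} ==> d t \<le> K * (LINT s:{0..t}|lborel. d s)"
    and t: "t \<in> {0..T}"
  shows "d t \<le> 0"
proof -
  have le: "d t \<le> C * ((K * t) ^ k / fact k)" for k
    using iterated_integral_bound[of K T "%_. d" C t k] assms by auto
  have "(%k. C * ((K * t) ^ k / fact k)) \<longlonglongrightarrow> C * 0"
    by (intro tendsto_mult tendsto_const summable_LIMSEQ_zero)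
    (use summable_exp[of "K * t"] in \<open>simp add: field_simps\<close>)
  then show ?thesis
    using le by (intro LIMSEQ_le_const[where a="d t"]) auto
qed

lemma ode_exists:
  fixes F :: "real => 'a::euclidean_space => 'a"
  assumes T: "0 \<le> T" and K: "0 \<le> K"
    and cont: "\<And>y. continuous_on {0..T} y ==> continuous_on {0..T} (%t. F t (y t))"
    and lip: "\<And>t x y. t \<in> {0..T} ==> norm (F t x - F t y) \<le> K * norm (x - y)"
  shows "\<exists>y. y 0 = y0 \<and> (\<forall>t\<in>{0..T}. (y has_vector_derivative F t (y t)) (at t within {0..T}))"
proof -
  define y where "y = rec_nat (%t. y0) (%_ y t. y0 + integral {0..t} (%s. F s (y s)))"
  have y0: "y 0 = (%t. y0)" and yS: "y (Suc k) = (%t. y0 + integral {0..t} (%s. F s (y k s)))" for k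
    by (simp_all add: y_def)
  have cy: "continuous_on {0..T} (y k)" for k
  proof (induction k)
    case (Suc k)
    show ?case unfolding yS
    by (intro continuous_intros indefinite_integral_continuous_1 integrable_continuous_interval cont Suc)
  qed (simp add: y0)
  have cF: "continuous_on {0..T} (%t. F t (y k t))" for k by (intro cont cy)
  define d where "d k t = norm (y (Suc k) t - y k t)" for k t
  have cd: "continuous_on {0..T} (d k)" for k unfolding d_def by (intro continuous_intros cy)
  have "compact (d 0 ` {0..T})" by (intro compact_continuous_image cd) auto
  then obtain C where C: "\<And>t. t \<in> {0..T} ==> d 0 t \<le> C"
    by (meson bdd_above_def bounded_imp_bdd_above compact_imp_bounded imageI)
  have C0: "0 \<le> C" using C[of 0] T by (auto simp: d_def intro: order_trans[OF norm_ge_zero])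
  have bound: "d k t \<le> C * (K * t) ^ k / fact k" if "t \<in> {0..T}" for k t
  proof (rule iterated_integral_bound[where T=T])
    show "0 \<le> K" "t \<in> {0..T}" by fact+
    show "d 0 t \<le> C" if "t \<in> {0..T}" for t by (rule C[OF that])
    show "set_integrable lborel {0..T} (d k)" for k
    by (intro borel_integrable_atLeastAtMost' cd)
    fix k t assume t: "t \<in> {0..T}"
    have sub: "{0..t} \<subseteq> {0..T}" using t by auto
    note ci = integrable_continuous_interval[OF continuous_on_subset[OF _ sub]]
    have "d (Suc k) t = norm (integral {0..t} (%s. F s (y (Suc k) s)) - integral {0..t} (%s. F s (y k s)))"
    by (simp add: d_def yS)
    also have "\<dots> = norm (integral {0..t} (%s. F s (y (Suc k) s) - F s (y k s)))"
    by (subst integral_diff) (auto intro!: ci cF)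
    also have "\<dots> \<le> integral {0..t} (%s. K * d k s)"
    proof (rule integral_norm_bound_integral)
    show "norm (F s (y (Suc k) s) - F s (y k s)) \<le> K * d k s" if "s \<in> {0..t}" for s
    using lip[of s] that sub by (auto simp: d_def)
    qed (intro ci continuous_intros cF cd)+
    also have "\<dots> = K * (LINT s:{0..t}|lborel. d k s)"
    by (subst set_borel_integral_eq_integral(2))
    (auto intro!: borel_integrable_atLeastAtMost' continuous_on_subset[OF cd sub])
    finally show "d (Suc k) t \<le> K * (LINT s:{0..t}|lborel. d k s)" .
  qed
  have unif: "uniform_limit {0..T} (%n t. \<Sum>k<n. y (Suc k) t - y k t)
    (%t. \<Sum>k. y (Suc k) t - y k t) sequentially"
  proof (rule Weierstrass_m_test[where M="%k. C * (K * T) ^ k / fact k"])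
    fix k t assume t: "t \<in> {0..T}"
    have "C * (K * t) ^ k / fact k \<le> C * (K * T) ^ k / fact k"
    using t K C0 by (intro divide_right_mono mult_left_mono power_mono) auto
    then show "norm (y (Suc k) t - y k t) \<le> C * (K * T) ^ k / fact k"
    using bound[OF t, of k] by (simp add: d_def)
  next
    show "summable (%k. C * (K * T) ^ k / fact k)"
    using summable_mult[OF summable_exp[of "K * T"], of C] by (simp add: field_simps)
  qed
  define Y where "Y t = y0 + (\<Sum>k. y (Suc k) t - y k t)" for t
  have yn: "y n t = y0 + (\<Sum>k<n. y (Suc k) t - y k t)" for n t
    by (induction n) (simp_all add: y0)
  have "uniform_limit {0..T} (%n t. y0 + (\<Sum>k<n. y (Suc k) t - y k t)) Y sequentially"
    unfolding Y_def[abs_def] by (intro uniform_limit_add uniform_limit_const unif)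
  then have lim: "uniform_limit {0..T} y Y sequentially"
    by (simp only: yn[symmetric])
  have cY: "continuous_on {0..T} Y"
    by (rule uniform_limit_theorem[OF _ lim]) (auto simp: cy)
  have limF: "uniform_limit {0..T} (%k t. F t (y k t)) (%t. F t (Y t)) sequentially"
  proof (rule uniform_limitI)
    fix e :: real assume e: "0 < e"
    have "\<forall>\<^sub>F n in sequentially. \<forall>t\<in>{0..T}. dist (y n t) (Y t) < e / (K + 1)"
    using uniform_limitD[OF lim, of "e / (K + 1)"] e K by simp
    then show "\<forall>\<^sub>F n in sequentially. \<forall>t\<in>{0..T}. dist (F t (y n t)) (F t (Y t)) < e"
    proof (eventually_elim, intro ballI)
    fix n t assume a: "\<forall>t\<in>{0..T}. dist (y n t) (Y t) < e / (K + 1)" and t: "t \<in> {0..T}"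
    have "dist (F t (y n t)) (F t (Y t)) \<le> K * dist (y n t) (Y t)"
    using lip[OF t] by (simp add: dist_norm)
    also have "\<dots> \<le> K * (e / (K + 1))" using a t K by (intro mult_left_mono) (auto intro: less_imp_le)
    also have "\<dots> < e" using e K by (simp add: field_simps)
    finally show "dist (F t (y n t)) (F t (Y t)) < e" .
    qed
  qed
  have Yint: "Y t = y0 + integral {0..t} (%s. F s (Y s))" if t: "t \<in> {0..T}" for t
  proof -
    have sub: "{0..t} \<subseteq> {0..T}" using t by auto
    have *: "uniform_limit {0..t} (%k t. F t (y k t)) (%t. F t (Y t)) sequentially"
    by (rule uniform_limit_on_subset[OF limF sub])
    obtain I J where IJ: "\<And>n. ((%s. F s (y n s)) has_integral I n) {0..t}"
    "((%s. F s (Y s)) has_integral J) {0..t}" "I \<longlonglongrightarrow> J"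
    using uniform_limit_integral[OF *] continuous_on_subset[OF cF sub] by (metis trivial_limit_sequentially)
    have "(%n. y (Suc n) t) \<longlonglongrightarrow> y0 + J"
    unfolding yS using IJ(3) IJ(1)[THEN integral_unique] by (auto intro!: tendsto_intros)
    moreover have "(%n. y (Suc n) t) \<longlonglongrightarrow> Y t"
    using tendsto_uniform_limitI[OF lim t] by (rule LIMSEQ_Suc)
    ultimately show ?thesis using IJ(2) LIMSEQ_unique integral_unique by metis
  qed
  have "(Y has_vector_derivative F t (Y t)) (at t within {0..T})" if t: "t \<in> {0..T}" for t
  proof -
    have "((%u. y0 + integral {0..u} (%s. F s (Y s))) has_vector_derivative 0 + F t (Y t)) (at t within {0..T})"
    by (intro has_vector_derivative_add has_vector_derivative_const
    integral_has_vector_derivative[OF cont[OF cY] t])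
    then show ?thesis
    by (simp only: add_0) (rule has_vector_derivative_transform[OF t _ , rotated], auto simp: Yint)
  qed
  moreover have "Y 0 = y0" using Yint[of 0] T by simp
  ultimately show ?thesis by blast
qed

lemma ode_exists_backward:
  fixes F :: "real => 'a::euclidean_space => 'a"
  assumes T: "0 \<le> T" and K: "0 \<le> K"
    and cont: "\<And>y. continuous_on {0..T} y ==> continuous_on {0..T} (%t. F t (y t))"
    and lip: "\<And>t x y. t \<in> {0..T} ==> norm (F t x - F t y) \<le> K * norm (x - y)"
  shows "\<exists>y. y T = y0 \<and> (\<forall>t\<in>{0..T}. (y has_vector_derivative F t (y t)) (at t within {0..T}))"
proof -
  have refl: "(%t. T - t) ` {0..T} = {0..T}"
    by (auto simp: image_iff intro!: bexI[of _ "T - _"])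
  have contr: "continuous_on {0..T} (%t. f (T - t))" if "continuous_on {0..T} f" for f :: "real => 'a"
    by (rule continuous_on_compose2[OF that]) (auto intro!: continuous_intros)
  have "\<exists>z. z 0 = y0 \<and> (\<forall>t\<in>{0..T}. (z has_vector_derivative - F (T - t) (z t)) (at t within {0..T}))"
  proof (rule ode_exists[OF T K, where F="%t x. - F (T - t) x"])
    fix z :: "real => 'a" assume "continuous_on {0..T} z"
    from contr[OF cont[OF contr[OF this]]]
    show "continuous_on {0..T} (%t. - F (T - t) (z t))" by (auto intro: continuous_intros)
  next
    fix t x y assume "t \<in> {0..T}"
    then show "norm (- F (T - t) x - - F (T - t) y) \<le> K * norm (x - y)"
    using lip[of "T - t" x y] by (simp add: norm_minus_commute)
  qed
  then obtain z where z: "z 0 = y0"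
    "\<And>t. t \<in> {0..T} ==> (z has_vector_derivative - F (T - t) (z t)) (at t within {0..T})" by blast
  have "((%t. z (T - t)) has_vector_derivative F t (z (T - t))) (at t within {0..T})" if t: "t \<in> {0..T}" for t
  proof -
    have "((z \<circ> (%t. T - t)) has_vector_derivative (-1) *\<^sub>R (- F (T - (T - t)) (z (T - t)))) (at t within {0..T})"
    proof (rule vector_diff_chain_within)
    show "((-) T has_vector_derivative - 1) (at t within {0..T})"
    by (auto intro!: derivative_eq_intros)
    show "(z has_vector_derivative - F (T - (T - t)) (z (T - t))) (at (T - t) within (-) T ` {0..T})"
    using z(2)[of "T - t"] t by (simp only: refl) auto
    qed
    then show ?thesis by (simp add: o_def)
  qed
  then show ?thesis using z(1) by (intro exI[of _ "%t. z (T - t)"]) auto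
qed

lemma inner_integral_triangle:
  fixes u v :: "real => 'a::euclidean_space"
  assumes u: "set_integrable lborel {0..t} u" and v: "set_integrable lborel {0..t} v"
  shows "set_integrable lborel {0..t} (%s. u s \<bullet> (LINT r:{0..s}|lborel. v r))"
    and "(LINT s:{0..t}|lborel. u s) \<bullet> (LINT s:{0..t}|lborel. v s) =
    (LINT s:{0..t}|lborel. u s \<bullet> (LINT r:{0..s}|lborel. v r) + (LINT r:{0..s}|lborel. u r) \<bullet> v s)"
proof -
  define U where "U s = indicat_real {0..t} s *\<^sub>R u s" for s
  define V where "V s = indicat_real {0..t} s *\<^sub>R v s" for s
  have iU: "integrable lborel U" and iV: "integrable lborel V"
    using u v by (auto simp: set_integrable_def U_def[abs_def] V_def[abs_def])
  have [measurable]: "U \<in> borel_measurable borel" "V \<in> borel_measurable borel"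
    using iU iV by (auto dest: borel_measurable_integrable)
  have gen: "integrable (lborel \<Otimes>\<^sub>M lborel) (%(x, y). F x \<bullet> G y)"
    if F: "integrable lborel F" and G: "integrable lborel G" for F G :: "real => 'a"
  proof -
    have [measurable]: "F \<in> borel_measurable borel" "G \<in> borel_measurable borel"
    using F G by (auto dest: borel_measurable_integrable)
    show ?thesis
    proof (rule Bochner_Integration.integrable_bound[where f="%(x, y). norm (F x) * norm (G y)"])
    show "integrable (lborel \<Otimes>\<^sub>M lborel) (%(x, y). norm (F x) * norm (G y))"
    proof (rule lborel_pair.Fubini_integrable)
    show "integrable lborel (%x. LINT y|lborel. norm (case (x, y) of (x, y) => norm (F x) * norm (G y)))"
    using F G by simp
    show "AE x in lborel. integrable lborel (%y. case (x, y) of (x, y) => norm (F x) * norm (G y))"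
    using G by simp
    qed measurable
    show "(%(x, y). F x \<bullet> G y) \<in> borel_measurable (lborel \<Otimes>\<^sub>M lborel)" by measurable
    show "AE x in lborel \<Otimes>\<^sub>M lborel. norm (case x of (x, y) => F x \<bullet> G y) \<le> norm (case x of (x, y) => norm (F x) * norm (G y))"
    by (auto simp: Cauchy_Schwarz_ineq2)
    qed
  qed
  note iUV = gen[OF iU iV]
  define lo where "lo = (%(x, y). if y \<le> x then U x \<bullet> V y else (0::real))"
  define hi where "hi = (%(x, y). if x < y then U x \<bullet> V y else (0::real))"
  have ilo: "integrable (lborel \<Otimes>\<^sub>M lborel) lo"
    by (rule Bochner_Integration.integrable_bound[OF iUV]) (auto simp: lo_def)
  have ihi: "integrable (lborel \<Otimes>\<^sub>M lborel) hi"
    by (rule Bochner_Integration.integrable_bound[OF iUV]) (auto simp: hi_def)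
  have in_lo: "(LINT y|lborel. lo (x, y)) = indicator {0..t} x *\<^sub>R (u x \<bullet> (LINT r:{0..x}|lborel. v r))" for x
  proof (cases "x \<in> {0..t}")
    case True
    have "(LINT y|lborel. lo (x, y)) = (LINT y|lborel. u x \<bullet> (indicator {0..x} y *\<^sub>R v y))"
    using True by (intro Bochner_Integration.integral_cong) (auto simp: lo_def U_def V_def indicator_def)
    also have "\<dots> = u x \<bullet> (LINT y|lborel. indicator {0..x} y *\<^sub>R v y)"
    proof (rule integral_inner_right)
    have "set_integrable lborel {0..x} v" by (rule set_integrable_subset[OF v]) (use True in auto)
    then show "u x \<noteq> 0 ==> integrable lborel (%y. indicat_real {0..x} y *\<^sub>R v y)" by (simp add: set_integrable_def)
    qed
    finally show ?thesis using True by (simp add: set_lebesgue_integral_def)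
  qed (simp add: lo_def U_def cong: if_cong)
  have in_hi: "(LINT x|lborel. hi (x, y)) = indicator {0..t} y *\<^sub>R ((LINT r:{0..y}|lborel. u r) \<bullet> v y)" for y
  proof (cases "y \<in> {0..t}")
    case True
    have "(LINT x|lborel. hi (x, y)) = (LINT x|lborel. (indicator {0..y} x *\<^sub>R u x) \<bullet> v y)"
    proof (rule integral_cong_AE)
    show "(%x. hi (x, y)) \<in> borel_measurable lborel" unfolding hi_def by simp
    have "set_integrable lborel {0..y} u" by (rule set_integrable_subset[OF u]) (use True in auto)
    then show "(%x. (indicator {0..y} x *\<^sub>R u x) \<bullet> v y) \<in> borel_measurable lborel"
    by (auto simp: set_integrable_def intro!: borel_measurable_inner simp del: inner_scaleR_left)
    show "AE x in lborel. hi (x, y) = (indicator {0..y} x *\<^sub>R u x) \<bullet> v y"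
    using AE_lborel_singleton[of y]
    by eventually_elim (use True in \<open>auto simp: hi_def U_def V_def indicator_def\<close>)
    qed
    also have "\<dots> = (LINT x|lborel. indicator {0..y} x *\<^sub>R u x) \<bullet> v y"
    proof (rule integral_inner_left)
    have "set_integrable lborel {0..y} u" by (rule set_integrable_subset[OF u]) (use True in auto)
    then show "v y \<noteq> 0 ==> integrable lborel (%x. indicat_real {0..y} x *\<^sub>R u x)" by (simp add: set_integrable_def)
    qed
    finally show ?thesis using True by (simp add: set_lebesgue_integral_def)
  qed (simp add: hi_def V_def cong: if_cong)
  have 1: "integrable lborel (%x. indicator {0..t} x *\<^sub>R (u x \<bullet> (LINT r:{0..x}|lborel. v r)))"
    using lborel_pair.integrable_fst'[OF ilo] by (simp add: in_lo)
  then show "set_integrable lborel {0..t} (%s. u s \<bullet> (LINT r:{0..s}|lborel. v r))"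
    by (simp add: set_integrable_def)
  have 2: "integrable lborel (%y. indicator {0..t} y *\<^sub>R ((LINT r:{0..y}|lborel. u r) \<bullet> v y))"
    using lborel_pair.integrable_snd[of "%x y. hi (x, y)"] ihi by (simp add: in_hi)
  have "(LINT s:{0..t}|lborel. u s) \<bullet> (LINT s:{0..t}|lborel. v s) = (LINT x|lborel. U x) \<bullet> (LINT y|lborel. V y)"
    by (simp add: set_lebesgue_integral_def U_def V_def)
  also have "\<dots> = (LINT x|lborel. U x \<bullet> (LINT y|lborel. V y))"
    using iU by (simp add: integral_inner_left)
  also have "\<dots> = (LINT x|lborel. (LINT y|lborel. U x \<bullet> V y))"
    using iV by (simp add: integral_inner_right)
  also have "\<dots> = integral\<^sup>L (lborel \<Otimes>\<^sub>M lborel) (%(x, y). U x \<bullet> V y)"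
    using lborel_pair.integral_fst'[OF iUV] by simp
  also have "\<dots> = integral\<^sup>L (lborel \<Otimes>\<^sub>M lborel) (%z. lo z + hi z)"
    by (rule Bochner_Integration.integral_cong) (auto simp: lo_def hi_def)
  also have "\<dots> = integral\<^sup>L (lborel \<Otimes>\<^sub>M lborel) lo + integral\<^sup>L (lborel \<Otimes>\<^sub>M lborel) hi"
    by (intro Bochner_Integration.integral_add ilo ihi)
  also have "integral\<^sup>L (lborel \<Otimes>\<^sub>M lborel) lo = (LINT x|lborel. indicator {0..t} x *\<^sub>R (u x \<bullet> (LINT r:{0..x}|lborel. v r)))"
    using lborel_pair.integral_fst'[OF ilo] by (simp add: in_lo)
  also have "integral\<^sup>L (lborel \<Otimes>\<^sub>M lborel) hi = (LINT y|lborel. indicator {0..t} y *\<^sub>R ((LINT r:{0..y}|lborel. u r) \<bullet> v y))"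
    using lborel_pair.integral_snd[of "%x y. hi (x, y)"] ihi by (simp add: in_hi)
  finally show "(LINT s:{0..t}|lborel. u s) \<bullet> (LINT s:{0..t}|lborel. v s) =
    (LINT s:{0..t}|lborel. u s \<bullet> (LINT r:{0..s}|lborel. v r) + (LINT r:{0..s}|lborel. u r) \<bullet> v s)"
    using 1 2 by (simp add: set_lebesgue_integral_def scaleR_add_right del: real_scaleR_def)
qed

section \<open>Matrices\<close>

interpretation mv: bounded_bilinear "(*v) :: real^'n^'m => real^'n => real^'m"
proof -
  have "bilinear ((*v) :: real^'n^'m => real^'n => real^'m)"
    unfolding bilinear_def
    by (auto intro!: linearI simp: matrix_vector_mult_add_rdistrib matrix_vector_right_distrib
    scaleR_matrix_vector_assoc matrix_vector_mult_scaleR)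
  then show "bounded_bilinear ((*v) :: real^'n^'m => real^'n => real^'m)"
    by (simp add: bilinear_conv_bounded_bilinear)
qed

interpretation mm: bounded_bilinear "(**) :: real^'n^'m => real^'k^'n => real^'k^'m"
proof -
  have "bilinear ((**) :: real^'n^'m => real^'k^'n => real^'k^'m)"
    unfolding bilinear_def
    by (auto intro!: linearI simp: matrix_matrix_mult_def vec_eq_iff sum_distrib_left sum.distrib
    algebra_simps)
  then show "bounded_bilinear ((**) :: real^'n^'m => real^'k^'n => real^'k^'m)"
    by (simp add: bilinear_conv_bounded_bilinear)
qed

lemma bounded_linear_transpose: "bounded_linear (transpose :: real^'n^'m => real^'m^'n)"
  by (subst linear_conv_bounded_linear[symmetric], rule linearI) (simp_all add: transpose_def vec_eq_iff)

lemmas continuous_on_transpose = bounded_linear.continuous_on[OF bounded_linear_transpose]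
lemmas transpose_add = linear_add[OF bounded_linear.linear[OF bounded_linear_transpose]]
lemmas transpose_diff = linear_diff[OF bounded_linear.linear[OF bounded_linear_transpose]]

lemmas continuous_matrix_intros = mv.continuous_on mm.continuous_on continuous_on_transpose

lemma inner_transpose: "(N *v x) \<bullet> y = x \<bullet> (transpose N *v y)" for N :: "real^'n^'m"
  by (metis dot_lmul_matrix inner_commute transpose_matrix_vector)

lemma symm_inner: "symm N ==> (N *v x) \<bullet> y = (N *v y) \<bullet> x"
  by (metis inner_commute inner_transpose symm_def)

lemma symm_quadratic_eqI:
  assumes "symm M" "symm N" and eq: "\<And>v. v \<bullet> (M *v v) = v \<bullet> (N *v v)"
  shows "M = N"
proof -
  have q: "v \<bullet> (M *v w) = v \<bullet> (N *v w)" for v w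
    using eq[of "v + w"] eq[of v] eq[of w] symm_inner[OF assms(1), of v w] symm_inner[OF assms(2), of v w]
    by (simp add: matrix_vector_right_distrib inner_add_left inner_add_right inner_commute)
  have "M *v w = N *v w" for w
  proof -
    have "(M *v w - N *v w) \<bullet> (M *v w - N *v w) = 0"
    using q[of "M *v w - N *v w" w] by (simp only: inner_diff_right[of "M *v w - N *v w"])
    then show ?thesis by simp
  qed
  then show ?thesis by (simp add: matrix_eq)
qed

lemma matrix_inv_right:
  "invertible N ==> N ** matrix_inv N = mat 1" for N :: "real^'n^'n"
  unfolding invertible_def matrix_inv_def by (metis (mono_tags, lifting) someI_ex)

lemma continuous_on_matrix_inv:
  fixes f :: "'a::topological_space => real^'n^'n"
  assumes cont: "continuous_on X f" and inv: "\<And>x. x \<in> X ==> invertible (f x)"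
  shows "continuous_on X (%x. matrix_inv (f x))"
proof -
  define g where "g x = (\<chi> k l. det (\<chi> i j. if j = k then (axis l 1 :: real^'n) $ i else f x $ i $ j) / det (f x))" for x
  have det: "continuous_on X (%x. det (h x))" if "\<And>i j. continuous_on X (%x. h x $ i $ j)" for h :: "'a => real^'n^'n"
    unfolding det_def by (intro continuous_intros that)
  have cf: "continuous_on X (%x. f x $ i $ j)" for i j
    by (intro continuous_intros cont)
  have d0: "det (f x) \<noteq> 0" if "x \<in> X" for x
    using inv[OF that] by (simp add: invertible_det_nz)
  have eq: "g x = matrix_inv (f x)" if x: "x \<in> X" for x
  proof -
    have "f x *v (matrix_inv (f x) *v axis l 1) = axis l 1" for l
    using matrix_inv_right[OF inv[OF x]] by (simp add: matrix_vector_mul_assoc)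
    from iffD1[OF cramer[OF d0[OF x]] this] have "matrix_inv (f x) *v axis l 1 = (\<chi> k. det (\<chi> i j. if j = k then (axis l 1 :: real^'n) $ i else f x $ i $ j) / det (f x))" for l
    by simp
    then show ?thesis
    by (simp add: g_def vec_eq_iff matrix_vector_mult_basis column_def)
  qed
  have cg: "continuous_on X g"
    unfolding g_def
  proof (intro continuous_on_vec_lambda continuous_intros det cf)
    fix i j k l
    show "continuous_on X (%x. if j = k then (axis l 1 :: real^'n) $ i else f x $ i $ j)"
    by (cases "j = k") (simp_all add: cf)
  qed (use d0 cont in auto)
  show ?thesis by (rule continuous_on_eq[OF cg eq])
qed

lemma invertible_if_quadratic_pos:
  fixes N :: "real^'n^'n"
  assumes "0 < \<delta>" and "\<And>y. \<delta> * (y \<bullet> y) \<le> y \<bullet> (N *v y)"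
  shows "invertible N"
proof -
  have "x = 0" if "N *v x = 0" for x
  proof -
    have "\<delta> * (x \<bullet> x) \<le> 0" using assms(2)[of x] that by simp
    then have "x \<bullet> x \<le> 0" using assms(1) by (simp only: mult_le_0_iff) auto
    then show ?thesis by (metis inner_ge_zero inner_eq_zero_iff order_antisym)
  qed
  then show ?thesis
    using matrix_left_invertible_ker[of N] invertible_left_inverse by blast
qed

lemma compact_family_bound:
  fixes L :: "'c::topological_space => 'a::euclidean_space => 'b::real_normed_vector"
  assumes X: "compact X" and lin: "\<And>t. t \<in> X ==> linear (L t)"
    and cont: "\<And>x. continuous_on X (%t. L t x)"
  shows "\<exists>K\<ge>0. \<forall>t\<in>X. \<forall>x. norm (L t x) \<le> K * norm x"
proof -
  have "\<exists>C\<ge>0. \<forall>t\<in>X. norm (L t b) \<le> C" for b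
  proof -
    have "bounded ((%t. L t b) ` X)"
    by (intro compact_imp_bounded compact_continuous_image cont X)
    then show ?thesis unfolding bounded_pos by (meson imageI less_imp_le)
  qed
  then obtain C where C: "\<And>b. 0 \<le> C b" "\<And>b t. t \<in> X ==> norm (L t b) \<le> C b" by metis
  show ?thesis
  proof (intro exI[of _ "\<Sum>b\<in>Basis. C b"] conjI ballI allI)
    show "0 \<le> (\<Sum>b\<in>Basis. C b)" by (intro sum_nonneg C)
    fix t x assume t: "t \<in> X"
    have "L t x = L t (\<Sum>b\<in>Basis. (x \<bullet> b) *\<^sub>R b)" by (simp add: euclidean_representation)
    also have "\<dots> = (\<Sum>b\<in>Basis. (x \<bullet> b) *\<^sub>R L t b)"
    by (simp add: linear_sum[OF lin[OF t]] linear_cmul[OF lin[OF t]])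
    also have "norm \<dots> \<le> (\<Sum>b\<in>Basis. norm x * C b)"
    by (rule order_trans[OF norm_sum sum_mono])
    (auto intro!: mult_mono C t Basis_le_norm)
    finally show "norm (L t x) \<le> (\<Sum>b\<in>Basis. C b) * norm x"
    by (simp add: sum_distrib_left mult.commute)
  qed
qed

lemma matrix_family_bound:
  assumes "continuous_on {a..b::real} (N :: real => real^'n^'m)"
  shows "\<exists>K\<ge>0. \<forall>t\<in>{a..b}. \<forall>x. norm (N t *v x) \<le> K * norm x"
  by (rule compact_family_bound)
    (auto intro!: continuous_matrix_intros assms continuous_intros linearI
    simp: matrix_vector_right_distrib matrix_vector_mult_scaleR)

lemma psd_form_zero:
  assumes sym: "symm N" and nn: "\<And>w. 0 \<le> w \<bullet> (N *v w)" and v: "v \<bullet> (N *v v) = 0"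
  shows "N *v v = 0"
proof (rule ccontr)
  define w where "w = N *v v"
  assume "N *v v \<noteq> 0"
  then have w: "0 < w \<bullet> w" by (simp add: w_def)
  define q where "q = w \<bullet> (N *v w)"
  have q: "0 \<le> q" unfolding q_def by (rule nn)
  define s where "s = - (w \<bullet> w) / (q + 1)"
  have "(v + s *\<^sub>R w) \<bullet> (N *v (v + s *\<^sub>R w)) = s * (2 * (w \<bullet> w) + s * q)"
    using v symm_inner[OF sym, of v w]
    by (simp add: matrix_vector_right_distrib matrix_vector_mult_scaleR inner_add_left inner_add_right
    w_def[symmetric] q_def inner_commute algebra_simps)
  moreover have "s < 0" using w q by (simp add: s_def divide_neg_pos)
  moreover have "2 * (w \<bullet> w) + s * q > 0"
  proof -
    have "(w \<bullet> w) * (q / (q + 1)) \<le> (w \<bullet> w) * 1" using w q by (intro mult_left_mono) auto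
    then have "- s * q \<le> w \<bullet> w" by (simp add: s_def)
    then show ?thesis using w by linarith
  qed
  ultimately show False using nn[of "v + s *\<^sub>R w"] by (metis mult_neg_pos not_le)
qed

section \<open>Lyapunov comparison\<close>

text \<open>If positivity failed for the perturbation \<open>F + \<epsilon> e\<^sup>\<lambda>\<^sup>(\<^sup>T\<^sup>-\<^sup>t\<^sup>) I\<close>, then at the last time at which it is
  not positive definite, it has a null vector, whose quadratic form would then have a negative derivative although
  it is positive at later times.\<close>

lemma lyapunov_nonneg:
  fixes F F' A C :: "real => real^'n^'n"
  assumes der: "\<And>t. t \<in> {0..T} ==> (F has_vector_derivative F' t) (at t within {0..T})"
    and sym: "\<And>t. t \<in> {0..T} ==> symm (F t)"
    and cA: "continuous_on {0..T} A" and cC: "continuous_on {0..T} C"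
    and le: "\<And>t v. t \<in> {0..T} ==>
    v \<bullet> (F' t *v v) + 2 * ((A t *v v) \<bullet> (F t *v v)) + (C t *v v) \<bullet> (F t *v (C t *v v)) \<le> 0"
    and fin: "\<And>v. 0 \<le> v \<bullet> (F T *v v)"
    and t: "t \<in> {0..T}"
  shows "0 \<le> v \<bullet> (F t *v v)"
proof -
  obtain a where a: "0 \<le> a" "\<And>t x. t \<in> {0..T} ==> norm (A t *v x) \<le> a * norm x"
    using matrix_family_bound[OF cA] by blast
  obtain k where k: "0 \<le> k" "\<And>t x. t \<in> {0..T} ==> norm (C t *v x) \<le> k * norm x"
    using matrix_family_bound[OF cC] by blast
  define l where "l = 2 * a + k\<^sup>2 + 1"
  define e where "e t = exp (l * (T - t))" for t
  have e0: "0 < e t" for t by (simp add: e_def)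
  have cF: "continuous_on {0..T} F"
    using der continuous_on_vector_derivative by blast
  have pos: "0 < v \<bullet> (F t *v v) + \<epsilon> * e t * (v \<bullet> v)" if \<epsilon>: "0 < \<epsilon>" and v: "norm v = 1" and t: "t \<in> {0..T}" for \<epsilon> v t
  proof (rule ccontr)
    define g where "g = (%(t, v). v \<bullet> (F t *v v) + \<epsilon> * e t * (v \<bullet> v))"
    define B where "B = {z \<in> {0..T} \<times> sphere 0 1. g z \<le> 0}"
    assume "\<not> ?thesis"
    then have ne: "B \<noteq> {}" using v t by (auto simp: B_def g_def intro!: exI[of _ t] exI[of _ v])
    have cg: "continuous_on ({0..T} \<times> sphere 0 1) g"
    unfolding g_def e_def case_prod_beta
    by (intro continuous_intros continuous_matrix_intros continuous_on_compose2[OF cF]) auto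
    have "closedin (top_of_set ({0..T} \<times> sphere (0::real^'n) 1)) B"
    unfolding B_def using continuous_closedin_preimage[OF cg closed_atMost[of 0]]
    by (simp add: vimage_def Int_def)
    then have "compact B" by (rule closedin_compact[rotated]) (intro compact_Times compact_Icc compact_sphere)
    then obtain t0 v0 where tv: "(t0, v0) \<in> B" and max: "\<And>s w. (s, w) \<in> B ==> s \<le> t0"
    using continuous_attains_sup[of B fst] ne by (force intro: continuous_intros)
    have t0: "t0 \<in> {0..T}" and v0: "v0 \<bullet> v0 = 1" "norm v0 = 1" and g0: "g (t0, v0) \<le> 0"
    using tv by (auto simp: B_def norm_eq_sqrt_inner)
    have "0 < g (T, v0)" using fin[of v0] \<epsilon> v0 by (simp add: g_def e_def add_nonneg_pos)
    then have "t0 \<noteq> T" using g0 by auto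
    then have t0T: "t0 < T" using t0 by auto
    have later: "0 < g (s, w)" if "t0 < s" "s \<le> T" "norm w = 1" for s w
    proof (rule ccontr)
    assume "\<not> 0 < g (s, w)"
    then have "(s, w) \<in> B" using that t0 by (auto simp: B_def)
    then show False using max that by force
    qed
    have unit_nonneg: "0 \<le> g (t0, w)" if w: "norm w = 1" for w
    proof (rule tendsto_lowerbound)
    have "continuous_on {0..T} (%t. g (t, w))"
    by (rule continuous_on_compose2[OF cg]) (auto intro!: continuous_intros simp: w)
    then have "((%t. g (t, w)) \<longlongrightarrow> g (t0, w)) (at t0 within {t0..T})"
    using t0 by (auto simp: continuous_on_def intro!: tendsto_within_subset[of _ _ t0 "{0..T}" "{t0..T}"])
    then show "((%t. g (t, w)) \<longlongrightarrow> g (t0, w)) (at_right t0)"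
    using at_within_Icc_at_right[OF t0T] by simp
    show "\<forall>\<^sub>F s in at_right t0. 0 \<le> g (s, w)"
    using t0T later[OF _ _ w] by (auto simp: eventually_at_right_field intro!: exI[of _ T] less_imp_le)
    qed simp
    define G where "G = F t0 + mat (\<epsilon> * e t0)"
    have matv: "mat r *v w = r *\<^sub>R w" for r :: real and w :: "real^'n"
    by (simp add: vec_eq_iff matrix_vector_mult_def mat_def if_distrib if_distribR cong: if_cong)
    have gG: "w \<bullet> (G *v w) = g (t0, w)" for w
    by (simp add: G_def g_def matrix_vector_mult_add_rdistrib matv inner_add_right)
    have Gnn: "0 \<le> w \<bullet> (G *v w)" for w
    proof (cases "w = 0")
    case False
    have "(w /\<^sub>R norm w) \<bullet> (G *v (w /\<^sub>R norm w)) = (w \<bullet> (G *v w)) / (norm w)\<^sup>2"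
    by (simp add: matrix_vector_mult_scaleR power2_eq_square field_simps)
    moreover have "0 \<le> (w /\<^sub>R norm w) \<bullet> (G *v (w /\<^sub>R norm w))"
    unfolding gG using False by (intro unit_nonneg) simp
    ultimately show ?thesis using False by (simp add: zero_le_divide_iff)
    qed simp
    have "symm G" using sym[OF t0] by (simp add: G_def symm_def transpose_add)
    moreover have Gv0: "v0 \<bullet> (G *v v0) = 0" using Gnn[of v0] g0 gG[of v0] by linarith
    ultimately have "G *v v0 = 0" using psd_form_zero Gnn by blast
    then have Fv0: "F t0 *v v0 = - (\<epsilon> * e t0) *\<^sub>R v0"
    by (simp add: G_def matrix_vector_mult_add_rdistrib matv add_eq_0_iff)
    define D where "D = v0 \<bullet> (F' t0 *v v0) - \<epsilon> * l * e t0"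
    have "((%t. g (t, v0)) has_vector_derivative
    v0 \<bullet> (F' t0 *v v0) + \<epsilon> * (- l * e t0)) (at t0 within {0..T})"
    unfolding g_def case_prod_conv v0 mult_1_right
    proof (intro has_vector_derivative_add
    bounded_linear.has_vector_derivative[OF bounded_linear_compose[OF bounded_linear_inner_right mv.bounded_linear_left] der[OF t0]])
    show "((%t. \<epsilon> * e t) has_vector_derivative \<epsilon> * (- l * e t0)) (at t0 within {0..T})"
    unfolding e_def has_real_derivative_iff_has_vector_derivative[symmetric]
    by (auto intro!: derivative_eq_intros)
    qed
    then have "((%t. g (t, v0)) has_real_derivative D) (at t0 within {0..T})"
    by (simp add: has_real_derivative_iff_has_vector_derivative D_def algebra_simps)
    moreover have "D < 0"
    proof -
    define q where "q = \<epsilon> * e t0"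
    have q: "0 < q" using \<epsilon> e0 by (simp add: q_def)
    have "- ((C t0 *v v0) \<bullet> (F t0 *v (C t0 *v v0))) \<le> q * ((C t0 *v v0) \<bullet> (C t0 *v v0))"
    using Gnn[of "C t0 *v v0"] by (simp add: gG g_def q_def)
    also have "\<dots> \<le> q * k\<^sup>2"
    using k(2)[OF t0, of v0] v0 k(1) q by (intro mult_left_mono) (simp_all add: power2_norm_eq_inner[symmetric])
    finally have 1: "- ((C t0 *v v0) \<bullet> (F t0 *v (C t0 *v v0))) \<le> q * k\<^sup>2" .
    have "- ((A t0 *v v0) \<bullet> (F t0 *v v0)) = q * ((A t0 *v v0) \<bullet> v0)"
    by (simp add: Fv0 q_def)
    also have "\<dots> \<le> q * a"
    using Cauchy_Schwarz_ineq2[of "A t0 *v v0" v0] a(2)[OF t0, of v0] v0 q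
    by (intro mult_left_mono) auto
    finally have "v0 \<bullet> (F' t0 *v v0) \<le> 2 * (q * a) + q * k\<^sup>2"
    using le[OF t0, of v0] 1 by linarith
    moreover have "\<epsilon> * l * e t0 = 2 * (q * a) + q * k\<^sup>2 + q" by (simp add: l_def q_def algebra_simps)
    ultimately show ?thesis using q by (simp add: D_def)
    qed
    ultimately obtain d where d: "d > 0" "\<And>h. h > 0 ==> t0 + h \<in> {0..T} ==> h < d ==> g (t0 + h, v0) < g (t0, v0)"
    using has_real_derivative_neg_dec_right by blast
    define h where "h = min (d / 2) (T - t0)"
    have "0 < h" "h < d" "t0 + h \<le> T" using d(1) t0T by (auto simp: h_def min_def)
    then show False using d(2)[of h] later[of "t0 + h" v0] v0 t0 g0 by auto
  qed
  have "- e t * (v \<bullet> v) * \<epsilon> \<le> v \<bullet> (F t *v v)" if \<epsilon>: "0 < \<epsilon>" for \<epsilon>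
  proof (cases "v = 0")
    case False
    have "0 < (v /\<^sub>R norm v) \<bullet> (F t *v (v /\<^sub>R norm v)) + \<epsilon> * e t * ((v /\<^sub>R norm v) \<bullet> (v /\<^sub>R norm v))"
    by (rule pos[OF \<epsilon> _ t]) (use False in simp)
    also have "\<dots> = (v \<bullet> (F t *v v) + \<epsilon> * e t * (v \<bullet> v)) / (norm v)\<^sup>2"
    by (simp add: matrix_vector_mult_scaleR power2_eq_square field_simps add_divide_distrib)
    finally show ?thesis using False by (simp add: zero_less_divide_iff algebra_simps)
  qed simp
  moreover have "((%\<epsilon>. - e t * (v \<bullet> v) * \<epsilon>) \<longlongrightarrow> - e t * (v \<bullet> v) * 0) (at_right 0)"
    by (intro tendsto_intros)
  ultimately have "- e t * (v \<bullet> v) * 0 \<le> v \<bullet> (F t *v v)"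
    by (intro tendsto_upperbound[of "%\<epsilon>. - e t * (v \<bullet> v) * \<epsilon>" _ "at_right 0"])
    (auto simp: eventually_at_right_field intro!: exI[of _ 1])
  then show ?thesis by simp
qed

section \<open>Riccati equations\<close>

locale lq_data =
  fixes T :: real
    and A C Q :: "real => real^'n^'n" and B D S :: "real => real^'m^'n" and R :: "real => real^'m^'m"
    and G :: "real^'n^'n"
  assumes T0: "0 \<le> T"
    and cont: "continuous_on {0..T} A" "continuous_on {0..T} B" "continuous_on {0..T} C"
    "continuous_on {0..T} D" "continuous_on {0..T} Q" "continuous_on {0..T} S" "continuous_on {0..T} R"
    and symQ: "\<And>t. t \<in> {0..T} ==> symm (Q t)" and symR: "\<And>t. t \<in> {0..T} ==> symm (R t)"
    and symG: "symm G"
begin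

definition RR :: "real => real^'n^'n => real^'m^'m" where
  "RR t P = transpose (D t) ** P ** D t + R t"

definition SS :: "real => real^'n^'n => real^'m^'n" where
  "SS t P = P ** B t + transpose (C t) ** P ** D t + S t"

definition gain :: "real => real^'n^'n => real^'n^'m" where
  "gain t P = - (matrix_inv (RR t P) ** transpose (SS t P))"

text \<open>Along the state equation, \<open>ham t P v y\<close> is the drift of \<open>\<langle>P X, X\<rangle>\<close> (without the term of
  \<open>P'\<close>) plus the running cost, at \<open>X = v\<close> and \<open>u = y\<close>.\<close>

definition ham :: "real => real^'n^'n => real^'n => real^'m => real" where
  "ham t P v y = 2 * ((A t *v v + B t *v y) \<bullet> (P *v v)) + (C t *v v + D t *v y) \<bullet> (P *v (C t *v v + D t *v y))
    + v \<bullet> (Q t *v v) + 2 * ((S t *v y) \<bullet> v) + y \<bullet> (R t *v y)"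

definition riccati :: "(real => real^'n^'n) => bool" where
  "riccati P \<longleftrightarrow> C1_on T P \<and> (\<forall>t\<in>{0..T}. symm (P t)) \<and>
    (\<forall>t\<in>{0..T}. Dt T P t + P t ** A t + transpose (A t) ** P t + transpose (C t) ** P t ** C t + Q t
    - transpose (gain t (P t)) ** RR t (P t) ** gain t (P t) = 0) \<and>
    P T = G \<and> uniformly_pd_on T (%t. RR t (P t))"

definition compensator :: "(real => real^'n^'n) => (real => real^'n^'n) => real => bool" where
  "compensator H H' \<delta> \<longleftrightarrow> 0 < \<delta> \<and> (\<forall>t\<in>{0..T}. (H has_vector_derivative H' t) (at t within {0..T})) \<and>
    (\<forall>t\<in>{0..T}. symm (H t)) \<and> (\<forall>t\<in>{0..T}. \<forall>v y. 0 \<le> v \<bullet> (H' t *v v) + ham t (H t) v y) \<and>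
    (\<forall>t\<in>{0..T}. \<forall>y. \<delta> * (y \<bullet> y) \<le> y \<bullet> (RR t (H t) *v y)) \<and> (\<forall>v. v \<bullet> (H T *v v) \<le> v \<bullet> (G *v v))"

lemma ham_diff:
  "ham t P v y - ham t H v y = 2 * ((A t *v v + B t *v y) \<bullet> ((P - H) *v v))
    + (C t *v v + D t *v y) \<bullet> ((P - H) *v (C t *v v + D t *v y))"
  by (simp add: ham_def mv.diff_left inner_diff_right algebra_simps)

lemma RR_form: "y \<bullet> (RR t P *v z) = (D t *v y) \<bullet> (P *v (D t *v z)) + y \<bullet> (R t *v z)"
  by (simp add: RR_def mv.add_left inner_add_right matrix_vector_mul_assoc[symmetric] inner_transpose)

lemma symm_RR: "t \<in> {0..T} ==> symm P ==> symm (RR t P)"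
  using symR[of t] by (simp add: RR_def symm_def transpose_add matrix_transpose_mul matrix_mul_assoc)

lemma RR_mono: "0 \<le> (D t *v y) \<bullet> ((P - H) *v (D t *v y)) ==> y \<bullet> (RR t H *v y) \<le> y \<bullet> (RR t P *v y)"
  by (simp add: RR_form mv.diff_left inner_diff_right)

lemma ham_expand:
  assumes "symm P"
  shows "ham t P v y = 2 * ((A t *v v) \<bullet> (P *v v)) + (C t *v v) \<bullet> (P *v (C t *v v)) + v \<bullet> (Q t *v v)
    + 2 * ((SS t P *v y) \<bullet> v) + y \<bullet> (RR t P *v y)"
proof -
  have "(SS t P *v y) \<bullet> v = (B t *v y) \<bullet> (P *v v) + (D t *v y) \<bullet> (P *v (C t *v v)) + (S t *v y) \<bullet> v"
    using symm_inner[OF assms, of "B t *v y" v] symm_inner[OF assms, of "D t *v y" "C t *v v"]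
    inner_transpose[of "C t" v "P *v (D t *v y)"]
    by (simp add: SS_def mv.add_left inner_add_left inner_add_right matrix_vector_mul_assoc[symmetric] inner_commute)
  then show ?thesis
    using symm_inner[OF assms, of "D t *v y" "C t *v v"]
    by (simp add: ham_def RR_form mv.add_right inner_add_left inner_add_right inner_commute algebra_simps)
qed

lemma RR_gain:
  assumes "invertible (RR t P)"
  shows "RR t P *v (gain t P *v v) = - (transpose (SS t P) *v v)"
  by (simp add: gain_def mv.minus_left mv.minus_right matrix_vector_mul_assoc matrix_mul_assoc
    matrix_inv_right[OF assms])

lemma ham_complete:
  assumes "t \<in> {0..T}" "symm P" and inv: "invertible (RR t P)"
  shows "ham t P v y = ham t P v (gain t P *v v)
    + (y - gain t P *v v) \<bullet> (RR t P *v (y - gain t P *v v))"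
proof -
  define z where "z = gain t P *v v"
  have S: "(SS t P *v w) \<bullet> v = - (w \<bullet> (RR t P *v z))" for w
    by (simp add: inner_transpose RR_gain[OF inv] z_def)
  have "y \<bullet> (RR t P *v z) = z \<bullet> (RR t P *v y)"
    using symm_inner[OF symm_RR[OF assms(1,2)], of y z] by (simp add: inner_commute)
  then show ?thesis
    unfolding ham_expand[OF assms(2)] z_def[symmetric] S
    by (simp add: mv.diff_right inner_diff_left inner_diff_right algebra_simps)
qed

lemma ham_gain:
  assumes "t \<in> {0..T}" "symm P" and inv: "invertible (RR t P)"
  shows "ham t P v (gain t P *v v) = v \<bullet> ((P ** A t + transpose (A t) ** P + transpose (C t) ** P ** C t + Q t
    - transpose (gain t P) ** RR t P ** gain t P) *v v)"
proof -
  define z where "z = gain t P *v v"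
  have S: "(SS t P *v w) \<bullet> v = - (w \<bullet> (RR t P *v z))" for w
    by (simp add: inner_transpose RR_gain[OF inv] z_def)
  have "v \<bullet> ((P ** A t) *v v) = (A t *v v) \<bullet> (P *v v)"
    using symm_inner[OF assms(2), of "A t *v v" v] by (simp add: matrix_vector_mul_assoc[symmetric] inner_commute)
  moreover have "v \<bullet> ((transpose (A t) ** P) *v v) = (A t *v v) \<bullet> (P *v v)"
    by (simp add: matrix_vector_mul_assoc[symmetric] inner_transpose)
  moreover have "v \<bullet> ((transpose (C t) ** P ** C t) *v v) = (C t *v v) \<bullet> (P *v (C t *v v))"
    by (simp add: matrix_vector_mul_assoc[symmetric] inner_transpose)
  moreover have "v \<bullet> ((transpose (gain t P) ** RR t P ** gain t P) *v v) = z \<bullet> (RR t P *v z)"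
    by (simp add: matrix_vector_mul_assoc[symmetric] inner_transpose z_def)
  ultimately show ?thesis
    unfolding ham_expand[OF assms(2)] z_def[symmetric] S
    by (simp add: mv.add_left mv.diff_left inner_add_right inner_diff_right)
qed

lemma continuous_RR:
  assumes "continuous_on X \<tau>" "\<tau> ` X \<subseteq> {0..T}" "continuous_on X p"
  shows "continuous_on X (%x. RR (\<tau> x) (p x))"
  unfolding RR_def
  by (intro continuous_intros continuous_matrix_intros continuous_on_compose2[OF _ assms(1,2)] assms(3) cont)

lemma continuous_gain:
  assumes "continuous_on X \<tau>" "\<tau> ` X \<subseteq> {0..T}" "continuous_on X p"
    and "\<And>x. x \<in> X ==> invertible (RR (\<tau> x) (p x))"
  shows "continuous_on X (%x. gain (\<tau> x) (p x))"
  unfolding gain_def SS_def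
  by (intro continuous_intros continuous_matrix_intros continuous_on_matrix_inv continuous_RR
    continuous_on_compose2[OF _ assms(1,2)] assms cont)

text \<open>The right-hand side of the Lyapunov equation for the feedback \<open>N\<close>, written as \<open>- (M + M\<^sup>T)\<close> to
  make symmetry of the solution evident.\<close>

definition lyap :: "real => real^'n^'m => real^'n^'n => real^'n^'n" where
  "lyap t N P = (let M = P ** (A t + B t ** N) + (1/2) *\<^sub>R (transpose (C t + D t ** N) ** P ** (C t + D t ** N))
    + (1/2) *\<^sub>R Q t + S t ** N + (1/2) *\<^sub>R (transpose N ** R t ** N)
    in - (M + transpose M))"

lemma symm_lyap: "symm (lyap t N P)"
proof -
  have "transpose (- M) = - transpose M" for M :: "real^'n^'n"
    by (simp add: transpose_def vec_eq_iff)
  then show ?thesis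
    by (simp only: lyap_def Let_def symm_def transpose_add transpose_transpose) (simp only: add.commute)
qed

lemma lyap_form:
  assumes "symm P"
  shows "v \<bullet> (lyap t N P *v v) = - ham t P v (N *v v)"
proof -
  have tr: "v \<bullet> (transpose M *v v) = v \<bullet> (M *v v)" for M :: "real^'n^'n"
    by (metis inner_commute inner_transpose)
  have PP: "v \<bullet> (P *v w) = w \<bullet> (P *v v)" for w
    using symm_inner[OF assms, of v w] by (simp add: inner_commute)
  have form: "v \<bullet> ((transpose K ** L ** K) *v v) = (K *v v) \<bullet> (L *v (K *v v))"
    for K :: "real^'n^'k" and L
    by (simp only: matrix_vector_mul_assoc[symmetric]) (metis inner_transpose)
  show ?thesis
    unfolding lyap_def Let_def mv.minus_left mv.add_left inner_add_right inner_minus_right tr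
    scaleR_matrix_vector_assoc[symmetric] inner_scaleR_right form
    by (simp only: matrix_vector_mul_assoc[symmetric] mv.add_left ham_def PP inner_commute[of v "S t *v (N *v v)"])
qed

lemma continuous_lyap:
  assumes "continuous_on X \<tau>" "\<tau> ` X \<subseteq> {0..T}" "continuous_on X n" "continuous_on X p"
  shows "continuous_on X (%x. lyap (\<tau> x) (n x) (p x))"
  unfolding lyap_def Let_def
  by (intro continuous_intros continuous_matrix_intros continuous_on_compose2[OF _ assms(1,2)] assms cont)

definition solves_lyap :: "(real => real^'n^'m) => (real => real^'n^'n) => bool" where
  "solves_lyap N P \<longleftrightarrow> P T = G \<and> (\<forall>t\<in>{0..T}. symm (P t)) \<and>
    (\<forall>t\<in>{0..T}. (P has_vector_derivative lyap t (N t) (P t)) (at t within {0..T}))"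

lemma lyap_exists:
  assumes cN: "continuous_on {0..T} N"
  shows "\<exists>P. solves_lyap N P"
proof -
  define L where "L t P = P ** (A t + B t ** N t) + (1/2) *\<^sub>R (transpose (C t + D t ** N t) ** P ** (C t + D t ** N t))"
    for t and P :: "real^'n^'n"
  have diff: "lyap t (N t) P - lyap t (N t) 0 = - (L t P + transpose (L t P))" for t P
    by (simp add: lyap_def L_def Let_def transpose_add mm.zero_left mm.zero_right)
  have tsc: "transpose (r *\<^sub>R M) = r *\<^sub>R transpose M" for r and M :: "real^'n^'n"
    by (rule linear_cmul[OF bounded_linear.linear[OF bounded_linear_transpose]])
  have L: "L t (x + y) = L t x + L t y" "L t (r *\<^sub>R x) = r *\<^sub>R L t x" for t r x y
    by (simp_all add: L_def mm.add_left mm.add_right mm.scaleR_left mm.scaleR_right scaleR_add_right)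
  have lin: "linear (%P. lyap t (N t) P - lyap t (N t) 0)" for t
    unfolding diff by (rule linearI) (simp_all add: L transpose_add tsc scaleR_diff_right)
  have "continuous_on {0..T} (%t. lyap t (N t) x - lyap t (N t) 0)" for x
    by (intro continuous_intros continuous_lyap cN) auto
  from compact_family_bound[OF compact_Icc lin this]
  obtain K where K: "0 \<le> K" "\<And>t P. t \<in> {0..T} ==> norm (lyap t (N t) P - lyap t (N t) 0) \<le> K * norm P"
    by metis
  have "\<exists>P. P T = G \<and> (\<forall>t\<in>{0..T}. (P has_vector_derivative lyap t (N t) (P t)) (at t within {0..T}))"
  proof (rule ode_exists_backward[OF T0 K(1)])
    fix y :: "real => real^'n^'n" assume "continuous_on {0..T} y"
    then show "continuous_on {0..T} (%t. lyap t (N t) (y t))" by (intro continuous_lyap cN) auto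
  next
    fix t x y assume t: "t \<in> {0..T}"
    have "lyap t (N t) x - lyap t (N t) y = lyap t (N t) (x - y) - lyap t (N t) 0"
    using linear_diff[OF lin[of t], of x y] by simp
    then show "norm (lyap t (N t) x - lyap t (N t) y) \<le> K * norm (x - y)"
    using K(2)[OF t, of "x - y"] by simp
  qed
  then obtain P where P: "P T = G"
    "\<And>t. t \<in> {0..T} ==> (P has_vector_derivative lyap t (N t) (P t)) (at t within {0..T})" by blast
  have "symm (P t)" if t: "t \<in> {0..T}" for t
  proof -
    define E where "E s = P s - transpose (P s)" for s
    have "(E has_vector_derivative 0) (at s within {0..T})" if s: "s \<in> {0..T}" for s
    using has_vector_derivative_diff[OF P(2)[OF s] bounded_linear.has_vector_derivative[OF bounded_linear_transpose P(2)[OF s]]]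
    symm_lyap[of s "N s" "P s"]
    by (simp add: E_def[abs_def] symm_def)
    then obtain k where "\<And>s. s \<in> {0..T} ==> E s = k"
    using has_vector_derivative_zero_constant[of "{0..T}" E] by auto
    moreover have "E T = 0" using symG by (simp add: E_def P(1) symm_def)
    ultimately show ?thesis using t T0 by (auto simp: E_def symm_def)
  qed
  then show ?thesis using P by (auto simp: solves_lyap_def)
qed

lemma solves_lyapD:
  assumes "solves_lyap N P"
  shows "P T = G" "\<And>t. t \<in> {0..T} ==> symm (P t)"
    "\<And>t. t \<in> {0..T} ==> (P has_vector_derivative lyap t (N t) (P t)) (at t within {0..T})"
    "continuous_on {0..T} P"
proof -
  show d: "(P has_vector_derivative lyap t (N t) (P t)) (at t within {0..T})" if "t \<in> {0..T}" for t
    using assms that by (simp add: solves_lyap_def)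
  show "continuous_on {0..T} P" by (rule continuous_on_vector_derivative[OF d])
qed (use assms in \<open>auto simp: solves_lyap_def\<close>)

text \<open>\<open>F\<close> and \<open>E\<close> are a super- and a subsolution for the same feedback \<open>N\<close>.\<close>

lemma ham_comparison:
  assumes F: "\<And>t. t \<in> {0..T} ==> (F has_vector_derivative F' t) (at t within {0..T})" "\<And>t. t \<in> {0..T} ==> symm (F t)"
    and E: "\<And>t. t \<in> {0..T} ==> (E has_vector_derivative E' t) (at t within {0..T})" "\<And>t. t \<in> {0..T} ==> symm (E t)"
    and cN: "continuous_on {0..T} N"
    and super: "\<And>t v. t \<in> {0..T} ==> v \<bullet> (F' t *v v) + ham t (F t) v (N t *v v) \<le> 0"
    and sub: "\<And>t v. t \<in> {0..T} ==> 0 \<le> v \<bullet> (E' t *v v) + ham t (E t) v (N t *v v)"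
    and fin: "\<And>v. v \<bullet> (E T *v v) \<le> v \<bullet> (F T *v v)"
    and t: "t \<in> {0..T}"
  shows "v \<bullet> (E t *v v) \<le> v \<bullet> (F t *v v)"
proof -
  have "0 \<le> v \<bullet> ((F t - E t) *v v)"
  proof (rule lyapunov_nonneg[where F'="%t. F' t - E' t" and A="%t. A t + B t ** N t" and C="%t. C t + D t ** N t" and T=T])
    show "((%t. F t - E t) has_vector_derivative F' s - E' s) (at s within {0..T})" if "s \<in> {0..T}" for s
    using that by (intro has_vector_derivative_diff F E)
    show "symm (F s - E s)" if "s \<in> {0..T}" for s
    using F(2)[OF that] E(2)[OF that] by (simp add: symm_def transpose_diff)
    show "continuous_on {0..T} (%t. A t + B t ** N t)" "continuous_on {0..T} (%t. C t + D t ** N t)"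
    by (intro continuous_intros continuous_matrix_intros cont cN)+
    show "w \<bullet> ((F' s - E' s) *v w) + 2 * (((A s + B s ** N s) *v w) \<bullet> ((F s - E s) *v w)) +
    ((C s + D s ** N s) *v w) \<bullet> ((F s - E s) *v ((C s + D s ** N s) *v w)) \<le> 0" if "s \<in> {0..T}" for s w
    using super[OF that, of w] sub[OF that, of w] ham_diff[of s "F s" w "N s *v w" "E s"]
    by (simp add: mv.diff_left mv.add_left inner_diff_right matrix_vector_mul_assoc[symmetric])
    show "0 \<le> w \<bullet> ((F T - E T) *v w)" for w using fin[of w] by (simp add: mv.diff_left inner_diff_right)
  qed (rule t)
  then show ?thesis by (simp add: mv.diff_left inner_diff_right)
qed

definition kleinman_step :: "(real => real^'n^'m) => real => real^'n^'n" where
  "kleinman_step N = (SOME P. solves_lyap N P)"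

primrec kleinman :: "nat => real => real^'n^'n" where
  "kleinman 0 = kleinman_step (%t. 0)"
| "kleinman (Suc k) = kleinman_step (%t. gain t (kleinman k t))"

lemma kleinman_step: "continuous_on {0..T} N ==> solves_lyap N (kleinman_step N)"
  unfolding kleinman_step_def using lyap_exists by (rule someI_ex)

lemma compensatorD:
  assumes "compensator H H' \<delta>"
  shows "0 < \<delta>" "\<And>t. t \<in> {0..T} ==> (H has_vector_derivative H' t) (at t within {0..T})"
    "\<And>t. t \<in> {0..T} ==> symm (H t)" "\<And>t v y. t \<in> {0..T} ==> 0 \<le> v \<bullet> (H' t *v v) + ham t (H t) v y"
    "\<And>t y. t \<in> {0..T} ==> \<delta> * (y \<bullet> y) \<le> y \<bullet> (RR t (H t) *v y)"
    "\<And>v. v \<bullet> (H T *v v) \<le> v \<bullet> (G *v v)"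
  using assms by (simp_all add: compensator_def)

context
  fixes H H' \<delta> assumes comp: "compensator H H' \<delta>"
begin

lemma lyap_ge_compensator:
  assumes P: "solves_lyap N P" and N: "continuous_on {0..T} N" and t: "t \<in> {0..T}"
  shows "v \<bullet> (H t *v v) \<le> v \<bullet> (P t *v v)"
proof (rule ham_comparison[where F=P and E=H and F'="%t. lyap t (N t) (P t)" and E'=H' and N=N])
  show "v \<bullet> (H T *v v) \<le> v \<bullet> (P T *v v)" for v
    using compensatorD(6)[OF comp] solves_lyapD(1)[OF P] by simp
  show "v \<bullet> (lyap t (N t) (P t) *v v) + ham t (P t) v (N t *v v) \<le> 0" if "t \<in> {0..T}" for t v
    using lyap_form[OF solves_lyapD(2)[OF P that]] by simp
qed (fact solves_lyapD(2,3)[OF P] compensatorD(2,3,4)[OF comp] N t)+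

lemma RR_ge:
  assumes "t \<in> {0..T}" and ge: "\<And>v. v \<bullet> (H t *v v) \<le> v \<bullet> (P *v v)"
  shows "\<delta> * (y \<bullet> y) \<le> y \<bullet> (RR t P *v y)" and "invertible (RR t P)"
proof -
  show *: "\<delta> * (y \<bullet> y) \<le> y \<bullet> (RR t P *v y)" for y
    using compensatorD(5)[OF comp assms(1), of y] RR_mono[where H="H t" and P=P and t=t and y=y] ge[of "D t *v y"]
    by (simp add: mv.diff_left inner_diff_right)
  show "invertible (RR t P)"
    by (rule invertible_if_quadratic_pos[OF compensatorD(1)[OF comp] *])
qed

lemma kleinman_solves:
  "\<exists>N. continuous_on {0..T} N \<and> solves_lyap N (kleinman k) \<and>
    solves_lyap (%t. gain t (kleinman k t)) (kleinman (Suc k)) \<and>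
    continuous_on {0..T} (%t. gain t (kleinman k t))"
proof -
  have step: "continuous_on {0..T} (%t. gain t (P t))" if "solves_lyap N P" "continuous_on {0..T} N" for N P
    by (rule continuous_gain)
    (auto intro!: RR_ge(2) lyap_ge_compensator[OF that] solves_lyapD(4)[OF that(1)] continuous_intros)
  have "\<exists>N. continuous_on {0..T} N \<and> solves_lyap N (kleinman k)"
  proof (induction k)
    case 0
    show ?case by (auto intro!: exI[of _ "%t. 0"] kleinman_step)
  next
    case (Suc k)
    then obtain N where "continuous_on {0..T} N" "solves_lyap N (kleinman k)" by blast
    note c = step[OF this(2,1)]
    show ?case by (intro exI conjI, rule c) (simp add: kleinman_step[OF c])
  qed
  then obtain N where N: "continuous_on {0..T} N" "solves_lyap N (kleinman k)" by blast
  note c = step[OF this(2,1)]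
  show ?thesis by (intro exI[of _ N] conjI N c) (simp add: kleinman_step[OF c])
qed

lemma kleinman_props:
  "solves_lyap (%t. gain t (kleinman k t)) (kleinman (Suc k))"
  "continuous_on {0..T} (kleinman k)" "kleinman k T = G"
  "t \<in> {0..T} ==> symm (kleinman k t)"
  "t \<in> {0..T} ==> v \<bullet> (H t *v v) \<le> v \<bullet> (kleinman k t *v v)"
proof -
  obtain N where N: "continuous_on {0..T} N" "solves_lyap N (kleinman k)"
    and S: "solves_lyap (%t. gain t (kleinman k t)) (kleinman (Suc k))"
    using kleinman_solves[of k] by metis
  show "solves_lyap (%t. gain t (kleinman k t)) (kleinman (Suc k))" by (rule S)
  show "continuous_on {0..T} (kleinman k)" "kleinman k T = G" "t \<in> {0..T} ==> symm (kleinman k t)"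
    by (rule solves_lyapD[OF N(2)])+
  show "t \<in> {0..T} ==> v \<bullet> (H t *v v) \<le> v \<bullet> (kleinman k t *v v)"
    by (rule lyap_ge_compensator[OF N(2,1)])
qed

lemma kleinman_antimono:
  assumes t: "t \<in> {0..T}"
  shows "v \<bullet> (kleinman (Suc k) t *v v) \<le> v \<bullet> (kleinman k t *v v)"
proof -
  obtain N where N: "continuous_on {0..T} N" "solves_lyap N (kleinman k)"
    "continuous_on {0..T} (%t. gain t (kleinman k t))"
    using kleinman_solves[of k] by metis
  note P1 = kleinman_props(1)[of k]
  show ?thesis
  proof (rule ham_comparison[where F="kleinman k" and E="kleinman (Suc k)" and F'="%t. lyap t (N t) (kleinman k t)"
    and E'="%t. lyap t (gain t (kleinman k t)) (kleinman (Suc k) t)" and N="%t. gain t (kleinman k t)"])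
    show "v \<bullet> (kleinman (Suc k) T *v v) \<le> v \<bullet> (kleinman k T *v v)" for v
    by (simp only: kleinman_props(3))
    show "v \<bullet> (lyap t (N t) (kleinman k t) *v v) + ham t (kleinman k t) v (gain t (kleinman k t) *v v) \<le> 0"
    if t: "t \<in> {0..T}" for t v
    proof -
    note k = kleinman_props(4)[OF t, of k] and R = RR_ge[where P="kleinman k t", OF t kleinman_props(5)[OF t]]
    have "0 \<le> \<delta> * (y \<bullet> y)" for y :: "real^'m" using compensatorD(1)[OF comp] by simp
    then have "0 \<le> y \<bullet> (RR t (kleinman k t) *v y)" for y using R(1) order_trans by blast
    then show ?thesis
    using lyap_form[OF k, of v t "N t"] ham_complete[OF t k R(2), of v "N t *v v"] by simp
    qed
    show "0 \<le> v \<bullet> (lyap t (gain t (kleinman k t)) (kleinman (Suc k) t) *v v) +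
    ham t (kleinman (Suc k) t) v (gain t (kleinman k t) *v v)" if t: "t \<in> {0..T}" for t v
    using lyap_form[OF kleinman_props(4)[OF t, of "Suc k"]] by simp
  qed (fact solves_lyapD(2,3)[OF P1] solves_lyapD(2,3)[OF N(2)] N(3) t)+
qed

end

end

lemma symm_entry:
  fixes N :: "real^'n^'n"
  assumes "symm N"
  shows "N $ i $ j = (1/4) * ((axis i 1 + axis j 1) \<bullet> (N *v (axis i 1 + axis j 1)) - (axis i 1 - axis j 1) \<bullet> (N *v (axis i 1 - axis j 1)))"
proof -
  have "N $ i $ j = axis i 1 \<bullet> (N *v axis j 1)"
    by (simp add: inner_axis' matrix_vector_mult_basis column_def)
  moreover have "axis i 1 \<bullet> (N *v axis j 1) = axis j 1 \<bullet> (N *v axis i 1)"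
    using symm_inner[OF assms, of "axis i 1" "axis j 1"] by (simp add: inner_commute)
  ultimately show ?thesis
    by (simp add: mv.add_right mv.diff_right inner_add_left inner_add_right inner_diff_left inner_diff_right)
qed

lemma symm_limit:
  fixes N :: "nat => real^'n^'n"
  assumes "\<And>k. symm (N k)" "N \<longlonglongrightarrow> L"
  shows "symm L"
proof -
  have "(%k. transpose (N k)) \<longlonglongrightarrow> transpose L"
    by (intro bounded_linear.tendsto[OF bounded_linear_transpose] assms)
  then show ?thesis using assms LIMSEQ_unique by (auto simp: symm_def)
qed

lemma symm_sandwich_bound:
  fixes N L U :: "real^'n^'n"
  assumes N: "symm N" and lo: "\<And>v. v \<bullet> (L *v v) \<le> v \<bullet> (N *v v)" and up: "\<And>v. v \<bullet> (N *v v) \<le> v \<bullet> (U *v v)"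
    and L: "\<And>v. norm (L *v v) \<le> K * norm v" and U: "\<And>v. norm (U *v v) \<le> K * norm v" and K: "0 \<le> K"
  shows "norm N \<le> 2 * K * real (CARD('n) * CARD('n))"
proof -
  have q: "\<bar>v \<bullet> (N *v v)\<bar> \<le> 4 * K" if v: "norm v \<le> 2" for v
  proof -
    have "\<bar>v \<bullet> (X *v v)\<bar> \<le> 4 * K" if "\<And>v. norm (X *v v) \<le> K * norm v" for X :: "real^'n^'n"
    proof -
    have "\<bar>v \<bullet> (X *v v)\<bar> \<le> norm v * (K * norm v)"
    by (rule order_trans[OF Cauchy_Schwarz_ineq2 mult_left_mono[OF that]]) simp
    also have "\<dots> \<le> 2 * (K * 2)" using v K by (intro mult_mono) auto
    finally show ?thesis by simp
    qed
    from this[OF L] this[OF U] show ?thesis using lo[of v] up[of v] by linarith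
  qed
  have ax: "norm (axis i (1::real) + axis j 1 :: real^'n) \<le> 2" "norm (axis i (1::real) - axis j 1 :: real^'n) \<le> 2" for i j
    using norm_triangle_ineq[of "axis i (1::real) :: real^'n" "axis j 1"] norm_triangle_ineq4[of "axis i (1::real) :: real^'n" "axis j 1"]
    by (simp_all add: norm_axis_1)
  have e: "\<bar>N $ i $ j\<bar> \<le> 2 * K" for i j
  proof -
    have *: "\<bar>x\<bar> \<le> 4 * K ==> \<bar>y\<bar> \<le> 4 * K ==> \<bar>(1/4) * (x - y)\<bar> \<le> 2 * K" for x y :: real
    by (simp add: abs_le_iff)
    show ?thesis unfolding symm_entry[OF N, of i j] by (rule *[OF q[OF ax(1)] q[OF ax(2)]])
  qed
  have "norm N \<le> (\<Sum>i\<in>UNIV. \<Sum>j\<in>UNIV. \<bar>N $ i $ j\<bar>)"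
    unfolding norm_vec_def[of N] by (rule order_trans[OF L2_set_le_sum sum_mono]) (auto simp: norm_le_l1_cart)
  also have "\<dots> \<le> (\<Sum>i\<in>(UNIV::'n set). \<Sum>j\<in>(UNIV::'n set). 2 * K)"
    by (intro sum_mono e)
  finally show ?thesis by (simp add: algebra_simps)
qed

lemma AE_lborel_continuous_nonneg:
  fixes f :: "real => real"
  assumes T: "a < b" and f: "continuous_on {a..b} f" and ae: "AE t in lborel. t \<in> {a..b} \<longrightarrow> 0 \<le> f t"
    and t: "t \<in> {a..b}"
  shows "0 \<le> f t"
proof -
  have "0 \<le> f s" if s: "s \<in> {a<..<b}" for s
  proof (rule ccontr)
    assume neg: "\<not> 0 \<le> f s"
    define V where "V = {x \<in> {a<..<b}. f x < 0}"
    have "open V"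
    proof -
    have "open ({a<..<b} \<inter> f -` {..<0})"
    by (rule continuous_open_preimage) (auto intro: continuous_on_subset[OF f])
    then show ?thesis by (simp add: V_def vimage_def Int_def)
    qed
    moreover have "V \<noteq> {}" using neg s by (auto simp: V_def)
    moreover have "negligible V"
    proof -
    have "AE t in lborel. t \<notin> V" using ae by eventually_elim (auto simp: V_def)
    then have "V \<in> null_sets lborel"
    using \<open>open V\<close> by (subst AE_iff_null_sets[of V lborel]) auto
    then show ?thesis by (simp add: negligible_iff_null_sets null_sets_completionI)
    qed
    ultimately show False using open_not_negligible by blast
  qed
  moreover have "closure {a<..<b} = {a..b}" using T by (simp add: closure_greaterThanLessThan)
  ultimately show ?thesis
    using continuous_ge_on_closure[of "{a<..<b}" f t 0] f t by auto
qed

lemma psd_on_form: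
  assumes T: "0 < T" and psd: "psd_on T N" and cN: "continuous_on {0..T} N" and t: "t \<in> {0..T}"
  shows "0 \<le> v \<bullet> (N t *v v)"
proof (rule AE_lborel_continuous_nonneg[OF T _ _ t])
  show "continuous_on {0..T} (%t. v \<bullet> (N t *v v))"
    by (intro continuous_intros continuous_matrix_intros cN)
  show "AE t in lborel. t \<in> {0..T} \<longrightarrow> 0 \<le> v \<bullet> (N t *v v)"
    using psd unfolding psd_on_def by eventually_elim (auto simp: psd_def)
qed

lemma mat_vector_mult: "mat r *v w = r *\<^sub>R w" for r :: real and w :: "real^'n"
  by (simp add: vec_eq_iff matrix_vector_mult_def mat_def if_distrib if_distribR cong: if_cong)

lemma uniformly_pd_form:
  assumes pd: "uniformly_pd_on T N" and cN: "continuous_on {0..T} N" and T: "0 < T"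
  shows "\<exists>\<delta>>0. \<forall>t\<in>{0..T}. \<forall>y. \<delta> * (y \<bullet> y) \<le> y \<bullet> (N t *v y)"
proof -
  obtain \<delta> where \<delta>: "\<delta> > 0" "psd_on T (%t. N t - mat \<delta>)" using pd by (auto simp: uniformly_pd_on_def)
  have "0 \<le> y \<bullet> ((N t - mat \<delta>) *v y)" if "t \<in> {0..T}" for t y
    by (rule psd_on_form[OF T \<delta>(2) _ that]) (intro continuous_intros cN)
  then show ?thesis
    using \<delta>(1) by (intro exI[of _ \<delta>]) (auto simp: mv.diff_left mat_vector_mult inner_diff_right)
qed

context lq_data
begin

lemma riccatiD:
  assumes P: "riccati P" and T: "0 < T"
  shows "continuous_on {0..T} P"
    and "\<And>t. t \<in> {0..T} ==> (P has_vector_derivative Dt T P t) (at t within {0..T})"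
    and "continuous_on {0..T} (Dt T P)"
    and "\<And>t. t \<in> {0..T} ==> symm (P t)" and "P T = G"
    and "\<exists>\<delta>>0. \<forall>t\<in>{0..T}. \<forall>y. \<delta> * (y \<bullet> y) \<le> y \<bullet> (RR t (P t) *v y)"
    and "\<And>t. t \<in> {0..T} ==> invertible (RR t (P t))"
    and "continuous_on {0..T} (%t. gain t (P t))"
    and "\<And>t v y. t \<in> {0..T} ==> v \<bullet> (Dt T P t *v v) + ham t (P t) v y =
    (y - gain t (P t) *v v) \<bullet> (RR t (P t) *v (y - gain t (P t) *v v))"
    and "\<And>t v y. t \<in> {0..T} ==> 0 \<le> y \<bullet> (RR t (P t) *v y)"
proof -
  have P': "C1_on T P" "\<And>t. t \<in> {0..T} ==> symm (P t)" "P T = G" "uniformly_pd_on T (%t. RR t (P t))"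
    "\<And>t. t \<in> {0..T} ==> Dt T P t + P t ** A t + transpose (A t) ** P t + transpose (C t) ** P t ** C t + Q t
    - transpose (gain t (P t)) ** RR t (P t) ** gain t (P t) = 0"
    using P by (auto simp: riccati_def)
  show "\<And>t. t \<in> {0..T} ==> symm (P t)" "P T = G" by fact+
  show der: "(P has_vector_derivative Dt T P t) (at t within {0..T})" if "t \<in> {0..T}" for t
    using P'(1) that by (simp add: C1_on_def Dt_def vector_derivative_works[symmetric])
  show cP: "continuous_on {0..T} P" by (rule continuous_on_vector_derivative[OF der])
  show "continuous_on {0..T} (Dt T P)" using P'(1) by (simp add: C1_on_def)
  have cR: "continuous_on {0..T} (%t. RR t (P t))" by (intro continuous_RR cP continuous_intros) auto
  show d: "\<exists>\<delta>>0. \<forall>t\<in>{0..T}. \<forall>y. \<delta> * (y \<bullet> y) \<le> y \<bullet> (RR t (P t) *v y)"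
    by (rule uniformly_pd_form[OF P'(4) cR T])
  show inv: "invertible (RR t (P t))" if "t \<in> {0..T}" for t
    using d that invertible_if_quadratic_pos by metis
  show "continuous_on {0..T} (%t. gain t (P t))" by (intro continuous_gain cP continuous_intros inv) auto
  show "v \<bullet> (Dt T P t *v v) + ham t (P t) v y =
    (y - gain t (P t) *v v) \<bullet> (RR t (P t) *v (y - gain t (P t) *v v))" if t: "t \<in> {0..T}" for t v y
  proof -
    have "v \<bullet> ((Dt T P t + (P t ** A t + transpose (A t) ** P t + transpose (C t) ** P t ** C t + Q t
    - transpose (gain t (P t)) ** RR t (P t) ** gain t (P t))) *v v) = 0"
    using P'(5)[OF t] by (simp add: algebra_simps)
    then have "v \<bullet> (Dt T P t *v v) + ham t (P t) v (gain t (P t) *v v) = 0"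
    unfolding ham_gain[OF t P'(2)[OF t] inv[OF t]] by (simp only: mv.add_left[of "Dt T P t"] inner_add_right)
    then show ?thesis using ham_complete[OF t P'(2)[OF t] inv[OF t], of v y] by linarith
  qed
  show "0 \<le> y \<bullet> (RR t (P t) *v y)" if t: "t \<in> {0..T}" for t y
  proof -
    obtain \<delta> where "\<delta> > 0" "\<delta> * (y \<bullet> y) \<le> y \<bullet> (RR t (P t) *v y)" using d t by blast
    moreover from this have "0 \<le> \<delta> * (y \<bullet> y)" by simp
    ultimately show ?thesis by linarith
  qed
qed

lemma riccati_le:
  assumes P: "riccati P" and E: "riccati E" and T: "0 < T" and t: "t \<in> {0..T}"
  shows "v \<bullet> (E t *v v) \<le> v \<bullet> (P t *v v)"
proof (rule ham_comparison[where F=P and E=E and F'="Dt T P" and E'="Dt T E" and N="%t. gain t (P t)"])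
  show "v \<bullet> (Dt T P t *v v) + ham t (P t) v (gain t (P t) *v v) \<le> 0" if "t \<in> {0..T}" for t v
    using riccatiD(9)[OF P T that, of v "gain t (P t) *v v"] by simp
  show "0 \<le> v \<bullet> (Dt T E t *v v) + ham t (E t) v (gain t (P t) *v v)" if "t \<in> {0..T}" for t v
    using riccatiD(9)[OF E T that, of v "gain t (P t) *v v"] riccatiD(10)[OF E T that] by simp
  show "v \<bullet> (E T *v v) \<le> v \<bullet> (P T *v v)" for v by (simp add: riccatiD(5)[OF E T] riccatiD(5)[OF P T])
qed (fact riccatiD(2,4)[OF P T] riccatiD(2,4)[OF E T] riccatiD(8)[OF P T] t)+

lemma riccati_unique:
  assumes P: "riccati P" and E: "riccati E" and T: "0 < T" and t: "t \<in> {0..T}"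
  shows "P t = E t"
  by (rule symm_quadratic_eqI)
    (use riccatiD(4)[OF P T t] riccatiD(4)[OF E T t] riccati_le[OF P E T t] riccati_le[OF E P T t] in \<open>auto intro: antisym\<close>)

lemma riccati_exists:
  assumes comp: "compensator H H' \<delta>" and T: "0 < T"
  shows "\<exists>P. riccati P \<and> (\<forall>t\<in>{0..T}. \<forall>v. v \<bullet> (H t *v v) \<le> v \<bullet> (P t *v v))"
proof -
  note kp = kleinman_props[OF comp]
  define K where "K = kleinman"
  note kp = kp[folded K_def] and mono = kleinman_antimono[OF comp, folded K_def]
  have le0: "v \<bullet> (K k t *v v) \<le> v \<bullet> (K 0 t *v v)" if t: "t \<in> {0..T}" for k t v
    by (induction k) (auto intro: order_trans[OF mono[OF t]])
  have cH: "continuous_on {0..T} H"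
    by (rule continuous_on_vector_derivative[OF compensatorD(2)[OF comp]])
  obtain bH where bH: "0 \<le> bH" "\<And>t x. t \<in> {0..T} ==> norm (H t *v x) \<le> bH * norm x"
    using matrix_family_bound[OF cH] by metis
  obtain b0 where b0: "0 \<le> b0" "\<And>t x. t \<in> {0..T} ==> norm (K 0 t *v x) \<le> b0 * norm x"
    using matrix_family_bound[OF kp(2)[of 0]] by metis
  define b where "b = 2 * (bH + b0) * real (CARD('n) * CARD('n))"
  have nb: "norm (K k t) \<le> b" if t: "t \<in> {0..T}" for k t
    unfolding b_def
  proof (rule symm_sandwich_bound[OF kp(4)[OF t] kp(5)[OF t] le0[OF t]])
    show "norm (H t *v v) \<le> (bH + b0) * norm v" for v
    using bH(2)[OF t, of v] b0(1) by (simp add: distrib_right add_increasing2)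
    show "norm (K 0 t *v v) \<le> (bH + b0) * norm v" for v
    using b0(2)[OF t, of v] bH(1) by (simp add: distrib_right add_increasing)
  qed (use bH b0 in simp)
  have conv: "convergent (%k. K k t)" if t: "t \<in> {0..T}" for t
  proof -
    have q: "convergent (%k. v \<bullet> (K k t *v v))" for v
    proof -
    have "decseq (%k. v \<bullet> (K k t *v v))" by (intro decseq_SucI mono t)
    then show ?thesis
    using decseq_convergent[of "%k. v \<bullet> (K k t *v v)" "v \<bullet> (H t *v v)"] kp(5)[OF t, of v]
    by (metis convergent_def)
    qed
    have "\<exists>l. (%k. K k t $ i $ j) \<longlonglongrightarrow> l" for i j
    unfolding symm_entry[OF kp(4)[OF t]] convergent_def[symmetric]
    by (intro convergent_mult convergent_const convergent_diff q)
    then obtain l where "\<And>i j. (%k. K k t $ i $ j) \<longlonglongrightarrow> l i j" by metis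
    then have "(%k. K k t) \<longlonglongrightarrow> (\<chi> i j. l i j)"
    by (intro vec_tendstoI) (simp add: vec_tendstoI)
    then show ?thesis by (auto simp: convergent_def)
  qed
  define P where "P t = lim (%k. K k t)" for t
  have lim: "(%k. K k t) \<longlonglongrightarrow> P t" if "t \<in> {0..T}" for t
    using conv[OF that] by (simp add: P_def convergent_LIMSEQ_iff)
  have symP: "symm (P t)" if "t \<in> {0..T}" for t
    by (rule symm_limit[OF kp(4)[OF that] lim[OF that]])
  have HP: "v \<bullet> (H t *v v) \<le> v \<bullet> (P t *v v)" if t: "t \<in> {0..T}" for t v
    by (rule LIMSEQ_le_const[of "%k. v \<bullet> (K k t *v v)"])
    (auto intro!: tendsto_intros mv.tendsto lim t kp(5))
  define Z where "Z = {0..T} \<times> cball (0::real^'n^'n) b \<times> cball (0::real^'n^'n) b"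
  define Y where "Y = (\<Inter>y. Z \<inter> (%(t, P1, P2). y \<bullet> (RR t P1 *v y) - \<delta> * (y \<bullet> y)) -` {0..})"
  have cptZ: "compact Z" unfolding Z_def by (intro compact_Times compact_Icc compact_cball)
  have clY: "closed Y"
    unfolding Y_def case_prod_beta
    by (intro closed_INT ballI continuous_closed_preimage continuous_intros continuous_matrix_intros
    continuous_RR compact_imp_closed cptZ closed_atLeast) (auto simp: Z_def)
  have "compact Y"
    using compact_Int_closed[OF cptZ clY] by (simp add: Y_def Int_absorb1 inf.absorb2 Inf_lower2 INT_lower le_infI1 INF_lower2)
  define \<Phi> where "\<Phi> = (%(t, P1, P2). lyap t (gain t P1) P2)"
  have c\<Phi>: "continuous_on Y \<Phi>"
    unfolding \<Phi>_def case_prod_beta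
  proof (intro continuous_lyap continuous_gain continuous_intros)
    show "invertible (RR (fst z) (fst (snd z)))" if "z \<in> Y" for z
    using that compensatorD(1)[OF comp]
    by (intro invertible_if_quadratic_pos[of \<delta>]) (auto simp: Y_def case_prod_beta)
  qed (auto simp: Y_def Z_def)
  have inY: "(t, K k t, K l t) \<in> Y" if "t \<in> {0..T}" for t k l
    using nb[OF that] that RR_ge(1)[OF comp that kp(5)[OF that, of _ k]] by (auto simp: Y_def Z_def)
  have inYP: "(t, P t, P t) \<in> Y" if "t \<in> {0..T}" for t
    by (rule closed_sequentially[OF clY, of "%k. (t, K k t, K k t)"])
    (auto intro!: inY that tendsto_Pair lim)
  obtain B where B: "\<And>z. z \<in> Y ==> norm (\<Phi> z) \<le> B"
    using compact_imp_bounded[OF compact_continuous_image[OF c\<Phi> \<open>compact Y\<close>]] by (auto simp: bounded_iff)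
  define F where "F t = lyap t (gain t (P t)) (P t)" for t
  have int: "F integrable_on {0..t}" "P t = P 0 + integral {0..t} F" if t: "t \<in> {0..T}" for t
  proof -
    define f where "f k s = lyap s (gain s (K k s)) (K (Suc k) s)" for k s
    have sub: "{0..t} \<subseteq> {0..T}" using t by auto
    have hi: "(f k has_integral K (Suc k) t - K (Suc k) 0) {0..t}" for k
    unfolding f_def
    proof (rule fundamental_theorem_of_calculus)
    show "(K (Suc k) has_vector_derivative lyap s (gain s (K k s)) (K (Suc k) s)) (at s within {0..t})"
    if "s \<in> {0..t}" for s
    using solves_lyapD(3)[OF kp(1)] that sub by (blast intro: has_vector_derivative_within_subset)
    qed (use t in auto)
    have fF: "(%k. f k s) \<longlonglongrightarrow> F s" if s: "s \<in> {0..t}" for s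
    proof -
    have s: "s \<in> {0..T}" using s sub by auto
    have "((%k. \<Phi> (s, K k s, K (Suc k) s)) \<longlongrightarrow> \<Phi> (s, P s, P s)) sequentially"
    by (rule continuous_on_tendsto_compose[OF c\<Phi> _ inYP[OF s]])
    (auto intro!: tendsto_Pair tendsto_const lim[OF s] LIMSEQ_Suc inY s always_eventually)
    then show ?thesis by (simp add: \<Phi>_def f_def F_def)
    qed
    have bd: "norm (f k s) \<le> B" if "s \<in> {0..t}" for k s
    using B[OF inY[of s k "Suc k"]] that sub by (auto simp: \<Phi>_def f_def)
    have dc: "F integrable_on {0..t}" "(%k. integral {0..t} (f k)) \<longlonglongrightarrow> integral {0..t} F"
    by (rule dominated_convergence[where h="%_. B" and f=f];
    use hi bd fF in \<open>auto simp: integrable_on_def intro: exI\<close>)+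
    show "F integrable_on {0..t}" by fact
    have "(%k. K (Suc k) t - K (Suc k) 0) \<longlonglongrightarrow> P t - P 0"
    by (intro tendsto_diff LIMSEQ_Suc lim t) (use T in auto)
    then have "P t - P 0 = integral {0..t} F"
    using dc(2) integral_unique[OF hi] LIMSEQ_unique by simp
    then show "P t = P 0 + integral {0..t} F" by (metis add.commute diff_add_cancel)
  qed
  have cP: "continuous_on {0..T} P"
  proof -
    have "continuous_on {0..T} (%t. P 0 + integral {0..t} F)"
    using T by (intro continuous_intros indefinite_integral_continuous_1 int(1)) auto
    then show ?thesis by (rule continuous_on_eq) (rule int(2)[symmetric])
  qed
  have inv: "invertible (RR t (P t))" if "t \<in> {0..T}" for t
    by (rule RR_ge(2)[OF comp that HP[OF that]])
  have cF: "continuous_on {0..T} F"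
    unfolding F_def by (intro continuous_lyap continuous_gain continuous_intros cP inv) auto
  have der: "(P has_vector_derivative F t) (at t within {0..T})" if t: "t \<in> {0..T}" for t
  proof -
    have "((%u. P 0 + integral {0..u} F) has_vector_derivative 0 + F t) (at t within {0..T})"
    by (intro has_vector_derivative_add has_vector_derivative_const integral_has_vector_derivative[OF cF t])
    then show ?thesis
    unfolding add_0 by (rule has_vector_derivative_transform[OF t, rotated]) (rule int(2))
  qed
  have Dt: "Dt T P t = F t" if "t \<in> {0..T}" for t
    unfolding Dt_def by (rule vector_derivative_within_closed_interval[OF T _ der]) (use that in auto)
  have "riccati P"
    unfolding riccati_def
  proof (intro conjI ballI symP)
    show "C1_on T P"
    unfolding C1_on_def
    proof (intro conjI ballI)
    show "P differentiable at t within {0..T}" if "t \<in> {0..T}" for t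
    using der[OF that] by (rule differentiableI_vector)
    show "continuous_on {0..T} (Dt T P)" by (rule continuous_on_eq[OF cF]) (simp add: Dt)
    qed
    show "P T = G"
    using lim[of T] kp(3) T LIMSEQ_unique[OF _ tendsto_const[of G]] by simp
    show "uniformly_pd_on T (%t. RR t (P t))"
    unfolding uniformly_pd_on_def psd_on_def
    proof (intro exI[of _ \<delta>] conjI AE_I2 impI)
    show "psd (RR t (P t) - mat \<delta>)" if t: "t \<in> {0..T}" for t
    using symm_RR[OF t symP[OF t]] RR_ge(1)[OF comp t HP[OF t]]
    by (auto simp: psd_def symm_def transpose_diff mv.diff_left mat_vector_mult inner_diff_right)
    qed (rule compensatorD(1)[OF comp])
    fix t assume t: "t \<in> {0..T}"
    define N where "N = P t ** A t + transpose (A t) ** P t + transpose (C t) ** P t ** C t + Q t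
    - transpose (gain t (P t)) ** RR t (P t) ** gain t (P t)"
    have "symm N"
    using symP[OF t] symQ[OF t] symm_RR[OF t symP[OF t]]
    by (simp add: N_def symm_def transpose_diff transpose_add matrix_transpose_mul matrix_mul_assoc add.commute)
    then have "symm (F t + N)" using symm_lyap by (simp add: F_def symm_def transpose_add)
    moreover have "v \<bullet> ((F t + N) *v v) = 0" for v
    using lyap_form[OF symP[OF t], of v t "gain t (P t)"] ham_gain[OF t symP[OF t] inv[OF t], of v]
    by (simp add: F_def N_def mv.add_left inner_add_right)
    moreover have "symm (0::real^'n^'n)" by (simp add: symm_def transpose_def vec_eq_iff)
    ultimately have "F t + N = 0" by (intro symm_quadratic_eqI) auto
    then show "Dt T P t + P t ** A t + transpose (A t) ** P t + transpose (C t) ** P t ** C t + Q t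
    - transpose (gain t (P t)) ** RR t (P t) ** gain t (P t) = 0"
    by (simp add: Dt[OF t] N_def algebra_simps)
  qed
  then show ?thesis using HP by blast
qed

end

section \<open>Square-integrable functions\<close>

definition sqi :: "'x measure => ('x => 'a::euclidean_space) => bool" where
  "sqi M f \<longleftrightarrow> f \<in> borel_measurable M \<and> integrable M (%x. (norm (f x))\<^sup>2)"

lemma sqi_measurable [measurable_dest]: "sqi M f ==> f \<in> borel_measurable M"
  and sqi_integrable: "sqi M f ==> integrable M (%x. (norm (f x))\<^sup>2)"
  by (auto simp: sqi_def)

lemma sqi_bound:
  assumes f: "f \<in> borel_measurable M" and g: "integrable M g" and le: "AE x in M. (norm (f x))\<^sup>2 \<le> g x"
  shows "sqi M f"
  unfolding sqi_def
proof (intro conjI f Bochner_Integration.integrable_bound[OF g])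
  show "(%x. (norm (f x))\<^sup>2) \<in> borel_measurable M" using f by measurable
  show "AE x in M. norm ((norm (f x))\<^sup>2) \<le> norm (g x)" using le by eventually_elim auto
qed

lemma norm_add_square_le: "(norm (x + y))\<^sup>2 \<le> 2 * (norm x)\<^sup>2 + 2 * (norm y)\<^sup>2"
  for x y :: "'a::real_normed_vector"
proof -
  have "(norm (x + y))\<^sup>2 \<le> (norm x + norm y)\<^sup>2" by (intro power_mono norm_triangle_ineq) auto
  also have "\<dots> \<le> 2 * (norm x)\<^sup>2 + 2 * (norm y)\<^sup>2"
    using sum_squares_bound[of "norm x" "norm y"] by (simp add: power2_sum)
  finally show ?thesis .
qed

lemma norm_diff_square_le: "(norm (x - y))\<^sup>2 \<le> 2 * (norm x)\<^sup>2 + 2 * (norm y)\<^sup>2"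
  for x y :: "'a::real_normed_vector"
  using norm_add_square_le[of x "- y"] by simp

lemma sqi_add: "sqi M f ==> sqi M g ==> sqi M (%x. f x + g x)"
  by (rule sqi_bound[where g="%x. 2 * (norm (f x))\<^sup>2 + 2 * (norm (g x))\<^sup>2"])
    (auto simp: sqi_def norm_add_square_le)

lemma sqi_diff: "sqi M f ==> sqi M g ==> sqi M (%x. f x - g x)"
  by (rule sqi_bound[where g="%x. 2 * (norm (f x))\<^sup>2 + 2 * (norm (g x))\<^sup>2"])
    (auto simp: sqi_def norm_diff_square_le)

lemma sqi_bounded_linear:
  assumes L: "bounded_linear L" and f: "sqi M f"
  shows "sqi M (%x. L (f x))"
proof -
  obtain K where K: "\<And>x. norm (L x) \<le> norm x * K" "0 \<le> K" using bounded_linear.nonneg_bounded[OF L] by blast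
  show ?thesis
  proof (rule sqi_bound[where g="%x. K\<^sup>2 * (norm (f x))\<^sup>2"])
    show "(%x. L (f x)) \<in> borel_measurable M"
    using f linear_continuous_on[OF L, of UNIV] borel_measurable_continuous_onI measurable_compose[of f M borel L borel]
    by (auto simp: sqi_def)
    have "(norm (L (f x)))\<^sup>2 \<le> K\<^sup>2 * (norm (f x))\<^sup>2" for x
    using power_mono[OF K(1)[of "f x"], of 2] by (simp add: power_mult_distrib mult.commute)
    then show "AE x in M. (norm (L (f x)))\<^sup>2 \<le> K\<^sup>2 * (norm (f x))\<^sup>2" by simp
  qed (use f in \<open>simp add: sqi_def\<close>)
qed

lemma sqi_0: "sqi M (%_. 0)"
  by (simp add: sqi_def)

lemma sqi_const: "finite_measure M ==> sqi M (%_. c)"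
  by (simp add: sqi_def finite_measure.integrable_const)

lemma integrable_inner_sqi:
  assumes "sqi M f" "sqi M g"
  shows "integrable M (%x. f x \<bullet> g x)"
proof (rule Bochner_Integration.integrable_bound)
  show "integrable M (%x. (norm (f x))\<^sup>2 + (norm (g x))\<^sup>2)" using assms by (auto simp: sqi_def)
  have "\<bar>f x \<bullet> g x\<bar> \<le> (norm (f x))\<^sup>2 + (norm (g x))\<^sup>2" for x
    using Cauchy_Schwarz_ineq2[of "f x" "g x"] sum_squares_bound[of "norm (f x)" "norm (g x)"]
    mult_nonneg_nonneg[OF norm_ge_zero[of "f x"] norm_ge_zero[of "g x"]] by linarith
  then show "AE x in M. norm (f x \<bullet> g x) \<le> norm ((norm (f x))\<^sup>2 + (norm (g x))\<^sup>2)" by simp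
qed (use assms in \<open>measurable\<close>)

lemma Cauchy_Schwarz_sqi:
  assumes f: "sqi M f" and g: "sqi M g"
  shows "\<bar>\<integral>x. f x \<bullet> g x \<partial>M\<bar> \<le> sqrt (LINT x|M. (norm (f x))\<^sup>2) * sqrt (LINT x|M. (norm (g x))\<^sup>2)"
proof -
  define a b c where "a = (LINT x|M. (norm (f x))\<^sup>2)" and "b = (LINT x|M. f x \<bullet> g x)" and "c = (LINT x|M. (norm (g x))\<^sup>2)"
  have ac: "0 \<le> a" "0 \<le> c" by (simp_all add: a_def c_def)
  have q: "0 \<le> s\<^sup>2 * a - 2 * s * r * b + r\<^sup>2 * c" for s r
  proof -
    have "0 \<le> (LINT x|M. (norm (s *\<^sub>R f x - r *\<^sub>R g x))\<^sup>2)" by simp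
    also have "\<dots> = (LINT x|M. s\<^sup>2 * (norm (f x))\<^sup>2 - 2 * s * r * (f x \<bullet> g x) + r\<^sup>2 * (norm (g x))\<^sup>2)"
    by (intro Bochner_Integration.integral_cong refl)
    (simp only: power2_norm_eq_inner, simp add: inner_diff_left inner_diff_right inner_commute power2_eq_square algebra_simps)
    also have "\<dots> = s\<^sup>2 * a - 2 * s * r * b + r\<^sup>2 * c"
    using f g integrable_inner_sqi[OF f g] by (simp add: a_def b_def c_def sqi_def)
    finally show ?thesis .
  qed
  have "b\<^sup>2 \<le> a * c"
  proof (cases "c = 0")
    case True
    have "0 \<le> - 2 * r * b + a" for r using q[of 1 r] True by simp
    from this[of "(a + 1) / (2 * b)"] have "b = 0" by (cases "b = 0") (auto simp: field_simps)
    then show ?thesis using True by simp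
  next
    case False
    have "0 \<le> c * (a * c - b\<^sup>2)" using q[of c b] by (simp add: power2_eq_square algebra_simps)
    then show ?thesis using False ac by (simp add: zero_le_mult_iff)
  qed
  then have "sqrt (b\<^sup>2) \<le> sqrt (a * c)" by (rule real_sqrt_le_mono)
  then show ?thesis by (simp add: real_sqrt_mult a_def b_def c_def)
qed

lemma tendsto_inner_sqi:
  assumes f: "\<And>n. sqi M (f n)" "sqi M F" "(%n. \<integral>x. (norm (f n x - F x))\<^sup>2 \<partial>M) \<longlonglongrightarrow> 0"
    and g: "\<And>n. sqi M (g n)" "sqi M G" "(%n. \<integral>x. (norm (g n x - G x))\<^sup>2 \<partial>M) \<longlonglongrightarrow> 0"
  shows "(%n. \<integral>x. f n x \<bullet> g n x \<partial>M) \<longlonglongrightarrow> (LINT x|M. F x \<bullet> G x)"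
proof -
  define a where "a n x = f n x - F x" for n x
  define b where "b n x = g n x - G x" for n x
  have ab: "sqi M (a n)" "sqi M (b n)" for n
    unfolding a_def[abs_def] b_def[abs_def] by (intro sqi_diff f g)+
  have lim: "(%n. \<integral>x. u n x \<bullet> v n x \<partial>M) \<longlonglongrightarrow> 0"
    if u: "\<And>n. sqi M (u n)" and v: "\<And>n. sqi M (v n)"
    and ul: "(%n. \<integral>x. (norm (u n x))\<^sup>2 \<partial>M) \<longlonglongrightarrow> lu" and vl: "(%n. \<integral>x. (norm (v n x))\<^sup>2 \<partial>M) \<longlonglongrightarrow> lv"
    and z: "lu = 0 \<or> lv = 0"
    for u v :: "nat => 'a => 'b" and lu lv
  proof (rule Lim_null_comparison)
    show "\<forall>\<^sub>F n in sequentially. norm (LINT x|M. u n x \<bullet> v n x) \<le> sqrt (LINT x|M. (norm (u n x))\<^sup>2) * sqrt (LINT x|M. (norm (v n x))\<^sup>2)"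
    using Cauchy_Schwarz_sqi[OF u v] by simp
    have "(%n. sqrt (LINT x|M. (norm (u n x))\<^sup>2) * sqrt (LINT x|M. (norm (v n x))\<^sup>2)) \<longlonglongrightarrow> sqrt lu * sqrt lv"
    by (intro tendsto_intros ul vl)
    then show "(%n. sqrt (LINT x|M. (norm (u n x))\<^sup>2) * sqrt (LINT x|M. (norm (v n x))\<^sup>2)) \<longlonglongrightarrow> 0" using z by auto
  qed
  have 1: "(%n. \<integral>x. a n x \<bullet> b n x \<partial>M) \<longlonglongrightarrow> 0"
    by (rule lim[of a b 0 0]) (use ab f(3) g(3) in \<open>simp_all add: a_def b_def\<close>)
  have 2: "(%n. \<integral>x. a n x \<bullet> G x \<partial>M) \<longlonglongrightarrow> 0"
    by (rule lim[of a "%n. G" 0 "\<integral>x. (norm (G x))\<^sup>2 \<partial>M"]) (use ab f(3) g(2) in \<open>simp_all add: a_def\<close>)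
  have 3: "(%n. \<integral>x. F x \<bullet> b n x \<partial>M) \<longlonglongrightarrow> 0"
    by (rule lim[of "%n. F" b "\<integral>x. (norm (F x))\<^sup>2 \<partial>M" 0]) (use ab g(3) f(2) in \<open>simp_all add: b_def\<close>)
  have "(LINT x|M. f n x \<bullet> g n x) = (LINT x|M. a n x \<bullet> b n x) + (LINT x|M. a n x \<bullet> G x) + (LINT x|M. F x \<bullet> b n x) + (LINT x|M. F x \<bullet> G x)" for n
  proof -
    have "(LINT x|M. f n x \<bullet> g n x) = (LINT x|M. a n x \<bullet> b n x + a n x \<bullet> G x + F x \<bullet> b n x + F x \<bullet> G x)"
    by (rule Bochner_Integration.integral_cong)
    (simp_all add: a_def b_def inner_diff_left inner_diff_right)
    then show ?thesis
    using integrable_inner_sqi[OF ab(1)[of n] ab(2)[of n]] integrable_inner_sqi[OF ab(1)[of n] g(2)]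
    integrable_inner_sqi[OF f(2) ab(2)[of n]] integrable_inner_sqi[OF f(2) g(2)] by simp
  qed
  then show ?thesis using tendsto_add[OF tendsto_add[OF tendsto_add[OF 1 2] 3] tendsto_const[of "\<integral>x. F x \<bullet> G x \<partial>M"]]
    by simp
qed

lemma (in finite_measure) sqi_integrable_finite:
  assumes "sqi M f"
  shows "integrable M f"
proof (rule Bochner_Integration.integrable_bound)
  show "integrable M (%x. 1 + (norm (f x))\<^sup>2)" using assms by (auto simp: sqi_def)
  have "norm (f x) \<le> 1 + (norm (f x))\<^sup>2" for x
    using sum_squares_bound[of "norm (f x)" 1] by (simp add: power2_eq_square) (smt (verit) norm_ge_zero mult_nonneg_nonneg)
  then show "AE x in M. norm (f x) \<le> norm (1 + (norm (f x))\<^sup>2)" by simp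
qed (use assms in measurable)

lemma (in finite_measure) norm_integral_square_le:
  assumes "sqi M f"
  shows "(norm (LINT x|M. f x))\<^sup>2 \<le> measure M (space M) * (LINT x|M. (norm (f x))\<^sup>2)"
proof -
  have 1: "sqi M (%x. norm (f x))" using assms by (auto simp: sqi_def)
  have 2: "sqi M (%x. 1::real)" by (rule sqi_const) unfold_locales
  have "norm (LINT x|M. f x) \<le> (LINT x|M. norm (f x))" by (rule integral_norm_bound)
  also have "\<dots> \<le> sqrt (LINT x|M. (norm (f x))\<^sup>2) * sqrt (measure M (space M))"
    using Cauchy_Schwarz_sqi[OF 1 2] by simp
  finally have "(norm (LINT x|M. f x))\<^sup>2 \<le> (sqrt (LINT x|M. (norm (f x))\<^sup>2) * sqrt (measure M (space M)))\<^sup>2"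
    by (intro power_mono) auto
  then show ?thesis by (simp add: power_mult_distrib mult.commute)
qed

section \<open>Brownian motion\<close>

locale bm_space = prob_space M + complete_measure M for M :: "'w measure" +
  fixes T :: real and W :: "real => 'w => real"
  assumes T_pos: "0 < T" and bm: "brownian_motion M T W"
begin

lemma W_measurable: "t \<in> {0..T} ==> W t \<in> borel_measurable M"
  using bm by (simp add: brownian_motion_def)

lemma filt_gen:
  assumes "t \<le> T"
  shows "{W s -` B \<inter> space M | s B. s \<in> {0..t} \<and> B \<in> sets borel} \<union> null_sets M \<subseteq> sets M"
  using W_measurable measurable_sets assms by fastforce

lemma space_filt: "space (filt M W t) = space M"
  by (simp add: filt_def space_measure_of_conv)

lemma sets_filt:
  assumes "t \<le> T"
  shows "sets (filt M W t) = sigma_sets (space M)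
    ({W s -` B \<inter> space M | s B. s \<in> {0..t} \<and> B \<in> sets borel} \<union> null_sets M)"
  using filt_gen[OF assms] sets.sets_into_space unfolding filt_def by (intro sets_measure_of) blast

lemma filt_le_M: "t \<le> T ==> sets (filt M W t) \<subseteq> sets M"
  unfolding sets_filt by (rule sets.sigma_sets_subset[OF filt_gen])

lemma filt_mono:
  assumes "s \<le> t" "t \<le> T"
  shows "sets (filt M W s) \<subseteq> sets (filt M W t)"
proof -
  have s: "s \<le> T" using assms by simp
  have "{W u -` B \<inter> space M | u B. u \<in> {0..s} \<and> B \<in> sets borel} \<subseteq> {W u -` B \<inter> space M | u B. u \<in> {0..t} \<and> B \<in> sets borel}"
    using assms by (intro Collect_mono) (metis atLeastAtMost_iff order_trans)
  then show ?thesis unfolding sets_filt[OF assms(2)] sets_filt[OF s]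
    by (intro sigma_sets_mono') blast
qed

lemma filt_null: "t \<le> T ==> N \<in> null_sets M ==> N \<in> sets (filt M W t)"
  by (simp add: sets_filt)

lemma filt_measurable_M: "t \<le> T ==> f \<in> measurable (filt M W t) N ==> f \<in> measurable M N"
  by (rule measurable_mono[THEN subsetD, rotated 4, of _ "filt M W t"]) (use filt_le_M space_filt in auto)

lemma filt_measurable_mono: "s \<le> t ==> t \<le> T ==> f \<in> measurable (filt M W s) N ==> f \<in> measurable (filt M W t) N"
  by (rule measurable_mono[THEN subsetD, rotated 4, of _ "filt M W s"]) (use filt_mono space_filt in auto)

lemma W_filt_measurable:
  assumes "s \<in> {0..t}" "t \<le> T"
  shows "W s \<in> borel_measurable (filt M W t)"
  using assms by (intro measurableI) (auto simp: sets_filt[OF assms(2)] space_filt intro!: sigma_sets.Basic)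

lemma filt_AE_cong:
  fixes g :: "'w => 'b::topological_space"
  assumes f: "f \<in> borel_measurable (filt M W t)" and t: "t \<le> T" and ae: "AE w in M. f w = g w"
  shows "g \<in> borel_measurable (filt M W t)"
proof (rule measurableI)
  fix A :: "'b set" assume A: "A \<in> sets borel"
  define N where "N = {w \<in> space M. f w \<noteq> g w}"
  have N: "N \<in> null_sets M" using ae unfolding AE_iff_null_sets by (simp add: N_def)
  have "g -` A \<inter> space M = ((f -` A \<inter> space M) - N) \<union> (g -` A \<inter> N)" by (auto simp: N_def)
  moreover have "g -` A \<inter> N \<in> null_sets M" by (rule complete2[OF _ N]) auto
  moreover have "f -` A \<inter> space M \<in> sets (filt M W t)"
    using measurable_sets[OF f A] by (simp add: space_filt)
  ultimately show "g -` A \<inter> space (filt M W t) \<in> sets (filt M W t)"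
    using filt_null[OF t] N by (auto simp: space_filt)
qed auto

definition B :: "real => 'w => real" where
  "B t w = (if W 0 w = 0 \<and> continuous_on {0..T} (%t. W t w) then W t w else 0)"

lemma B_eq_W: "AE w in M. \<forall>t. B t w = W t w"
proof -
  have "AE w in M. W 0 w = 0" "AE w in M. continuous_on {0..T} (%t. W t w)"
    using bm by (auto simp: brownian_motion_def)
  then show ?thesis by eventually_elim (simp add: B_def)
qed

lemma B_continuous: "continuous_on {0..T} (%t. B t w)"
proof -
  let ?c = "W 0 w = 0 \<and> continuous_on {0..T} (%t. W t w)"
  have "(%t. B t w) = (%t. W t w)" if ?c using that by (simp add: B_def fun_eq_iff)
  moreover have "(%t. B t w) = (%t. 0)" if "\<not> ?c" by (simp only: B_def if_not_P[OF that])
  ultimately show ?thesis by (metis continuous_on_const)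
qed

lemma B_filt_measurable: "s \<in> {0..t} ==> t \<le> T ==> B s \<in> borel_measurable (filt M W t)"
  by (rule filt_AE_cong[OF W_filt_measurable]) (use B_eq_W in auto)

lemma indep_past_increment:
  assumes s: "0 \<le> s" "s < t" "t \<le> T"
  shows "indep_set (sets (filt M W s)) {(%w. W t w - W s w) -` E \<inter> space M | E. E \<in> sets borel}"
proof -
  define \<Delta> where "\<Delta> w = W t w - W s w" for w
  define \<G> where "\<G> = {A \<in> sets M. \<exists>F C. finite F \<and> F \<subseteq> {0..s} \<and> (\<forall>u. C u \<in> sets borel) \<and>
    (AE w in M. w \<in> A \<longleftrightarrow> (\<forall>u\<in>F. W u w \<in> C u))}"
  define \<D> where "\<D> = {\<Delta> -` E \<inter> space M | E. E \<in> sets (borel :: real measure)}"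
  have [measurable]: "\<Delta> \<in> borel_measurable M"
    unfolding \<Delta>_def[abs_def] using s by (intro borel_measurable_diff W_measurable) auto
  have W0: "AE w in M. W 0 w = 0" using bm by (auto simp: brownian_motion_def)
  have Int\<G>: "Int_stable \<G>"
  proof (rule Int_stableI)
    fix a b assume "a \<in> \<G>" "b \<in> \<G>"
    then obtain F C F' C' where *: "a \<in> sets M" "b \<in> sets M" "finite F" "F \<subseteq> {0..s}" "\<forall>u. C u \<in> sets borel"
    "AE w in M. w \<in> a \<longleftrightarrow> (\<forall>u\<in>F. W u w \<in> C u)" "finite F'" "F' \<subseteq> {0..s}" "\<forall>u. C' u \<in> sets borel"
    "AE w in M. w \<in> b \<longleftrightarrow> (\<forall>u\<in>F'. W u w \<in> C' u)"
    unfolding \<G>_def by blast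
    define CC where "CC u = (if u \<in> F then C u else UNIV) \<inter> (if u \<in> F' then C' u else UNIV)" for u
    have "AE w in M. w \<in> a \<inter> b \<longleftrightarrow> (\<forall>u\<in>F \<union> F'. W u w \<in> CC u)"
    using *(6,10) by eventually_elim (auto simp: CC_def)
    moreover have "\<forall>u. CC u \<in> sets borel" using * by (auto simp: CC_def)
    ultimately show "a \<inter> b \<in> \<G>"
    unfolding \<G>_def using * by (auto intro!: exI[of _ "F \<union> F'"] exI[of _ CC])
  qed
  have Int\<D>: "Int_stable \<D>"
  proof (rule Int_stableI)
    fix a b assume "a \<in> \<D>" "b \<in> \<D>"
    then obtain E E' where "E \<in> sets borel" "E' \<in> sets borel" "a = \<Delta> -` E \<inter> space M" "b = \<Delta> -` E' \<inter> space M"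
    by (auto simp: \<D>_def)
    then show "a \<inter> b \<in> \<D>" by (auto simp: \<D>_def intro!: exI[of _ "E \<inter> E'"])
  qed
  have "prob (a \<inter> b) = prob a * prob b" if a: "a \<in> \<G>" and b: "b \<in> \<D>" for a b
  proof -
    obtain F C where FC: "a \<in> sets M" "finite F" "F \<subseteq> {0..s}" "\<forall>u. C u \<in> sets borel"
    "AE w in M. w \<in> a \<longleftrightarrow> (\<forall>u\<in>F. W u w \<in> C u)" using a by (auto simp: \<G>_def)
    obtain E where E: "E \<in> sets borel" "b = \<Delta> -` E \<inter> space M" using b by (auto simp: \<D>_def)
    define L where "L = sorted_list_of_set (insert 0 (insert s F))"
    have L: "sorted L" "set L = insert 0 (insert s F)"
    unfolding L_def using FC(2) by (simp_all only: sorted_sorted_list_of_set set_sorted_list_of_set finite_insert)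
    then have "L \<noteq> []" by (metis insert_not_empty set_empty)
    define k where "k = length L - 1"
    have lenL: "length L = Suc k" using \<open>L \<noteq> []\<close> by (cases L) (auto simp: k_def)
    define \<tau> where "\<tau> i = (if i \<le> k then L ! i else t)" for i
    have \<tau>s: "\<tau> i \<in> {0..s}" if "i \<le> k" for i
    using L(2) nth_mem[of i L] that lenL FC(3) s by (auto simp: \<tau>_def)
    have \<tau>0: "\<tau> 0 = 0"
    proof -
    obtain j where "j < length L" "L ! j = 0" using L(2) in_set_conv_nth[of 0 L] by auto
    then have "L ! 0 \<le> 0" using sorted_nth_mono[OF L(1), of 0 j] by auto
    then show ?thesis using \<tau>s[of 0] by (auto simp: \<tau>_def)
    qed
    have \<tau>k: "\<tau> k = s"
    proof -
    obtain j where "j < length L" "L ! j = s" using L(2) in_set_conv_nth[of s L] by auto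
    then have "s \<le> L ! k" using sorted_nth_mono[OF L(1), of j k] lenL by auto
    then show ?thesis using \<tau>s[of k] by (auto simp: \<tau>_def)
    qed
    have ind: "indep_vars (%_. borel) (%i w. W (\<tau> (Suc i)) w - W (\<tau> i) w) {..<Suc k}"
    proof -
    have "(\<forall>i\<le>Suc k. \<tau> i \<in> {0..T}) \<and> (\<forall>i<Suc k. \<tau> i \<le> \<tau> (Suc i))"
    proof (intro conjI allI impI)
    fix i assume "i \<le> Suc k"
    then show "\<tau> i \<in> {0..T}" using \<tau>s[of i] s by (cases "i \<le> k") (auto simp: \<tau>_def)
    next
    fix i assume i: "i < Suc k"
    show "\<tau> i \<le> \<tau> (Suc i)"
    proof (cases "Suc i \<le> k")
    case True
    then show ?thesis using sorted_nth_mono[OF L(1), of i "Suc i"] lenL by (auto simp: \<tau>_def)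
    next
    case False
    then show ?thesis using \<tau>s[of i] s i by (auto simp: \<tau>_def)
    qed
    qed
    then show ?thesis using bm unfolding brownian_motion_def by blast
    qed
    define X where "X i w = W (\<tau> (Suc i)) w - W (\<tau> i) w" for i w
    have iv: "indep_var (PiM {..<k} (%_. borel)) (%w. restrict (%i. X i w) {..<k}) (PiM {k} (%_. borel)) (%w. restrict (%i. X i w) {k})"
    unfolding X_def by (rule indep_var_restrict[OF ind]) auto
    have "\<forall>u\<in>F. \<exists>i\<le>k. \<tau> i = u"
    proof
    fix u assume "u \<in> F"
    then obtain i where "i < length L" "L ! i = u" using L(2) in_set_conv_nth[of u L] by auto
    then show "\<exists>i\<le>k. \<tau> i = u" using lenL by (auto simp: \<tau>_def intro!: exI[of _ i])
    qed
    then obtain ix where ix: "\<And>u. u \<in> F ==> ix u \<le> k \<and> \<tau> (ix u) = u" by metis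
    define P1 where "P1 = {x \<in> space (PiM {..<k} (%_. borel :: real measure)). \<forall>u\<in>F. (\<Sum>j<ix u. x j) \<in> C u}"
    have P1: "P1 \<in> sets (PiM {..<k} (%_. borel))"
    unfolding P1_def
    proof (rule sets.sets_Collect_finite_All[OF _ FC(2)])
    fix u assume u: "u \<in> F"
    have "(%x. \<Sum>j<ix u. x j) \<in> borel_measurable (PiM {..<k} (%_. borel :: real measure))"
    using ix[OF u] by (intro borel_measurable_sum measurable_component_singleton) auto
    from measurable_sets[OF this, of "C u"] FC(4)
    show "{x \<in> space (PiM {..<k} (%_. borel)). (\<Sum>j<ix u. x j) \<in> C u} \<in> sets (PiM {..<k} (%_. borel))"
    by (simp add: vimage_def Int_def conj_commute)
    qed
    define P2 where "P2 = {x \<in> space (PiM {k} (%_. borel :: real measure)). x k \<in> E}"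
    have P2: "P2 \<in> sets (PiM {k} (%_. borel))"
    unfolding P2_def using E(1) by measurable
    have tel: "\<forall>n. (\<Sum>j<n. X j w) = W (\<tau> n) w - W (\<tau> 0) w" for w
    unfolding X_def using sum_lessThan_telescope[of "%i. W (\<tau> i) w"] by blast
    have X1: "AE w in M. w \<in> a \<longleftrightarrow> restrict (%i. X i w) {..<k} \<in> P1"
    using FC(5) W0
    proof eventually_elim
    fix w assume 1: "w \<in> a \<longleftrightarrow> (\<forall>u\<in>F. W u w \<in> C u)" and 2: "W 0 w = 0"
    have "(\<Sum>j<ix u. restrict (%i. X i w) {..<k} j) = W u w" if "u \<in> F" for u
    proof -
    have "(\<Sum>j<ix u. restrict (%i. X i w) {..<k} j) = (\<Sum>j<ix u. X j w)"
    using ix[OF that] by (intro sum.cong) auto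
    then show ?thesis using ix[OF that] spec[OF tel[of w], of "ix u"] \<tau>0 2 by simp
    qed
    then show "w \<in> a \<longleftrightarrow> restrict (%i. X i w) {..<k} \<in> P1"
    using 1 by (auto simp: P1_def space_PiM)
    qed
    have Xk: "X k w = \<Delta> w" for w using \<tau>k by (simp add: X_def \<Delta>_def \<tau>_def)
    have X2: "w \<in> b \<longleftrightarrow> restrict (%i. X i w) {k} \<in> P2" if "w \<in> space M" for w
    using that Xk by (auto simp: P2_def E(2) space_PiM)
    note rv = indep_var_rv1[OF iv] indep_var_rv2[OF iv]
    have s1: "(%w. restrict (%i. X i w) {..<k}) -` P1 \<inter> space M \<in> sets M"
    by (rule measurable_sets[OF rv(1) P1])
    have bM: "b \<in> sets M" unfolding E(2) using E(1) by measurable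
    have b_eq: "b = (%w. restrict (%i. X i w) {k}) -` P2 \<inter> space M"
    using X2 sets.sets_into_space[OF bM] by auto
    have pa: "prob a = prob ((%w. restrict (%i. X i w) {..<k}) -` P1 \<inter> space M)"
    by (rule finite_measure_eq_AE[OF _ FC(1) s1]) (use X1 AE_space in eventually_elim, auto)
    have "prob (a \<inter> b) = prob ((%w. (restrict (%i. X i w) {..<k}, restrict (%i. X i w) {k})) -` (P1 \<times> P2) \<inter> space M)"
    proof (rule finite_measure_eq_AE)
    show "AE w in M. (w \<in> a \<inter> b) = (w \<in> (%w. (restrict (%i. X i w) {..<k}, restrict (%i. X i w) {k})) -` (P1 \<times> P2) \<inter> space M)"
    using X1 AE_space by eventually_elim (auto simp: b_eq)
    show "(%w. (restrict (%i. X i w) {..<k}, restrict (%i. X i w) {k})) -` (P1 \<times> P2) \<inter> space M \<in> sets M"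
    using sets.Int[OF s1 bM] unfolding b_eq by (rule back_subst[of "%x. x \<in> sets M"]) auto
    qed (use FC(1) bM in auto)
    also have "\<dots> = prob a * prob b"
    unfolding indep_varD[OF iv P1 P2] pa b_eq ..
    finally show ?thesis .
  qed
  then have "indep_set \<G> \<D>"
    by (intro indep_setI) (auto simp: \<G>_def \<D>_def)
  from indep_set_sigma_sets[OF this Int\<G> Int\<D>]
  have ind: "indep_set (sigma_sets (space M) \<G>) (sigma_sets (space M) \<D>)" .
  have "sets (filt M W s) \<subseteq> sigma_sets (space M) \<G>"
  proof -
    have "W u -` E \<inter> space M \<in> \<G>" if "u \<in> {0..s}" "E \<in> sets borel" for u E
    using that W_measurable[of u] s measurable_sets[of "W u" M borel E] unfolding \<G>_def
    by (auto intro!: exI[of _ "{u}"] exI[of _ "%_. E"] AE_I2)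
    moreover have "N \<in> \<G>" if "N \<in> null_sets M" for N
    using that AE_not_in[OF that] unfolding \<G>_def
    by (auto intro!: exI[of _ "{0::real}"] exI[of _ "%_. {}"] simp: s)
    ultimately show ?thesis
    using s by (subst sets_filt) (auto intro!: sigma_sets_mono')
  qed
  moreover have "\<D> \<subseteq> sigma_sets (space M) \<D>" by auto
  ultimately show ?thesis
    using indep_setD[OF ind] indep_setD_ev1[OF ind] indep_setD_ev2[OF ind]
    unfolding \<D>_def[symmetric] \<Delta>_def[abs_def, symmetric]
    by (intro indep_setI) (auto simp: \<D>_def \<Delta>_def)
qed

lemma increment_indep_var:
  assumes s: "0 \<le> s" "s < t" "t \<le> T" and Y: "Y \<in> borel_measurable (filt M W s)"
    and f: "f \<in> borel_measurable borel"
  shows "indep_var borel (Y :: 'w => real) borel (%w. f (W t w - W s w) :: real)"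
proof -
  have sT: "s \<le> T" using s by simp
  have ind: "indep_set (sigma_sets (space M) (sets (filt M W s)))
    (sigma_sets (space M) {(%w. W t w - W s w) -` E \<inter> space M | E. E \<in> sets borel})"
  proof (rule indep_set_sigma_sets[OF indep_past_increment[OF s]])
    show "Int_stable (sets (filt M W s))" by (simp add: Int_stable_def sets.Int)
    show "Int_stable {(%w. W t w - W s w) -` E \<inter> space M | E. E \<in> sets borel}"
    proof (rule Int_stableI)
    fix a b assume "a \<in> {(%w. W t w - W s w) -` E \<inter> space M | E. E \<in> sets borel}"
    and "b \<in> {(%w. W t w - W s w) -` E \<inter> space M | E. E \<in> sets borel}"
    then obtain E E' where "E \<in> sets borel" "E' \<in> sets borel" "a = (%w. W t w - W s w) -` E \<inter> space M"
    "b = (%w. W t w - W s w) -` E' \<inter> space M" by blast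
    then show "a \<inter> b \<in> {(%w. W t w - W s w) -` E \<inter> space M | E. E \<in> sets borel}"
    by (auto intro!: exI[of _ "E \<inter> E'"])
    qed
  qed
  have sub1: "{Y -` A \<inter> space M | A. A \<in> sets borel} \<subseteq> sets (filt M W s)"
    using measurable_sets[OF Y] by (auto simp: space_filt)
  have sub2: "{(%w. f (W t w - W s w)) -` A \<inter> space M | A. A \<in> sets borel}
    \<subseteq> {(%w. W t w - W s w) -` E \<inter> space M | E. E \<in> sets borel}"
  proof
    fix x assume "x \<in> {(%w. f (W t w - W s w)) -` A \<inter> space M | A. A \<in> sets borel}"
    then obtain A where "A \<in> sets borel" "x = (%w. f (W t w - W s w)) -` A \<inter> space M" by blast
    then show "x \<in> {(%w. W t w - W s w) -` E \<inter> space M | E. E \<in> sets borel}"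
    using measurable_sets[OF f, of A] by (auto intro!: exI[of _ "f -` A"])
  qed
  note sub = sigma_sets_mono'[OF sub1, of "space M"] sigma_sets_mono'[OF sub2, of "space M"]
  show ?thesis
    unfolding indep_var_eq
  proof (intro conjI)
    show "random_variable borel Y" by (rule filt_measurable_M[OF sT Y])
    have "(%w. W t w - W s w) \<in> borel_measurable M" using s by (intro borel_measurable_diff W_measurable) auto
    then show "random_variable borel (%w. f (W t w - W s w))" by (rule measurable_compose[OF _ f])
    show "indep_set (sigma_sets (space M) {Y -` A \<inter> space M |A. A \<in> sets borel})
    (sigma_sets (space M) {(%w. f (W t w - W s w)) -` A \<inter> space M |A. A \<in> sets borel})"
    by (intro indep_setI indep_setD[OF ind] order_trans[OF sub(1) indep_setD_ev1[OF ind]]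
    order_trans[OF sub(2) indep_setD_ev2[OF ind]] subsetD[OF sub(1)] subsetD[OF sub(2)])
  qed
qed

lemma increment_moments:
  assumes s: "0 \<le> s" "s < t" "t \<le> T"
  shows "integrable M (%w. W t w - W s w)" "(LINT w|M. W t w - W s w) = 0"
    "integrable M (%w. (W t w - W s w)\<^sup>2)" "(LINT w|M. (W t w - W s w)\<^sup>2) = t - s"
proof -
  define \<sigma> where "\<sigma> = sqrt (t - s)"
  have \<sigma>: "0 < \<sigma>" using s by (simp add: \<sigma>_def)
  have D: "distributed M lborel (%w. W t w - W s w) (%y. ennreal (normal_density 0 \<sigma> y))"
    using bm s by (simp add: brownian_motion_def \<sigma>_def)
  show "(LINT w|M. W t w - W s w) = 0" by (rule normal_distributed_expectation[OF \<sigma> D])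
  then show "(LINT w|M. (W t w - W s w)\<^sup>2) = t - s"
    using normal_distributed_variance[OF \<sigma> D] s by (simp add: \<sigma>_def)
  have "integrable lborel (%x. normal_density 0 \<sigma> x * x ^ k)" for k
    using integrable_normal_moment[OF \<sigma>, of 0 k] by simp
  then have "integrable M (%w. (W t w - W s w) ^ k)" for k
    by (subst distributed_integrable[OF D, symmetric]) auto
  from this[of 1] this[of 2] show "integrable M (%w. W t w - W s w)" "integrable M (%w. (W t w - W s w)\<^sup>2)"
    by simp_all
qed

lemma B_increment:
  assumes s: "0 \<le> s" "s \<le> t" "t \<le> T" and Y: "Y \<in> borel_measurable (filt M W s)" "integrable M Y"
  shows "integrable M (%w. Y w * (B t w - B s w))" "(LINT w|M. Y w * (B t w - B s w)) = 0"
    "integrable M (%w. Y w * (B t w - B s w)\<^sup>2)" "(LINT w|M. Y w * (B t w - B s w)\<^sup>2) = (t - s) * (LINT w|M. Y w)"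
proof -
  have meas: "Y \<in> borel_measurable M" "W t \<in> borel_measurable M" "W s \<in> borel_measurable M"
    "B t \<in> borel_measurable M" "B s \<in> borel_measurable M"
    using filt_measurable_M[OF _ Y(1)] s W_measurable B_filt_measurable[of t T] B_filt_measurable[of s T]
    filt_measurable_M[of T] by auto
  have ae: "AE w in M. Y w * (W t w - W s w) = Y w * (B t w - B s w)"
    "AE w in M. Y w * (W t w - W s w)\<^sup>2 = Y w * (B t w - B s w)\<^sup>2"
    using B_eq_W by auto
  have *: "integrable M (%w. Y w * (W t w - W s w)) \<and> (LINT w|M. Y w * (W t w - W s w)) = 0 \<and>
    integrable M (%w. Y w * (W t w - W s w)\<^sup>2) \<and>
    (LINT w|M. Y w * (W t w - W s w)\<^sup>2) = (t - s) * (LINT w|M. Y w)"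
  proof (cases "s = t")
    case False
    then have st: "s < t" using s by simp
    note m = increment_moments[OF s(1) st s(3)]
    note i = increment_indep_var[OF s(1) st s(3) Y(1), of "%x. x"] increment_indep_var[OF s(1) st s(3) Y(1), of "%x. x\<^sup>2"]
    show ?thesis
    using indep_var_integrable[OF i(1) Y(2) m(1)] indep_var_lebesgue_integral[OF i(1) Y(2) m(1)]
    indep_var_integrable[OF i(2) Y(2) m(3)] indep_var_lebesgue_integral[OF i(2) Y(2) m(3)] m(2,4)
    by simp
  qed simp
  show "integrable M (%w. Y w * (B t w - B s w))"
    using * by (subst integrable_cong_AE[THEN iffD1, OF _ _ ae(1)]) (use meas in simp_all)
  show "(LINT w|M. Y w * (B t w - B s w)) = 0"
    using * by (subst integral_cong_AE[OF _ _ ae(1), symmetric]) (use meas in simp_all)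
  show "integrable M (%w. Y w * (B t w - B s w)\<^sup>2)"
    using * by (subst integrable_cong_AE[THEN iffD1, OF _ _ ae(2)]) (use meas in simp_all)
  show "(LINT w|M. Y w * (B t w - B s w)\<^sup>2) = (t - s) * (LINT w|M. Y w)"
    using * by (subst integral_cong_AE[OF _ _ ae(2), symmetric]) (use meas in simp_all)
qed

end

section \<open>Processes\<close>

abbreviation lam :: "real => real measure" where
  "lam t \<equiv> restrict_space lborel {0..t}"

lemma finite_measure_lam: "finite_measure (lam t)"
  by (rule finite_measureI) (simp add: emeasure_restrict_space space_restrict_space emeasure_lborel_Icc_eq)

lemma set_integral_lam: "(LINT s:{0..t}|lborel. f s) = (LINT s|lam t. f s)"
  for f :: "real => 'a::{banach, second_countable_topology}"
  by (subst integral_restrict_space) (simp_all add: set_lebesgue_integral_def)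

lemma set_integrable_lam: "set_integrable lborel {0..t} f \<longleftrightarrow> integrable (lam t) f"
  for f :: "real => 'a::{banach, second_countable_topology}"
  by (subst integrable_restrict_space) (simp_all add: set_integrable_def)

lemma sqi_nn_iff: "sqi M f \<longleftrightarrow> f \<in> borel_measurable M \<and> (\<integral>\<^sup>+x. ennreal ((norm (f x))\<^sup>2) \<partial>M) < \<infinity>"
proof (cases "f \<in> borel_measurable M")
  case True
  then show ?thesis by (simp add: sqi_def integrable_iff_bounded)
qed (simp add: sqi_def)

lemma measurable_norm_square:
  fixes f :: "'a => 'b => 'c::euclidean_space"
  assumes "(%(s, w). f s w) \<in> borel_measurable N"
  shows "(%(s, w). ennreal ((norm (f s w))\<^sup>2)) \<in> borel_measurable N"
proof -
  have "(%z. f (fst z) (snd z)) \<in> borel_measurable N" using assms by (simp add: case_prod_beta')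
  then show ?thesis unfolding case_prod_beta' by measurable
qed

lemma SUP_dyadic:
  fixes f :: "real => real"
  assumes T: "0 < T" and f: "continuous_on {0..T} f"
  shows "(SUP t\<in>{0..T}. ennreal (f t)) = (SUP n. SUP j\<in>{..(2::nat)^n}. ennreal (f (T * real j / 2^n)))"
proof (rule antisym)
  have mem: "T * real j / 2^n \<in> {0..T}" if "j \<le> 2^n" for j n :: nat
  proof -
    have "real j \<le> 2^n" using that by (metis of_nat_le_iff of_nat_numeral of_nat_power)
    then show ?thesis using T by (simp add: field_simps)
  qed
  then show "(SUP n. SUP j\<in>{..(2::nat)^n}. ennreal (f (T * real j / 2^n))) \<le> (SUP t\<in>{0..T}. ennreal (f t))"
    by (intro SUP_least SUP_upper) auto
  show "(SUP t\<in>{0..T}. ennreal (f t)) \<le> (SUP n. SUP j\<in>{..(2::nat)^n}. ennreal (f (T * real j / 2^n)))"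
  proof (rule SUP_least)
    fix t assume t: "t \<in> {0..T}"
    define j where "j n = nat \<lfloor>t / T * 2^n\<rfloor>" for n :: nat
    have jr: "real (j n) = of_int \<lfloor>t / T * 2^n\<rfloor>" for n using t T by (simp add: j_def)
    have jle: "j n \<le> 2^n" for n
    proof -
    have "t / T * 2^n \<le> 1 * 2^n" using t T by (intro mult_right_mono) auto
    then have "real (j n) \<le> 2^n" unfolding jr by linarith
    then show ?thesis by (metis of_nat_le_iff of_nat_numeral of_nat_power)
    qed
    have "(%n. T * real (j n) / 2^n) \<longlonglongrightarrow> t"
    proof (rule tendsto_sandwich)
    show "\<forall>\<^sub>F n in sequentially. t - T * (1/2)^n \<le> T * real (j n) / 2^n"
    proof (intro always_eventually allI)
    fix n
    have "t / T * 2^n - 1 \<le> real (j n)" unfolding jr by linarith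
    then have "T / 2^n * (t / T * 2^n - 1) \<le> T / 2^n * real (j n)" using T by (intro mult_left_mono) auto
    moreover have "T / 2^n * (t / T * 2^n - 1) = t - T * (1/2)^n"
    using T by (simp add: right_diff_distrib power_divide)
    ultimately show "t - T * (1/2)^n \<le> T * real (j n) / 2^n" by simp
    qed
    show "\<forall>\<^sub>F n in sequentially. T * real (j n) / 2^n \<le> t"
    proof (intro always_eventually allI)
    fix n
    have "real (j n) \<le> t / T * 2^n" unfolding jr by linarith
    then have "T / 2^n * real (j n) \<le> T / 2^n * (t / T * 2^n)" using T by (intro mult_left_mono) auto
    then show "T * real (j n) / 2^n \<le> t" using T by simp
    qed
    have "(%n. t - T * (1/2)^n) \<longlonglongrightarrow> t - T * 0" by (intro tendsto_intros LIMSEQ_power_zero) auto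
    then show "(%n. t - T * (1/2)^n) \<longlonglongrightarrow> t" by simp
    qed simp
    then have "(%n. f (T * real (j n) / 2^n)) \<longlonglongrightarrow> f t"
    using mem[OF jle] t by (intro continuous_on_tendsto_compose[OF f]) auto
    then have "(%n. ennreal (f (T * real (j n) / 2^n))) \<longlonglongrightarrow> ennreal (f t)" by (rule tendsto_ennrealI)
    then show "ennreal (f t) \<le> (SUP n. SUP j\<in>{..(2::nat)^n}. ennreal (f (T * real j / 2^n)))"
    proof (rule LIMSEQ_le_const2, intro exI allI impI)
    fix n
    show "ennreal (f (T * real (j n) / 2^n)) \<le> (SUP n. SUP j\<in>{..(2::nat)^n}. ennreal (f (T * real j / 2^n)))"
    using jle[of n] by (intro SUP_upper2[of n] SUP_upper2[of "j n"]) auto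
    qed
  qed
qed

context bm_space
begin

definition ac :: "(real => 'w => 'a::euclidean_space) => bool" where
  "ac X \<longleftrightarrow> (\<forall>t\<in>{0..T}. X t \<in> borel_measurable (filt M W t)) \<and>
    (\<forall>w\<in>space M. continuous_on {0..T} (%t. X t w))"

definition supn :: "(real => 'w => 'a::euclidean_space) => 'w => ennreal" where
  "supn X w = (SUP t\<in>{0..T}. ennreal ((norm (X t w))\<^sup>2))"

lemma acD: "ac X ==> t \<in> {0..T} ==> X t \<in> borel_measurable (filt M W t)"
  "ac X ==> w \<in> space M ==> continuous_on {0..T} (%t. X t w)"
  by (auto simp: ac_def)

lemma ac_measurable: "ac X ==> t \<in> {0..T} ==> X t \<in> borel_measurable M"
  by (rule filt_measurable_M[of t, OF _ acD(1)]) auto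

lemma ac_add: "ac X ==> ac Y ==> ac (%t w. X t w + Y t w)"
  and ac_diff: "ac X ==> ac Y ==> ac (%t w. X t w - Y t w)"
  and ac_const: "ac (%t w. c)"
  unfolding ac_def by (auto intro!: continuous_intros borel_measurable_add borel_measurable_diff)

lemma supn_dyadic:
  "ac X ==> w \<in> space M ==>
    supn X w = (SUP n. SUP j\<in>{..(2::nat)^n}. ennreal ((norm (X (T * real j / 2^n) w))\<^sup>2))"
  unfolding supn_def by (rule SUP_dyadic[OF T_pos]) (auto intro!: continuous_intros acD)

lemma dyadic_mem: "j \<le> 2^n ==> T * real j / 2^n \<in> {0..T}" for j n :: nat
proof -
  assume "j \<le> 2^n"
  then have "real j \<le> 2^n" by (metis of_nat_le_iff of_nat_numeral of_nat_power)
  then show ?thesis using T_pos by (simp add: field_simps)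
qed

lemma supn_measurable:
  assumes "ac X"
  shows "supn X \<in> borel_measurable M"
proof -
  have "(%w. SUP n. SUP j\<in>{..(2::nat)^n}. ennreal ((norm (X (T * real j / 2^n) w))\<^sup>2)) \<in> borel_measurable M"
  proof (intro borel_measurable_SUP)
    fix n j assume "j \<in> {..(2::nat)^n}"
    then have [measurable]: "X (T * real j / 2^n) \<in> borel_measurable M"
    by (intro ac_measurable[OF assms] dyadic_mem) auto
    show "(%w. ennreal ((norm (X (T * real j / 2^n) w))\<^sup>2)) \<in> borel_measurable M" by measurable
  qed (auto intro: countable_finite)
  then show ?thesis by (rule measurable_cong[THEN iffD2, rotated]) (rule supn_dyadic[OF assms])
qed

lemma supn_upper: "t \<in> {0..T} ==> ennreal ((norm (X t w))\<^sup>2) \<le> supn X w"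
  unfolding supn_def by (rule SUP_upper)

lemma ac_progressive:
  assumes X: "ac X"
  shows "progressive M T W X"
  unfolding progressive_def
proof
  fix t assume t: "t \<in> {0..T}"
  let ?N = "restrict_space borel {0..t} \<Otimes>\<^sub>M filt M W t"
  define \<tau> where "\<tau> n j = t * real j / real (Suc n)" for n j
  define Xn where "Xn n = (%(s, w). \<Sum>j\<le>Suc n. indicat_real {s. \<lfloor>real (Suc n) * s / t\<rfloor> = int j} s *\<^sub>R X (\<tau> n j) w)" for n
  have \<tau>: "\<tau> n j \<in> {0..t}" if "j \<le> Suc n" for n j
  proof -
    have "t * real j \<le> t * real (Suc n)" using t that by (intro mult_left_mono) auto
    then show ?thesis using t by (simp add: \<tau>_def field_simps)
  qed
  show "(%(s, w). X s w) \<in> borel_measurable ?N"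
  proof (rule borel_measurable_LIMSEQ_metric[where f=Xn])
    fix n
    show "Xn n \<in> borel_measurable ?N"
    unfolding Xn_def case_prod_beta
    proof (intro borel_measurable_sum borel_measurable_scaleR)
    fix j assume j: "j \<in> {..Suc n}"
    have "{s. \<lfloor>real (Suc n) * s / t\<rfloor> = int j} \<in> sets borel" by measurable
    then show "(%x. indicat_real {s. \<lfloor>real (Suc n) * s / t\<rfloor> = int j} (fst x)) \<in> borel_measurable ?N"
    by (intro measurable_compose[OF measurable_fst] measurable_restrict_space1 borel_measurable_indicator)
    have "X (\<tau> n j) \<in> borel_measurable (filt M W t)"
    using acD(1)[OF X, of "\<tau> n j"] \<tau>[of j n] j t by (intro filt_measurable_mono[of "\<tau> n j" t]) auto
    then show "(%x. X (\<tau> n j) (snd x)) \<in> borel_measurable ?N"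
    by (rule measurable_compose[OF measurable_snd])
    qed
  next
    fix z assume "z \<in> space ?N"
    then obtain s w where z: "z = (s, w)" "s \<in> {0..t}" "w \<in> space M"
    by (auto simp: space_pair_measure space_restrict_space space_filt)
    define j where "j n = nat \<lfloor>real (Suc n) * s / t\<rfloor>" for n
    have s1: "0 \<le> real (Suc n) * s / t" "real (Suc n) * s / t \<le> real (Suc n)" for n
    proof -
    show "0 \<le> real (Suc n) * s / t" using z t by simp
    show "real (Suc n) * s / t \<le> real (Suc n)"
    proof (cases "t = 0")
    case False
    then have "real (Suc n) * s \<le> real (Suc n) * t" "0 < t" using z t by (auto intro!: mult_left_mono)
    then show ?thesis by (simp add: divide_le_eq)
    qed simp
    qed
    have jr: "real (j n) = of_int \<lfloor>real (Suc n) * s / t\<rfloor>" for n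
    using s1(1)[of n] by (simp add: j_def)
    have jle: "j n \<le> Suc n" for n
    proof -
    have "real (j n) \<le> real (Suc n)" unfolding jr using s1(2)[of n] by linarith
    then show ?thesis by simp
    qed
    have Xn_eq: "Xn n z = X (\<tau> n (j n)) w" for n
    proof -
    have "Xn n z = (\<Sum>i\<le>Suc n. if i = j n then X (\<tau> n i) w else 0)"
    unfolding Xn_def z case_prod_conv
    proof (intro sum.cong refl)
    fix i
    have "\<lfloor>real (Suc n) * s / t\<rfloor> = int i \<longleftrightarrow> i = j n" using jr[of n] by linarith
    then show "indicat_real {s. \<lfloor>real (Suc n) * s / t\<rfloor> = int i} s *\<^sub>R X (\<tau> n i) w = (if i = j n then X (\<tau> n i) w else 0)"
    by (simp add: indicator_def)
    qed
    also have "\<dots> = X (\<tau> n (j n)) w" using jle[of n] by (subst sum.delta) auto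
    finally show ?thesis .
    qed
    have "(%n. \<tau> n (j n)) \<longlonglongrightarrow> s"
    proof (rule LIM_zero_cancel, rule Lim_null_comparison)
    show "\<forall>\<^sub>F n in sequentially. norm (\<tau> n (j n) - s) \<le> t * (1 / real (Suc n))"
    proof (intro always_eventually allI)
    fix n
    show "norm (\<tau> n (j n) - s) \<le> t * (1 / real (Suc n))"
    proof (cases "t = 0")
    case False
    then have t: "0 < t" using t by simp
    have "\<bar>real (j n) - real (Suc n) * s / t\<bar> \<le> 1" unfolding jr by linarith
    then have "t / real (Suc n) * \<bar>real (j n) - real (Suc n) * s / t\<bar> \<le> t / real (Suc n) * 1"
    using t by (intro mult_left_mono) auto
    moreover have "\<tau> n (j n) - s = t / real (Suc n) * (real (j n) - real (Suc n) * s / t)"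
    using t by (simp add: \<tau>_def right_diff_distrib del: of_nat_Suc)
    ultimately show ?thesis using t by (simp add: abs_mult)
    qed (use z in \<open>auto simp: \<tau>_def\<close>)
    qed
    have "(%n. t * (1 / real (Suc n))) \<longlonglongrightarrow> t * 0"
    by (intro tendsto_intros) (use LIMSEQ_inverse_real_of_nat in \<open>simp add: inverse_eq_divide\<close>)
    then show "(%n. t * (1 / real (Suc n))) \<longlonglongrightarrow> 0" by simp
    qed
    then have "(%n. X (\<tau> n (j n)) w) \<longlonglongrightarrow> X s w"
    using \<tau>[OF jle] t z
    by (intro continuous_on_tendsto_compose[OF acD(2)[OF X z(3)]]) (auto intro!: always_eventually intro: order_trans)
    then show "(%n. Xn n z) \<longlonglongrightarrow> (case z of (s, w) => X s w)" by (simp add: Xn_eq[unfolded z(1)] z)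
  qed
qed

abbreviation PM :: "real => (real \<times> 'w) measure" where
  "PM t \<equiv> lam t \<Otimes>\<^sub>M M"

lemma pair_sigma_finite_PM: "pair_sigma_finite (lam t) M"
proof -
  interpret l: finite_measure "lam t" by (rule finite_measure_lam)
  show ?thesis by unfold_locales
qed

lemma finite_measure_PM: "finite_measure (PM t)"
proof -
  interpret l: finite_measure "lam t" by (rule finite_measure_lam)
  show ?thesis by (rule finite_measure_pair_measure) unfold_locales
qed

lemma progressiveD:
  assumes "progressive M T W \<phi>" "t \<in> {0..T}"
  shows "(%(s, w). \<phi> s w) \<in> borel_measurable (lam t \<Otimes>\<^sub>M filt M W t)"
    and "(%(s, w). \<phi> s w) \<in> borel_measurable (PM t)"
    and "\<phi> t \<in> borel_measurable (filt M W t)"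
proof -
  have m: "(%(s, w). \<phi> s w) \<in> borel_measurable (restrict_space borel {0..t} \<Otimes>\<^sub>M filt M W t)"
    using assms by (simp add: progressive_def)
  have "sets (lam t) = sets (restrict_space borel {0..t})"
    by (rule sets_restrict_space_cong) simp
  then have eq: "sets (lam t \<Otimes>\<^sub>M filt M W t) = sets (restrict_space borel {0..t} \<Otimes>\<^sub>M filt M W t)"
    by (rule sets_pair_measure_cong) simp
  show 1: "(%(s, w). \<phi> s w) \<in> borel_measurable (lam t \<Otimes>\<^sub>M filt M W t)"
    using m measurable_cong_sets[OF eq refl] by blast
  have "(%z. (fst z, snd z)) \<in> measurable (PM t) (lam t \<Otimes>\<^sub>M filt M W t)"
    using assms(2) filt_measurable_M[of t "%x. x" "filt M W t"]
    by (intro measurable_Pair measurable_fst measurable_compose[OF measurable_snd]) auto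
  from measurable_compose[OF this 1] show "(%(s, w). \<phi> s w) \<in> borel_measurable (PM t)"
    by simp
  have "(%w. (t, w)) \<in> measurable (filt M W t) (lam t \<Otimes>\<^sub>M filt M W t)"
    using assms(2) by (intro measurable_Pair1') (simp add: space_restrict_space)
  from measurable_compose[OF this 1] show "\<phi> t \<in> borel_measurable (filt M W t)" by simp
qed

lemma nn_integral_PM:
  assumes "(%(s, w). f s w) \<in> borel_measurable (PM t)"
  shows "(\<integral>\<^sup>+w. (\<integral>\<^sup>+s\<in>{0..t}. f s w \<partial>lborel) \<partial>M) = (\<integral>\<^sup>+z. f (fst z) (snd z) \<partial>PM t)"
    "(\<integral>\<^sup>+s\<in>{0..t}. (\<integral>\<^sup>+w. f s w \<partial>M) \<partial>lborel) = (\<integral>\<^sup>+z. f (fst z) (snd z) \<partial>PM t)"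
proof -
  interpret PM: pair_sigma_finite "lam t" M by (rule pair_sigma_finite_PM)
  have eq: "(\<integral>\<^sup>+s\<in>{0..t}. g s \<partial>lborel) = (\<integral>\<^sup>+s. g s \<partial>lam t)" for g
    by (subst nn_integral_restrict_space) auto
  show "(\<integral>\<^sup>+w. (\<integral>\<^sup>+s\<in>{0..t}. f s w \<partial>lborel) \<partial>M) = (\<integral>\<^sup>+z. f (fst z) (snd z) \<partial>PM t)"
    unfolding eq using PM.nn_integral_snd[OF assms] by (simp add: case_prod_beta case_prod_beta')
  show "(\<integral>\<^sup>+s\<in>{0..t}. (\<integral>\<^sup>+w. f s w \<partial>M) \<partial>lborel) = (\<integral>\<^sup>+z. f (fst z) (snd z) \<partial>PM t)"
    unfolding eq using nn_integral_fst[OF assms] by (simp add: case_prod_beta case_prod_beta')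
qed

lemma L2F_iff: "\<phi> \<in> L2F M T W \<longleftrightarrow> progressive M T W \<phi> \<and> sqi (PM T) (%z. \<phi> (fst z) (snd z))"
  for \<phi> :: "real => 'w => 'a::euclidean_space"
proof (cases "progressive M T W \<phi>")
  case True
  have m: "(%(s, w). \<phi> s w) \<in> borel_measurable (PM T)"
    using T_pos by (intro progressiveD(2)[OF True]) auto
  then have m2: "(%(s, w). ennreal ((norm (\<phi> s w))\<^sup>2)) \<in> borel_measurable (PM T)"
    by (rule measurable_norm_square)
  show ?thesis
    using True m by (simp add: L2F_def sqi_nn_iff nn_integral_PM(1)[OF m2] case_prod_beta case_prod_beta')
qed (simp add: L2F_def)

lemma L2F_progressive: "\<phi> \<in> L2F M T W ==> progressive M T W \<phi>"
  by (simp add: L2F_def)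

lemma L2F_sqi:
  fixes \<phi> :: "real => 'w => 'a::euclidean_space"
  assumes \<phi>: "\<phi> \<in> L2F M T W" and t: "t \<in> {0..T}"
  shows "sqi (PM t) (%z. \<phi> (fst z) (snd z))"
proof -
  have p: "progressive M T W \<phi>" "sqi (PM T) (%z. \<phi> (fst z) (snd z))" using \<phi> by (auto simp: L2F_iff)
  have TT: "T \<in> {0..T}" using T_pos by auto
  note m = progressiveD(2)[OF p(1) t] progressiveD(2)[OF p(1) TT]
  have m2: "(%(s, w). ennreal ((norm (\<phi> s w))\<^sup>2)) \<in> borel_measurable (PM t)"
    "(%(s, w). ennreal ((norm (\<phi> s w))\<^sup>2)) \<in> borel_measurable (PM T)"
    by (rule measurable_norm_square[OF m(1)], rule measurable_norm_square[OF m(2)])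
  have "(\<integral>\<^sup>+w. (\<integral>\<^sup>+s\<in>{0..t}. ennreal ((norm (\<phi> s w))\<^sup>2) \<partial>lborel) \<partial>M) \<le>
    (\<integral>\<^sup>+w. (\<integral>\<^sup>+s\<in>{0..T}. ennreal ((norm (\<phi> s w))\<^sup>2) \<partial>lborel) \<partial>M)"
    using t by (intro nn_integral_mono mult_left_mono) (auto simp: indicator_def)
  then show ?thesis
    using p(2) m by (auto simp: sqi_nn_iff nn_integral_PM(1)[OF m2(1)] nn_integral_PM(1)[OF m2(2)] case_prod_beta case_prod_beta')
qed

lemma L2F_AE_sqi:
  fixes \<phi> :: "real => 'w => 'a::euclidean_space"
  assumes "\<phi> \<in> L2F M T W"
  shows "AE s in lam T. sqi M (\<phi> s)" "AE w in M. sqi (lam T) (%s. \<phi> s w)"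
proof -
  interpret PM: pair_sigma_finite "lam T" M by (rule pair_sigma_finite_PM)
  have TT: "T \<in> {0..T}" using T_pos by auto
  have s: "sqi (PM T) (%z. \<phi> (fst z) (snd z))" using assms by (simp add: L2F_iff)
  then have m: "(%z. \<phi> (fst z) (snd z)) \<in> borel_measurable (PM T)"
    and i: "integrable (PM T) (%z. (norm (\<phi> (fst z) (snd z)))\<^sup>2)" by (auto simp: sqi_def)
  have sec1: "\<phi> s \<in> borel_measurable M" if "s \<in> space (lam T)" for s
    using measurable_compose[OF measurable_Pair1'[OF that] m] by simp
  have sec2: "(%s. \<phi> s w) \<in> borel_measurable (lam T)" if "w \<in> space M" for w
    using measurable_compose[OF measurable_Pair2'[OF that] m] by simp
  show "AE s in lam T. sqi M (\<phi> s)"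
    using PM.AE_integrable_fst'[OF i] AE_space by eventually_elim (auto simp: sqi_def sec1)
  show "AE w in M. sqi (lam T) (%s. \<phi> s w)"
    using PM.AE_integrable_snd[of "%x y. (norm (\<phi> x y))\<^sup>2"] i AE_space
    by (auto simp: case_prod_beta case_prod_beta' sqi_def elim!: eventually_elim2 intro: sec2)
qed

lemma integral_PM:
  fixes F :: "real => 'w => 'a::euclidean_space"
  assumes i: "integrable (PM t) (%z. F (fst z) (snd z))"
  shows "(LINT z|PM t. F (fst z) (snd z)) = (LINT s:{0..t}|lborel. (LINT w|M. F s w))"
    "(LINT z|PM t. F (fst z) (snd z)) = (LINT w|M. (LINT s:{0..t}|lborel. F s w))"
    "set_integrable lborel {0..t} (%s. \<integral>w. F s w \<partial>M)"
    "integrable M (%w. LINT s:{0..t}|lborel. F s w)"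
proof -
  interpret PM: pair_sigma_finite "lam t" M by (rule pair_sigma_finite_PM)
  have i': "integrable (PM t) (%(s, w). F s w)" using i by (simp add: case_prod_beta case_prod_beta')
  show "(LINT z|PM t. F (fst z) (snd z)) = (LINT s:{0..t}|lborel. (LINT w|M. F s w))"
    unfolding set_integral_lam using PM.integral_fst'[OF i] by simp
  show "(LINT z|PM t. F (fst z) (snd z)) = (LINT w|M. (LINT s:{0..t}|lborel. F s w))"
    unfolding set_integral_lam using PM.integral_snd[OF i'] by (simp add: case_prod_beta case_prod_beta')
  show "set_integrable lborel {0..t} (%s. \<integral>w. F s w \<partial>M)"
    unfolding set_integrable_lam using PM.integrable_fst'[OF i] by simp
  show "integrable M (%w. LINT s:{0..t}|lborel. F s w)"
    unfolding set_integral_lam using PM.integrable_snd[OF i'] by simp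
qed

lemma L2F_add: "\<phi> \<in> L2F M T W ==> \<psi> \<in> L2F M T W ==> (%t w. \<phi> t w + \<psi> t w) \<in> L2F M T W"
  and L2F_diff: "\<phi> \<in> L2F M T W ==> \<psi> \<in> L2F M T W ==> (%t w. \<phi> t w - \<psi> t w) \<in> L2F M T W"
  for \<phi> \<psi> :: "real => 'w => 'a::euclidean_space"
  by (auto simp: L2F_iff progressive_def case_prod_beta case_prod_beta' intro!: sqi_add sqi_diff borel_measurable_add borel_measurable_diff)

lemma L2F_matrix:
  fixes N :: "real => real^'n^'m"
  assumes N: "continuous_on {0..T} N" and \<phi>: "\<phi> \<in> L2F M T W"
  shows "(%t w. N t *v \<phi> t w) \<in> L2F M T W"
proof -
  obtain K where K: "0 \<le> K" "\<And>t x. t \<in> {0..T} ==> norm (N t *v x) \<le> K * norm x"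
    using matrix_family_bound[OF N] by metis
  have mN: "N \<in> borel_measurable (restrict_space borel {0..t})" if "t \<in> {0..T}" for t
    using that by (intro borel_measurable_continuous_on_restrict continuous_on_subset[OF N]) auto
  have p: "progressive M T W (%t w. N t *v \<phi> t w)"
    unfolding progressive_def
  proof
    fix t assume t: "t \<in> {0..T}"
    have 1: "(%z. N (fst z)) \<in> borel_measurable (restrict_space borel {0..t} \<Otimes>\<^sub>M filt M W t)"
    by (rule measurable_compose[OF measurable_fst mN[OF t]])
    have 2: "(%z. \<phi> (fst z) (snd z)) \<in> borel_measurable (restrict_space borel {0..t} \<Otimes>\<^sub>M filt M W t)"
    using L2F_progressive[OF \<phi>] t by (simp add: progressive_def case_prod_beta case_prod_beta')
    have 3: "(%z. (N (fst z), \<phi> (fst z) (snd z))) \<in> borel_measurable (restrict_space borel {0..t} \<Otimes>\<^sub>M filt M W t)"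
    using 1 2 by (rule borel_measurable_Pair)
    have 4: "(%(A, x). A *v x) \<in> borel_measurable (borel :: ((real^'n^'m) \<times> (real^'n)) measure)"
    by (intro borel_measurable_continuous_onI) (auto simp: case_prod_beta case_prod_beta' intro!: continuous_matrix_intros continuous_intros)
    from measurable_compose[OF 3 4]
    show "(%(s, w). N s *v \<phi> s w) \<in> borel_measurable (restrict_space borel {0..t} \<Otimes>\<^sub>M filt M W t)"
    by (simp add: case_prod_beta')
  qed
  have s: "sqi (PM T) (%z. \<phi> (fst z) (snd z))" using \<phi> by (simp add: L2F_iff)
  have "sqi (PM T) (%z. N (fst z) *v \<phi> (fst z) (snd z))"
  proof (rule sqi_bound[where g="%z. K\<^sup>2 * (norm (\<phi> (fst z) (snd z)))\<^sup>2"])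
    show "(%z. N (fst z) *v \<phi> (fst z) (snd z)) \<in> borel_measurable (PM T)"
    using progressiveD(2)[OF p, of T] T_pos by (simp add: case_prod_beta case_prod_beta')
    show "integrable (PM T) (%z. K\<^sup>2 * (norm (\<phi> (fst z) (snd z)))\<^sup>2)" using s by (simp add: sqi_def)
    show "AE z in PM T. (norm (N (fst z) *v \<phi> (fst z) (snd z)))\<^sup>2 \<le> K\<^sup>2 * (norm (\<phi> (fst z) (snd z)))\<^sup>2"
    proof (rule AE_I2)
    fix z assume "z \<in> space (PM T)"
    then have "fst z \<in> {0..T}" by (auto simp: space_pair_measure space_restrict_space)
    from power_mono[OF K(2)[OF this, of "\<phi> (fst z) (snd z)"], of 2]
    show "(norm (N (fst z) *v \<phi> (fst z) (snd z)))\<^sup>2 \<le> K\<^sup>2 * (norm (\<phi> (fst z) (snd z)))\<^sup>2"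
    by (simp add: power_mult_distrib)
    qed
  qed
  then show ?thesis using p by (simp add: L2F_iff)
qed

lemma norm_mean_square_le:
  "sqi M f ==> (norm (LINT w|M. f w))\<^sup>2 \<le> (LINT w|M. (norm (f w))\<^sup>2)"
  using norm_integral_square_le[of f] prob_space by simp

lemma L2F_mean:
  fixes \<phi> :: "real => 'w => 'a::euclidean_space"
  assumes \<phi>: "\<phi> \<in> L2F M T W"
  shows "(%t w. mean M \<phi> t) \<in> L2F M T W"
proof -
  interpret PM: pair_sigma_finite "lam T" M by (rule pair_sigma_finite_PM)
  have mm: "mean M \<phi> \<in> borel_measurable (lam t)" if "t \<in> {0..T}" for t
    unfolding mean_def[abs_def]
    using progressiveD(2)[OF L2F_progressive[OF \<phi>] that] by (rule borel_measurable_lebesgue_integral)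
  have p: "progressive M T W (%t w. mean M \<phi> t)"
    unfolding progressive_def
  proof
    fix t assume t: "t \<in> {0..T}"
    have "sets (lam t) = sets (restrict_space borel {0..t})" by (rule sets_restrict_space_cong) simp
    then have "mean M \<phi> \<in> borel_measurable (restrict_space borel {0..t})"
    using mm[OF t] measurable_cong_sets by blast
    from measurable_compose[OF measurable_fst this]
    show "(%(s, w). mean M \<phi> s) \<in> borel_measurable (restrict_space borel {0..t} \<Otimes>\<^sub>M filt M W t)"
    by (simp add: case_prod_beta case_prod_beta')
  qed
  have TT: "T \<in> {0..T}" using T_pos by auto
  have i: "integrable (PM T) (%z. (norm (\<phi> (fst z) (snd z)))\<^sup>2)" using \<phi> by (simp add: L2F_iff sqi_def)
  have m2: "(%(s, w). ennreal ((norm (mean M \<phi> s))\<^sup>2)) \<in> borel_measurable (PM T)"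
    by (rule measurable_norm_square[OF progressiveD(2)[OF p TT]])
  have m3: "(%(s, w). ennreal ((norm (\<phi> s w))\<^sup>2)) \<in> borel_measurable (PM T)"
    by (rule measurable_norm_square[OF progressiveD(2)[OF L2F_progressive[OF \<phi>] TT]])
  have eq: "(\<integral>\<^sup>+s\<in>{0..T}. g s \<partial>lborel) = (\<integral>\<^sup>+s. g s \<partial>lam T)" for g
    by (subst nn_integral_restrict_space) auto
  have "(\<integral>\<^sup>+z. ennreal ((norm (mean M \<phi> (fst z)))\<^sup>2) \<partial>PM T) = (\<integral>\<^sup>+s. (\<integral>\<^sup>+w. ennreal ((norm (mean M \<phi> s))\<^sup>2) \<partial>M) \<partial>lam T)"
    using nn_integral_PM(2)[OF m2] by (simp only: eq)
  also have "\<dots> \<le> (\<integral>\<^sup>+s. (\<integral>\<^sup>+w. ennreal ((norm (\<phi> s w))\<^sup>2) \<partial>M) \<partial>lam T)"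
  proof (rule nn_integral_mono_AE)
    show "AE s in lam T. (\<integral>\<^sup>+w. ennreal ((norm (mean M \<phi> s))\<^sup>2) \<partial>M) \<le> (\<integral>\<^sup>+w. ennreal ((norm (\<phi> s w))\<^sup>2) \<partial>M)"
    using L2F_AE_sqi(1)[OF \<phi>]
    proof eventually_elim
    fix s assume s: "sqi M (\<phi> s)"
    then have "(\<integral>\<^sup>+w. ennreal ((norm (\<phi> s w))\<^sup>2) \<partial>M) = ennreal (LINT w|M. (norm (\<phi> s w))\<^sup>2)"
    by (intro nn_integral_eq_integral) (auto simp: sqi_def)
    then show "(\<integral>\<^sup>+w. ennreal ((norm (mean M \<phi> s))\<^sup>2) \<partial>M) \<le> (\<integral>\<^sup>+w. ennreal ((norm (\<phi> s w))\<^sup>2) \<partial>M)"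
    using norm_mean_square_le[OF s] by (simp add: emeasure_space_1 mean_def ennreal_leI)
    qed
  qed
  also have "\<dots> = (\<integral>\<^sup>+z. ennreal ((norm (\<phi> (fst z) (snd z)))\<^sup>2) \<partial>PM T)"
    using nn_integral_PM(2)[OF m3] by (simp only: eq)
  also have "\<dots> < \<infinity>" using i by (simp add: integrable_iff_bounded)
  finally have "sqi (PM T) (%z. mean M \<phi> (fst z))"
    using progressiveD(2)[OF p TT] by (simp add: sqi_nn_iff case_prod_beta case_prod_beta')
  then show ?thesis using p by (simp add: L2F_iff)
qed

lemma L2FC_L2F:
  fixes X :: "real => 'w => 'a::euclidean_space"
  assumes X: "X \<in> L2FC M T W"
  shows "X \<in> L2F M T W"
proof -
  have p: "progressive M T W X" and s: "(\<integral>\<^sup>+w. supn X w \<partial>M) < \<infinity>" using X by (auto simp: L2FC_def supn_def)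
  have "(\<integral>\<^sup>+w. (\<integral>\<^sup>+t\<in>{0..T}. ennreal ((norm (X t w))\<^sup>2) \<partial>lborel) \<partial>M) \<le> (\<integral>\<^sup>+w. ennreal T * supn X w \<partial>M)"
  proof (rule nn_integral_mono)
    fix w
    have "(\<integral>\<^sup>+t\<in>{0..T}. ennreal ((norm (X t w))\<^sup>2) \<partial>lborel) \<le> (\<integral>\<^sup>+t. supn X w * indicator {0..T} t \<partial>lborel)"
    by (intro nn_integral_mono) (auto simp: indicator_def intro: supn_upper)
    then show "(\<integral>\<^sup>+t\<in>{0..T}. ennreal ((norm (X t w))\<^sup>2) \<partial>lborel) \<le> ennreal T * supn X w"
    using T_pos by (simp add: nn_integral_cmult_indicator mult.commute)
  qed
  also have "\<dots> < \<infinity>"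
  proof -
    have ac: "AE w in M. continuous_on {0..T} (%t. X t w)" using X by (auto simp: L2FC_def)
    define N where "N = {w \<in> space M. \<not> continuous_on {0..T} (%t. X t w)}"
    have N: "N \<in> null_sets M" using ac by (simp add: AE_iff_null_sets N_def)
    define Y where "Y t w = (if continuous_on {0..T} (%t. X t w) then X t w else 0)" for t w
    have "Y t \<in> borel_measurable (filt M W t)" if "t \<in> {0..T}" for t
    by (rule filt_AE_cong[OF progressiveD(3)[OF p that]]) (use that ac in \<open>auto simp: Y_def\<close>)
    moreover have "continuous_on {0..T} (%t. Y t w)" for w
    proof (cases "continuous_on {0..T} (%t. X t w)")
    case True then show ?thesis by (simp only: Y_def if_P)
    next
    case False then show ?thesis by (simp only: Y_def if_not_P continuous_on_const not_False_eq_True)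
    qed
    ultimately have "ac Y" by (simp add: ac_def)
    then have [measurable]: "supn Y \<in> borel_measurable M" by (rule supn_measurable)
    have eq: "AE w in M. supn X w = supn Y w"
    using ac by eventually_elim (simp add: supn_def Y_def)
    have "(\<integral>\<^sup>+w. ennreal T * supn X w \<partial>M) = (\<integral>\<^sup>+w. ennreal T * supn Y w \<partial>M)"
    using eq by (intro nn_integral_cong_AE) auto
    also have "\<dots> = ennreal T * (\<integral>\<^sup>+w. supn Y w \<partial>M)" by (rule nn_integral_cmult) measurable
    also have "(\<integral>\<^sup>+w. supn Y w \<partial>M) = (\<integral>\<^sup>+w. supn X w \<partial>M)"
    using eq by (intro nn_integral_cong_AE) auto
    finally show ?thesis using s by (simp add: ennreal_mult_less_top)
  qed
  finally show ?thesis using p by (simp add: L2F_def)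
qed

lemma L2FC_sqi:
  fixes X :: "real => 'w => 'a::euclidean_space"
  assumes X: "X \<in> L2FC M T W" and t: "t \<in> {0..T}"
  shows "sqi M (X t)"
proof -
  have p: "progressive M T W X" and s: "(\<integral>\<^sup>+w. supn X w \<partial>M) < \<infinity>" using X by (auto simp: L2FC_def supn_def)
  have "X t \<in> borel_measurable M" using filt_measurable_M[OF _ progressiveD(3)[OF p t]] t by simp
  moreover have "(\<integral>\<^sup>+w. ennreal ((norm (X t w))\<^sup>2) \<partial>M) \<le> (\<integral>\<^sup>+w. supn X w \<partial>M)"
    by (intro nn_integral_mono supn_upper t)
  ultimately show ?thesis using s by (auto simp: sqi_nn_iff)
qed

lemma ac_L2FC: "ac X ==> (\<integral>\<^sup>+w. supn X w \<partial>M) < \<infinity> ==> X \<in> L2FC M T W"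
  by (simp add: L2FC_def supn_def ac_progressive acD AE_I2)

lemma time_integral_exists:
  fixes b :: "real => 'w => 'a::euclidean_space"
  assumes b: "b \<in> L2F M T W"
  shows "\<exists>J. ac J \<and> (AE w in M. \<forall>t\<in>{0..T}. J t w = (LINT s:{0..t}|lborel. b s w))"
proof -
  define J where "J t w = (if set_integrable lborel {0..T} (%s. b s w) then (LINT s:{0..t}|lborel. b s w) else 0)" for t w
  interpret l: finite_measure "lam T" by (rule finite_measure_lam)
  have "AE w in M. set_integrable lborel {0..T} (%s. b s w)"
    using L2F_AE_sqi(2)[OF b] by eventually_elim (simp add: set_integrable_lam l.sqi_integrable_finite)
  then have ae: "AE w in M. \<forall>t. J t w = (LINT s:{0..t}|lborel. b s w)"
    by eventually_elim (simp add: J_def)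
  have "ac J"
    unfolding ac_def
  proof (intro conjI ballI)
    fix t assume t: "t \<in> {0..T}"
    interpret lt: finite_measure "lam t" by (rule finite_measure_lam)
    have "(%(w, s). b s w) \<in> borel_measurable (filt M W t \<Otimes>\<^sub>M lam t)"
    using measurable_compose[OF measurable_pair_swap' progressiveD(1)[OF L2F_progressive[OF b] t]]
    by (simp add: case_prod_beta case_prod_beta')
    then have "(%w. \<integral>s. b s w \<partial>lam t) \<in> borel_measurable (filt M W t)"
    by (rule lt.borel_measurable_lebesgue_integral)
    then show "J t \<in> borel_measurable (filt M W t)"
    by (rule filt_AE_cong) (use t ae in \<open>auto simp: set_integral_lam\<close>)
  next
    fix w
    show "continuous_on {0..T} (%t. J t w)"
    proof (cases "set_integrable lborel {0..T} (%s. b s w)")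
    case True
    have "continuous_on {0..T} (%t. integral {0..t} (%s. b s w))"
    by (rule indefinite_integral_continuous_1[OF set_borel_integral_eq_integral(1)[OF True]])
    then show ?thesis
    proof (rule continuous_on_eq)
    fix t assume t: "t \<in> {0..T}"
    have "set_integrable lborel {0..t} (%s. b s w)" by (rule set_integrable_subset[OF True]) (use t in auto)
    then show "integral {0..t} (%s. b s w) = J t w"
    using True by (simp add: J_def set_borel_integral_eq_integral(2))
    qed
    next
    case False
    then show ?thesis by (simp only: J_def if_not_P continuous_on_const not_False_eq_True)
    qed
  qed
  then show ?thesis using ae by (intro exI[of _ J]) auto
qed

lemma time_integral_bound:
  fixes b :: "real => 'w => 'a::euclidean_space"
  assumes b: "b \<in> L2F M T W" and J: "AE w in M. \<forall>t\<in>{0..T}. J t w = (LINT s:{0..t}|lborel. b s w)"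
    and t: "t \<in> {0..T}"
  shows "(\<integral>\<^sup>+w. (SUP s\<in>{0..t}. ennreal ((norm (J s w))\<^sup>2)) \<partial>M) \<le> ennreal (T * (LINT z|PM t. (norm (b (fst z) (snd z)))\<^sup>2))"
proof -
  interpret PM: pair_sigma_finite "lam t" M by (rule pair_sigma_finite_PM)
  have i: "integrable (PM t) (%z. (norm (b (fst z) (snd z)))\<^sup>2)" using L2F_sqi[OF b t] by (simp add: sqi_def)
  have ip: "integrable M (%w. LINT s:{0..t}|lborel. (norm (b s w))\<^sup>2)"
    using integral_PM(4)[where F="%s w. (norm (b s w))\<^sup>2", OF i] .
  have nn: "0 \<le> (LINT s:{0..t}|lborel. (norm (b s w))\<^sup>2)" for t w
    unfolding set_integral_lam by simp
  have "(\<integral>\<^sup>+w. (SUP s\<in>{0..t}. ennreal ((norm (J s w))\<^sup>2)) \<partial>M) \<le> (\<integral>\<^sup>+w. ennreal (T * (LINT s:{0..t}|lborel. (norm (b s w))\<^sup>2)) \<partial>M)"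
  proof (rule nn_integral_mono_AE)
    show "AE w in M. (SUP s\<in>{0..t}. ennreal ((norm (J s w))\<^sup>2)) \<le> ennreal (T * (LINT s:{0..t}|lborel. (norm (b s w))\<^sup>2))"
    using J L2F_AE_sqi(2)[OF b]
    proof (eventually_elim, intro SUP_least)
    fix w s assume J: "\<forall>t\<in>{0..T}. J t w = (LINT s:{0..t}|lborel. b s w)"
    and sq: "sqi (lam T) (%s. b s w)" and s: "s \<in> {0..t}"
    interpret ls: finite_measure "lam s" by (rule finite_measure_lam)
    have iT: "set_integrable lborel {0..T} (%s. (norm (b s w))\<^sup>2)" using sq by (simp add: sqi_def set_integrable_lam)
    have mono: "(LINT r:{0..s}|lborel. (norm (b r w))\<^sup>2) \<le> (LINT r:{0..t}|lborel. (norm (b r w))\<^sup>2)"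
    proof -
    have "set_integrable lborel {0..s} (%r. (norm (b r w))\<^sup>2)" "set_integrable lborel {0..t} (%r. (norm (b r w))\<^sup>2)"
    by (rule set_integrable_subset[OF iT]; use s t in auto)+
    then show ?thesis
    unfolding set_lebesgue_integral_def set_integrable_def
    by (rule integral_mono) (use s in \<open>auto simp: indicator_def\<close>)
    qed
    have "(%r. b r w) \<in> borel_measurable (lam s)"
    proof -
    have "(%r. b r w) \<in> borel_measurable (restrict_space (lam T) {0..s})"
    by (rule measurable_restrict_space1) (use sq in \<open>simp add: sqi_def\<close>)
    moreover have "sets (restrict_space (lam T) {0..s}) = sets (lam s)"
    using s t by (simp add: restrict_restrict_space Int_absorb1)
    ultimately show ?thesis using measurable_cong_sets by blast
    qed
    moreover have "set_integrable lborel {0..s} (%r. (norm (b r w))\<^sup>2)"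
    by (rule set_integrable_subset[OF iT]) (use s t in auto)
    ultimately have "sqi (lam s) (%r. b r w)" by (simp add: sqi_def set_integrable_lam)
    from ls.norm_integral_square_le[OF this]
    have "(norm (J s w))\<^sup>2 \<le> s * (LINT r:{0..s}|lborel. (norm (b r w))\<^sup>2)"
    using J s t by (simp add: set_integral_lam measure_restrict_space space_restrict_space)
    also have "\<dots> \<le> T * (LINT r:{0..t}|lborel. (norm (b r w))\<^sup>2)"
    using s t by (intro mult_mono mono nn) auto
    finally show "ennreal ((norm (J s w))\<^sup>2) \<le> ennreal (T * (LINT s:{0..t}|lborel. (norm (b s w))\<^sup>2))"
    by (rule ennreal_leI)
    qed
  qed
  also have "\<dots> = ennreal (LINT w|M. T * (LINT s:{0..t}|lborel. (norm (b s w))\<^sup>2))"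
    using ip nn T_pos by (intro nn_integral_eq_integral) auto
  also have "(LINT w|M. T * (LINT s:{0..t}|lborel. (norm (b s w))\<^sup>2)) = T * (LINT z|PM t. (norm (b (fst z) (snd z)))\<^sup>2)"
    using integral_PM(2)[where F="%s w. (norm (b s w))\<^sup>2", OF i] by simp
  finally show ?thesis .
qed

end

section \<open>Stochastic integrals of simple processes\<close>

context bm_space
begin

definition mart :: "(real => 'w => 'a::euclidean_space) => bool" where
  "mart N \<longleftrightarrow> ac N \<and> (\<forall>t\<in>{0..T}. sqi M (N t)) \<and>
    (\<forall>s t Y. 0 \<le> s \<longrightarrow> s \<le> t \<longrightarrow> t \<le> T \<longrightarrow> Y \<in> borel_measurable (filt M W s) \<longrightarrow> sqi M Y \<longrightarrow>
    (LINT w|M. Y w \<bullet> N t w) = (LINT w|M. Y w \<bullet> N s w))"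

lemma martI:
  assumes "ac N" "\<And>t. t \<in> {0..T} ==> sqi M (N t)"
    and "\<And>s t Y. 0 \<le> s ==> s \<le> t ==> t \<le> T ==> Y \<in> borel_measurable (filt M W s) ==> sqi M Y ==>
    (LINT w|M. Y w \<bullet> N t w) = (LINT w|M. Y w \<bullet> N s w)"
  shows "mart N"
  unfolding mart_def using assms by blast

lemma martD:
  assumes "mart N"
  shows "ac N" "\<And>t. t \<in> {0..T} ==> sqi M (N t)"
    "\<And>s t Y. 0 \<le> s ==> s \<le> t ==> t \<le> T ==> Y \<in> borel_measurable (filt M W s) ==> sqi M Y ==>
    (LINT w|M. Y w \<bullet> N t w) = (LINT w|M. Y w \<bullet> N s w)"
  using assms unfolding mart_def by blast+

lemma mart_add:
  fixes X Y :: "real => 'w => 'a::euclidean_space"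
  assumes X: "mart X" and Y: "mart Y"
  shows "mart (%t w. X t w + Y t w)"
proof (rule martI)
  fix s t and Z :: "'w => 'a" assume *: "0 \<le> s" "s \<le> t" "t \<le> T" "Z \<in> borel_measurable (filt M W s)" "sqi M Z"
  have t: "t \<in> {0..T}" "s \<in> {0..T}" using * by auto
  show "(LINT w|M. Z w \<bullet> (X t w + Y t w)) = (LINT w|M. Z w \<bullet> (X s w + Y s w))"
    using martD(3)[OF X *] martD(3)[OF Y *] martD(2)[OF X t(1)] martD(2)[OF Y t(1)] martD(2)[OF X t(2)] martD(2)[OF Y t(2)] *(5)
    by (simp add: inner_add_right integrable_inner_sqi)
qed (assumption | rule ac_add sqi_add martD(1,2)[OF X] martD(1,2)[OF Y])+

lemma mart_diff:
  fixes X Y :: "real => 'w => 'a::euclidean_space"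
  assumes X: "mart X" and Y: "mart Y"
  shows "mart (%t w. X t w - Y t w)"
proof (rule martI)
  fix s t and Z :: "'w => 'a" assume *: "0 \<le> s" "s \<le> t" "t \<le> T" "Z \<in> borel_measurable (filt M W s)" "sqi M Z"
  have t: "t \<in> {0..T}" "s \<in> {0..T}" using * by auto
  show "(LINT w|M. Z w \<bullet> (X t w - Y t w)) = (LINT w|M. Z w \<bullet> (X s w - Y s w))"
    using martD(3)[OF X *] martD(3)[OF Y *] martD(2)[OF X t(1)] martD(2)[OF Y t(1)] martD(2)[OF X t(2)] martD(2)[OF Y t(2)] *(5)
    by (simp add: inner_diff_right integrable_inner_sqi)
qed (assumption | rule ac_diff sqi_diff martD(1,2)[OF X] martD(1,2)[OF Y])+

lemma mart_0: "mart (%t w. 0)"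
  by (rule martI) (auto intro: ac_const sqi_0)

lemma mart_sum: "(\<And>i. i \<in> I ==> mart (N i)) ==> mart (%t w. \<Sum>i\<in>I. N i t w)"
  by (induction I rule: infinite_finite_induct) (auto intro: mart_add mart_0)

lemma B_measurable: "t \<in> {0..T} ==> B t \<in> borel_measurable M"
  by (rule filt_measurable_M[of t, OF _ B_filt_measurable]) auto

lemma B_increment_sqi:
  assumes s: "0 \<le> s" "s \<le> t" "t \<le> T"
  shows "sqi M (%w. B t w - B s w)"
proof -
  have "integrable M (%w. 1 * (B t w - B s w)\<^sup>2)" by (rule B_increment(3)[OF s]) simp_all
  moreover have "(%w. B t w - B s w) \<in> borel_measurable M"
    by (intro borel_measurable_diff B_measurable) (use s in auto)
  ultimately show ?thesis by (simp add: sqi_def)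
qed

lemma sqi_bounded_mult:
  assumes f: "sqi M f" and g: "g \<in> borel_measurable M" and K: "\<And>w. w \<in> space M ==> norm (g w) \<le> K"
  shows "sqi M (%w. f w *\<^sub>R g w)"
proof (rule sqi_bound[where g="%w. K\<^sup>2 * (norm (f w))\<^sup>2"])
  show "AE w in M. (norm (f w *\<^sub>R g w))\<^sup>2 \<le> K\<^sup>2 * (norm (f w))\<^sup>2"
  proof (rule AE_I2)
    fix w assume "w \<in> space M"
    then have "(norm (g w))\<^sup>2 \<le> K\<^sup>2" using K by (intro power_mono) auto
    from mult_left_mono[OF this, of "(f w)\<^sup>2"]
    show "(norm (f w *\<^sub>R g w))\<^sup>2 \<le> K\<^sup>2 * (norm (f w))\<^sup>2"
    by (simp add: power_mult_distrib mult.commute)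
  qed
qed (use f g in \<open>auto simp: sqi_def\<close>)

definition atom :: "real => real => ('w => 'a::euclidean_space) => real => 'w => 'a" where
  "atom a b \<xi> t w = (B (min t b) w - B (min t a) w) *\<^sub>R \<xi> w"

definition coef :: "real => ('w => 'a::euclidean_space) => bool" where
  "coef a \<xi> \<longleftrightarrow> \<xi> \<in> borel_measurable (filt M W a) \<and> (\<exists>K. \<forall>w\<in>space M. norm (\<xi> w) \<le> K)"

lemma coef_sqi:
  assumes "coef a \<xi>" "a \<le> T"
  shows "sqi M \<xi>"
proof -
  obtain K where K: "\<And>w. w \<in> space M ==> norm (\<xi> w) \<le> K" using assms by (auto simp: coef_def)
  have "\<xi> \<in> borel_measurable M" using assms filt_measurable_M by (auto simp: coef_def)
  from sqi_bounded_mult[OF sqi_const[of M "1::real"] this K] show ?thesis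
    by (simp add: finite_measure_axioms)
qed

lemma atom_sqi:
  assumes ab: "0 \<le> a" "a \<le> b" "b \<le> T" and \<xi>: "coef a \<xi>" and t: "t \<in> {0..T}"
  shows "sqi M (atom a b \<xi> t)"
proof -
  obtain K where K: "\<And>w. w \<in> space M ==> norm (\<xi> w) \<le> K" using \<xi> by (auto simp: coef_def)
  have "\<xi> \<in> borel_measurable M" using \<xi> ab filt_measurable_M[of a] by (auto simp: coef_def)
  then show ?thesis
    unfolding atom_def[abs_def]
    using ab t by (intro sqi_bounded_mult[OF _ _ K] B_increment_sqi) auto
qed

lemma atom_clamp:
  assumes "a \<le> b"
  shows "atom a b \<xi> t w = (B (max a (min t b)) w - B a w) *\<^sub>R \<xi> w"
  using assms by (cases "t \<le> a") (auto simp: atom_def min_def max_def)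

lemma atom_mart:
  fixes \<xi> :: "'w => 'a::euclidean_space"
  assumes ab: "0 \<le> a" "a \<le> b" "b \<le> T" and \<xi>: "coef a \<xi>"
  shows "mart (atom a b \<xi>)"
proof (rule martI)
  have ma: "\<xi> \<in> borel_measurable (filt M W a)" using \<xi> by (simp add: coef_def)
  show "ac (atom a b \<xi>)"
    unfolding ac_def
  proof (intro conjI ballI)
    fix t assume t: "t \<in> {0..T}"
    show "atom a b \<xi> t \<in> borel_measurable (filt M W t)"
    proof (cases "t \<le> a")
    case True
    then show ?thesis using ab by (simp add: atom_def[abs_def])
    next
    case False
    then show ?thesis
    unfolding atom_def[abs_def] using t ab
    by (intro borel_measurable_scaleR borel_measurable_diff B_filt_measurable filt_measurable_mono[OF _ _ ma]) auto
    qed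
  next
    fix w
    show "continuous_on {0..T} (%t. atom a b \<xi> t w)"
    unfolding atom_clamp[OF ab(2)]
    by (intro continuous_intros continuous_on_compose2[OF B_continuous]) (use ab in auto)
  qed
  show "sqi M (atom a b \<xi> t)" if "t \<in> {0..T}" for t by (rule atom_sqi[OF ab \<xi> that])
  fix s t and Y :: "'w => 'a" assume *: "0 \<le> s" "s \<le> t" "t \<le> T" "Y \<in> borel_measurable (filt M W s)" "sqi M Y"
  define c where "c r = max a (min r b)" for r
  have st: "s \<in> {0..T}" "t \<in> {0..T}" using * by auto
  have "(LINT w|M. (Y w \<bullet> \<xi> w) * (B (c t) w - B (c s) w)) = 0"
  proof (cases "s \<le> b")
    case True
    then have cs: "c s = max a s" using ab by (simp add: c_def)
    have cT: "c s \<le> T" "c s \<le> c t" "c t \<le> T" "0 \<le> c s" using ab * True by (auto simp: c_def)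
    show ?thesis
    proof (rule B_increment(2)[OF cT(4,2,3)])
    have "Y \<in> borel_measurable (filt M W (c s))" "\<xi> \<in> borel_measurable (filt M W (c s))"
    using filt_measurable_mono[OF _ cT(1) *(4)] filt_measurable_mono[OF _ cT(1) ma] by (auto simp: cs)
    then show "(%w. Y w \<bullet> \<xi> w) \<in> borel_measurable (filt M W (c s))" by (rule borel_measurable_inner)
    show "integrable M (%w. Y w \<bullet> \<xi> w)"
    using ab by (intro integrable_inner_sqi *(5) coef_sqi[OF \<xi>]) auto
    qed
  next
    case False
    then have "c s = c t" using * by (simp add: c_def)
    then show ?thesis by simp
  qed
  also have "(LINT w|M. (Y w \<bullet> \<xi> w) * (B (c t) w - B (c s) w)) = (LINT w|M. Y w \<bullet> atom a b \<xi> t w - Y w \<bullet> atom a b \<xi> s w)"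
    by (intro Bochner_Integration.integral_cong refl)
    (simp add: atom_clamp[OF ab(2)] c_def inner_diff_right[symmetric] scaleR_diff_left[symmetric] del: inner_diff_right, simp add: algebra_simps)
  also have "\<dots> = (LINT w|M. Y w \<bullet> atom a b \<xi> t w) - (LINT w|M. Y w \<bullet> atom a b \<xi> s w)"
    by (intro Bochner_Integration.integral_diff integrable_inner_sqi *(5) atom_sqi[OF ab \<xi>] st)
  finally show "(LINT w|M. Y w \<bullet> atom a b \<xi> t w) = (LINT w|M. Y w \<bullet> atom a b \<xi> s w)" by simp
qed

lemma increment_product_aux:
  fixes \<zeta> :: "'w => real"
  assumes ab: "0 \<le> a" "a \<le> b" "b \<le> T" and cd: "a \<le> c" "c \<le> d" "d \<le> T" and \<zeta>: "coef c \<zeta>"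
  shows "(LINT w|M. \<zeta> w * ((B b w - B a w) * (B d w - B c w))) = max 0 (min b d - c) * (LINT w|M. \<zeta> w)"
proof -
  have m\<zeta>: "\<zeta> \<in> borel_measurable (filt M W c)" using \<zeta> by (simp add: coef_def)
  obtain K where K: "\<And>w. w \<in> space M ==> norm (\<zeta> w) \<le> K" using \<zeta> by (auto simp: coef_def)
  have cT: "c \<le> T" "0 \<le> c" using cd ab by auto
  have i\<zeta>: "integrable M \<zeta>" by (rule sqi_integrable_finite[OF coef_sqi[OF \<zeta> cT(1)]])
  have past: "integrable M (%w. (\<zeta> w * (B q w - B p w)) * (B s w - B r w)) \<and>
    (LINT w|M. (\<zeta> w * (B q w - B p w)) * (B s w - B r w)) = 0"
    if "0 \<le> p" "p \<le> q" "q \<le> r" "r \<le> s" "s \<le> T" "c \<le> r" for p q r s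
  proof -
    have r: "0 \<le> r" "r \<le> T" using that by auto
    have m: "\<zeta> \<in> borel_measurable (filt M W r)" by (rule filt_measurable_mono[OF that(6) r(2) m\<zeta>])
    have i: "integrable M (%w. \<zeta> w * (B q w - B p w))"
    using integrable_inner_sqi[OF coef_sqi[OF \<zeta> cT(1)] B_increment_sqi[of p q]] that by simp
    have m2: "(%w. \<zeta> w * (B q w - B p w)) \<in> borel_measurable (filt M W r)"
    using that r by (intro borel_measurable_times m borel_measurable_diff B_filt_measurable) auto
    show ?thesis using B_increment(1,2)[OF r(1) that(4,5) m2 i] by simp
  qed
  show ?thesis
  proof (cases "b \<le> c")
    case True
    then have "max 0 (min b d - c) = 0" using cd by auto
    then show ?thesis using past[of a b c d] ab cd True by (simp add: mult.assoc)
  next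
    case False
    have sq: "integrable M (%w. \<zeta> w * ((B b w - B c w) * (B d w - B c w))) \<and>
    (LINT w|M. \<zeta> w * ((B b w - B c w) * (B d w - B c w))) = (min b d - c) * (LINT w|M. \<zeta> w)"
    proof -
    define e f where "e = min b d" and "f = max b d"
    have ef: "c \<le> e" "e \<le> f" "f \<le> T" "e \<le> T" using False ab cd by (auto simp: e_def f_def)
    have eq: "\<zeta> w * ((B b w - B c w) * (B d w - B c w)) =
    \<zeta> w * (B e w - B c w)\<^sup>2 + (\<zeta> w * (B e w - B c w)) * (B f w - B e w)" for w
    by (cases "b \<le> d") (simp_all add: e_def f_def power2_eq_square algebra_simps)
    note 1 = B_increment(3,4)[OF cT(2) ef(1,4) m\<zeta> i\<zeta>] and 2 = past[of c e e f]
    show ?thesis unfolding eq using 1 2 ef cT by (simp add: e_def)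
    qed
    have eq: "\<zeta> w * ((B b w - B a w) * (B d w - B c w)) =
    (\<zeta> w * (B c w - B a w)) * (B d w - B c w) + \<zeta> w * ((B b w - B c w) * (B d w - B c w))" for w
    by (simp add: algebra_simps)
    have "max 0 (min b d - c) = min b d - c" using False cd by auto
    then show ?thesis unfolding eq using sq past[of a c c d] ab cd by simp
  qed
qed

lemma increment_product:
  fixes \<zeta> :: "'w => real"
  assumes ab: "0 \<le> a" "a \<le> b" "b \<le> T" and cd: "0 \<le> c" "c \<le> d" "d \<le> T" and \<zeta>: "coef (max a c) \<zeta>"
  shows "(LINT w|M. \<zeta> w * ((B b w - B a w) * (B d w - B c w))) = max 0 (min b d - max a c) * (LINT w|M. \<zeta> w)"
proof (cases "a \<le> c")
  case True
  show ?thesis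
    using increment_product_aux[OF ab True cd(2,3)] \<zeta> unfolding max_absorb2[OF True] by blast
next
  case False
  then have ca: "c \<le> a" by simp
  have eq: "(B b w - B a w) * (B d w - B c w) = (B d w - B c w) * (B b w - B a w)" for w by simp
  show ?thesis
    using increment_product_aux[OF cd ca ab(2,3)] \<zeta> unfolding max_absorb1[OF ca] eq min.commute[of b d] by blast
qed

lemma coef_inner:
  assumes "coef a \<xi>" "coef c \<eta>" "a \<le> T" "c \<le> T"
  shows "coef (max a c) (%w. \<xi> w \<bullet> \<eta> w)"
proof -
  obtain K L where K: "\<And>w. w \<in> space M ==> norm (\<xi> w) \<le> K" and L: "\<And>w. w \<in> space M ==> norm (\<eta> w) \<le> L"
    using assms by (auto simp: coef_def)
  have "\<xi> \<in> borel_measurable (filt M W (max a c))" "\<eta> \<in> borel_measurable (filt M W (max a c))"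
    using assms by (auto simp: coef_def intro: filt_measurable_mono[of a] filt_measurable_mono[of c])
  then have "(%w. \<xi> w \<bullet> \<eta> w) \<in> borel_measurable (filt M W (max a c))" by (rule borel_measurable_inner)
  moreover have "norm (\<xi> w \<bullet> \<eta> w) \<le> K * L" if "w \<in> space M" for w
  proof -
    have "norm (\<xi> w \<bullet> \<eta> w) \<le> norm (\<xi> w) * norm (\<eta> w)" using Cauchy_Schwarz_ineq2 by simp
    also have "\<dots> \<le> K * L"
    using K[OF that] L[OF that] order_trans[OF norm_ge_zero K[OF that]] by (intro mult_mono) auto
    finally show ?thesis .
  qed
  ultimately show ?thesis by (auto simp: coef_def)
qed

lemma integral_indicator_product:
  assumes "0 \<le> a" "0 \<le> c" "0 \<le> t"
  shows "(LINT s:{0..t}|lborel. indicat_real {a<..b} s * indicat_real {c<..d} s) = max 0 (min t (min b d) - max a c)"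
proof -
  have "(LINT s:{0..t}|lborel. indicat_real {a<..b} s * indicat_real {c<..d} s) = (LINT s|lborel. indicator {max a c<..min t (min b d)} s)"
    unfolding set_lebesgue_integral_def
    by (intro Bochner_Integration.integral_cong refl) (use assms in \<open>auto simp: indicator_def\<close>)
  also have "\<dots> = max 0 (min t (min b d) - max a c)"
  proof (cases "max a c \<le> min t (min b d)")
    case True
    then show ?thesis using measure_lborel_Ioc[OF True] by (simp del: measure_lborel_Ioc)
  next
    case False
    then have lt: "min t (min b d) < max a c" by (simp only: not_le)
    then have "{max a c<..min t (min b d)} = {}" by (intro greaterThanAtMost_empty less_imp_le)
    moreover have "max 0 (min t (min b d) - max a c) = 0" using lt by (intro max_absorb1) linarith
    moreover have "(LINT s|lborel. indicat_real {} s) = 0" by simp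
    ultimately show ?thesis by (simp only:)
  qed
  finally show ?thesis .
qed

lemma atom_isometry:
  assumes ab: "0 \<le> a" "a \<le> b" "b \<le> T" and \<xi>: "coef a \<xi>" and cd: "0 \<le> c" "c \<le> d" "d \<le> T" and \<eta>: "coef c \<eta>"
    and t: "t \<in> {0..T}"
  shows "integrable (PM t) (%z. (indicat_real {a<..b} (fst z) *\<^sub>R \<xi> (snd z)) \<bullet> (indicat_real {c<..d} (fst z) *\<^sub>R \<eta> (snd z)))"
    and "(LINT w|M. atom a b \<xi> t w \<bullet> atom c d \<eta> t w) =
    (LINT z|PM t. (indicat_real {a<..b} (fst z) *\<^sub>R \<xi> (snd z)) \<bullet> (indicat_real {c<..d} (fst z) *\<^sub>R \<eta> (snd z)))"
proof -
  interpret F: finite_measure "PM t" by (rule finite_measure_PM)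
  define \<zeta> where "\<zeta> w = \<xi> w \<bullet> \<eta> w" for w
  define I where "I s = indicat_real {a<..b} s * indicat_real {c<..d} s" for s
  have aT: "a \<le> T" "c \<le> T" using ab cd by auto
  have \<zeta>: "coef (max a c) \<zeta>" unfolding \<zeta>_def[abs_def] by (rule coef_inner[OF \<xi> \<eta> aT])
  have m\<zeta>: "\<zeta> \<in> borel_measurable M" using \<zeta> aT filt_measurable_M[of "max a c"] by (auto simp: coef_def)
  obtain K where K: "\<And>w. w \<in> space M ==> norm (\<zeta> w) \<le> K" using \<zeta> by (auto simp: coef_def)
  have eq: "(indicat_real {a<..b} (fst z) *\<^sub>R \<xi> (snd z)) \<bullet> (indicat_real {c<..d} (fst z) *\<^sub>R \<eta> (snd z)) = I (fst z) * \<zeta> (snd z)" for z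
    by (simp add: I_def \<zeta>_def)
  have int: "integrable (PM t) (%z. I (fst z) * \<zeta> (snd z))"
  proof (rule F.integrable_const_bound[where B="max K 0"])
    show "AE z in PM t. norm (I (fst z) * \<zeta> (snd z)) \<le> max K 0"
    proof (rule AE_I2)
    fix z assume "z \<in> space (PM t)"
    then have "norm (\<zeta> (snd z)) \<le> K" using K by (auto simp: space_pair_measure)
    then show "norm (I (fst z) * \<zeta> (snd z)) \<le> max K 0" by (auto simp: I_def indicator_def)
    qed
    have "I \<in> borel_measurable (lam t)" unfolding I_def[abs_def] by (intro measurable_restrict_space1) measurable
    then show "(%z. I (fst z) * \<zeta> (snd z)) \<in> borel_measurable (PM t)"
    using m\<zeta> by measurable
  qed
  then show "integrable (PM t) (%z. (indicat_real {a<..b} (fst z) *\<^sub>R \<xi> (snd z)) \<bullet> (indicat_real {c<..d} (fst z) *\<^sub>R \<eta> (snd z)))"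
    by (simp only: eq)
  have "(LINT z|PM t. I (fst z) * \<zeta> (snd z)) = (LINT s:{0..t}|lborel. (LINT w|M. I s * \<zeta> w))"
    by (rule integral_PM(1)[OF int])
  also have "\<dots> = (LINT s:{0..t}|lborel. I s) * (LINT w|M. \<zeta> w)" by simp
  also have "\<dots> = max 0 (min t (min b d) - max a c) * (LINT w|M. \<zeta> w)"
    unfolding I_def using integral_indicator_product[of a c t b d] ab cd t by simp
  finally have R: "(LINT z|PM t. I (fst z) * \<zeta> (snd z)) = max 0 (min t (min b d) - max a c) * (LINT w|M. \<zeta> w)" .
  have L: "atom a b \<xi> t w \<bullet> atom c d \<eta> t w = \<zeta> w * ((B (min t b) w - B (min t a) w) * (B (min t d) w - B (min t c) w))" for w
    by (simp add: atom_def \<zeta>_def)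
  have "(LINT w|M. atom a b \<xi> t w \<bullet> atom c d \<eta> t w) = max 0 (min t (min b d) - max a c) * (LINT w|M. \<zeta> w)"
  proof (cases "a \<le> t \<and> c \<le> t")
    case True
    have *: "min (min t b) (min t d) = min t (min b d)" by auto
    show ?thesis unfolding L using increment_product[of a "min t b" c "min t d" \<zeta>] True ab cd \<zeta> t
    by (simp add: * min_absorb2)
  next
    case False
    then have "(B (min t b) w - B (min t a) w) * (B (min t d) w - B (min t c) w) = 0" for w using ab cd by auto
    moreover have "max 0 (min t (min b d) - max a c) = 0" using False by auto
    ultimately show ?thesis unfolding L by (simp only: mult_zero_right mult_zero_left Bochner_Integration.integral_zero)
  qed
  then show "(LINT w|M. atom a b \<xi> t w \<bullet> atom c d \<eta> t w) =
    (LINT z|PM t. (indicat_real {a<..b} (fst z) *\<^sub>R \<xi> (snd z)) \<bullet> (indicat_real {c<..d} (fst z) *\<^sub>R \<eta> (snd z)))"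
    unfolding eq R .
qed

lemma simple_atoms:
  assumes "is_simple M T W (N, \<tau>, \<xi>)" "i < N"
  shows "0 \<le> \<tau> i" "\<tau> i \<le> \<tau> (Suc i)" "\<tau> (Suc i) \<le> T" "coef (\<tau> i) (\<xi> i)"
proof -
  show "0 \<le> \<tau> i" "\<tau> i \<le> \<tau> (Suc i)" "\<tau> (Suc i) \<le> T" using assms by (auto simp: is_simple_def)
  show "coef (\<tau> i) (\<xi> i)" using assms unfolding is_simple_def coef_def case_prod_conv by blast
qed

lemma simple_integral_atoms: "simple_integral B (N, \<tau>, \<xi>) t w = (\<Sum>i<N. atom (\<tau> i) (\<tau> (Suc i)) (\<xi> i) t w)"
  by (simp add: simple_integral_def atom_def)

lemma simple_integral_mart: "is_simple M T W \<phi> ==> mart (simple_integral B \<phi>)"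
proof (cases \<phi>)
  case (fields N \<tau> \<xi>)
  assume "is_simple M T W \<phi>"
  then have "mart (%t w. \<Sum>i<N. atom (\<tau> i) (\<tau> (Suc i)) (\<xi> i) t w)"
    unfolding fields using simple_atoms by (intro mart_sum atom_mart) auto
  then show ?thesis by (simp add: fields simple_integral_atoms[abs_def] fun_eq_iff)
qed

lemma simple_integral_W: "AE w in M. \<forall>t. simple_integral W \<phi> t w = simple_integral B \<phi> t w"
  using B_eq_W by eventually_elim (simp add: simple_integral_def split: prod.splits)

lemma simple_isometry:
  fixes \<phi> \<psi> :: "nat \<times> (nat => real) \<times> (nat => 'w => 'a::euclidean_space)"
  assumes \<phi>: "is_simple M T W \<phi>" and \<psi>: "is_simple M T W \<psi>" and t: "t \<in> {0..T}"
  shows "(LINT w|M. simple_integral B \<phi> t w \<bullet> simple_integral B \<psi> t w) =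
    (LINT z|PM t. simple_val \<phi> (fst z) (snd z) \<bullet> simple_val \<psi> (fst z) (snd z))"
proof -
  obtain N \<tau> \<xi> N' \<tau>' \<xi>' where eq: "\<phi> = (N, \<tau>, \<xi>)" "\<psi> = (N', \<tau>', \<xi>')" by (metis prod_cases3)
  note a = simple_atoms[OF \<phi>[unfolded eq]] and b = simple_atoms[OF \<psi>[unfolded eq]]
  have "(LINT w|M. simple_integral B \<phi> t w \<bullet> simple_integral B \<psi> t w) =
    (LINT w|M. (\<Sum>i<N. \<Sum>j<N'. atom (\<tau> i) (\<tau> (Suc i)) (\<xi> i) t w \<bullet> atom (\<tau>' j) (\<tau>' (Suc j)) (\<xi>' j) t w))"
    unfolding eq simple_integral_atoms inner_sum_left unfolding inner_sum_right ..
  also have "\<dots> = (\<Sum>i<N. \<Sum>j<N'. \<integral>w. atom (\<tau> i) (\<tau> (Suc i)) (\<xi> i) t w \<bullet> atom (\<tau>' j) (\<tau>' (Suc j)) (\<xi>' j) t w \<partial>M)"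
  proof -
    have s: "sqi M (atom (\<tau> i) (\<tau> (Suc i)) (\<xi> i) t)" if "i < N" for i by (rule atom_sqi[OF a[OF that] t])
    have s': "sqi M (atom (\<tau>' i) (\<tau>' (Suc i)) (\<xi>' i) t)" if "i < N'" for i by (rule atom_sqi[OF b[OF that] t])
    show ?thesis
    by (subst Bochner_Integration.integral_sum)
    (auto intro!: Bochner_Integration.integrable_sum integrable_inner_sqi s s' sum.cong Bochner_Integration.integral_sum)
  qed
  also have "\<dots> = (\<Sum>i<N. \<Sum>j<N'. \<integral>z. (indicat_real {\<tau> i<..\<tau> (Suc i)} (fst z) *\<^sub>R \<xi> i (snd z)) \<bullet> (indicat_real {\<tau>' j<..\<tau>' (Suc j)} (fst z) *\<^sub>R \<xi>' j (snd z)) \<partial>PM t)"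
    using a b t by (intro sum.cong refl atom_isometry(2)) auto
  also have "\<dots> = (\<Sum>i<N. \<integral>z. (\<Sum>j<N'. (indicat_real {\<tau> i<..\<tau> (Suc i)} (fst z) *\<^sub>R \<xi> i (snd z)) \<bullet> (indicat_real {\<tau>' j<..\<tau>' (Suc j)} (fst z) *\<^sub>R \<xi>' j (snd z))) \<partial>PM t)"
    by (intro sum.cong refl Bochner_Integration.integral_sum[symmetric] atom_isometry(1)) (use a b t in auto)
  also have "\<dots> = (LINT z|PM t. (\<Sum>i<N. \<Sum>j<N'. (indicat_real {\<tau> i<..\<tau> (Suc i)} (fst z) *\<^sub>R \<xi> i (snd z)) \<bullet> (indicat_real {\<tau>' j<..\<tau>' (Suc j)} (fst z) *\<^sub>R \<xi>' j (snd z))))"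
    by (intro Bochner_Integration.integral_sum[symmetric] Bochner_Integration.integrable_sum atom_isometry(1)) (use a b t in auto)
  also have "\<dots> = (LINT z|PM t. simple_val \<phi> (fst z) (snd z) \<bullet> simple_val \<psi> (fst z) (snd z))"
    unfolding eq simple_val_def case_prod_conv inner_sum_left unfolding inner_sum_right ..
  finally show ?thesis .
qed

lemma simple_val_L2F:
  fixes \<phi> :: "nat \<times> (nat => real) \<times> (nat => 'w => 'a::euclidean_space)"
  assumes \<phi>: "is_simple M T W \<phi>"
  shows "simple_val \<phi> \<in> L2F M T W"
proof -
  obtain N \<tau> \<xi> where eq: "\<phi> = (N, \<tau>, \<xi>)" by (metis prod_cases3)
  note a = simple_atoms[OF \<phi>[unfolded eq]]
  have atomL: "(%s w. indicat_real {a<..b} s *\<^sub>R \<xi> w) \<in> L2F M T W"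
    if ab: "0 \<le> a" "a \<le> b" "b \<le> T" and \<xi>: "coef a \<xi>" for a b and \<xi> :: "'w => 'a"
  proof -
    have p: "progressive M T W (%s w. indicat_real {a<..b} s *\<^sub>R \<xi> w)"
    unfolding progressive_def
    proof
    fix t assume t: "t \<in> {0..T}"
    show "(%(s, w). indicat_real {a<..b} s *\<^sub>R \<xi> w) \<in> borel_measurable (restrict_space borel {0..t} \<Otimes>\<^sub>M filt M W t)"
    proof (cases "a \<le> t")
    case True
    have "\<xi> \<in> borel_measurable (filt M W t)" using \<xi> t by (intro filt_measurable_mono[OF True]) (auto simp: coef_def)
    moreover have "indicat_real {a<..b} \<in> borel_measurable (restrict_space borel {0..t})"
    by (rule measurable_restrict_space1) measurable
    ultimately show ?thesis unfolding case_prod_beta' by measurable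
    next
    case False
    have "(%(s, w). indicat_real {a<..b} s *\<^sub>R \<xi> w) \<in> borel_measurable (restrict_space borel {0..t} \<Otimes>\<^sub>M filt M W t) \<longleftrightarrow>
    (%_. 0::'a) \<in> borel_measurable (restrict_space borel {0..t} \<Otimes>\<^sub>M filt M W t)"
    using False by (intro measurable_cong) (auto simp: space_pair_measure space_restrict_space indicator_def)
    then show ?thesis by simp
    qed
    qed
    have "integrable (PM T) (%z. (norm (indicat_real {a<..b} (fst z) *\<^sub>R \<xi> (snd z)))\<^sup>2)"
    using atom_isometry(1)[OF ab \<xi> ab \<xi>, of T] T_pos by (simp only: power2_norm_eq_inner) simp
    then show ?thesis
    using p progressiveD(2)[OF p, of T] T_pos by (simp add: L2F_iff sqi_def case_prod_beta')
  qed
  have "(%s w. \<Sum>i<n. indicat_real {\<tau> i<..\<tau> (Suc i)} s *\<^sub>R \<xi> i w) \<in> L2F M T W" if "n \<le> N" for n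
    using that
  proof (induction n)
    case 0
    show ?case by (simp add: L2F_iff progressive_def sqi_0)
  next
    case (Suc n)
    then show ?case using a[of n] by (auto intro!: L2F_add atomL)
  qed
  then show ?thesis by (simp add: eq simple_val_def)
qed

section \<open>Doob's inequality and completeness\<close>

lemma doob_pathwise:
  fixes x S :: "nat => real"
  assumes S0: "S 0 = x 0" and SS: "\<And>i. S (Suc i) = max (S i) (x (Suc i))"
  shows "(S n)\<^sup>2 \<le> 4 * (x n)\<^sup>2 - 4 * (\<Sum>i<n. S i * (x (Suc i) - x i))"
proof -
  have "(S n)\<^sup>2 / 2 + (S 0)\<^sup>2 / 2 \<le> S n * x n - (\<Sum>i<n. S i * (x (Suc i) - x i))" for n
  proof (induction n)
    case 0
    show ?case by (simp add: S0 power2_eq_square)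
  next
    case (Suc n)
    show ?case
    proof (cases "x (Suc n) \<le> S n")
    case True
    then have "S (Suc n) = S n" using SS by simp
    then show ?thesis using Suc by (simp add: algebra_simps)
    next
    case False
    then have *: "S (Suc n) = x (Suc n)" using SS by simp
    have "0 \<le> (S n - x (Suc n))\<^sup>2" by simp
    then have "S n * x (Suc n) \<le> (S n)\<^sup>2 / 2 + (x (Suc n))\<^sup>2 / 2" by (simp add: power2_diff)
    then show ?thesis using Suc by (simp add: * algebra_simps power2_eq_square)
    qed
  qed
  from this[of n] have "(S n)\<^sup>2 / 2 \<le> S n * x n - (\<Sum>i<n. S i * (x (Suc i) - x i))"
    using zero_le_power2[of "S 0"] by linarith
  moreover have "S n * x n \<le> (S n)\<^sup>2 / 4 + (x n)\<^sup>2"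
    using zero_le_power2[of "S n / 2 - x n"] by (simp add: power2_diff power_divide)
  ultimately show ?thesis by linarith
qed

lemma norm_diff_ge_sgn: "sgn a \<bullet> (b - a) \<le> norm b - norm a" for a b :: "'a::real_inner"
proof (cases "a = 0")
  case False
  have "sgn a \<bullet> b \<le> norm b"
    using norm_cauchy_schwarz[of "sgn a" b] False by (simp add: norm_sgn)
  moreover have "sgn a \<bullet> a = norm a"
    using False by (simp add: sgn_div_norm dot_square_norm power2_eq_square)
  ultimately show ?thesis by (simp add: inner_diff_right)
qed simp

lemma doob_discrete:
  assumes N: "mart N" and \<tau>: "\<And>i. i \<le> n ==> \<tau> i \<in> {0..T}" "\<And>i. i < n ==> \<tau> i \<le> \<tau> (Suc i)"
  shows "(\<integral>\<^sup>+w. (SUP j\<in>{..n}. ennreal ((norm (N (\<tau> j) w))\<^sup>2)) \<partial>M) \<le> ennreal (4 * (LINT w|M. (norm (N (\<tau> n) w))\<^sup>2))"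
proof -
  define S where "S = rec_nat (%w. norm (N (\<tau> 0) w)) (%i S w. max (S w) (norm (N (\<tau> (Suc i)) w)))"
  have S0: "S 0 w = norm (N (\<tau> 0) w)" and SS: "S (Suc i) w = max (S i w) (norm (N (\<tau> (Suc i)) w))" for i w
    by (simp_all add: S_def)
  have sN: "sqi M (N (\<tau> i))" if "i \<le> n" for i by (rule martD(2)[OF N \<tau>(1)[OF that]])
  have mN: "N (\<tau> i) \<in> borel_measurable (filt M W (\<tau> j))" if "i \<le> j" "j \<le> n" for i j
  proof -
    have "\<tau> i \<le> \<tau> j" using that
    proof (induction j)
    case (Suc j)
    show ?case
    proof (cases "i = Suc j")
    case False
    then have "\<tau> i \<le> \<tau> j" using Suc by simp
    then show ?thesis using \<tau>(2)[of j] Suc.prems by simp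
    qed simp
    qed simp
    then show ?thesis
    using that \<tau>(1)[of j] by (intro filt_measurable_mono[OF _ _ acD(1)[OF martD(1)[OF N] \<tau>(1)]]) auto
  qed
  have Snn: "0 \<le> S i w" for i w by (induction i) (auto simp: S0 SS)
  have mS: "S i \<in> borel_measurable (filt M W (\<tau> j))" if "i \<le> j" "j \<le> n" for i j
    using that
  proof (induction i)
    case 0
    then show ?case using mN[of 0 j] unfolding S0[abs_def] by measurable
  next
    case (Suc i)
    have [measurable]: "S i \<in> borel_measurable (filt M W (\<tau> j))" using Suc by simp
    have [measurable]: "N (\<tau> (Suc i)) \<in> borel_measurable (filt M W (\<tau> j))" using mN[of "Suc i" j] Suc.prems by simp
    show ?case unfolding SS[abs_def] by measurable
  qed
  have mSM: "S i \<in> borel_measurable M" if "i \<le> n" for i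
    using filt_measurable_M[OF _ mS[of i i]] \<tau>(1)[of i] that by simp
  have Sle: "norm (N (\<tau> j) w) \<le> S i w" if "j \<le> i" for i j w
    using that
  proof (induction i)
    case (Suc i)
    then show ?case by (cases "j = Suc i") (auto simp: SS le_max_iff_disj)
  qed (simp add: S0)
  have sS: "sqi M (S i)" if "i \<le> n" for i
  proof (rule sqi_bound[where g="%w. \<Sum>j\<le>i. (norm (N (\<tau> j) w))\<^sup>2"])
    show "integrable M (%w. \<Sum>j\<le>i. (norm (N (\<tau> j) w))\<^sup>2)"
    using that sN by (intro Bochner_Integration.integrable_sum) (auto simp: sqi_def)
    have "(S i w)\<^sup>2 \<le> (\<Sum>j\<le>i. (norm (N (\<tau> j) w))\<^sup>2)" for i w
    proof (induction i)
    case (Suc i)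
    show ?case
    proof (cases "norm (N (\<tau> (Suc i)) w) \<le> S i w")
    case True
    then show ?thesis using Suc by (simp add: SS max_absorb1 add_increasing2)
    next
    case False
    then show ?thesis by (simp add: SS max_absorb2 sum_nonneg)
    qed
    qed (simp add: S0)
    then show "AE w in M. (norm (S i w))\<^sup>2 \<le> (\<Sum>j\<le>i. (norm (N (\<tau> j) w))\<^sup>2)" by simp
  qed (rule mSM[OF that])
  define Y where "Y i w = S i w *\<^sub>R sgn (N (\<tau> i) w)" for i w
  have mY: "Y i \<in> borel_measurable (filt M W (\<tau> i))" if "i \<le> n" for i
    unfolding Y_def[abs_def] sgn_div_norm using mS[OF _ that, of i] mN[OF _ that, of i] by measurable
  have sY: "sqi M (Y i)" if i: "i \<le> n" for i
    unfolding Y_def[abs_def]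
  proof (rule sqi_bounded_mult[where K=1, OF sS[OF i]])
    show "(%w. sgn (N (\<tau> i) w)) \<in> borel_measurable M"
    unfolding sgn_div_norm using sqi_measurable[OF sN[OF i]] by measurable
  qed (simp add: norm_sgn)
  have path: "(S n w)\<^sup>2 \<le> 4 * (norm (N (\<tau> n) w))\<^sup>2 - 4 * (\<Sum>i<n. Y i w \<bullet> (N (\<tau> (Suc i)) w - N (\<tau> i) w))" for w
  proof -
    have "(\<Sum>i<n. Y i w \<bullet> (N (\<tau> (Suc i)) w - N (\<tau> i) w)) \<le> (\<Sum>i<n. S i w * (norm (N (\<tau> (Suc i)) w) - norm (N (\<tau> i) w)))"
    unfolding Y_def by (intro sum_mono) (simp add: norm_diff_ge_sgn mult_left_mono Snn)
    then show ?thesis using doob_pathwise[of "%i. S i w" "%i. norm (N (\<tau> i) w)" n] S0 SS by simp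
  qed
  have iY: "integrable M (%w. Y i w \<bullet> (N (\<tau> (Suc i)) w - N (\<tau> i) w))" if "i < n" for i
    using that by (intro integrable_inner_sqi sY sqi_diff sN) auto
  have zero: "(LINT w|M. Y i w \<bullet> (N (\<tau> (Suc i)) w - N (\<tau> i) w)) = 0" if i: "i < n" for i
  proof -
    have "(LINT w|M. Y i w \<bullet> (N (\<tau> (Suc i)) w - N (\<tau> i) w)) = (LINT w|M. Y i w \<bullet> N (\<tau> (Suc i)) w) - (LINT w|M. Y i w \<bullet> N (\<tau> i) w)"
    unfolding inner_diff_right using i by (intro Bochner_Integration.integral_diff integrable_inner_sqi sY sN) auto
    also have "\<dots> = 0"
    using martD(3)[OF N _ \<tau>(2)[OF i] _ mY sY] \<tau>(1)[of i] \<tau>(1)[of "Suc i"] i by simp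
    finally show ?thesis .
  qed
  have "(\<integral>\<^sup>+w. (SUP j\<in>{..n}. ennreal ((norm (N (\<tau> j) w))\<^sup>2)) \<partial>M) \<le> (\<integral>\<^sup>+w. ennreal ((S n w)\<^sup>2) \<partial>M)"
    by (intro nn_integral_mono SUP_least ennreal_leI power_mono Sle) auto
  also have "\<dots> = ennreal (LINT w|M. (S n w)\<^sup>2)"
    using sS[of n] by (intro nn_integral_eq_integral) (auto simp: sqi_def)
  also have "(LINT w|M. (S n w)\<^sup>2) \<le> (LINT w|M. 4 * (norm (N (\<tau> n) w))\<^sup>2 - 4 * (\<Sum>i<n. Y i w \<bullet> (N (\<tau> (Suc i)) w - N (\<tau> i) w)))"
    using sS[of n] sN[of n] iY path
    by (intro integral_mono Bochner_Integration.integrable_diff integrable_mult_right Bochner_Integration.integrable_sum)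
    (auto simp: sqi_def)
  also have "\<dots> = 4 * (LINT w|M. (norm (N (\<tau> n) w))\<^sup>2)"
  proof -
    have iS: "integrable M (%w. \<Sum>i<n. Y i w \<bullet> (N (\<tau> (Suc i)) w - N (\<tau> i) w))"
    by (rule Bochner_Integration.integrable_sum) (use iY in auto)
    have zS: "(LINT w|M. (\<Sum>i<n. Y i w \<bullet> (N (\<tau> (Suc i)) w - N (\<tau> i) w))) = 0"
    by (subst Bochner_Integration.integral_sum) (use iY zero in auto)
    show ?thesis
    by (subst Bochner_Integration.integral_diff)
    (use sN[of n] zS in \<open>auto simp: sqi_def intro!: integrable_mult_right iS\<close>)
  qed
  finally show ?thesis by (simp add: ennreal_leI)
qed

lemma doob:
  assumes N: "mart N"
  shows "(\<integral>\<^sup>+w. supn N w \<partial>M) \<le> ennreal (4 * (LINT w|M. (norm (N T w))\<^sup>2))"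
proof -
  define A where "A n w = (SUP j\<in>{..(2::nat)^n}. ennreal ((norm (N (T * real j / 2^n) w))\<^sup>2))" for n w
  have ac: "ac N" by (rule martD(1)[OF N])
  have mA: "A n \<in> borel_measurable M" for n
    unfolding A_def[abs_def]
  proof (intro borel_measurable_SUP)
    fix j assume "j \<in> {..(2::nat)^n}"
    then have [measurable]: "N (T * real j / 2^n) \<in> borel_measurable M"
    by (intro ac_measurable[OF ac] dyadic_mem) auto
    show "(%w. ennreal ((norm (N (T * real j / 2^n) w))\<^sup>2)) \<in> borel_measurable M" by measurable
  qed (auto intro: countable_finite)
  have "incseq A"
  proof (rule incseq_SucI, rule le_funI)
    fix n w
    show "A n w \<le> A (Suc n) w"
    unfolding A_def
    proof (rule SUP_least)
    fix j assume "j \<in> {..(2::nat)^n}"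
    then show "ennreal ((norm (N (T * real j / 2^n) w))\<^sup>2) \<le> (SUP j\<in>{..(2::nat)^Suc n}. ennreal ((norm (N (T * real j / 2^Suc n) w))\<^sup>2))"
    by (intro SUP_upper2[of "2 * j"]) auto
    qed
  qed
  have "(\<integral>\<^sup>+w. supn N w \<partial>M) = (\<integral>\<^sup>+w. (SUP n. A n w) \<partial>M)"
    by (intro nn_integral_cong) (simp add: supn_dyadic[OF ac] A_def)
  also have "\<dots> = (SUP n. \<integral>\<^sup>+w. A n w \<partial>M)"
    by (rule nn_integral_monotone_convergence_SUP[OF \<open>incseq A\<close> mA])
  also have "\<dots> \<le> ennreal (4 * (LINT w|M. (norm (N T w))\<^sup>2))"
  proof (rule SUP_least)
    fix n
    have "(\<integral>\<^sup>+w. A n w \<partial>M) \<le> ennreal (4 * (LINT w|M. (norm (N (T * real ((2::nat)^n) / 2^n) w))\<^sup>2))"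
    unfolding A_def
    using T_pos dyadic_mem by (intro doob_discrete[OF N]) (auto intro!: divide_right_mono)
    then show "(\<integral>\<^sup>+w. A n w \<partial>M) \<le> ennreal (4 * (LINT w|M. (norm (N T w))\<^sup>2))" by simp
  qed
  finally show ?thesis .
qed

end

context bm_space
begin

lemma continuous_limit:
  fixes X :: "nat => real => 'w => 'a::euclidean_space"
  assumes ac: "\<And>k. ac (X k)"
    and bd: "\<And>k. (\<integral>\<^sup>+q. supn (%t q. X (Suc k) t q - X k t q) q \<partial>M) \<le> ennreal (c * (1/4)^k)" and c: "0 \<le> c"
  shows "\<exists>Z. ac Z \<and> (%k. \<integral>\<^sup>+q. supn (%t q. X k t q - Z t q) q \<partial>M) \<longlonglongrightarrow> 0"
proof -
  define D where "D k t q = X (Suc k) t q - X k t q" for k t q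
  have acD': "ac (D k)" for k unfolding D_def[abs_def] by (intro ac_diff ac)
  have mD[measurable]: "supn (D k) \<in> borel_measurable M" for k by (rule supn_measurable[OF acD'])
  define g where "g q = (\<Sum>k. ennreal (2^k) * supn (D k) q)" for q
  have mg[measurable]: "g \<in> borel_measurable M" unfolding g_def[abs_def] by measurable
  have "(\<integral>\<^sup>+q. g q \<partial>M) = (\<Sum>k. \<integral>\<^sup>+q. ennreal (2^k) * supn (D k) q \<partial>M)"
    unfolding g_def by (rule nn_integral_suminf) measurable
  also have "\<dots> \<le> (\<Sum>k. ennreal (c * (1/2)^k))"
  proof (intro suminf_le summableI)
    fix k
    have "(\<integral>\<^sup>+q. ennreal (2^k) * supn (D k) q \<partial>M) = ennreal (2^k) * (\<integral>\<^sup>+q. supn (D k) q \<partial>M)"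
    by (rule nn_integral_cmult) measurable
    also have "\<dots> \<le> ennreal (2^k) * ennreal (c * (1/4)^k)"
    using bd[of k] unfolding D_def[abs_def] by (intro mult_left_mono) auto
    also have "\<dots> = ennreal (c * (1/2)^k)"
    proof -
    have "(2::real)^k * (c * (1/4)^k) = c * (2 * (1/4))^k" unfolding power_mult_distrib by simp
    then show ?thesis using c by (simp add: ennreal_mult[symmetric])
    qed
    finally show "(\<integral>\<^sup>+q. ennreal (2^k) * supn (D k) q \<partial>M) \<le> ennreal (c * (1/2)^k)" .
  qed
  also have "\<dots> = ennreal (c * 2)"
  proof -
    have "(%k. c * (1/2)^k) sums (c * (1 / (1 - 1/2)))" by (intro sums_mult geometric_sums) simp
    then show ?thesis using c by (intro suminf_ennreal_eq) auto
  qed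
  finally have gi: "(\<integral>\<^sup>+q. g q \<partial>M) \<le> ennreal (c * 2)" .
  then have gfin: "AE q in M. g q \<noteq> \<infinity>"
    by (intro nn_integral_noteq_infinite) (auto simp: top_unique)
  define r where "r = sqrt (1/2)"
  have r: "0 < r" "r < 1" "r\<^sup>2 = 1/2" by (simp_all add: r_def)
  have Db: "norm (D k t q) \<le> sqrt (enn2real (g q)) * r^k" if "g q \<noteq> \<infinity>" "t \<in> {0..T}" for k t q
  proof -
    have "ennreal (2^k) * supn (D k) q \<le> g q"
    unfolding g_def by (rule sum_le_suminf[of _ "{k}", simplified]) auto
    moreover have "ennreal (2^k * (norm (D k t q))\<^sup>2) \<le> ennreal (2^k) * supn (D k) q"
    using supn_upper[OF that(2), of "D k" q] by (simp add: ennreal_mult mult_left_mono)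
    ultimately have "ennreal (2^k * (norm (D k t q))\<^sup>2) \<le> ennreal (enn2real (g q))"
    using that(1) by (metis ennreal_enn2real infinity_ennreal_def less_top order_trans)
    then have "2^k * (norm (D k t q))\<^sup>2 \<le> enn2real (g q)" by (simp add: ennreal_le_iff)
    moreover have "(r^k)\<^sup>2 * 2^k = (1::real)"
    proof -
    have "(r^k)\<^sup>2 * 2^k = (r\<^sup>2 * 2)^k" by (simp add: power_mult_distrib power_mult[symmetric] mult.commute)
    then show ?thesis by (simp add: r(3))
    qed
    ultimately have "(norm (D k t q))\<^sup>2 \<le> enn2real (g q) * (r^k)\<^sup>2"
    proof -
    assume a: "2^k * (norm (D k t q))\<^sup>2 \<le> enn2real (g q)" and b: "(r^k)\<^sup>2 * 2^k = (1::real)"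
    have "(r^k)\<^sup>2 * (2^k * (norm (D k t q))\<^sup>2) \<le> (r^k)\<^sup>2 * enn2real (g q)"
    using a by (intro mult_left_mono) auto
    then show ?thesis using b by (simp only: mult.assoc[symmetric] mult_1_left) (simp add: mult.commute)
    qed
    then have "(norm (D k t q))\<^sup>2 \<le> (sqrt (enn2real (g q)) * r^k)\<^sup>2"
    by (simp only: power_mult_distrib real_sqrt_pow2 enn2real_nonneg)
    moreover have "0 \<le> sqrt (enn2real (g q)) * r^k" using r(1) by simp
    ultimately show ?thesis by (rule power2_le_imp_le)
  qed
  have sumr: "summable (%k. sqrt (enn2real (g q)) * r^k)" for q
    using r by (intro summable_mult summable_geometric) auto
  define Z where "Z t q = (if g q \<noteq> \<infinity> then X 0 t q + (\<Sum>k. D k t q) else 0)" for t q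
  have Xn: "X n t q = X 0 t q + (\<Sum>k<n. D k t q)" for n t q
    by (induction n) (simp_all add: D_def)
  have summD: "summable (%k. D k t q)" if "g q \<noteq> \<infinity>" "t \<in> {0..T}" for t q
    by (rule summable_comparison_test'[OF sumr[of q], of 0]) (use Db[OF that] in auto)
  have ZX: "(norm (X n t q - Z t q))\<^sup>2 \<le> enn2real (g q) * ((1/2)^n / (1 - r)\<^sup>2)" if gt: "g q \<noteq> \<infinity>" "t \<in> {0..T}" for n t q
  proof -
    have s: "summable (%k. norm (D (k + n) t q))"
    by (rule summable_comparison_test'[OF summable_ignore_initial_segment[OF sumr[of q], of n], of 0]) (use Db[OF gt] in auto)
    have "(\<Sum>k. D k t q) = (\<Sum>k. D (k + n) t q) + (\<Sum>k<n. D k t q)"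
    by (rule suminf_split_initial_segment[OF summD[OF gt]])
    then have "norm (X n t q - Z t q) = norm (\<Sum>k. D (k + n) t q)"
    using gt unfolding Z_def by (subst Xn) (simp add: norm_minus_commute)
    also have "\<dots> \<le> (\<Sum>k. norm (D (k + n) t q))" by (rule summable_norm[OF s])
    also have "\<dots> \<le> (\<Sum>k. sqrt (enn2real (g q)) * r^(k + n))"
    by (rule suminf_le[OF Db[OF gt] s summable_ignore_initial_segment[OF sumr]])
    also have "\<dots> = (\<Sum>k. (sqrt (enn2real (g q)) * r^n) * r^k)" by (simp add: power_add mult_ac)
    also have "\<dots> = (sqrt (enn2real (g q)) * r^n) * (1 / (1 - r))"
    using r by (subst suminf_mult) (auto simp: suminf_geometric)
    finally have "(norm (X n t q - Z t q))\<^sup>2 \<le> ((sqrt (enn2real (g q)) * r^n) * (1 / (1 - r)))\<^sup>2"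
    by (intro power_mono) auto
    also have "\<dots> = enn2real (g q) * ((r\<^sup>2)^n / (1 - r)\<^sup>2)"
    by (simp add: power_mult_distrib power_divide power_mult[symmetric] mult.commute)
    finally show ?thesis by (simp add: r(3))
  qed
  have "ac Z"
    unfolding ac_def
  proof (intro conjI ballI)
    fix t assume t: "t \<in> {0..T}"
    have [measurable]: "X 0 t \<in> borel_measurable (filt M W t)" "D k t \<in> borel_measurable (filt M W t)" for k
    using acD(1)[OF ac t] acD(1)[OF acD' t] by auto
    have "(%q. X 0 t q + (\<Sum>k. D k t q)) \<in> borel_measurable (filt M W t)" by measurable
    then show "Z t \<in> borel_measurable (filt M W t)"
    by (rule filt_AE_cong) (use t gfin in \<open>auto simp: Z_def elim!: eventually_mono\<close>)
  next
    fix q assume q: "q \<in> space M"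
    show "continuous_on {0..T} (%t. Z t q)"
    proof (cases "g q \<noteq> \<infinity>")
    case True
    have "uniform_limit {0..T} (%n t. \<Sum>k<n. D k t q) (%t. \<Sum>k. D k t q) sequentially"
    by (rule Weierstrass_m_test[OF Db[OF True] sumr])
    then have "continuous_on {0..T} (%t. \<Sum>k. D k t q)"
    by (rule uniform_limit_theorem[rotated])
    (auto intro!: always_eventually continuous_on_sum acD(2)[OF acD' q])
    then have "continuous_on {0..T} (%t. X 0 t q + (\<Sum>k. D k t q))"
    by (intro continuous_on_add acD(2)[OF ac q])
    then show ?thesis using True by (simp only: Z_def simp_thms if_True)
    next
    case False
    then show ?thesis by (simp only: Z_def simp_thms if_False continuous_on_const)
    qed
  qed
  moreover have "(%k. \<integral>\<^sup>+q. supn (%t q. X k t q - Z t q) q \<partial>M) \<longlonglongrightarrow> 0"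
  proof (rule tendsto_sandwich[where f="%_. 0"])
    define C where "C = c * 2 / (1 - r)\<^sup>2"
    have C: "0 \<le> C" using c by (simp add: C_def)
    show "\<forall>\<^sub>F n in sequentially. (\<integral>\<^sup>+q. supn (%t q. X n t q - Z t q) q \<partial>M) \<le> ennreal (C * (1/2)^n)"
    proof (intro always_eventually allI)
    fix n
    have "(\<integral>\<^sup>+q. supn (%t q. X n t q - Z t q) q \<partial>M) \<le> (\<integral>\<^sup>+q. g q * ennreal ((1/2)^n / (1 - r)\<^sup>2) \<partial>M)"
    proof (rule nn_integral_mono_AE)
    show "AE q in M. supn (%t q. X n t q - Z t q) q \<le> g q * ennreal ((1/2)^n / (1 - r)\<^sup>2)"
    using gfin
    proof eventually_elim
    fix q assume fin: "g q \<noteq> \<infinity>"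
    have "supn (%t q. X n t q - Z t q) q \<le> ennreal (enn2real (g q) * ((1/2)^n / (1 - r)\<^sup>2))"
    unfolding supn_def by (intro SUP_least ennreal_leI ZX[OF fin])
    also have "\<dots> = ennreal (enn2real (g q)) * ennreal ((1/2)^n / (1 - r)\<^sup>2)" by (rule ennreal_mult) auto
    also have "ennreal (enn2real (g q)) = g q" using fin by (simp add: less_top)
    finally show "supn (%t q. X n t q - Z t q) q \<le> g q * ennreal ((1/2)^n / (1 - r)\<^sup>2)" .
    qed
    qed
    also have "\<dots> = (\<integral>\<^sup>+q. g q \<partial>M) * ennreal ((1/2)^n / (1 - r)\<^sup>2)" by (rule nn_integral_multc) measurable
    also have "\<dots> \<le> ennreal (c * 2) * ennreal ((1/2)^n / (1 - r)\<^sup>2)" by (intro mult_right_mono gi) simp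
    also have "\<dots> = ennreal (C * (1/2)^n)" using c by (simp add: ennreal_mult[symmetric] C_def)
    finally show "(\<integral>\<^sup>+q. supn (%t q. X n t q - Z t q) q \<partial>M) \<le> ennreal (C * (1/2)^n)" .
    qed
    have "(%n. C * (1/2)^n) \<longlonglongrightarrow> C * 0" by (intro tendsto_intros LIMSEQ_power_zero) auto
    then have "(%n. ennreal (C * (1/2)^n)) \<longlonglongrightarrow> ennreal 0" by (intro tendsto_ennrealI) simp
    then show "(%n. ennreal (C * (1/2)^n)) \<longlonglongrightarrow> 0" by simp
  qed auto
  ultimately show ?thesis by blast
qed

end

section \<open>Approximation by backward averages\<close>

definition bcoef :: "real => nat => (real => 'a::euclidean_space) => nat => 'a" where
  "bcoef T n f i = (if i = 0 then 0 else (real n / T) *\<^sub>R (LINT s:{T * real (i - 1) / real n<..T * real i / real n}|lborel. f s))"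

definition bavg :: "real => nat => (real => 'a::euclidean_space) => real => 'a" where
  "bavg T n f t = (\<Sum>i<n. indicat_real {T * real i / real n<..T * real (Suc i) / real n} t *\<^sub>R bcoef T n f i)"

context
  fixes T :: real assumes T: "0 < T"
begin

lemma grid_subset: "i < n ==> {T * real i / real n<..T * real (Suc i) / real n} \<subseteq> {0..T}"
proof -
  assume i: "i < n"
  then have "T * real (Suc i) \<le> T * real n" using T by (intro mult_left_mono) auto
  then have "T * real (Suc i) / real n \<le> T" using i by (simp add: divide_le_eq del: of_nat_Suc)
  moreover have "0 \<le> T * real i / real n" using T by simp
  ultimately show ?thesis by (auto simp del: of_nat_Suc)
qed

lemma grid_disjoint:
  assumes "t \<in> {T * real i / real n<..T * real (Suc i) / real n}" "t \<in> {T * real j / real n<..T * real (Suc j) / real n}"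
    and n: "0 < n"
  shows "i = j"
proof -
  have lt: "k < Suc l" if "T * real k / real n < t" "t \<le> T * real (Suc l) / real n" for k l
  proof -
    have "T * real k / real n < T * real (Suc l) / real n" using that by linarith
    then have "real k < real (Suc l)" using T n by (simp add: divide_less_cancel del: of_nat_Suc)
    then show ?thesis by simp
  qed
  show ?thesis using lt[of i j] lt[of j i] assms by auto
qed

lemma bavg_at:
  assumes "i < n" "t \<in> {T * real i / real n<..T * real (Suc i) / real n}"
  shows "bavg T n f t = bcoef T n f i"
proof -
  have "bavg T n f t = (\<Sum>j<n. if j = i then bcoef T n f j else 0)"
    unfolding bavg_def
  proof (intro sum.cong refl)
    fix j assume "j \<in> {..<n}"
    show "indicat_real {T * real j / real n<..T * real (Suc j) / real n} t *\<^sub>R bcoef T n f j = (if j = i then bcoef T n f j else 0)"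
    proof (cases "j = i")
    case True
    then show ?thesis using assms by (simp del: of_nat_Suc)
    next
    case False
    then have "t \<notin> {T * real j / real n<..T * real (Suc j) / real n}" using grid_disjoint assms by blast
    then show ?thesis using False by (simp del: of_nat_Suc greaterThanAtMost_iff)
    qed
  qed
  then show ?thesis using assms by simp
qed

lemma grid_cover:
  assumes t: "0 < t" "t \<le> T" and n: "0 < n"
  obtains i where "i < n" "t \<in> {T * real i / real n<..T * real (Suc i) / real n}"
proof -
  define i where "i = nat (\<lceil>real n * t / T\<rceil> - 1)"
  have pos: "0 < real n * t / T" using t n T by simp
  then have c1: "1 \<le> \<lceil>real n * t / T\<rceil>" by linarith
  have "real n * t / T \<le> real n" using t T n by (simp add: divide_le_eq)
  then have "\<lceil>real n * t / T\<rceil> \<le> int n" by linarith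
  then have "i < n" using c1 n by (auto simp: i_def)
  have ir: "real i = of_int \<lceil>real n * t / T\<rceil> - 1" using c1 by (simp add: i_def)
  have "real i < real n * t / T" "real n * t / T \<le> real (Suc i)" using ir by (simp_all, linarith+)
  then have "T / real n * real i < T / real n * (real n * t / T)" "T / real n * (real n * t / T) \<le> T / real n * real (Suc i)"
    using T n by (intro mult_strict_left_mono mult_left_mono; simp)+
  then have "t \<in> {T * real i / real n<..T * real (Suc i) / real n}" using T n by (simp del: of_nat_Suc)
  then show ?thesis using \<open>i < n\<close> that by blast
qed

lemma set_integrable_sub: "integrable (lam T) f ==> A \<in> sets borel ==> A \<subseteq> {0..T} ==> set_integrable lborel A f"
  for f :: "real => 'a::euclidean_space"
  using set_integrable_subset[of lborel "{0..T}" f A] by (simp add: set_integrable_lam)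

lemma bcoef_norm:
  fixes f :: "real => 'a::euclidean_space"
  assumes "0 < i"
  shows "norm (bcoef T n f i) \<le> (real n / T) * (LINT s:{T * real (i - 1) / real n<..T * real i / real n}|lborel. norm (f s))"
proof -
  have "norm (LINT s:{T * real (i - 1) / real n<..T * real i / real n}|lborel. f s)
    \<le> (LINT s:{T * real (i - 1) / real n<..T * real i / real n}|lborel. norm (f s))"
    unfolding set_lebesgue_integral_def
    by (rule order_trans[OF integral_norm_bound]) simp
  from mult_left_mono[OF this, of "real n / T"] show ?thesis using assms T by (simp add: bcoef_def)
qed

lemma bavg_measurable: "bavg T n f \<in> borel_measurable borel"
  unfolding bavg_def[abs_def] by measurable

lemma bavg_integrable: "integrable (lam T) (bavg T n f)"
proof -
  interpret finite_measure "lam T" by (rule finite_measure_lam)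
  show ?thesis
  proof (rule integrable_const_bound[where B="\<Sum>i<n. norm (bcoef T n f i)"])
    show "AE t in lam T. norm (bavg T n f t) \<le> (\<Sum>i<n. norm (bcoef T n f i))"
    unfolding bavg_def by (intro AE_I2 order_trans[OF norm_sum] sum_mono) (simp add: indicator_def del: of_nat_Suc)
  qed (rule measurable_restrict_space1[OF bavg_measurable[unfolded measurable_lborel2[symmetric]]])
qed

lemma sum_grid_indicator:
  "(\<Sum>j<m. indicat_real {T * real j / real n<..T * real (Suc j) / real n} s) = indicat_real {0<..T * real m / real n} s"
proof (induction m)
  case (Suc m)
  have "0 \<le> T * real m / real n" "T * real m / real n \<le> T * real (Suc m) / real n"
    using T by (auto intro!: divide_right_mono mult_left_mono)
  then show ?case using Suc by (auto simp: indicator_def simp del: of_nat_Suc)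
qed simp

lemma bcoef_add:
  fixes f g :: "real => 'a::euclidean_space"
  assumes f: "integrable (lam T) f" and g: "integrable (lam T) g" and i: "i < n"
  shows "bcoef T n (%s. f s + g s) i = bcoef T n f i + bcoef T n g i"
    "bcoef T n (%s. f s - g s) i = bcoef T n f i - bcoef T n g i"
proof -
  have "{T * real (i - 1) / real n<..T * real i / real n} \<subseteq> {0..T}" if "i \<noteq> 0"
    using grid_subset[of "i - 1" n] i that by simp
  then have "set_integrable lborel {T * real (i - 1) / real n<..T * real i / real n} f"
    "set_integrable lborel {T * real (i - 1) / real n<..T * real i / real n} g" if "i \<noteq> 0"
    using set_integrable_sub[OF f] set_integrable_sub[OF g] that by auto
  then show "bcoef T n (%s. f s + g s) i = bcoef T n f i + bcoef T n g i"
    "bcoef T n (%s. f s - g s) i = bcoef T n f i - bcoef T n g i"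
    by (cases "i = 0"; simp add: bcoef_def set_integral_add set_integral_diff scaleR_add_right scaleR_diff_right)+
qed

lemma bavg_add:
  fixes f g :: "real => 'a::euclidean_space"
  assumes f: "integrable (lam T) f" and g: "integrable (lam T) g"
  shows "bavg T n (%s. f s + g s) t = bavg T n f t + bavg T n g t"
    "bavg T n (%s. f s - g s) t = bavg T n f t - bavg T n g t"
  unfolding bavg_def sum.distrib[symmetric] sum_subtractf[symmetric]
  by (intro sum.cong refl; simp add: bcoef_add[OF f g] scaleR_add_right scaleR_diff_right)+

lemma bavg_contract:
  fixes f :: "real => 'a::euclidean_space"
  assumes f: "integrable (lam T) f" and n: "0 < n"
  shows "(LINT t|lam T. norm (bavg T n f t)) \<le> (LINT t|lam T. norm (f t))"
proof -
  interpret finite_measure "lam T" by (rule finite_measure_lam)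
  define J where "J i = {T * real i / real n<..T * real (Suc i) / real n}" for i
  have Jsub: "J i \<subseteq> {0..T}" if "i < n" for i unfolding J_def by (rule grid_subset[OF that])
  have Jm: "J i \<in> sets borel" for i by (simp add: J_def)
  have iJ: "integrable (lam T) (indicat_real (J i))" for i
    by (rule integrable_const_bound[where B=1]) (auto simp: J_def intro!: measurable_restrict_space1)
  have vJ: "(LINT t|lam T. indicat_real (J i) t) = T / real n" if i: "i < n" for i
  proof -
    have "(LINT t|lam T. indicat_real (J i) t) = (LINT t|lborel. indicat_real (J i) t)"
    unfolding set_integral_lam[symmetric] set_lebesgue_integral_def
    using Jsub[OF i] by (intro Bochner_Integration.integral_cong refl) (auto simp: indicator_def)
    also have "\<dots> = T / real n"
    using T n by (simp add: J_def field_simps)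
    finally show ?thesis .
  qed
  have nf: "integrable (lam T) (%t. norm (f t))" using f by simp
  have "(LINT t|lam T. norm (bavg T n f t)) \<le> (LINT t|lam T. (\<Sum>i<n. norm (bcoef T n f i) * indicat_real (J i) t))"
  proof (rule integral_mono)
    show "norm (bavg T n f t) \<le> (\<Sum>i<n. norm (bcoef T n f i) * indicat_real (J i) t)" for t
    unfolding bavg_def J_def by (rule order_trans[OF norm_sum sum_mono]) (simp del: of_nat_Suc)
  qed (intro integrable_norm bavg_integrable Bochner_Integration.integrable_sum integrable_mult_right iJ)+
  also have "\<dots> = (\<Sum>i<n. \<integral>t. norm (bcoef T n f i) * indicat_real (J i) t \<partial>lam T)"
    by (intro Bochner_Integration.integral_sum integrable_mult_right iJ)
  also have "\<dots> = (\<Sum>i<n. norm (bcoef T n f i) * (T / real n))"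
    by (intro sum.cong refl) (simp only: integral_mult_right_zero vJ lessThan_iff)
  also have "\<dots> = (\<Sum>j<n - 1. norm (bcoef T n f (Suc j)) * (T / real n))"
  proof -
    have "n = Suc (n - 1)" using n by simp
    then have "(\<Sum>i<n. norm (bcoef T n f i) * (T / real n)) = norm (bcoef T n f 0) * (T / real n) + (\<Sum>j<n - 1. norm (bcoef T n f (Suc j)) * (T / real n))"
    using sum.lessThan_Suc_shift[of "%i. norm (bcoef T n f i) * (T / real n)" "n - 1"] by simp
    then show ?thesis by (simp add: bcoef_def)
  qed
  also have "\<dots> \<le> (\<Sum>j<n - 1. LINT s:J j|lborel. norm (f s))"
  proof (rule sum_mono)
    fix j assume "j \<in> {..<n - 1}"
    have "norm (bcoef T n f (Suc j)) * (T / real n) \<le> (real n / T * (LINT s:J j|lborel. norm (f s))) * (T / real n)"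
    using bcoef_norm[of "Suc j" n f] T by (intro mult_right_mono) (simp_all add: J_def)
    then show "norm (bcoef T n f (Suc j)) * (T / real n) \<le> (LINT s:J j|lborel. norm (f s))" using T n by simp
  qed
  also have "\<dots> = (LINT s|lborel. (\<Sum>j<n - 1. indicat_real (J j) s *\<^sub>R norm (f s)))"
    unfolding set_lebesgue_integral_def
    by (rule Bochner_Integration.integral_sum[symmetric])
    (use set_integrable_sub[OF nf Jm Jsub] in \<open>auto simp: set_integrable_def\<close>)
  also have "\<dots> \<le> (LINT s|lborel. indicat_real {0..T} s *\<^sub>R norm (f s))"
  proof (rule integral_mono)
    show "integrable lborel (%s. \<Sum>j<n - 1. indicat_real (J j) s *\<^sub>R norm (f s))"
    by (rule Bochner_Integration.integrable_sum)
    (use set_integrable_sub[OF nf Jm Jsub] in \<open>auto simp: set_integrable_def\<close>)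
    show "integrable lborel (%s. indicat_real {0..T} s *\<^sub>R norm (f s))"
    using nf by (simp only: set_integrable_lam[symmetric] set_integrable_def)
    fix s
    have le: "T * real (n - 1) / real n \<le> T" using T n by (simp add: divide_le_eq)
    have "(\<Sum>j<n - 1. indicat_real (J j) s *\<^sub>R norm (f s)) = indicat_real {0<..T * real (n - 1) / real n} s * norm (f s)"
    unfolding real_scaleR_def sum_distrib_right[symmetric] J_def sum_grid_indicator ..
    also have "\<dots> \<le> indicat_real {0..T} s *\<^sub>R norm (f s)" using le by (auto simp: indicator_def)
    finally show "(\<Sum>j<n - 1. indicat_real (J j) s *\<^sub>R norm (f s)) \<le> indicat_real {0..T} s *\<^sub>R norm (f s)" .
  qed
  also have "\<dots> = (LINT t|lam T. norm (f t))"
    unfolding set_integral_lam[symmetric] set_lebesgue_integral_def ..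
  finally show ?thesis .
qed

definition bapprox :: "(real => 'a::euclidean_space) => bool" where
  "bapprox f \<longleftrightarrow> integrable (lam T) f \<and> (%n. \<integral>t. norm (bavg T (Suc n) f t - f t) \<partial>lam T) \<longlonglongrightarrow> 0"

lemma bapprox_limit:
  fixes f :: "real => 'a::euclidean_space"
  assumes fk: "\<And>k. bapprox (F k)" and f: "f \<in> borel_measurable (lam T)" and g: "integrable (lam T) g"
    and lim: "\<And>t. t \<in> space (lam T) ==> (%k. F k t) \<longlonglongrightarrow> f t"
    and bd: "\<And>k t. t \<in> space (lam T) ==> norm (F k t) \<le> g t"
  shows "bapprox f"
proof -
  have iF: "integrable (lam T) (F k)" for k using fk by (simp add: bapprox_def)
  have mF: "F k \<in> borel_measurable (lam T)" for k using iF by (rule borel_measurable_integrable)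
  have if': "integrable (lam T) f"
    by (rule integrable_dominated_convergence[of f "lam T" F g]) (use f g lim bd mF in auto)
  have L1: "(%k. \<integral>t. norm (F k t - f t) \<partial>lam T) \<longlonglongrightarrow> 0"
  proof -
    have "(%k. \<integral>t. norm (F k t - f t) \<partial>lam T) \<longlonglongrightarrow> (LINT t|lam T. 0)"
    proof (rule integral_dominated_convergence[where w="%t. g t + norm (f t)"])
    show "AE t in lam T. (%k. norm (F k t - f t)) \<longlonglongrightarrow> 0"
    using lim by (intro AE_I2 tendsto_norm_zero LIM_zero) auto
    show "AE t in lam T. norm (norm (F k t - f t)) \<le> g t + norm (f t)" for k
    using bd by (intro AE_I2) (auto intro: order_trans[OF norm_triangle_ineq4] add_mono)
    qed (use f mF g if' in auto)
    then show ?thesis by simp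
  qed
  have "(%n. \<integral>t. norm (bavg T (Suc n) f t - f t) \<partial>lam T) \<longlonglongrightarrow> 0"
  proof (rule LIMSEQ_I)
    fix e :: real assume e: "0 < e"
    obtain k where k: "(LINT t|lam T. norm (F k t - f t)) < e / 3"
    using LIMSEQ_D[OF L1, of "e/3"] e by force
    have "(%n. \<integral>t. norm (bavg T (Suc n) (F k) t - F k t) \<partial>lam T) \<longlonglongrightarrow> 0" using fk by (simp add: bapprox_def)
    then obtain n0 where n0: "\<And>n. n \<ge> n0 ==> (LINT t|lam T. norm (bavg T (Suc n) (F k) t - F k t)) < e / 3"
    using LIMSEQ_D[of "%n. \<integral>t. norm (bavg T (Suc n) (F k) t - F k t) \<partial>lam T" 0 "e/3"] e by force
    have "(LINT t|lam T. norm (bavg T (Suc n) f t - f t)) < e" if n: "n \<ge> n0" for n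
    proof -
    let ?A = "bavg T (Suc n)"
    note ib = bavg_integrable[of "Suc n"]
    have "(LINT t|lam T. norm (?A f t - f t)) \<le> (LINT t|lam T. norm (?A (%s. F k s - f s) t) + norm (?A (F k) t - F k t) + norm (F k t - f t))"
    proof (rule integral_mono)
    fix t
    have "?A f t - f t = - ?A (%s. F k s - f s) t + (?A (F k) t - F k t) + (F k t - f t)"
    by (simp add: bavg_add(2)[OF iF if'])
    then show "norm (?A f t - f t) \<le> norm (?A (%s. F k s - f s) t) + norm (?A (F k) t - F k t) + norm (F k t - f t)"
    using norm_triangle_ineq[of "- ?A (%s. F k s - f s) t + (?A (F k) t - F k t)" "F k t - f t"]
    norm_triangle_ineq[of "- ?A (%s. F k s - f s) t" "?A (F k) t - F k t"] by simp
    qed (intro integrable_norm Bochner_Integration.integrable_diff Bochner_Integration.integrable_add ib iF if')+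
    also have "\<dots> = (LINT t|lam T. norm (?A (%s. F k s - f s) t)) + (LINT t|lam T. norm (?A (F k) t - F k t)) + (LINT t|lam T. norm (F k t - f t))"
    proof -
    have "integrable (lam T) (%t. norm (?A (%s. F k s - f s) t))" "integrable (lam T) (%t. norm (?A (F k) t - F k t))"
    "integrable (lam T) (%t. norm (F k t - f t))"
    by (intro integrable_norm Bochner_Integration.integrable_diff ib iF if')+
    then show ?thesis by simp
    qed
    also have "(LINT t|lam T. norm (?A (%s. F k s - f s) t)) \<le> (LINT t|lam T. norm (F k t - f t))"
    using iF if' by (intro bavg_contract) auto
    finally show ?thesis using k n0[OF n] by linarith
    qed
    then show "\<exists>no. \<forall>n\<ge>no. norm ((LINT t|lam T. norm (bavg T (Suc n) f t - f t)) - 0) < e"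
    by (intro exI[of _ n0]) auto
  qed
  then show ?thesis using if' by (simp add: bapprox_def)
qed

lemma bapprox_add:
  fixes f g :: "real => 'a::euclidean_space"
  assumes f: "bapprox f" and g: "bapprox g"
  shows "bapprox (%t. f t + g t)" "bapprox (%t. f t - g t)"
proof -
  have i: "integrable (lam T) f" "integrable (lam T) g" using f g by (auto simp: bapprox_def)
  have lim: "(%n. (LINT t|lam T. norm (bavg T (Suc n) f t - f t)) + (LINT t|lam T. norm (bavg T (Suc n) g t - g t))) \<longlonglongrightarrow> 0"
    using f g tendsto_add_zero by (auto simp: bapprox_def)
  have le: "(LINT t|lam T. norm (bavg T (Suc n) h t - h t)) \<le> (LINT t|lam T. norm (bavg T (Suc n) f t - f t)) + (LINT t|lam T. norm (bavg T (Suc n) g t - g t))"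
    if h: "integrable (lam T) h" "\<And>t. norm (bavg T (Suc n) h t - h t) \<le> norm (bavg T (Suc n) f t - f t) + norm (bavg T (Suc n) g t - g t)" for h :: "real => 'a" and n
    by (subst Bochner_Integration.integral_add[symmetric])
    (intro integral_mono h(2) integrable_norm Bochner_Integration.integrable_diff Bochner_Integration.integrable_add bavg_integrable i h(1))+
  have tri: "norm (x + y) \<le> norm x + norm y" "norm (x - y) \<le> norm x + norm y" for x y :: 'a
    by (rule norm_triangle_ineq, rule norm_triangle_ineq4)
  have "norm (bavg T (Suc n) (%t. f t + g t) t - (f t + g t)) \<le> norm (bavg T (Suc n) f t - f t) + norm (bavg T (Suc n) g t - g t)" for n t
    using tri(1)[of "bavg T (Suc n) f t - f t" "bavg T (Suc n) g t - g t"] by (simp add: bavg_add[OF i] algebra_simps)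
  from le[OF _ this] show "bapprox (%t. f t + g t)"
    unfolding bapprox_def using i by (auto intro!: tendsto_sandwich[OF _ _ tendsto_const lim] always_eventually)
  have "norm (bavg T (Suc n) (%t. f t - g t) t - (f t - g t)) \<le> norm (bavg T (Suc n) f t - f t) + norm (bavg T (Suc n) g t - g t)" for n t
    using tri(2)[of "bavg T (Suc n) f t - f t" "bavg T (Suc n) g t - g t"] by (simp add: bavg_add[OF i] algebra_simps)
  from le[OF _ this] show "bapprox (%t. f t - g t)"
    unfolding bapprox_def using i by (auto intro!: tendsto_sandwich[OF _ _ tendsto_const lim] always_eventually)
qed

lemma bapprox_0: "bapprox (%_. 0)"
  by (simp add: bapprox_def bavg_def bcoef_def set_lebesgue_integral_def cong: if_cong)

lemma bapprox_scaleR: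
  fixes c :: "'a::euclidean_space"
  assumes f: "bapprox (f :: real => real)"
  shows "bapprox (%t. f t *\<^sub>R c)"
proof -
  have i: "integrable (lam T) f" using f by (simp add: bapprox_def)
  have "bcoef T n (%t. f t *\<^sub>R c) k = bcoef T n f k *\<^sub>R c" if k: "k < n" for n k
  proof (cases "k = 0")
    case False
    then have "set_integrable lborel {T * real (k - 1) / real n<..T * real k / real n} f"
    using set_integrable_sub[OF i] grid_subset[of "k - 1" n] k by auto
    then have "(LINT s:{T * real (k - 1) / real n<..T * real k / real n}|lborel. f s *\<^sub>R c) =
    (LINT s:{T * real (k - 1) / real n<..T * real k / real n}|lborel. f s) *\<^sub>R c"
    unfolding set_lebesgue_integral_def set_integrable_def
    by (subst integral_scaleR_left[symmetric]) (simp_all only: scaleR_scaleR real_scaleR_def)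
    then show ?thesis using False by (simp add: bcoef_def)
  qed (simp add: bcoef_def)
  then have "bavg T n (%t. f t *\<^sub>R c) t = bavg T n f t *\<^sub>R c" for n t
    unfolding bavg_def scaleR_sum_left
    by (intro sum.cong refl) (simp only: lessThan_iff scaleR_scaleR real_scaleR_def)
  then have "norm (bavg T n (%t. f t *\<^sub>R c) t - f t *\<^sub>R c) = norm (bavg T n f t - f t) * norm c" for n t
    by (simp only: scaleR_diff_left[symmetric] norm_scaleR real_norm_def)
  then show ?thesis using f by (auto simp: bapprox_def intro!: tendsto_mult_left_zero)
qed

lemma bapprox_half_line: "bapprox (indicat_real {..a})"
proof -
  interpret finite_measure "lam T" by (rule finite_measure_lam)
  have i: "integrable (lam T) (indicat_real {..a})"
    by (rule integrable_const_bound[where B=1]) (auto intro!: measurable_restrict_space1)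
  have bound: "(LINT t|lam T. norm (bavg T (Suc n) (indicat_real {..a}) t - indicat_real {..a} t)) \<le> 5 * T / real (Suc n)" for n
  proof -
    define h where "h = T / real (Suc n)"
    have h: "0 < h" using T by (simp add: h_def)
    have le: "norm (bavg T (Suc n) (indicat_real {..a}) t - indicat_real {..a} t) \<le>
    indicat_real {a - 2 * h..a + 2 * h} t + indicat_real {0..h} t" if t: "t \<in> {0..T}" for t
    proof (cases "t = 0")
    case True
    have "bavg T (Suc n) (indicat_real {..a}) 0 = 0"
    unfolding bavg_def using T by (intro sum.neutral) (auto simp: indicator_def not_less zero_le_mult_iff simp del: of_nat_Suc)
    then show ?thesis using True h by (simp add: indicator_def)
    next
    case False
    then obtain i where it: "i < Suc n" "t \<in> {T * real i / real (Suc n)<..T * real (Suc i) / real (Suc n)}"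
    using grid_cover[of t "Suc n"] t by auto
    have g: "T * real k / real (Suc n) = h * real k" for k by (simp add: h_def)
    have it': "h * real i < t" "t \<le> h * real i + h" using it(2) unfolding g by (auto simp: algebra_simps)
    note b = bavg_at[OF it, of "indicat_real {..a}"]
    show ?thesis
    proof (cases "i = 0")
    case True
    then have "t \<in> {0..h}" using it' by auto
    then show ?thesis using b True by (auto simp: bcoef_def indicator_def)
    next
    case i0: False
    define p where "p = h * real (i - 1)"
    have ip: "h * real i = p + h" using i0 by (simp add: p_def algebra_simps of_nat_diff)
    have b': "bavg T (Suc n) (indicat_real {..a}) t = (1 / h) * (LINT s:{p<..p + h}|lborel. indicat_real {..a} s)"
    unfolding b using i0 unfolding bcoef_def g p_def[symmetric] ip by (simp add: h_def)
    have Leb: "(LINT s:{p<..p + h}|lborel. indicat_real {..a} s) = measure lborel ({p<..p + h} \<inter> {..a})"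
    unfolding set_lebesgue_integral_def by (simp add: indicator_inter_arith[symmetric])
    have meas: "measure lborel ({p<..p + h} \<inter> {..a}) \<le> h"
    proof -
    have "measure lborel ({p<..p + h} \<inter> {..a}) \<le> measure lborel {p<..p + h}"
    using h by (intro measure_mono_fmeasurable) (auto simp: fmeasurable_def)
    then show ?thesis using h by simp
    qed
    consider "p + 2 * h \<le> a" | "a < p" | "p \<le> a" "a < p + 2 * h" by linarith
    then show ?thesis
    proof cases
    case 1
    then have "{p<..p + h} \<inter> {..a} = {p<..p + h}" using h by auto
    then have "bavg T (Suc n) (indicat_real {..a}) t = 1" using h by (simp add: b' Leb)
    moreover have "t \<le> a" using it' ip 1 by linarith
    ultimately show ?thesis by (simp add: indicator_def)
    next
    case 2
    then have "{p<..p + h} \<inter> {..a} = {}" by auto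
    then have "bavg T (Suc n) (indicat_real {..a}) t = 0" by (simp add: b' Leb)
    moreover have "a < t" using it' ip 2 h by linarith
    ultimately show ?thesis by (simp add: indicator_def)
    next
    case 3
    then have "t \<in> {a - 2 * h..a + 2 * h}" using it' ip h by auto
    moreover have "0 \<le> bavg T (Suc n) (indicat_real {..a}) t" "bavg T (Suc n) (indicat_real {..a}) t \<le> 1"
    using meas h by (simp_all add: b' Leb divide_le_eq)
    ultimately show ?thesis by (auto simp: indicator_def)
    qed
    qed
    qed
    have "(LINT t|lam T. norm (bavg T (Suc n) (indicat_real {..a}) t - indicat_real {..a} t)) \<le>
    (LINT t|lam T. indicat_real {a - 2 * h..a + 2 * h} t + indicat_real {0..h} t)"
    proof (rule integral_mono)
    show "integrable (lam T) (%t. indicat_real {a - 2 * h..a + 2 * h} t + indicat_real {0..h} t)"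
    by (rule integrable_const_bound[where B=2]) (auto intro!: measurable_restrict_space1 simp: indicator_def)
    show "integrable (lam T) (%t. norm (bavg T (Suc n) (indicat_real {..a}) t - indicat_real {..a} t))"
    by (intro integrable_norm Bochner_Integration.integrable_diff i bavg_integrable)
    show "norm (bavg T (Suc n) (indicat_real {..a}) t - indicat_real {..a} t) \<le>
    indicat_real {a - 2 * h..a + 2 * h} t + indicat_real {0..h} t" if "t \<in> space (lam T)" for t
    by (rule le) (use that in \<open>auto simp: space_restrict_space\<close>)
    qed
    also have "\<dots> \<le> (LINT t|lborel. indicat_real {a - 2 * h..a + 2 * h} t + indicat_real {0..h} t)"
    proof -
    have ind: "integrable lborel (indicat_real {u..v})" for u v :: real
    by (rule integrable_real_indicator) (auto simp: emeasure_lborel_Icc_eq)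
    have g: "integrable lborel (%t. indicat_real {a - 2 * h..a + 2 * h} t + indicat_real {0..h} t)"
    by (intro Bochner_Integration.integrable_add ind)
    show ?thesis
    unfolding set_integral_lam[symmetric] set_lebesgue_integral_def
    by (rule integral_mono[OF integrable_mult_indicator[OF _ g] g]) (auto simp: indicator_def)
    qed
    also have "\<dots> = 5 * h" using h by (subst Bochner_Integration.integral_add) (auto simp: emeasure_lborel_Icc_eq)
    finally show ?thesis by (simp add: h_def)
  qed
  have "(%n. \<integral>t. norm (bavg T (Suc n) (indicat_real {..a}) t - indicat_real {..a} t) \<partial>lam T) \<longlonglongrightarrow> 0"
  proof (rule tendsto_sandwich[where f="%_. 0" and h="%n. 5 * T * inverse (real (Suc n))"])
    have "(%n. 5 * T * inverse (real (Suc n))) \<longlonglongrightarrow> 5 * T * 0"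
    by (intro tendsto_mult tendsto_const LIMSEQ_inverse_real_of_nat)
    then show "(%n. 5 * T * inverse (real (Suc n))) \<longlonglongrightarrow> 0" by simp
    show "\<forall>\<^sub>F n in sequentially. (LINT t|lam T. norm (bavg T (Suc n) (indicat_real {..a}) t - indicat_real {..a} t)) \<le> 5 * T * inverse (real (Suc n))"
    using bound by (intro always_eventually allI) (simp only: divide_inverse)
  qed (auto intro!: always_eventually)
  then show ?thesis using i by (simp add: bapprox_def)
qed

lemma bapprox_indicator:
  assumes "A \<in> sets borel"
  shows "bapprox (indicat_real A)"
proof -
  interpret finite_measure "lam T" by (rule finite_measure_lam)
  have one: "integrable (lam T) (%_. 1::real)" by (rule integrable_const)
  have meas: "indicat_real A \<in> borel_measurable (lam T)" if "A \<in> sets borel" for A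
    using that by (intro measurable_restrict_space1) simp
  have top: "bapprox (%_. 1::real)"
  proof (rule bapprox_limit[where F="%k. indicat_real {..real k}", OF bapprox_half_line _ one])
    fix t
    have "eventually (%k. indicat_real {..real k} t = 1) sequentially"
    using eventually_ge_at_top[of "nat \<lceil>t\<rceil>"] by eventually_elim (auto simp: indicator_def nat_le_iff ceiling_le_iff)
    then show "(%k. indicat_real {..real k} t) \<longlonglongrightarrow> 1" by (rule tendsto_eventually)
  qed (auto simp: indicator_def)
  have "Int_stable (range (atMost :: real => _))" by (auto simp: Int_stable_def)
  moreover have "range (atMost :: real => _) \<subseteq> Pow UNIV" by simp
  moreover have "A \<in> sigma_sets UNIV (range atMost)"
    using assms unfolding borel_eq_atMost by simp
  ultimately show ?thesis
  proof (induction rule: sigma_sets_induct_disjoint)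
    case (basic A)
    then show ?case using bapprox_half_line by auto
  next
    case empty
    show ?case using bapprox_0 by (simp add: indicator_def)
  next
    case (compl A)
    have "indicat_real (UNIV - A) = (%t. 1 - indicat_real A t)" by (auto simp: indicator_def)
    then show ?case using bapprox_add(2)[OF top compl(2)] by simp
  next
    case (union A)
    have Am: "A i \<in> sets borel" for i using union(2) unfolding borel_eq_atMost by auto
    have sums: "bapprox (%t. \<Sum>i<k. indicat_real (A i) t)" for k
    by (induction k) (auto intro: bapprox_0 bapprox_add union(3))
    have disj: "(\<Sum>i<k. indicat_real (A i) t) = indicat_real (\<Union>i<k. A i) t" for k t
    by (rule indicator_UN_disjoint[symmetric]) (use union(1) in \<open>auto intro: disjoint_family_on_mono\<close>)
    show ?case
    proof (rule bapprox_limit[OF sums _ one])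
    show "indicat_real (\<Union>i. A i) \<in> borel_measurable (lam T)" by (rule meas) (use Am in auto)
    show "norm (\<Sum>i<k. indicat_real (A i) t) \<le> 1" for k t unfolding disj by (simp add: indicator_def)
    show "(%k. \<Sum>i<k. indicat_real (A i) t) \<longlonglongrightarrow> indicat_real (\<Union>i. A i) t" for t
    unfolding disj by (rule LIMSEQ_indicator_UN)
    qed
  qed
qed

lemma bapprox_integrable:
  fixes f :: "real => 'a::euclidean_space"
  assumes "integrable (lam T) f"
  shows "bapprox f"
  using assms
proof (induction rule: integrable_induct)
  case (base A c)
  then have "A \<in> sets borel" by (auto simp: sets_restrict_space)
  then show ?case by (intro bapprox_scaleR bapprox_indicator)
next
  case (add f g)
  then show ?case by (intro bapprox_add)
next
  case (lim f s)
  then show ?case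
    by (intro bapprox_limit[of s f "%t. 2 * norm (f t)"]) auto
qed

end

lemma ennreal_tendsto_0D:
  assumes "(%k. ennreal (f k)) \<longlonglongrightarrow> 0" "\<And>k. 0 \<le> f k"
  shows "f \<longlonglongrightarrow> 0"
  using assms ennreal_tendsto_0_iff[of f] by simp

lemma sqi_nn_integral: "sqi M f ==> (\<integral>\<^sup>+x. ennreal ((norm (f x))\<^sup>2) \<partial>M) = ennreal (LINT x|M. (norm (f x))\<^sup>2)"
  by (intro nn_integral_eq_integral) (auto simp: sqi_def)

context bm_space
begin

definition pdist :: "real => (real => 'w => 'a::euclidean_space) => (real => 'w => 'a) => real" where
  "pdist t \<phi> \<psi> = (LINT z|PM t. (norm (\<phi> (fst z) (snd z) - \<psi> (fst z) (snd z)))\<^sup>2)"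

lemma pdist_nonneg: "0 \<le> pdist t \<phi> \<psi>"
  by (simp add: pdist_def)

lemma pdist_commute: "pdist t \<phi> \<psi> = pdist t \<psi> \<phi>"
  by (simp add: pdist_def norm_minus_commute)

lemma L2F_sqi_diff:
  fixes \<phi> \<psi> :: "real => 'w => 'a::euclidean_space"
  assumes "\<phi> \<in> L2F M T W" "\<psi> \<in> L2F M T W" "t \<in> {0..T}"
  shows "sqi (PM t) (%z. \<phi> (fst z) (snd z) - \<psi> (fst z) (snd z))"
  using assms by (intro sqi_diff L2F_sqi)

lemma pdist_triangle:
  fixes \<phi> \<psi> \<eta> :: "real => 'w => 'a::euclidean_space"
  assumes L: "\<phi> \<in> L2F M T W" "\<psi> \<in> L2F M T W" "\<eta> \<in> L2F M T W" and t: "t \<in> {0..T}"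
  shows "pdist t \<phi> \<eta> \<le> 2 * pdist t \<phi> \<psi> + 2 * pdist t \<psi> \<eta>"
proof -
  have i: "integrable (PM t) (%z. (norm (a (fst z) (snd z) - b (fst z) (snd z)))\<^sup>2)"
    if "a \<in> L2F M T W" "b \<in> L2F M T W" for a b :: "real => 'w => 'a"
    by (rule sqi_integrable[OF L2F_sqi_diff[OF that t]])
  have "pdist t \<phi> \<eta> \<le> (LINT z|PM t. 2 * (norm (\<phi> (fst z) (snd z) - \<psi> (fst z) (snd z)))\<^sup>2 + 2 * (norm (\<psi> (fst z) (snd z) - \<eta> (fst z) (snd z)))\<^sup>2)"
    unfolding pdist_def
  proof (rule integral_mono)
    fix z
    show "(norm (\<phi> (fst z) (snd z) - \<eta> (fst z) (snd z)))\<^sup>2 \<le> 2 * (norm (\<phi> (fst z) (snd z) - \<psi> (fst z) (snd z)))\<^sup>2 + 2 * (norm (\<psi> (fst z) (snd z) - \<eta> (fst z) (snd z)))\<^sup>2"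
    using norm_add_square_le[of "\<phi> (fst z) (snd z) - \<psi> (fst z) (snd z)" "\<psi> (fst z) (snd z) - \<eta> (fst z) (snd z)"] by simp
  qed (intro i L Bochner_Integration.integrable_add integrable_mult_right)+
  also have "\<dots> = 2 * pdist t \<phi> \<psi> + 2 * pdist t \<psi> \<eta>"
    unfolding pdist_def using i[OF L(1,2)] i[OF L(2,3)] by simp
  finally show ?thesis .
qed

lemma L2F_nn_dist:
  fixes \<phi> \<psi> :: "real => 'w => 'a::euclidean_space"
  assumes "\<phi> \<in> L2F M T W" "\<psi> \<in> L2F M T W"
  shows "(\<integral>\<^sup>+h. (\<integral>\<^sup>+t\<in>{0..T}. ennreal ((norm (\<phi> t h - \<psi> t h))\<^sup>2) \<partial>lborel) \<partial>M) = ennreal (pdist T \<phi> \<psi>)"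
proof -
  have T: "T \<in> {0..T}" using T_pos by simp
  have d: "(%t h. \<phi> t h - \<psi> t h) \<in> L2F M T W" by (rule L2F_diff[OF assms])
  have m: "(%(s, h). ennreal ((norm (\<phi> s h - \<psi> s h))\<^sup>2)) \<in> borel_measurable (PM T)"
    by (rule measurable_norm_square[OF progressiveD(2)[OF L2F_progressive[OF d] T]])
  show ?thesis
    unfolding nn_integral_PM(1)[OF m] pdist_def by (rule sqi_nn_integral[OF L2F_sqi_diff[OF assms T]])
qed

lemma pdist_mono:
  fixes \<phi> \<psi> :: "real => 'w => 'a::euclidean_space"
  assumes L: "\<phi> \<in> L2F M T W" "\<psi> \<in> L2F M T W" and t: "t \<in> {0..T}"
  shows "pdist t \<phi> \<psi> \<le> pdist T \<phi> \<psi>"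
proof -
  have T: "T \<in> {0..T}" using T_pos by simp
  define F where "F s = (LINT h|M. (norm (\<phi> s h - \<psi> s h))\<^sup>2)" for s
  have p: "pdist r \<phi> \<psi> = (LINT s:{0..r}|lborel. F s)" "set_integrable lborel {0..r} F" if r: "r \<in> {0..T}" for r
    using integral_PM(1,3)[where F="%s h. (norm (\<phi> s h - \<psi> s h))\<^sup>2", OF sqi_integrable[OF L2F_sqi_diff[OF L r]]]
    by (simp_all add: pdist_def F_def[abs_def])
  have "0 \<le> F s" for s by (simp add: F_def)
  then show ?thesis
    unfolding p(1)[OF t] p(1)[OF T] set_lebesgue_integral_def
    using p(2)[OF t] p(2)[OF T] t by (intro integral_mono) (auto simp: set_integrable_def indicator_def)
qed

section \<open>Simple processes are dense\<close>

lemma bounded_approx: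
  fixes Z :: "real => 'w => 'a::euclidean_space"
  assumes Z: "Z \<in> L2F M T W" and R: "0 \<le> R" "\<And>t h. norm (Z t h) \<le> R"
  shows "\<exists>\<phi>. (\<forall>n. is_simple M T W (\<phi> n)) \<and> (%n. pdist T (simple_val (\<phi> n)) Z) \<longlonglongrightarrow> 0"
proof -
  interpret l: finite_measure "lam T" by (rule finite_measure_lam)
  interpret F: finite_measure "PM T" by (rule finite_measure_PM)
  have T: "T \<in> {0..T}" using T_pos by simp
  define \<tau> where "\<tau> n i = T * real i / real (Suc n)" for n i
  define \<phi> where "\<phi> n = (Suc n, \<tau> n, %i h. bcoef T (Suc n) (%s. Z s h) i)" for n
  have sv: "simple_val (\<phi> n) t h = bavg T (Suc n) (%s. Z s h) t" for n t h
    by (simp only: simple_val_def \<phi>_def bavg_def \<tau>_def case_prod_conv)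
  have sec: "(%s. Z s h) \<in> borel_measurable (lam t)" if "h \<in> space M" "t \<in> {0..T}" for h t
    using measurable_compose[OF measurable_Pair2'[OF that(1)] progressiveD(2)[OF L2F_progressive[OF Z] that(2)]] by simp
  have iZ: "integrable (lam T) (%s. Z s h)" if "h \<in> space M" for h
    by (rule l.integrable_const_bound[where B=R]) (use sec[OF that T] R in auto)
  have \<tau>mem: "\<tau> n i \<in> {0..T}" if "i \<le> Suc n" for n i
  proof -
    have "T * real i \<le> T * real (Suc n)" using T_pos that by (intro mult_left_mono) auto
    then show ?thesis using T_pos by (simp add: \<tau>_def divide_le_eq del: of_nat_Suc)
  qed
  have \<tau>step: "\<tau> n (Suc i) - \<tau> n i = T / real (Suc n)" for n i
    unfolding \<tau>_def diff_divide_distrib[symmetric] right_diff_distrib[symmetric] by simp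
  have \<tau>mono: "\<tau> n i \<le> \<tau> n (Suc i)" for n i
    using \<tau>step[of n i] T_pos by (smt (verit) divide_pos_pos of_nat_0_less_iff zero_less_Suc)
  have cb: "norm (bcoef T (Suc n) (%s. Z s h) i) \<le> R" if i: "i \<le> n" and h: "h \<in> space M" for n i h
  proof (cases "i = 0")
    case True then show ?thesis using R by (simp add: bcoef_def)
  next
    case False
    then obtain j where j: "i = Suc j" by (cases i) auto
    have sub: "{\<tau> n j<..\<tau> n (Suc j)} \<subseteq> {0..T}" using \<tau>mem[of j n] \<tau>mem[of "Suc j" n] i j by auto
    have "norm (bcoef T (Suc n) (%s. Z s h) i) \<le> real (Suc n) / T * (LINT s:{\<tau> n j<..\<tau> n (Suc j)}|lborel. norm (Z s h))"
    using bcoef_norm[OF T_pos, of i "Suc n" "%s. Z s h"] by (simp add: j \<tau>_def del: of_nat_Suc)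
    also have "\<dots> \<le> real (Suc n) / T * (LINT s:{\<tau> n j<..\<tau> n (Suc j)}|lborel. R)"
    proof (intro mult_left_mono set_integral_mono)
    show "set_integrable lborel {\<tau> n j<..\<tau> n (Suc j)} (%s. norm (Z s h))"
    by (rule set_integrable_sub[OF T_pos _ _ sub]) (use iZ[OF h] in auto)
    show "set_integrable lborel {\<tau> n j<..\<tau> n (Suc j)} (%s. R)"
    by (rule set_integrable_sub[OF T_pos _ _ sub]) auto
    qed (use R T_pos in auto)
    also have "(LINT s:{\<tau> n j<..\<tau> n (Suc j)}|lborel. R) = R * (T / real (Suc n))"
    using \<tau>mono[of n j] \<tau>step[of n j] by (simp add: set_lebesgue_integral_def)
    finally show ?thesis using T_pos by simp
  qed
  have simple: "is_simple M T W (\<phi> n)" for n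
    unfolding is_simple_def \<phi>_def case_prod_conv
  proof (intro conjI allI impI exI[of _ R] ballI)
    fix i assume i: "i < Suc n"
    show "(%h. bcoef T (Suc n) (%s. Z s h) i) \<in> borel_measurable (filt M W (\<tau> n i))"
    proof (cases "i = 0")
    case True then show ?thesis by (simp add: bcoef_def)
    next
    case False
    let ?t = "\<tau> n i" and ?I = "{T * real (i - 1) / real (Suc n)<..T * real i / real (Suc n)}"
    interpret lt: finite_measure "lam ?t" by (rule finite_measure_lam)
    have t: "?t \<in> {0..T}" using \<tau>mem i by simp
    have 1: "(%(h, s). Z s h) \<in> borel_measurable (filt M W ?t \<Otimes>\<^sub>M lam ?t)"
    using measurable_compose[OF measurable_pair_swap' progressiveD(1)[OF L2F_progressive[OF Z] t]]
    by (simp add: case_prod_beta')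
    have 2: "(%z. indicat_real ?I (snd z)) \<in> borel_measurable (filt M W ?t \<Otimes>\<^sub>M lam ?t)"
    by (rule measurable_compose[OF measurable_snd]) (auto intro!: measurable_restrict_space1)
    have "(%(h, s). indicat_real ?I s *\<^sub>R Z s h) \<in> borel_measurable (filt M W ?t \<Otimes>\<^sub>M lam ?t)"
    unfolding case_prod_beta' by (intro borel_measurable_scaleR 2 1[unfolded case_prod_beta'])
    then have "(%h. \<integral>s. indicat_real ?I s *\<^sub>R Z s h \<partial>lam ?t) \<in> borel_measurable (filt M W ?t)"
    by (rule lt.borel_measurable_lebesgue_integral)
    moreover have "(LINT s|lam ?t. indicat_real ?I s *\<^sub>R Z s h) = (LINT s:?I|lborel. Z s h)" for h
    proof -
    have "0 \<le> T * real (i - 1) / real (Suc n)" using T_pos by simp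
    then have "?I \<subseteq> {0..?t}" by (auto simp: \<tau>_def simp del: of_nat_Suc)
    then show ?thesis
    unfolding set_integral_lam[symmetric] set_lebesgue_integral_def
    by (intro Bochner_Integration.integral_cong refl) (auto simp: indicator_def)
    qed
    ultimately show ?thesis using False unfolding bcoef_def by simp
    qed
    show "norm (bcoef T (Suc n) (%s. Z s h) i) \<le> R" if "h \<in> space M" for h using cb[of i n] i that by simp
  qed (use \<tau>mem \<tau>mono in auto)
  have svb: "norm (simple_val (\<phi> n) t h) \<le> R" if t: "t \<in> {0..T}" and h: "h \<in> space M" for n t h
  proof (cases "t = 0")
    case True
    have "simple_val (\<phi> n) t h = 0"
    unfolding sv bavg_def True using T_pos
    by (intro sum.neutral) (auto simp: indicator_def zero_le_mult_iff not_less simp del: of_nat_Suc)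
    then show ?thesis using R by simp
  next
    case False
    then obtain i where i: "i < Suc n" "t \<in> {T * real i / real (Suc n)<..T * real (Suc i) / real (Suc n)}"
    using grid_cover[OF T_pos, of t "Suc n"] t by auto
    show ?thesis unfolding sv bavg_at[OF T_pos i] using cb[of i n] i(1) h by simp
  qed
  have svL: "simple_val (\<phi> n) \<in> L2F M T W" for n by (rule simple_val_L2F[OF simple])
  define e where "e n h = (LINT t:{0..T}|lborel. (norm (simple_val (\<phi> n) t h - Z t h))\<^sup>2)" for n h
  have ei: "integrable M (e n)" and pe: "pdist T (simple_val (\<phi> n)) Z = (LINT h|M. e n h)" for n
    using integral_PM(2,4)[where F="%s h. (norm (simple_val (\<phi> n) s h - Z s h))\<^sup>2", OF sqi_integrable[OF L2F_sqi_diff[OF svL Z T]]]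
    by (simp_all add: pdist_def e_def[abs_def])
  have eb: "0 \<le> e n h \<and> e n h \<le> 2 * R * (LINT t|lam T. norm (bavg T (Suc n) (%s. Z s h) t - Z t h)) \<and> e n h \<le> 4 * R\<^sup>2 * T"
    if h: "h \<in> space M" for n h
  proof -
    have d: "norm (simple_val (\<phi> n) t h - Z t h) \<le> 2 * R" if "t \<in> space (lam T)" for t
    using norm_triangle_ineq4[of "simple_val (\<phi> n) t h" "Z t h"] svb[of t h n] R(2)[of t h] that h
    by (auto simp: space_restrict_space)
    have i1: "integrable (lam T) (%t. norm (simple_val (\<phi> n) t h - Z t h))"
    unfolding sv by (intro integrable_norm Bochner_Integration.integrable_diff bavg_integrable[OF T_pos] iZ h)
    have i2: "integrable (lam T) (%t. (norm (simple_val (\<phi> n) t h - Z t h))\<^sup>2)"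
    proof (rule l.integrable_const_bound[where B="(2 * R)\<^sup>2"])
    show "AE t in lam T. norm ((norm (simple_val (\<phi> n) t h - Z t h))\<^sup>2) \<le> (2 * R)\<^sup>2"
    using power_mono[OF d norm_ge_zero, of _ 2] by (intro AE_I2) simp
    qed (use borel_measurable_integrable[OF i1] in measurable)
    have e1: "e n h \<le> (LINT t|lam T. 2 * R * norm (simple_val (\<phi> n) t h - Z t h))"
    unfolding e_def set_integral_lam
    by (rule integral_mono[OF i2]) (use d i1 in \<open>auto simp: power2_eq_square intro!: mult_right_mono\<close>)
    have e2: "e n h \<le> (LINT t|lam T. (2 * R)\<^sup>2)"
    unfolding e_def set_integral_lam
    by (rule integral_mono[OF i2]) (use power_mono[OF d norm_ge_zero, of _ 2] in simp_all)
    have e3: "(LINT t|lam T. (2 * R)\<^sup>2) = 4 * R\<^sup>2 * T"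
    using T_pos by (simp add: measure_restrict_space space_restrict_space power_mult_distrib)
    have e4: "0 \<le> e n h" unfolding e_def set_integral_lam by simp
    from e1 have "e n h \<le> 2 * R * (LINT t|lam T. norm (bavg T (Suc n) (%s. Z s h) t - Z t h))"
    unfolding sv by (simp only: integral_mult_right_zero)
    with e2[unfolded e3] e4 show ?thesis by blast
  qed
  have "(%n. \<integral>h. e n h \<partial>M) \<longlonglongrightarrow> (LINT h|M. 0)"
  proof (rule integral_dominated_convergence[where w="%_. 4 * R\<^sup>2 * T"])
    show "AE h in M. (%n. e n h) \<longlonglongrightarrow> 0"
    proof (rule AE_I2)
    fix h assume h: "h \<in> space M"
    have "(%n. \<integral>t. norm (bavg T (Suc n) (%s. Z s h) t - Z t h) \<partial>lam T) \<longlonglongrightarrow> 0"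
    using bapprox_integrable[OF T_pos iZ[OF h]] by (simp add: bapprox_def[OF T_pos])
    from tendsto_mult_right_zero[OF this, of "2 * R"]
    show "(%n. e n h) \<longlonglongrightarrow> 0"
    by (rule Lim_null_comparison[rotated]) (use eb[OF h] in auto)
    qed
    show "AE h in M. norm (e n h) \<le> 4 * R\<^sup>2 * T" for n using eb by (intro AE_I2) auto
  qed (use ei in auto)
  then show ?thesis using simple pe by (intro exI[of _ \<phi>]) simp
qed

lemma simple_dense:
  fixes Z :: "real => 'w => 'a::euclidean_space"
  assumes Z: "Z \<in> L2F M T W" and e: "0 < e"
  shows "\<exists>\<phi>. is_simple M T W \<phi> \<and> pdist T (simple_val \<phi>) Z < e"
proof -
  have T: "T \<in> {0..T}" using T_pos by simp
  define ZR where "ZR R t h = (if norm (Z t h) \<le> real R then Z t h else 0)" for R :: nat and t h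
  have sZ: "integrable (PM T) (%z. (norm (Z (fst z) (snd z)))\<^sup>2)" by (rule sqi_integrable[OF L2F_sqi[OF Z T]])
  have mZ: "(%z. Z (fst z) (snd z)) \<in> borel_measurable (PM T)" by (rule sqi_measurable[OF L2F_sqi[OF Z T]])
  have "progressive M T W (ZR R)" for R
    unfolding progressive_def
  proof
    fix t assume "t \<in> {0..T}"
    then have [measurable]: "(%z. Z (fst z) (snd z)) \<in> borel_measurable (restrict_space borel {0..t} \<Otimes>\<^sub>M filt M W t)"
    using L2F_progressive[OF Z] by (simp add: progressive_def case_prod_beta')
    show "(%(s, h). ZR R s h) \<in> borel_measurable (restrict_space borel {0..t} \<Otimes>\<^sub>M filt M W t)"
    unfolding ZR_def case_prod_beta' by measurable
  qed
  moreover have mR: "(%z. ZR R (fst z) (snd z)) \<in> borel_measurable (PM T)" for R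
    unfolding ZR_def using mZ by measurable
  moreover have "sqi (PM T) (%z. ZR R (fst z) (snd z))" for R
    by (rule sqi_bound[OF mR sZ]) (auto simp: ZR_def)
  ultimately have LR: "ZR R \<in> L2F M T W" for R by (simp add: L2F_iff)
  have "(%R. pdist T (ZR R) Z) \<longlonglongrightarrow> (LINT z|PM T. 0)"
    unfolding pdist_def
  proof (rule integral_dominated_convergence[where w="%z. (norm (Z (fst z) (snd z)))\<^sup>2"])
    show "AE z in PM T. (%R. (norm (ZR R (fst z) (snd z) - Z (fst z) (snd z)))\<^sup>2) \<longlonglongrightarrow> 0"
    proof (rule AE_I2)
    fix z
    have "eventually (%R. (norm (ZR R (fst z) (snd z) - Z (fst z) (snd z)))\<^sup>2 = 0) sequentially"
    using eventually_ge_at_top[of "nat \<lceil>norm (Z (fst z) (snd z))\<rceil>"]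
    by eventually_elim (simp add: ZR_def nat_le_iff ceiling_le_iff)
    then show "(%R. (norm (ZR R (fst z) (snd z) - Z (fst z) (snd z)))\<^sup>2) \<longlonglongrightarrow> 0" by (rule tendsto_eventually)
    qed
    show "AE z in PM T. norm ((norm (ZR R (fst z) (snd z) - Z (fst z) (snd z)))\<^sup>2) \<le> (norm (Z (fst z) (snd z)))\<^sup>2" for R
    by (intro AE_I2) (simp add: ZR_def)
  qed (use sZ mZ mR in \<open>measurable\<close>)
  then have "(%R. pdist T (ZR R) Z) \<longlonglongrightarrow> 0" by simp
  from order_tendstoD(2)[OF this, of "e / 4"] e obtain R where R: "pdist T (ZR R) Z < e / 4"
    by (auto simp: eventually_sequentially)
  have "0 \<le> real R" "\<And>t h. norm (ZR R t h) \<le> real R" by (auto simp: ZR_def)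
  from bounded_approx[OF LR this] obtain \<phi> where \<phi>: "\<And>n. is_simple M T W (\<phi> n)" "(%n. pdist T (simple_val (\<phi> n)) (ZR R)) \<longlonglongrightarrow> 0"
    by blast
  from order_tendstoD(2)[OF \<phi>(2), of "e / 4"] e obtain n where n: "pdist T (simple_val (\<phi> n)) (ZR R) < e / 4"
    by (auto simp: eventually_sequentially)
  have "pdist T (simple_val (\<phi> n)) Z < e"
    using pdist_triangle[OF simple_val_L2F[OF \<phi>(1)] LR Z T, of n R] R n by linarith
  then show ?thesis using \<phi>(1) by blast
qed

section \<open>The Ito integral\<close>

lemma simple_diff_isometry:
  fixes \<phi> \<psi> :: "nat \<times> (nat => real) \<times> (nat => 'w => 'a::euclidean_space)"
  assumes \<phi>: "is_simple M T W \<phi>" and \<psi>: "is_simple M T W \<psi>" and t: "t \<in> {0..T}"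
  shows "(LINT h|M. (norm (simple_integral B \<phi> t h - simple_integral B \<psi> t h))\<^sup>2) = pdist t (simple_val \<phi>) (simple_val \<psi>)"
proof -
  have s: "sqi M (simple_integral B \<phi> t)" "sqi M (simple_integral B \<psi> t)"
    by (rule martD(2)[OF simple_integral_mart[OF \<phi>] t] martD(2)[OF simple_integral_mart[OF \<psi>] t])+
  have p: "sqi (PM t) (%z. simple_val \<phi> (fst z) (snd z))" "sqi (PM t) (%z. simple_val \<psi> (fst z) (snd z))"
    by (rule L2F_sqi[OF simple_val_L2F[OF \<phi>] t] L2F_sqi[OF simple_val_L2F[OF \<psi>] t])+
  have expand: "(LINT x|N. (norm (f x - g x))\<^sup>2) = (LINT x|N. f x \<bullet> f x) - 2 * (LINT x|N. f x \<bullet> g x) + (LINT x|N. g x \<bullet> g x)"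
    if "sqi N f" "sqi N g" for N :: "'z measure" and f g :: "'z => 'a"
  proof -
    have "(LINT x|N. (norm (f x - g x))\<^sup>2) = (LINT x|N. f x \<bullet> f x - 2 * (f x \<bullet> g x) + g x \<bullet> g x)"
    by (intro Bochner_Integration.integral_cong refl)
    (simp add: power2_norm_eq_inner inner_diff_left inner_diff_right inner_commute)
    then show ?thesis
    using integrable_inner_sqi[OF that] integrable_inner_sqi[OF that(1,1)] integrable_inner_sqi[OF that(2,2)] by simp
  qed
  show ?thesis
    unfolding pdist_def expand[OF s] expand[OF p] simple_isometry[OF \<phi> \<phi> t] simple_isometry[OF \<phi> \<psi> t] simple_isometry[OF \<psi> \<psi> t] ..
qed

lemma supn_add_le: "supn (%t h. X t h + Y t h) h \<le> 2 * supn X h + 2 * supn Y h"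
proof (subst supn_def, rule SUP_least)
  fix t assume t: "t \<in> {0..T}"
  have "ennreal ((norm (X t h + Y t h))\<^sup>2) \<le> ennreal (2 * (norm (X t h))\<^sup>2 + 2 * (norm (Y t h))\<^sup>2)"
    by (intro ennreal_leI norm_add_square_le)
  also have "\<dots> = 2 * ennreal ((norm (X t h))\<^sup>2) + 2 * ennreal ((norm (Y t h))\<^sup>2)"
    by (simp add: ennreal_mult)
  also have "\<dots> \<le> 2 * supn X h + 2 * supn Y h" by (intro add_mono mult_left_mono supn_upper t) auto
  finally show "ennreal ((norm (X t h + Y t h))\<^sup>2) \<le> 2 * supn X h + 2 * supn Y h" .
qed

lemma supn_add_integral:
  assumes "ac X" "ac Y"
  shows "(\<integral>\<^sup>+h. supn (%t h. X t h + Y t h) h \<partial>M) \<le> 2 * (\<integral>\<^sup>+h. supn X h \<partial>M) + 2 * (\<integral>\<^sup>+h. supn Y h \<partial>M)"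
proof -
  have [measurable]: "supn X \<in> borel_measurable M" "supn Y \<in> borel_measurable M"
    using assms by (auto intro: supn_measurable)
  have "(\<integral>\<^sup>+h. supn (%t h. X t h + Y t h) h \<partial>M) \<le> (\<integral>\<^sup>+h. 2 * supn X h + 2 * supn Y h \<partial>M)"
    by (intro nn_integral_mono supn_add_le)
  also have "\<dots> = 2 * (\<integral>\<^sup>+h. supn X h \<partial>M) + 2 * (\<integral>\<^sup>+h. supn Y h \<partial>M)"
    by (simp add: nn_integral_add nn_integral_cmult)
  finally show ?thesis .
qed

lemma supn_limit_finite:
  assumes ac: "\<And>k. ac (X k)" "ac Z" and lim: "(%k. \<integral>\<^sup>+h. supn (%t h. X k t h - Z t h) h \<partial>M) \<longlonglongrightarrow> 0"
    and fin: "\<And>k. (\<integral>\<^sup>+h. supn (X k) h \<partial>M) < \<infinity>"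
  shows "(\<integral>\<^sup>+h. supn Z h \<partial>M) < \<infinity>"
proof -
  have "eventually (%k. (\<integral>\<^sup>+h. supn (%t h. X k t h - Z t h) h \<partial>M) < 1) sequentially"
    by (rule order_tendstoD(2)[OF lim]) simp
  then obtain k where k: "(\<integral>\<^sup>+h. supn (%t h. X k t h - Z t h) h \<partial>M) < 1"
    by (auto simp: eventually_sequentially)
  have eq: "supn (%t h. Z t h - X k t h) = supn (%t h. X k t h - Z t h)"
    by (simp add: supn_def[abs_def] norm_minus_commute)
  have "(\<integral>\<^sup>+h. supn Z h \<partial>M) = (\<integral>\<^sup>+h. supn (%t h. (Z t h - X k t h) + X k t h) h \<partial>M)" by (simp add: supn_def)
  also have "\<dots> \<le> 2 * (\<integral>\<^sup>+h. supn (%t h. Z t h - X k t h) h \<partial>M) + 2 * (\<integral>\<^sup>+h. supn (X k) h \<partial>M)"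
    by (intro supn_add_integral ac_diff ac)
  also have "\<dots> < \<infinity>"
    unfolding eq using k fin[of k] by (auto simp: ennreal_mult_less_top intro: order_less_trans)
  finally show ?thesis .
qed

lemma mart_supn_finite:
  assumes "mart N"
  shows "(\<integral>\<^sup>+h. supn N h \<partial>M) < \<infinity>"
  using doob[OF assms] by (simp add: order_le_less_trans)

lemma mart_limit:
  fixes X :: "nat => real => 'w => 'a::euclidean_space"
  assumes X: "\<And>k. mart (X k)" and Z: "\<And>t. t \<in> {0..T} ==> sqi M (Z t)" "ac Z"
    and lim: "\<And>t. t \<in> {0..T} ==> (%k. \<integral>h. (norm (X k t h - Z t h))\<^sup>2 \<partial>M) \<longlonglongrightarrow> 0"
  shows "mart Z"
proof (rule martI)
  fix s t and Y :: "'w => 'a"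
  assume *: "0 \<le> s" "s \<le> t" "t \<le> T" "Y \<in> borel_measurable (filt M W s)" "sqi M Y"
  have L: "(%k. \<integral>h. Y h \<bullet> X k r h \<partial>M) \<longlonglongrightarrow> (LINT h|M. Y h \<bullet> Z r h)" if r: "r \<in> {0..T}" for r
    by (rule tendsto_inner_sqi) (use * martD(2)[OF X r] Z(1)[OF r] lim[OF r] in simp_all)
  have "(LINT h|M. Y h \<bullet> X k t h) = (LINT h|M. Y h \<bullet> X k s h)" for k by (rule martD(3)[OF X *])
  then show "(LINT h|M. Y h \<bullet> Z t h) = (LINT h|M. Y h \<bullet> Z s h)"
    using L[of t] L[of s] * LIMSEQ_unique by auto
qed (use Z in auto)

lemma ito_exists:
  fixes Z :: "real => 'w => 'a::euclidean_space"
  assumes Z: "Z \<in> L2F M T W"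
  shows "\<exists>I. has_ito_integral M T W Z I \<and> mart I"
proof -
  have T: "T \<in> {0..T}" using T_pos by simp
  have "\<forall>k. \<exists>\<phi>. is_simple M T W \<phi> \<and> pdist T (simple_val \<phi>) Z < (1/4)^k"
    using simple_dense[OF Z] by simp
  then obtain \<phi> where \<phi>: "\<And>k. is_simple M T W (\<phi> k)" "\<And>k. pdist T (simple_val (\<phi> k)) Z < (1/4)^k" by metis
  define N where "N k = simple_integral B (\<phi> k)" for k
  have mN: "mart (N k)" for k unfolding N_def by (rule simple_integral_mart[OF \<phi>(1)])
  note sL = simple_val_L2F[OF \<phi>(1)]
  have "(\<integral>\<^sup>+h. supn (%t h. N (Suc k) t h - N k t h) h \<partial>M) \<le> ennreal (16 * (1/4)^k)" for k
  proof -
    have "(\<integral>\<^sup>+h. supn (%t h. N (Suc k) t h - N k t h) h \<partial>M) \<le> ennreal (4 * pdist T (simple_val (\<phi> (Suc k))) (simple_val (\<phi> k)))"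
    using doob[OF mart_diff[OF mN mN], of "Suc k" k] simple_diff_isometry[OF \<phi>(1) \<phi>(1) T, of "Suc k" k] by (simp add: N_def)
    also have "\<dots> \<le> ennreal (16 * (1/4)^k)"
    proof (rule ennreal_leI)
    have "pdist T (simple_val (\<phi> (Suc k))) (simple_val (\<phi> k)) \<le> 2 * (1/4)^Suc k + 2 * (1/4)^k"
    using pdist_triangle[OF sL Z sL T, of "Suc k" k] \<phi>(2)[of k] \<phi>(2)[of "Suc k"] pdist_commute[of T Z "simple_val (\<phi> k)"]
    by linarith
    also have "\<dots> \<le> 4 * (1/4)^k" by simp
    finally show "4 * pdist T (simple_val (\<phi> (Suc k))) (simple_val (\<phi> k)) \<le> 16 * (1/4)^k" by simp
    qed
    finally show ?thesis .
  qed
  from continuous_limit[OF martD(1)[OF mN] this]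
  obtain I where I: "ac I" "(%k. \<integral>\<^sup>+h. supn (%t h. N k t h - I t h) h \<partial>M) \<longlonglongrightarrow> 0" by auto
  have fin: "(\<integral>\<^sup>+h. supn I h \<partial>M) < \<infinity>"
    by (rule supn_limit_finite[OF martD(1)[OF mN] I mart_supn_finite[OF mN]])
  have IL: "I \<in> L2FC M T W" by (rule ac_L2FC[OF I(1) fin])
  have sI: "sqi M (I t)" if "t \<in> {0..T}" for t by (rule L2FC_sqi[OF IL that])
  have nn: "(%k. \<integral>\<^sup>+h. ennreal ((norm (N k t h - I t h))\<^sup>2) \<partial>M) \<longlonglongrightarrow> 0" if t: "t \<in> {0..T}" for t
    by (rule tendsto_sandwich[OF _ _ tendsto_const I(2)])
    (auto intro!: always_eventually nn_integral_mono supn_upper[OF t, of "%t h. N _ t h - I t h", simplified])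
  have lim: "(%k. \<integral>h. (norm (N k t h - I t h))\<^sup>2 \<partial>M) \<longlonglongrightarrow> 0" if t: "t \<in> {0..T}" for t
    by (rule ennreal_tendsto_0D)
    (use nn[OF t] sqi_nn_integral[OF sqi_diff[OF martD(2)[OF mN t] sI[OF t]]] in simp_all)
  have "has_ito_integral M T W Z I"
    unfolding has_ito_integral_def
  proof (intro conjI Z IL exI[of _ \<phi>] allI \<phi>(1) ballI)
    have "(%k. pdist T (simple_val (\<phi> k)) Z) \<longlonglongrightarrow> 0"
    proof (rule tendsto_sandwich[OF _ _ tendsto_const])
    show "(%k. (1/4::real)^k) \<longlonglongrightarrow> 0" by (rule LIMSEQ_power_zero) simp
    show "\<forall>\<^sub>F k in sequentially. 0 \<le> pdist T (simple_val (\<phi> k)) Z"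
    by (intro always_eventually allI pdist_nonneg)
    show "\<forall>\<^sub>F k in sequentially. pdist T (simple_val (\<phi> k)) Z \<le> (1/4)^k"
    by (intro always_eventually allI less_imp_le \<phi>(2))
    qed
    then have "(%k. ennreal (pdist T (simple_val (\<phi> k)) Z)) \<longlonglongrightarrow> ennreal 0" by (rule tendsto_ennrealI)
    then show "(%k. \<integral>\<^sup>+h. (\<integral>\<^sup>+t\<in>{0..T}. ennreal ((norm (simple_val (\<phi> k) t h - Z t h))\<^sup>2) \<partial>lborel) \<partial>M) \<longlonglongrightarrow> 0"
    by (simp add: L2F_nn_dist[OF sL Z])
    fix t assume t: "t \<in> {0..T}"
    have "(\<integral>\<^sup>+h. ennreal ((norm (simple_integral W (\<phi> k) t h - I t h))\<^sup>2) \<partial>M) = (\<integral>\<^sup>+h. ennreal ((norm (N k t h - I t h))\<^sup>2) \<partial>M)" for k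
    by (rule nn_integral_cong_AE) (use simple_integral_W[of "\<phi> k"] in \<open>auto simp: N_def\<close>)
    then show "(%k. \<integral>\<^sup>+h. ennreal ((norm (simple_integral W (\<phi> k) t h - I t h))\<^sup>2) \<partial>M) \<longlonglongrightarrow> 0"
    using nn[OF t] by simp
  qed
  then show ?thesis using mart_limit[OF mN sI I(1) lim] by blast
qed

lemma has_itoD:
  fixes Z :: "real => 'w => 'a::euclidean_space"
  assumes "has_ito_integral M T W Z I"
  shows "\<exists>\<phi>. (\<forall>k. is_simple M T W (\<phi> k)) \<and>
    (\<forall>t\<in>{0..T}. (%k. \<integral>h. (norm (simple_integral B (\<phi> k) t h - I t h))\<^sup>2 \<partial>M) \<longlonglongrightarrow> 0) \<and>
    (\<forall>t\<in>{0..T}. (%k. pdist t (simple_val (\<phi> k)) Z) \<longlonglongrightarrow> 0)"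
    and "Z \<in> L2F M T W" "I \<in> L2FC M T W" "\<And>t. t \<in> {0..T} ==> sqi M (I t)"
proof -
  show Z: "Z \<in> L2F M T W" and IL: "I \<in> L2FC M T W" using assms by (auto simp: has_ito_integral_def)
  show sI: "sqi M (I t)" if "t \<in> {0..T}" for t by (rule L2FC_sqi[OF IL that])
  obtain \<phi> where \<phi>: "\<And>k. is_simple M T W (\<phi> k)"
    "(%k. \<integral>\<^sup>+h. (\<integral>\<^sup>+t\<in>{0..T}. ennreal ((norm (simple_val (\<phi> k) t h - Z t h))\<^sup>2) \<partial>lborel) \<partial>M) \<longlonglongrightarrow> 0"
    "\<And>t. t \<in> {0..T} ==> (%k. \<integral>\<^sup>+h. ennreal ((norm (simple_integral W (\<phi> k) t h - I t h))\<^sup>2) \<partial>M) \<longlonglongrightarrow> 0"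
    using assms unfolding has_ito_integral_def by blast
  note sL = simple_val_L2F[OF \<phi>(1)]
  have p: "(%k. pdist T (simple_val (\<phi> k)) Z) \<longlonglongrightarrow> 0"
    by (rule ennreal_tendsto_0D) (use \<phi>(2) pdist_nonneg in \<open>simp_all add: L2F_nn_dist[OF sL Z]\<close>)
  have "(%k. pdist t (simple_val (\<phi> k)) Z) \<longlonglongrightarrow> 0" if t: "t \<in> {0..T}" for t
    by (rule tendsto_sandwich[OF _ _ tendsto_const p])
    (auto intro!: always_eventually pdist_nonneg pdist_mono[OF sL Z t])
  moreover have "(%k. \<integral>h. (norm (simple_integral B (\<phi> k) t h - I t h))\<^sup>2 \<partial>M) \<longlonglongrightarrow> 0" if t: "t \<in> {0..T}" for t
  proof (rule ennreal_tendsto_0D)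
    have "(\<integral>\<^sup>+h. ennreal ((norm (simple_integral W (\<phi> k) t h - I t h))\<^sup>2) \<partial>M) =
    (\<integral>\<^sup>+h. ennreal ((norm (simple_integral B (\<phi> k) t h - I t h))\<^sup>2) \<partial>M)" for k
    by (rule nn_integral_cong_AE) (use simple_integral_W[of "\<phi> k"] in auto)
    then show "(%k. ennreal (LINT h|M. (norm (simple_integral B (\<phi> k) t h - I t h))\<^sup>2)) \<longlonglongrightarrow> 0"
    using \<phi>(3)[OF t] sqi_nn_integral[OF sqi_diff[OF martD(2)[OF simple_integral_mart[OF \<phi>(1)] t] sI[OF t]]] by simp
  qed simp
  ultimately show "\<exists>\<phi>. (\<forall>k. is_simple M T W (\<phi> k)) \<and>
    (\<forall>t\<in>{0..T}. (%k. \<integral>h. (norm (simple_integral B (\<phi> k) t h - I t h))\<^sup>2 \<partial>M) \<longlonglongrightarrow> 0) \<and>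
    (\<forall>t\<in>{0..T}. (%k. pdist t (simple_val (\<phi> k)) Z) \<longlonglongrightarrow> 0)"
    using \<phi>(1) by blast
qed

lemma ito_martingale:
  fixes Z :: "real => 'w => 'a::euclidean_space"
  assumes Z: "has_ito_integral M T W Z I" and s: "0 \<le> s" "s \<le> t" "t \<le> T"
    and Y: "Y \<in> borel_measurable (filt M W s)" "sqi M Y"
  shows "(LINT h|M. Y h \<bullet> I t h) = (LINT h|M. Y h \<bullet> I s h)"
proof -
  obtain \<phi> where \<phi>: "\<And>k. is_simple M T W (\<phi> k)"
    "\<And>t. t \<in> {0..T} ==> (%k. \<integral>h. (norm (simple_integral B (\<phi> k) t h - I t h))\<^sup>2 \<partial>M) \<longlonglongrightarrow> 0"
    using has_itoD(1)[OF Z] by blast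
  note mN = simple_integral_mart[OF \<phi>(1)]
  have L: "(%k. \<integral>h. Y h \<bullet> simple_integral B (\<phi> k) r h \<partial>M) \<longlonglongrightarrow> (LINT h|M. Y h \<bullet> I r h)" if r: "r \<in> {0..T}" for r
    by (rule tendsto_inner_sqi) (use Y martD(2)[OF mN r] has_itoD(4)[OF Z r] \<phi>(2)[OF r] in simp_all)
  have "(LINT h|M. Y h \<bullet> simple_integral B (\<phi> k) t h) = (LINT h|M. Y h \<bullet> simple_integral B (\<phi> k) s h)" for k
    by (rule martD(3)[OF mN s Y])
  then show ?thesis using L[of t] L[of s] s LIMSEQ_unique by auto
qed

lemma ito_isometry:
  fixes Z :: "real => 'w => 'a::euclidean_space" and Y :: "real => 'w => 'b::euclidean_space"
  assumes Z: "has_ito_integral M T W Z I" and Y: "has_ito_integral M T W Y J" and L: "bounded_linear L" and t: "t \<in> {0..T}"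
  shows "(LINT h|M. L (I t h) \<bullet> J t h) = (LINT z|PM t. L (Z (fst z) (snd z)) \<bullet> Y (fst z) (snd z))"
proof -
  interpret L: bounded_linear L by fact
  obtain K where K: "\<And>x. norm (L x) \<le> norm x * K" "0 \<le> K" using L.nonneg_bounded by blast
  obtain \<phi> where \<phi>: "\<And>k. is_simple M T W (\<phi> k)"
    "(%k. \<integral>h. (norm (simple_integral B (\<phi> k) t h - I t h))\<^sup>2 \<partial>M) \<longlonglongrightarrow> 0" "(%k. pdist t (simple_val (\<phi> k)) Z) \<longlonglongrightarrow> 0"
    using has_itoD(1)[OF Z] t by blast
  obtain \<psi> where \<psi>: "\<And>k. is_simple M T W (\<psi> k)"
    "(%k. \<integral>h. (norm (simple_integral B (\<psi> k) t h - J t h))\<^sup>2 \<partial>M) \<longlonglongrightarrow> 0" "(%k. pdist t (simple_val (\<psi> k)) Y) \<longlonglongrightarrow> 0"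
    using has_itoD(1)[OF Y] t by blast
  have limL: "(%k. \<integral>x. (norm (L (f k x) - L (g x)))\<^sup>2 \<partial>N) \<longlonglongrightarrow> 0"
    if "\<And>k. sqi N (f k)" "sqi N g" "(%k. \<integral>x. (norm (f k x - g x))\<^sup>2 \<partial>N) \<longlonglongrightarrow> 0"
    for N :: "'z measure" and f :: "nat => 'z => 'a" and g
  proof (rule Lim_null_comparison)
    show "(%k. K\<^sup>2 * (LINT x|N. (norm (f k x - g x))\<^sup>2)) \<longlonglongrightarrow> 0" by (rule tendsto_mult_right_zero[OF that(3)])
    show "\<forall>\<^sub>F k in sequentially. norm (LINT x|N. (norm (L (f k x) - L (g x)))\<^sup>2) \<le> K\<^sup>2 * (LINT x|N. (norm (f k x - g x))\<^sup>2)"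
    proof (intro always_eventually allI)
    fix k
    have d: "sqi N (%x. f k x - g x)" by (rule sqi_diff[OF that(1,2)])
    have "(LINT x|N. (norm (L (f k x) - L (g x)))\<^sup>2) \<le> (LINT x|N. K\<^sup>2 * (norm (f k x - g x))\<^sup>2)"
    proof (rule integral_mono)
    show "integrable N (%x. (norm (L (f k x) - L (g x)))\<^sup>2)"
    using sqi_integrable[OF sqi_bounded_linear[OF L d]] by (simp add: L.diff)
    show "integrable N (%x. K\<^sup>2 * (norm (f k x - g x))\<^sup>2)" by (intro integrable_mult_right sqi_integrable d)
    show "(norm (L (f k x) - L (g x)))\<^sup>2 \<le> K\<^sup>2 * (norm (f k x - g x))\<^sup>2" for x
    using power_mono[OF K(1)[of "f k x - g x"], of 2] by (simp add: L.diff power_mult_distrib mult.commute)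
    qed
    then show "norm (LINT x|N. (norm (L (f k x) - L (g x)))\<^sup>2) \<le> K\<^sup>2 * (LINT x|N. (norm (f k x - g x))\<^sup>2)" by simp
    qed
  qed
  have sI: "sqi M (simple_integral B (\<phi> k) t)" "sqi M (simple_integral B (\<psi> k) t)" for k
    by (rule martD(2)[OF simple_integral_mart[OF \<phi>(1)] t] martD(2)[OF simple_integral_mart[OF \<psi>(1)] t])+
  have sV: "sqi (PM t) (%z. simple_val (\<phi> k) (fst z) (snd z))" "sqi (PM t) (%z. simple_val (\<psi> k) (fst z) (snd z))" for k
    by (rule L2F_sqi[OF simple_val_L2F[OF \<phi>(1)] t] L2F_sqi[OF simple_val_L2F[OF \<psi>(1)] t])+
  note sIJ = has_itoD(4)[OF Z t] has_itoD(4)[OF Y t] and sZY = L2F_sqi[OF has_itoD(2)[OF Z] t] L2F_sqi[OF has_itoD(2)[OF Y] t]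
  have 1: "(%k. \<integral>h. L (simple_integral B (\<phi> k) t h) \<bullet> simple_integral B (\<psi> k) t h \<partial>M) \<longlonglongrightarrow> (LINT h|M. L (I t h) \<bullet> J t h)"
    by (intro tendsto_inner_sqi sqi_bounded_linear[OF L] sI sIJ limL \<phi>(2) \<psi>(2))
  have 2: "(%k. \<integral>z. L (simple_val (\<phi> k) (fst z) (snd z)) \<bullet> simple_val (\<psi> k) (fst z) (snd z) \<partial>PM t) \<longlonglongrightarrow>
    (LINT z|PM t. L (Z (fst z) (snd z)) \<bullet> Y (fst z) (snd z))"
    by (intro tendsto_inner_sqi sqi_bounded_linear[OF L] sV sZY limL \<phi>(3)[unfolded pdist_def] \<psi>(3)[unfolded pdist_def])
  have "(LINT h|M. L (simple_integral B (\<phi> k) t h) \<bullet> simple_integral B (\<psi> k) t h) =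
    (LINT z|PM t. L (simple_val (\<phi> k) (fst z) (snd z)) \<bullet> simple_val (\<psi> k) (fst z) (snd z))" for k
  proof -
    obtain n \<tau> \<xi> where eq: "\<phi> k = (n, \<tau>, \<xi>)" by (metis prod_cases3)
    define \<phi>L where "\<phi>L = (n, \<tau>, %i h. L (\<xi> i h))"
    have Lm: "L \<in> borel_measurable borel" by (intro borel_measurable_continuous_onI linear_continuous_on L)
    have "is_simple M T W \<phi>L"
    proof -
    obtain b where b: "\<And>i h. i < n ==> h \<in> space M ==> norm (\<xi> i h) \<le> b"
    using \<phi>(1)[of k] unfolding eq is_simple_def case_prod_conv by blast
    have "norm (L (\<xi> i h)) \<le> b * K" if "i < n" "h \<in> space M" for i h
    using K(1)[of "\<xi> i h"] mult_right_mono[OF b[OF that] K(2)] by linarith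
    moreover have "(%h. L (\<xi> i h)) \<in> borel_measurable (filt M W (\<tau> i))" if "i < n" for i
    by (rule measurable_compose[OF _ Lm]) (use \<phi>(1)[of k] that in \<open>auto simp: eq is_simple_def\<close>)
    ultimately show ?thesis
    using \<phi>(1)[of k] unfolding eq \<phi>L_def is_simple_def case_prod_conv by blast
    qed
    from simple_isometry[OF this \<psi>(1) t, of k]
    show ?thesis
    by (simp add: eq \<phi>L_def simple_integral_def simple_val_def L.sum L.scaleR)
  qed
  then show ?thesis using LIMSEQ_unique[OF 1] 2 by simp
qed

end

section \<open>Linear mean-field equations\<close>

context bm_space
begin

lemma T_mem: "T \<in> {0..T}"
  using T_pos by simp

lemma AE_lborel_PM: "(AE z in lborel \<Otimes>\<^sub>M M. fst z \<in> {0..T} \<longrightarrow> P z) \<longleftrightarrow> (AE z in PM T. P z)"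
proof
  interpret l: finite_measure "lam T" by (rule finite_measure_lam)
  have idm: "(%z. z) \<in> measurable (PM T) (lborel \<Otimes>\<^sub>M M)"
  proof -
    have "(%z. (fst z, snd z)) \<in> measurable (PM T) (lborel \<Otimes>\<^sub>M M)"
    by (intro measurable_Pair measurable_snd measurable_compose[OF measurable_fst] measurable_restrict_space1) simp
    then show ?thesis by simp
  qed
  have sec: "emeasure (PM T) (N \<inter> space (PM T)) \<le> emeasure (lborel \<Otimes>\<^sub>M M) N" if N: "N \<in> sets (lborel \<Otimes>\<^sub>M M)" for N
  proof -
    have N': "N \<inter> space (PM T) \<in> sets (PM T)" using measurable_sets[OF idm N] by simp
    have "emeasure (PM T) (N \<inter> space (PM T)) = (\<integral>\<^sup>+s. emeasure M (Pair s -` (N \<inter> space (PM T))) \<partial>lam T)"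
    by (rule emeasure_pair_measure_alt[OF N'])
    also have "\<dots> = (\<integral>\<^sup>+s. emeasure M (Pair s -` (N \<inter> space (PM T))) * indicator {0..T} s \<partial>lborel)"
    by (subst nn_integral_restrict_space) auto
    also have "\<dots> \<le> (\<integral>\<^sup>+s. emeasure M (Pair s -` N) \<partial>lborel)"
    by (intro nn_integral_mono) (auto simp: indicator_def intro!: emeasure_mono sets_Pair1[OF N])
    also have "\<dots> = emeasure (lborel \<Otimes>\<^sub>M M) N" by (rule emeasure_pair_measure_alt[OF N, symmetric])
    finally show ?thesis .
  qed
  assume "AE z in lborel \<Otimes>\<^sub>M M. fst z \<in> {0..T} \<longrightarrow> P z"
  then obtain N where N: "N \<in> null_sets (lborel \<Otimes>\<^sub>M M)" "{z \<in> space (lborel \<Otimes>\<^sub>M M). \<not> (fst z \<in> {0..T} \<longrightarrow> P z)} \<subseteq> N"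
    by (auto simp: eventually_ae_filter)
  show "AE z in PM T. P z"
  proof (rule AE_I)
    show "{z \<in> space (PM T). \<not> P z} \<subseteq> N \<inter> space (PM T)"
    using N(2) by (auto simp: space_pair_measure space_restrict_space)
    show "emeasure (PM T) (N \<inter> space (PM T)) = 0" using sec[of N] N(1) by (auto simp: null_sets_def)
    show "N \<inter> space (PM T) \<in> sets (PM T)" using measurable_sets[OF idm, of N] N(1) by auto
  qed
next
  interpret l: finite_measure "lam T" by (rule finite_measure_lam)
  define r where "r = (%z::real \<times> 'w. (max 0 (min T (fst z)), snd z))"
  have rm: "r \<in> measurable (lborel \<Otimes>\<^sub>M M) (PM T)"
    unfolding r_def
  proof (intro measurable_Pair measurable_snd)
    have "(%s. max 0 (min T s)) \<in> measurable lborel (lam T)"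
    using T_pos by (intro measurable_restrict_space2) auto
    from measurable_compose[OF measurable_fst this] show "(%z. max 0 (min T (fst z))) \<in> measurable (lborel \<Otimes>\<^sub>M M) (lam T)" .
  qed
  assume "AE z in PM T. P z"
  then obtain N where N: "N \<in> null_sets (PM T)" "{z \<in> space (PM T). \<not> P z} \<subseteq> N"
    by (auto simp: eventually_ae_filter)
  define N' where "N' = (r -` N \<inter> space (lborel \<Otimes>\<^sub>M M)) \<inter> ({0..T} \<times> space M)"
  have N'm: "N' \<in> sets (lborel \<Otimes>\<^sub>M M)"
    unfolding N'_def
  proof (rule sets.Int)
    show "r -` N \<inter> space (lborel \<Otimes>\<^sub>M M) \<in> sets (lborel \<Otimes>\<^sub>M M)"
    by (rule measurable_sets[OF rm]) (use N(1) in auto)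
    show "{0..T} \<times> space M \<in> sets (lborel \<Otimes>\<^sub>M M)" by (rule pair_measureI) auto
  qed
  show "AE z in lborel \<Otimes>\<^sub>M M. fst z \<in> {0..T} \<longrightarrow> P z"
  proof (rule AE_I[OF _ _ N'm])
    show "{z \<in> space (lborel \<Otimes>\<^sub>M M). \<not> (fst z \<in> {0..T} \<longrightarrow> P z)} \<subseteq> N'"
    proof
    fix z assume z: "z \<in> {z \<in> space (lborel \<Otimes>\<^sub>M M). \<not> (fst z \<in> {0..T} \<longrightarrow> P z)}"
    then have "z \<in> {z \<in> space (PM T). \<not> P z}" by (auto simp: space_pair_measure space_restrict_space)
    then have "z \<in> N" using N(2) by blast
    moreover have "r z = z" using z by (auto simp: r_def min_absorb2 max_absorb2)
    ultimately show "z \<in> N'" using z by (auto simp: N'_def space_pair_measure)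
    qed
    have "emeasure (lborel \<Otimes>\<^sub>M M) N' = (\<integral>\<^sup>+s. emeasure M (Pair s -` N') \<partial>lborel)"
    by (rule emeasure_pair_measure_alt[OF N'm])
    also have "\<dots> \<le> (\<integral>\<^sup>+s. emeasure M (Pair s -` N) * indicator {0..T} s \<partial>lborel)"
    proof (rule nn_integral_mono)
    fix s
    show "emeasure M (Pair s -` N') \<le> emeasure M (Pair s -` N) * indicator {0..T} s"
    proof (cases "s \<in> {0..T}")
    case True
    then have "Pair s -` N' \<subseteq> Pair s -` N" by (auto simp: N'_def r_def min_absorb2 max_absorb2)
    moreover have "Pair s -` N \<in> sets M" using N(1) by (intro sets_Pair1) auto
    ultimately show ?thesis using True by (simp add: emeasure_mono)
    next
    case False
    then have "Pair s -` N' = {}" by (auto simp: N'_def)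
    then show ?thesis by simp
    qed
    qed
    also have "\<dots> = (\<integral>\<^sup>+s. emeasure M (Pair s -` N) \<partial>lam T)" by (subst nn_integral_restrict_space) auto
    also have "\<dots> = emeasure (PM T) N" using N(1) by (intro emeasure_pair_measure_alt[symmetric]) auto
    finally show "emeasure (lborel \<Otimes>\<^sub>M M) N' = 0" using N(1) by (auto simp: null_sets_def)
  qed
qed

lemma eq_dtdP_iff: "eq_dtdP M T u v \<longleftrightarrow> (AE z in PM T. u (fst z) (snd z) = v (fst z) (snd z))"
  unfolding eq_dtdP_def by (rule AE_lborel_PM)

lemma pdist_eq_0:
  fixes \<phi> \<psi> :: "real => 'w => 'a::euclidean_space"
  assumes L: "\<phi> \<in> L2F M T W" "\<psi> \<in> L2F M T W"
  shows "pdist T \<phi> \<psi> = 0 \<longleftrightarrow> eq_dtdP M T \<phi> \<psi>"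
  unfolding pdist_def eq_dtdP_iff
  by (subst integral_nonneg_eq_0_iff_AE[OF sqi_integrable[OF L2F_sqi_diff[OF L T_mem]]]) auto

lemma pdist_add:
  fixes \<phi> \<psi> \<phi>' \<psi>' :: "real => 'w => 'a::euclidean_space"
  assumes L: "\<phi> \<in> L2F M T W" "\<psi> \<in> L2F M T W" "\<phi>' \<in> L2F M T W" "\<psi>' \<in> L2F M T W" and t: "t \<in> {0..T}"
  shows "pdist t (%s w. \<phi> s w + \<phi>' s w) (%s w. \<psi> s w + \<psi>' s w) \<le> 2 * pdist t \<phi> \<psi> + 2 * pdist t \<phi>' \<psi>'"
proof -
  note i = sqi_integrable[OF L2F_sqi_diff[OF L(1,2) t]] sqi_integrable[OF L2F_sqi_diff[OF L(3,4) t]]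
  have "pdist t (%s w. \<phi> s w + \<phi>' s w) (%s w. \<psi> s w + \<psi>' s w) \<le>
    (LINT z|PM t. 2 * (norm (\<phi> (fst z) (snd z) - \<psi> (fst z) (snd z)))\<^sup>2 + 2 * (norm (\<phi>' (fst z) (snd z) - \<psi>' (fst z) (snd z)))\<^sup>2)"
    unfolding pdist_def
  proof (rule integral_mono)
    show "integrable (PM t) (%z. (norm (\<phi> (fst z) (snd z) + \<phi>' (fst z) (snd z) - (\<psi> (fst z) (snd z) + \<psi>' (fst z) (snd z))))\<^sup>2)"
    by (rule sqi_integrable[OF L2F_sqi_diff[OF L2F_add[OF L(1,3)] L2F_add[OF L(2,4)] t]])
    fix z
    have "\<phi> (fst z) (snd z) + \<phi>' (fst z) (snd z) - (\<psi> (fst z) (snd z) + \<psi>' (fst z) (snd z)) =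
    (\<phi> (fst z) (snd z) - \<psi> (fst z) (snd z)) + (\<phi>' (fst z) (snd z) - \<psi>' (fst z) (snd z))" by simp
    then show "(norm (\<phi> (fst z) (snd z) + \<phi>' (fst z) (snd z) - (\<psi> (fst z) (snd z) + \<psi>' (fst z) (snd z))))\<^sup>2
    \<le> 2 * (norm (\<phi> (fst z) (snd z) - \<psi> (fst z) (snd z)))\<^sup>2 + 2 * (norm (\<phi>' (fst z) (snd z) - \<psi>' (fst z) (snd z)))\<^sup>2"
    using norm_add_square_le by metis
  qed (intro i Bochner_Integration.integrable_add integrable_mult_right)
  also have "\<dots> = 2 * pdist t \<phi> \<psi> + 2 * pdist t \<phi>' \<psi>'" unfolding pdist_def using i by simp
  finally show ?thesis .
qed

lemma pdist_matrix:
  fixes N :: "real => real^'n^'m"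
  assumes N: "continuous_on {0..T} N"
  shows "\<exists>K\<ge>0. \<forall>\<phi>\<in>L2F M T W. \<forall>\<psi>\<in>L2F M T W. \<forall>t\<in>{0..T}.
    pdist t (%s w. N s *v \<phi> s w) (%s w. N s *v \<psi> s w) \<le> K * pdist t \<phi> \<psi>"
proof -
  obtain K where K: "0 \<le> K" "\<And>t x. t \<in> {0..T} ==> norm (N t *v x) \<le> K * norm x"
    using matrix_family_bound[OF N] by metis
  have "pdist t (%s w. N s *v \<phi> s w) (%s w. N s *v \<psi> s w) \<le> K\<^sup>2 * pdist t \<phi> \<psi>"
    if L: "\<phi> \<in> L2F M T W" "\<psi> \<in> L2F M T W" and t: "t \<in> {0..T}" for \<phi> \<psi> t
  proof -
    note i = sqi_integrable[OF L2F_sqi_diff[OF L t]]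
    have "pdist t (%s w. N s *v \<phi> s w) (%s w. N s *v \<psi> s w) \<le> (LINT z|PM t. K\<^sup>2 * (norm (\<phi> (fst z) (snd z) - \<psi> (fst z) (snd z)))\<^sup>2)"
    unfolding pdist_def
    proof (rule integral_mono)
    show "integrable (PM t) (%z. (norm (N (fst z) *v \<phi> (fst z) (snd z) - N (fst z) *v \<psi> (fst z) (snd z)))\<^sup>2)"
    by (rule sqi_integrable[OF L2F_sqi_diff[OF L2F_matrix[OF N L(1)] L2F_matrix[OF N L(2)] t]])
    fix z assume "z \<in> space (PM t)"
    then have "fst z \<in> {0..T}" using t by (auto simp: space_pair_measure space_restrict_space)
    from power_mono[OF K(2)[OF this, of "\<phi> (fst z) (snd z) - \<psi> (fst z) (snd z)"], of 2]
    show "(norm (N (fst z) *v \<phi> (fst z) (snd z) - N (fst z) *v \<psi> (fst z) (snd z)))\<^sup>2 \<le> K\<^sup>2 * (norm (\<phi> (fst z) (snd z) - \<psi> (fst z) (snd z)))\<^sup>2"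
    by (simp add: mv.diff_right power_mult_distrib)
    qed (intro i integrable_mult_right)
    then show ?thesis by (simp add: pdist_def)
  qed
  then show ?thesis by (intro exI[of _ "K\<^sup>2"]) auto
qed

definition vdist :: "(real => 'w => 'a::euclidean_space) => (real => 'w => 'a) => real => real" where
  "vdist X Y s = (LINT w|M. (norm (X s w - Y s w))\<^sup>2)"

lemma pdist_vdist:
  fixes X Y :: "real => 'w => 'a::euclidean_space"
  assumes L: "X \<in> L2F M T W" "Y \<in> L2F M T W" and t: "t \<in> {0..T}"
  shows "pdist t X Y = (LINT s:{0..t}|lborel. vdist X Y s)" "set_integrable lborel {0..t} (vdist X Y)"
  using integral_PM(1,3)[where F="%s w. (norm (X s w - Y s w))\<^sup>2", OF sqi_integrable[OF L2F_sqi_diff[OF L t]]]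
  by (simp_all add: pdist_def vdist_def[abs_def])

lemma pdist_mean:
  fixes X Y :: "real => 'w => 'a::euclidean_space"
  assumes L: "X \<in> L2FC M T W" "Y \<in> L2FC M T W" and t: "t \<in> {0..T}"
  shows "pdist t (%s w. mean M X s) (%s w. mean M Y s) \<le> pdist t X Y"
proof -
  note X = L2FC_L2F[OF L(1)] and Y = L2FC_L2F[OF L(2)]
  have le: "vdist (%s w. mean M X s) (%s w. mean M Y s) s \<le> vdist X Y s" if s: "s \<in> {0..T}" for s
  proof -
    note sX = L2FC_sqi[OF L(1) s] and sY = L2FC_sqi[OF L(2) s]
    have "mean M X s - mean M Y s = (LINT w|M. X s w - Y s w)"
    unfolding mean_def using sqi_integrable_finite[OF sX] sqi_integrable_finite[OF sY] by simp
    then show ?thesis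
    using norm_mean_square_le[OF sqi_diff[OF sX sY]] by (simp add: vdist_def prob_space)
  qed
  show ?thesis
    unfolding pdist_vdist(1)[OF L2F_mean[OF X] L2F_mean[OF Y] t] pdist_vdist(1)[OF X Y t]
    by (rule set_integral_mono[OF pdist_vdist(2)[OF L2F_mean[OF X] L2F_mean[OF Y] t] pdist_vdist(2)[OF X Y t]])
    (use t in \<open>auto intro: le\<close>)
qed

lemma ito_diff_isometry:
  fixes Z Y :: "real => 'w => 'a::euclidean_space"
  assumes Z: "has_ito_integral M T W Z I" and Y: "has_ito_integral M T W Y J" and t: "t \<in> {0..T}"
  shows "vdist I J t = pdist t Z Y"
proof -
  have expand: "(LINT x|N. (norm (f x - g x))\<^sup>2) = (LINT x|N. f x \<bullet> f x) - 2 * (LINT x|N. f x \<bullet> g x) + (LINT x|N. g x \<bullet> g x)"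
    if "sqi N f" "sqi N g" for N :: "'z measure" and f g :: "'z => 'a"
  proof -
    have "(LINT x|N. (norm (f x - g x))\<^sup>2) = (LINT x|N. f x \<bullet> f x - 2 * (f x \<bullet> g x) + g x \<bullet> g x)"
    by (intro Bochner_Integration.integral_cong refl)
    (simp add: power2_norm_eq_inner inner_diff_left inner_diff_right inner_commute)
    then show ?thesis
    using integrable_inner_sqi[OF that] integrable_inner_sqi[OF that(1,1)] integrable_inner_sqi[OF that(2,2)] by simp
  qed
  show ?thesis
    unfolding vdist_def pdist_def expand[OF has_itoD(4)[OF Z t] has_itoD(4)[OF Y t]]
    expand[OF L2F_sqi[OF has_itoD(2)[OF Z] t] L2F_sqi[OF has_itoD(2)[OF Y] t]]
    ito_isometry[OF Z Z bounded_linear_ident t] ito_isometry[OF Z Y bounded_linear_ident t] ito_isometry[OF Y Y bounded_linear_ident t] ..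
qed

definition ito_process :: "'a::euclidean_space => (real => 'w => 'a) => (real => 'w => 'a) => (real => 'w => 'a) => bool" where
  "ito_process x b Z X \<longleftrightarrow> b \<in> L2F M T W \<and> X \<in> L2FC M T W \<and>
    (\<exists>I. has_ito_integral M T W Z I \<and> (AE w in M. \<forall>t\<in>{0..T}. X t w = x + (LINT s:{0..t}|lborel. b s w) + I t w))"

lemma L2F_set_integrable:
  fixes b :: "real => 'w => 'a::euclidean_space"
  assumes b: "b \<in> L2F M T W"
  shows "AE w in M. \<forall>t\<in>{0..T}. set_integrable lborel {0..t} (%s. b s w)"
  using L2F_AE_sqi(2)[OF b]
proof eventually_elim
  interpret l: finite_measure "lam T" by (rule finite_measure_lam)
  fix w assume "sqi (lam T) (%s. b s w)"
  then have i: "set_integrable lborel {0..T} (%s. b s w)" unfolding set_integrable_lam by (rule l.sqi_integrable_finite)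
  show "\<forall>t\<in>{0..T}. set_integrable lborel {0..t} (%s. b s w)"
  proof
    fix t assume "t \<in> {0..T}"
    then show "set_integrable lborel {0..t} (%s. b s w)" by (intro set_integrable_subset[OF i]) simp_all
  qed
qed

lemma ito_process_vdist:
  fixes X X' :: "real => 'w => 'a::euclidean_space"
  assumes X: "ito_process x b Z X" and X': "ito_process x b' Z' X'" and t: "t \<in> {0..T}"
  shows "vdist X X' t \<le> 2 * T * pdist t b b' + 2 * pdist t Z Z'"
proof -
  obtain I where I: "has_ito_integral M T W Z I" "AE w in M. \<forall>t\<in>{0..T}. X t w = x + (LINT s:{0..t}|lborel. b s w) + I t w"
    and b: "b \<in> L2F M T W" and XL: "X \<in> L2FC M T W" using X unfolding ito_process_def by blast
  obtain I' where I': "has_ito_integral M T W Z' I'" "AE w in M. \<forall>t\<in>{0..T}. X' t w = x + (LINT s:{0..t}|lborel. b' s w) + I' t w"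
    and b': "b' \<in> L2F M T W" and XL': "X' \<in> L2FC M T W" using X' unfolding ito_process_def by blast
  define J where "J s w = (LINT r:{0..s}|lborel. b r w - b' r w)" for s w
  have d: "(%s w. b s w - b' s w) \<in> L2F M T W" by (rule L2F_diff[OF b b'])
  have "(\<integral>\<^sup>+w. ennreal ((norm (J t w))\<^sup>2) \<partial>M) \<le> (\<integral>\<^sup>+w. (SUP s\<in>{0..t}. ennreal ((norm (J s w))\<^sup>2)) \<partial>M)"
    using t by (intro nn_integral_mono SUP_upper) auto
  also have "\<dots> \<le> ennreal (T * pdist t b b')"
    unfolding pdist_def by (rule time_integral_bound[OF d _ t]) (simp add: J_def)
  finally have Jb: "(\<integral>\<^sup>+w. ennreal ((norm (J t w))\<^sup>2) \<partial>M) \<le> ennreal (T * pdist t b b')" .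
  have Ib: "(\<integral>\<^sup>+w. ennreal ((norm (I t w - I' t w))\<^sup>2) \<partial>M) = ennreal (pdist t Z Z')"
    using sqi_nn_integral[OF sqi_diff[OF has_itoD(4)[OF I(1) t] has_itoD(4)[OF I'(1) t]]] ito_diff_isometry[OF I(1) I'(1) t]
    by (simp add: vdist_def)
  have eq: "AE w in M. X t w - X' t w = J t w + (I t w - I' t w)"
    using I(2) I'(2) L2F_set_integrable[OF b] L2F_set_integrable[OF b']
  proof eventually_elim
    case (elim w)
    then have "J t w = (LINT s:{0..t}|lborel. b s w) - (LINT s:{0..t}|lborel. b' s w)"
    using t by (simp add: J_def set_integral_diff)
    then show ?case using elim t by simp
  qed
  have sI: "sqi M (%w. I t w - I' t w)" by (rule sqi_diff[OF has_itoD(4)[OF I(1) t] has_itoD(4)[OF I'(1) t]])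
  have sX: "sqi M (%w. X t w - X' t w)" by (rule sqi_diff[OF L2FC_sqi[OF XL t] L2FC_sqi[OF XL' t]])
  define R where "R w = (X t w - X' t w) - (I t w - I' t w)" for w
  have [measurable]: "R \<in> borel_measurable M" "(%w. I t w - I' t w) \<in> borel_measurable M"
    unfolding R_def[abs_def] using sqi_measurable[OF sI] sqi_measurable[OF sX] by measurable
  have R: "AE w in M. R w = J t w" using eq by eventually_elim (simp add: R_def)
  have "ennreal (vdist X X' t) = (\<integral>\<^sup>+w. ennreal ((norm (X t w - X' t w))\<^sup>2) \<partial>M)"
    unfolding vdist_def by (rule sqi_nn_integral[OF sX, symmetric])
  also have "\<dots> \<le> (\<integral>\<^sup>+w. ennreal 2 * ennreal ((norm (R w))\<^sup>2) + ennreal 2 * ennreal ((norm (I t w - I' t w))\<^sup>2) \<partial>M)"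
  proof (rule nn_integral_mono)
    fix w
    have "ennreal ((norm (X t w - X' t w))\<^sup>2) \<le> ennreal (2 * (norm (R w))\<^sup>2 + 2 * (norm (I t w - I' t w))\<^sup>2)"
    using norm_add_square_le[of "R w" "I t w - I' t w"] by (intro ennreal_leI) (simp add: R_def)
    then show "ennreal ((norm (X t w - X' t w))\<^sup>2) \<le> ennreal 2 * ennreal ((norm (R w))\<^sup>2) + ennreal 2 * ennreal ((norm (I t w - I' t w))\<^sup>2)"
    by (simp add: ennreal_mult)
  qed
  also have "\<dots> = ennreal 2 * (\<integral>\<^sup>+w. ennreal ((norm (R w))\<^sup>2) \<partial>M) + ennreal 2 * ennreal (pdist t Z Z')"
    unfolding Ib[symmetric] by (subst nn_integral_add) (simp_all add: nn_integral_cmult)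
  also have "(\<integral>\<^sup>+w. ennreal ((norm (R w))\<^sup>2) \<partial>M) = (\<integral>\<^sup>+w. ennreal ((norm (J t w))\<^sup>2) \<partial>M)"
    using R by (intro nn_integral_cong_AE) auto
  also have "ennreal 2 * (\<integral>\<^sup>+w. ennreal ((norm (J t w))\<^sup>2) \<partial>M) + ennreal 2 * ennreal (pdist t Z Z') \<le>
    ennreal 2 * ennreal (T * pdist t b b') + ennreal 2 * ennreal (pdist t Z Z')"
    by (intro add_mono mult_left_mono Jb) auto
  also have "\<dots> = ennreal (2 * T * pdist t b b' + 2 * pdist t Z Z')"
    using T_pos pdist_nonneg[of t b b'] pdist_nonneg[of t Z Z'] by (simp add: ennreal_mult mult.assoc)
  finally show ?thesis
    using T_pos pdist_nonneg[of t b b'] pdist_nonneg[of t Z Z'] by (subst (asm) ennreal_le_iff) auto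
qed

lemma indistinguishableI:
  fixes X Y :: "real => 'w => 'a::euclidean_space"
  assumes L: "X \<in> L2FC M T W" "Y \<in> L2FC M T W" and eq: "\<And>t. t \<in> {0..T} ==> AE w in M. X t w = Y t w"
  shows "indistinguishable M T X Y"
proof -
  have "AE w in M. \<forall>n. \<forall>j\<in>{..(2::nat)^n}. X (T * real j / 2^n) w = Y (T * real j / 2^n) w"
    by (subst AE_all_countable, intro allI AE_finite_allI finite_atMost eq dyadic_mem) auto
  moreover have "AE w in M. continuous_on {0..T} (%t. X t w)" "AE w in M. continuous_on {0..T} (%t. Y t w)"
    using L by (auto simp: L2FC_def)
  ultimately have "AE w in M. \<forall>t\<in>{0..T}. X t w = Y t w"
  proof eventually_elim
    case (elim w)
    have "(SUP t\<in>{0..T}. ennreal (norm (X t w - Y t w))) = (SUP n. SUP j\<in>{..(2::nat)^n}. ennreal (norm (X (T * real j / 2^n) w - Y (T * real j / 2^n) w)))"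
    by (rule SUP_dyadic[OF T_pos]) (use elim in \<open>auto intro!: continuous_intros\<close>)
    also have "\<dots> \<le> 0" by (intro SUP_least) (use elim in auto)
    finally have sup: "(SUP t\<in>{0..T}. ennreal (norm (X t w - Y t w))) \<le> 0" .
    show ?case
    proof
    fix t assume "t \<in> {0..T}"
    then have "ennreal (norm (X t w - Y t w)) \<le> 0" by (rule order_trans[OF SUP_upper sup])
    then show "X t w = Y t w" by simp
    qed
  qed
  then show ?thesis by (simp add: indistinguishable_def)
qed

lemma vdist_0_imp:
  fixes X Y :: "real => 'w => 'a::euclidean_space"
  assumes "X \<in> L2FC M T W" "Y \<in> L2FC M T W" "t \<in> {0..T}" "vdist X Y t \<le> 0"
  shows "AE w in M. X t w = Y t w"
proof -
  have i: "integrable M (%w. (norm (X t w - Y t w))\<^sup>2)"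
    by (intro sqi_integrable sqi_diff L2FC_sqi[OF assms(1,3)] L2FC_sqi[OF assms(2,3)])
  have "(LINT w|M. (norm (X t w - Y t w))\<^sup>2) = 0"
    using assms(4) by (intro antisym) (simp_all add: vdist_def)
  then show ?thesis by (subst (asm) integral_nonneg_eq_0_iff_AE[OF i]) auto
qed

lemma vdist_bounded:
  fixes X Y :: "real => 'w => 'a::euclidean_space"
  assumes L: "X \<in> L2FC M T W" "Y \<in> L2FC M T W"
  shows "\<exists>c\<ge>0. \<forall>t\<in>{0..T}. vdist X Y t \<le> c"
proof -
  define a where "a Z = enn2real (\<integral>\<^sup>+w. supn Z w \<partial>M)" for Z :: "real => 'w => 'a"
  have le: "(LINT w|M. (norm (Z t w))\<^sup>2) \<le> a Z" if Z: "Z \<in> L2FC M T W" and t: "t \<in> {0..T}" for Z t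
  proof -
    have fin: "(\<integral>\<^sup>+w. supn Z w \<partial>M) < \<infinity>" using Z by (simp add: L2FC_def supn_def)
    have "ennreal (LINT w|M. (norm (Z t w))\<^sup>2) \<le> (\<integral>\<^sup>+w. supn Z w \<partial>M)"
    unfolding sqi_nn_integral[OF L2FC_sqi[OF Z t], symmetric] by (intro nn_integral_mono supn_upper t)
    from enn2real_mono[OF this fin[unfolded infinity_ennreal_def]] show ?thesis by (simp add: a_def)
  qed
  have "vdist X Y t \<le> 2 * a X + 2 * a Y" if t: "t \<in> {0..T}" for t
  proof -
    note s = sqi_integrable[OF L2FC_sqi[OF L(1) t]] sqi_integrable[OF L2FC_sqi[OF L(2) t]]
    have "vdist X Y t \<le> (LINT w|M. 2 * (norm (X t w))\<^sup>2 + 2 * (norm (Y t w))\<^sup>2)"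
    unfolding vdist_def
    by (rule integral_mono[OF sqi_integrable[OF sqi_diff[OF L2FC_sqi[OF L(1) t] L2FC_sqi[OF L(2) t]]]])
    (use s norm_diff_square_le in auto)
    also have "\<dots> = 2 * (LINT w|M. (norm (X t w))\<^sup>2) + 2 * (LINT w|M. (norm (Y t w))\<^sup>2)" using s by simp
    finally show ?thesis using le[OF L(1) t] le[OF L(2) t] by simp
  qed
  moreover have "0 \<le> 2 * a X + 2 * a Y" by (simp add: a_def)
  ultimately show ?thesis by blast
qed

lemma pdist_supn:
  fixes X Y :: "real => 'w => 'a::euclidean_space"
  assumes L: "X \<in> L2F M T W" "Y \<in> L2F M T W" and ac: "ac X" "ac Y"
  shows "ennreal (pdist T X Y) \<le> ennreal T * (\<integral>\<^sup>+w. supn (%t w. X t w - Y t w) w \<partial>M)"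
proof -
  have [measurable]: "supn (%t w. X t w - Y t w) \<in> borel_measurable M" by (intro supn_measurable ac_diff ac)
  have "ennreal (pdist T X Y) \<le> (\<integral>\<^sup>+w. ennreal T * supn (%t w. X t w - Y t w) w \<partial>M)"
    unfolding L2F_nn_dist[OF L, symmetric]
  proof (rule nn_integral_mono)
    fix w
    have "(\<integral>\<^sup>+t\<in>{0..T}. ennreal ((norm (X t w - Y t w))\<^sup>2) \<partial>lborel) \<le> (\<integral>\<^sup>+t. supn (%t w. X t w - Y t w) w * indicator {0..T} t \<partial>lborel)"
    by (intro nn_integral_mono) (auto simp: indicator_def intro: supn_upper[of _ "%t w. X t w - Y t w"])
    also have "\<dots> = supn (%t w. X t w - Y t w) w * ennreal T"
    by (subst nn_integral_cmult_indicator) (use T_pos in auto)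
    finally show "(\<integral>\<^sup>+t\<in>{0..T}. ennreal ((norm (X t w - Y t w))\<^sup>2) \<partial>lborel) \<le> ennreal T * supn (%t w. X t w - Y t w) w"
    by (simp only: mult.commute)
  qed
  then show ?thesis by (simp add: nn_integral_cmult)
qed

end

context bm_space
begin

definition mf :: "(real => real^'n^'n) => (real => real^'n^'n) => (real => 'w => real^'n) => (real => 'w => real^'n) => real => 'w => real^'n" where
  "mf A A' f X t w = A t *v X t w + A' t *v mean M X t + f t w"

lemma mf_L2F:
  assumes "continuous_on {0..T} A" "continuous_on {0..T} A'" "f \<in> L2F M T W" "X \<in> L2F M T W"
  shows "mf A A' f X \<in> L2F M T W"
  unfolding mf_def[abs_def]
  by (intro L2F_add assms L2F_matrix[OF assms(1)] L2F_matrix[OF assms(2)] L2F_mean)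

lemma mf_dist:
  fixes A A' :: "real => real^'n^'n"
  assumes A: "continuous_on {0..T} A" "continuous_on {0..T} A'"
  shows "\<exists>K\<ge>0. \<forall>X\<in>L2FC M T W. \<forall>Y\<in>L2FC M T W. \<forall>f\<in>L2F M T W. \<forall>g\<in>L2F M T W. \<forall>t\<in>{0..T}. eq_dtdP M T f g \<longrightarrow>
    pdist t (mf A A' f X) (mf A A' g Y) \<le> K * pdist t X Y"
proof -
  obtain a where a: "0 \<le> a" "\<And>\<phi> \<psi> t. \<phi> \<in> L2F M T W ==> \<psi> \<in> L2F M T W ==> t \<in> {0..T} ==>
    pdist t (%s w. A s *v \<phi> s w) (%s w. A s *v \<psi> s w) \<le> a * pdist t \<phi> \<psi>"
    using pdist_matrix[OF A(1)] by blast
  obtain a' where a': "0 \<le> a'" "\<And>\<phi> \<psi> t. \<phi> \<in> L2F M T W ==> \<psi> \<in> L2F M T W ==> t \<in> {0..T} ==>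
    pdist t (%s w. A' s *v \<phi> s w) (%s w. A' s *v \<psi> s w) \<le> a' * pdist t \<phi> \<psi>"
    using pdist_matrix[OF A(2)] by blast
  have "pdist t (mf A A' f X) (mf A A' g Y) \<le> (4 * a + 4 * a') * pdist t X Y"
    if L: "X \<in> L2FC M T W" "Y \<in> L2FC M T W" and f: "f \<in> L2F M T W" "g \<in> L2F M T W" and t: "t \<in> {0..T}" and eq: "eq_dtdP M T f g"
    for X Y :: "real => 'w => real^'n" and f g t
  proof -
    note X = L2FC_L2F[OF L(1)] and Y = L2FC_L2F[OF L(2)]
    note m = L2F_mean[OF X] L2F_mean[OF Y]
    note p = L2F_matrix[OF A(1) X] L2F_matrix[OF A(1) Y] L2F_matrix[OF A(2) m(1)] L2F_matrix[OF A(2) m(2)]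
    have f0: "pdist t f g \<le> 0"
    using pdist_mono[OF f t] eq pdist_eq_0[OF f] by simp
    have "pdist t (mf A A' f X) (mf A A' g Y) \<le>
    2 * pdist t (%s w. A s *v X s w + A' s *v mean M X s) (%s w. A s *v Y s w + A' s *v mean M Y s) + 2 * pdist t f g"
    unfolding mf_def[abs_def] by (rule pdist_add[OF L2F_add[OF p(1,3)] L2F_add[OF p(2,4)] f t])
    also have "pdist t (%s w. A s *v X s w + A' s *v mean M X s) (%s w. A s *v Y s w + A' s *v mean M Y s) \<le>
    2 * pdist t (%s w. A s *v X s w) (%s w. A s *v Y s w) + 2 * pdist t (%s w. A' s *v mean M X s) (%s w. A' s *v mean M Y s)"
    by (rule pdist_add[OF p t])
    also have "pdist t (%s w. A s *v X s w) (%s w. A s *v Y s w) \<le> a * pdist t X Y" by (rule a(2)[OF X Y t])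
    also have "pdist t (%s w. A' s *v mean M X s) (%s w. A' s *v mean M Y s) \<le> a' * pdist t X Y"
    by (rule order_trans[OF a'(2)[OF m t] mult_left_mono[OF pdist_mean[OF L t] a'(1)]])
    finally show ?thesis using f0 by (simp add: algebra_simps)
  qed
  then show ?thesis using a(1) a'(1) by (intro exI[of _ "4 * a + 4 * a'"]) simp
qed

context
  fixes A A' C C' :: "real => real^'n^'n"
  assumes cont: "continuous_on {0..T} A" "continuous_on {0..T} A'" "continuous_on {0..T} C" "continuous_on {0..T} C'"
begin

lemma solves_sde_mf_iff:
  assumes f: "f \<in> L2F M T W"
  shows "solves_sde M T W x (mf A A' f X) (mf C C' g X) X \<longleftrightarrow> ito_process x (mf A A' f X) (mf C C' g X) X"
  using mf_L2F[OF cont(1,2) f L2FC_L2F] by (auto simp: solves_sde_def ito_process_def)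

lemma mf_sde_vdist:
  "\<exists>K\<ge>0. \<forall>f\<in>L2F M T W. \<forall>f'\<in>L2F M T W. \<forall>g\<in>L2F M T W. \<forall>g'\<in>L2F M T W. \<forall>x X X' Y Y' t.
    eq_dtdP M T f f' \<longrightarrow> eq_dtdP M T g g' \<longrightarrow> X \<in> L2FC M T W \<longrightarrow> Y \<in> L2FC M T W \<longrightarrow>
    ito_process x (mf A A' f X) (mf C C' g X) X' \<longrightarrow> ito_process x (mf A A' f' Y) (mf C C' g' Y) Y' \<longrightarrow> t \<in> {0..T} \<longrightarrow>
    vdist X' Y' t \<le> K * pdist t X Y"
proof -
  obtain a where a: "0 \<le> a" "\<And>X Y f g t. X \<in> L2FC M T W ==> Y \<in> L2FC M T W ==> f \<in> L2F M T W ==> g \<in> L2F M T W ==> t \<in> {0..T} ==>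
    eq_dtdP M T f g ==> pdist t (mf A A' f X) (mf A A' g Y) \<le> a * pdist t X Y"
    using mf_dist[OF cont(1,2)] by blast
  obtain c where c: "0 \<le> c" "\<And>X Y f g t. X \<in> L2FC M T W ==> Y \<in> L2FC M T W ==> f \<in> L2F M T W ==> g \<in> L2F M T W ==> t \<in> {0..T} ==>
    eq_dtdP M T f g ==> pdist t (mf C C' f X) (mf C C' g Y) \<le> c * pdist t X Y"
    using mf_dist[OF cont(3,4)] by blast
  show ?thesis
  proof (intro exI[of _ "2 * T * a + 2 * c"] conjI ballI allI impI)
    show "0 \<le> 2 * T * a + 2 * c" using a c T_pos by simp
    fix f f' g g' x X X' Y Y' t
    assume *: "f \<in> L2F M T W" "f' \<in> L2F M T W" "g \<in> L2F M T W" "g' \<in> L2F M T W"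
    "eq_dtdP M T f f'" "eq_dtdP M T g g'" "X \<in> L2FC M T W" "Y \<in> L2FC M T W"
    "ito_process x (mf A A' f X) (mf C C' g X) X'" "ito_process x (mf A A' f' Y) (mf C C' g' Y) Y'" "t \<in> {0..T}"
    have "2 * T * pdist t (mf A A' f X) (mf A A' f' Y) \<le> 2 * T * (a * pdist t X Y)"
    using a(2)[OF *(7,8,1,2,11,5)] T_pos by (intro mult_left_mono) auto
    then show "vdist X' Y' t \<le> (2 * T * a + 2 * c) * pdist t X Y"
    using ito_process_vdist[OF *(9,10,11)] c(2)[OF *(7,8,3,4,11,6)] by (simp add: algebra_simps)
  qed
qed

lemma mf_sde_unique:
  assumes L: "f \<in> L2F M T W" "f' \<in> L2F M T W" "g \<in> L2F M T W" "g' \<in> L2F M T W"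
    and eq: "eq_dtdP M T f f'" "eq_dtdP M T g g'"
    and X: "solves_sde M T W x (mf A A' f X) (mf C C' g X) X" and Y: "solves_sde M T W x (mf A A' f' Y) (mf C C' g' Y) Y"
  shows "indistinguishable M T X Y"
proof -
  have XL: "X \<in> L2FC M T W" and YL: "Y \<in> L2FC M T W" using X Y by (auto simp: solves_sde_def)
  note p = X[unfolded solves_sde_mf_iff[OF L(1)]] Y[unfolded solves_sde_mf_iff[OF L(2)]]
  note F = L2FC_L2F[OF XL] L2FC_L2F[OF YL]
  obtain K where K: "0 \<le> K" "\<And>t. t \<in> {0..T} ==> vdist X Y t \<le> K * pdist t X Y"
    using mf_sde_vdist L eq XL YL p by meson
  obtain c where c: "\<And>t. t \<in> {0..T} ==> vdist X Y t \<le> c" using vdist_bounded[OF XL YL] by blast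
  have "vdist X Y t \<le> 0" if t: "t \<in> {0..T}" for t
  proof (rule gronwall_zero[OF K(1) pdist_vdist(2)[OF F T_mem] c _ t])
    show "vdist X Y t \<le> K * (LINT s:{0..t}|lborel. vdist X Y s)" if "t \<in> {0..T}" for t
    using K(2)[OF that] pdist_vdist(1)[OF F that] by simp
  qed
  then show ?thesis by (intro indistinguishableI XL YL vdist_0_imp)
qed

lemma mf_sde_step:
  assumes f: "f \<in> L2F M T W" "g \<in> L2F M T W" and X: "X \<in> L2FC M T W"
  shows "\<exists>X'. ac X' \<and> ito_process x (mf A A' f X) (mf C C' g X) X' \<and>
    (\<exists>J I. ac J \<and> (AE w in M. \<forall>t\<in>{0..T}. J t w = (LINT s:{0..t}|lborel. mf A A' f X s w)) \<and>
    has_ito_integral M T W (mf C C' g X) I \<and> mart I \<and> X' = (%t w. x + (J t w + I t w)))"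
proof -
  have b: "mf A A' f X \<in> L2F M T W" and Z: "mf C C' g X \<in> L2F M T W"
    by (intro mf_L2F cont f L2FC_L2F X)+
  obtain J where J: "ac J" "AE w in M. \<forall>t\<in>{0..T}. J t w = (LINT s:{0..t}|lborel. mf A A' f X s w)"
    using time_integral_exists[OF b] by blast
  obtain I where I: "has_ito_integral M T W (mf C C' g X) I" "mart I" using ito_exists[OF Z] by blast
  define X' where "X' = (%t w. x + (J t w + I t w))"
  note acI = martD(1)[OF I(2)]
  have ac: "ac X'" unfolding X'_def by (intro ac_add ac_const J(1) acI)
  have Jf: "(\<integral>\<^sup>+w. supn J w \<partial>M) < \<infinity>"
    unfolding supn_def using time_integral_bound[OF b J(2) T_mem] by (simp add: order_le_less_trans)
  have "(\<integral>\<^sup>+w. supn X' w \<partial>M) \<le> 2 * (\<integral>\<^sup>+w. supn (%t w. x) w \<partial>M) + 2 * (\<integral>\<^sup>+w. supn (%t w. J t w + I t w) w \<partial>M)"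
    unfolding X'_def by (intro supn_add_integral ac_add ac_const J(1) acI)
  also have "\<dots> < \<infinity>"
  proof -
    have "(\<integral>\<^sup>+w. supn (%t w. x) w \<partial>M) < \<infinity>"
    using T_pos by (simp add: supn_def emeasure_space_1)
    moreover have "(\<integral>\<^sup>+w. supn (%t w. J t w + I t w) w \<partial>M) < \<infinity>"
    by (rule order_le_less_trans[OF supn_add_integral[OF J(1) acI]])
    (use Jf mart_supn_finite[OF I(2)] in \<open>simp add: ennreal_mult_less_top\<close>)
    ultimately show ?thesis by (simp add: ennreal_mult_less_top)
  qed
  finally have "X' \<in> L2FC M T W" by (rule ac_L2FC[OF ac])
  moreover have "AE w in M. \<forall>t\<in>{0..T}. X' t w = x + (LINT s:{0..t}|lborel. mf A A' f X s w) + I t w"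
    using J(2) by eventually_elim (simp add: X'_def add.assoc)
  ultimately have "ito_process x (mf A A' f X) (mf C C' g X) X'"
    unfolding ito_process_def using b I(1) by blast
  then show ?thesis using ac J I by (intro exI[of _ X']) (auto simp: X'_def)
qed

lemma mf_sde_exists:
  assumes f: "f \<in> L2F M T W" "g \<in> L2F M T W"
  shows "\<exists>X. solves_sde M T W x (mf A A' f X) (mf C C' g X) X"
proof -
  define ok where "ok X X' \<longleftrightarrow> ac X' \<and> ito_process x (mf A A' f X) (mf C C' g X) X' \<and>
    (\<exists>J I. ac J \<and> (AE w in M. \<forall>t\<in>{0..T}. J t w = (LINT s:{0..t}|lborel. mf A A' f X s w)) \<and>
    has_ito_integral M T W (mf C C' g X) I \<and> mart I \<and> X' = (%t w. x + (J t w + I t w)))" for X X'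
  have okE: "\<exists>X'. ok X X'" if "X \<in> L2FC M T W" for X
    unfolding ok_def by (rule mf_sde_step[OF f that])
  have okL: "X' \<in> L2FC M T W" if "ok X X'" for X X' using that unfolding ok_def ito_process_def by blast
  have c0: "(%t w. x) \<in> L2FC M T W"
    by (rule ac_L2FC[OF ac_const]) (use T_pos in \<open>simp add: supn_def emeasure_space_1\<close>)
  have "\<exists>F. F 0 = (%t w. x) \<and> (\<forall>k. F k \<in> L2FC M T W) \<and> (\<forall>k. ok (F k) (F (Suc k)))"
  proof -
    define F where "F = rec_nat (%t w. x) (%_ X. SOME X'. ok X X')"
    have F: "F 0 = (%t w. x)" "F (Suc k) = (SOME X'. ok (F k) X')" for k by (simp_all add: F_def)
    have step: "ok (F k) (F (Suc k))" if "F k \<in> L2FC M T W" for k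
    unfolding F(2) by (rule someI_ex[OF okE[OF that]])
    have "F k \<in> L2FC M T W" for k
    by (induction k) (use c0 step okL F(1) in auto)
    then show ?thesis using F(1) step by blast
  qed
  then obtain X where XL: "\<And>k. X k \<in> L2FC M T W" and ok: "\<And>k. ok (X k) (X (Suc k))" by blast
  note XF = L2FC_L2F[OF XL]
  have ip: "ito_process x (mf A A' f (X k)) (mf C C' g (X k)) (X (Suc k))" for k using ok unfolding ok_def by blast
  have acS: "ac (X (Suc k))" for k using ok unfolding ok_def by blast
  have refl: "eq_dtdP M T h h" for h :: "real => 'w => real^'n" by (simp add: eq_dtdP_def)
  obtain K where K: "0 \<le> K" and Kb: "\<And>X X' Y Y' t. X \<in> L2FC M T W ==> Y \<in> L2FC M T W ==>
    ito_process x (mf A A' f X) (mf C C' g X) X' ==> ito_process x (mf A A' f Y) (mf C C' g Y) Y' ==> t \<in> {0..T} ==>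
    vdist X' Y' t \<le> K * pdist t X Y"
    using mf_sde_vdist f refl by meson
  obtain a where a: "0 \<le> a" "\<And>X Y. X \<in> L2FC M T W ==> Y \<in> L2FC M T W ==> pdist T (mf A A' f X) (mf A A' f Y) \<le> a * pdist T X Y"
    using mf_dist[OF cont(1,2)] f refl T_mem by meson
  obtain b where b: "0 \<le> b" "\<And>X Y. X \<in> L2FC M T W ==> Y \<in> L2FC M T W ==> pdist T (mf C C' g X) (mf C C' g Y) \<le> b * pdist T X Y"
    using mf_dist[OF cont(3,4)] f refl T_mem by meson
  define d where "d k t = vdist (X (Suc k)) (X k) t" for k t
  obtain c where c: "0 \<le> c" "\<And>t. t \<in> {0..T} ==> d 0 t \<le> c" using vdist_bounded[OF XL XL] unfolding d_def by blast
  have db: "d k t \<le> c * (K * t) ^ k / fact k" if t: "t \<in> {0..T}" for k t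
  proof (rule iterated_integral_bound[where d=d and T=T and K=K and C=c and k=k and t=t])
    show "0 \<le> K" "t \<in> {0..T}" by fact+
    show "d 0 t \<le> c" if "t \<in> {0..T}" for t by (rule c(2)[OF that])
    show "set_integrable lborel {0..T} (d k)" for k
    unfolding d_def by (rule pdist_vdist(2)[OF XF XF T_mem])
    show "d (Suc k) t \<le> K * (LINT s:{0..t}|lborel. d k s)" if t: "t \<in> {0..T}" for k t
    using Kb[OF XL XL ip ip t, of "Suc k" k] unfolding pdist_vdist(1)[OF XF XF t] d_def .
  qed
  have pb: "pdist T (X (Suc k)) (X k) \<le> T * (c * (K * T) ^ k / fact k)" for k
  proof -
    have "pdist T (X (Suc k)) (X k) \<le> (LINT s:{0..T}|lborel. c * (K * T) ^ k / fact k)"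
    unfolding pdist_vdist(1)[OF XF XF T_mem]
    proof (rule set_integral_mono[OF pdist_vdist(2)[OF XF XF T_mem]])
    show "set_integrable lborel {0..T} (%s. c * (K * T) ^ k / fact k)"
    by (intro borel_integrable_atLeastAtMost' continuous_on_const)
    fix s assume s: "s \<in> {0..T}"
    have "c * (K * s) ^ k / fact k \<le> c * (K * T) ^ k / fact k"
    using s K c(1) by (intro divide_right_mono mult_left_mono power_mono) auto
    then show "vdist (X (Suc k)) (X k) s \<le> c * (K * T) ^ k / fact k" using db[OF s, of k] by (simp add: d_def)
    qed
    then show ?thesis using T_pos by (simp add: set_lebesgue_integral_def mult_ac)
  qed
  define Q where "Q = 2 * T * a + 8 * b"
  have Q: "0 \<le> Q" using a b T_pos by (simp add: Q_def)
  have sb: "(\<integral>\<^sup>+w. supn (%t w. X (Suc (Suc k)) t w - X (Suc k) t w) w \<partial>M) \<le> ennreal (Q * pdist T (X (Suc k)) (X k))" for k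
  proof -
    obtain J I where JI: "ac J" "AE w in M. \<forall>t\<in>{0..T}. J t w = (LINT s:{0..t}|lborel. mf A A' f (X (Suc k)) s w)"
    "has_ito_integral M T W (mf C C' g (X (Suc k))) I" "mart I" "X (Suc (Suc k)) = (%t w. x + (J t w + I t w))"
    using ok[of "Suc k"] unfolding ok_def by blast
    obtain J' I' where JI': "ac J'" "AE w in M. \<forall>t\<in>{0..T}. J' t w = (LINT s:{0..t}|lborel. mf A A' f (X k) s w)"
    "has_ito_integral M T W (mf C C' g (X k)) I'" "mart I'" "X (Suc k) = (%t w. x + (J' t w + I' t w))"
    using ok[of k] unfolding ok_def by blast
    have b1: "mf A A' f (X (Suc k)) \<in> L2F M T W" "mf A A' f (X k) \<in> L2F M T W" by (intro mf_L2F cont f XF)+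
    have JJ: "(\<integral>\<^sup>+w. supn (%t w. J t w - J' t w) w \<partial>M) \<le> ennreal (T * pdist T (mf A A' f (X (Suc k))) (mf A A' f (X k)))"
    unfolding supn_def pdist_def
    proof (rule time_integral_bound[OF L2F_diff[OF b1] _ T_mem])
    show "AE w in M. \<forall>t\<in>{0..T}. J t w - J' t w = (LINT s:{0..t}|lborel. mf A A' f (X (Suc k)) s w - mf A A' f (X k) s w)"
    using JI(2) JI'(2) L2F_set_integrable[OF b1(1)] L2F_set_integrable[OF b1(2)]
    by eventually_elim (simp add: set_integral_diff)
    qed
    have II: "(\<integral>\<^sup>+w. supn (%t w. I t w - I' t w) w \<partial>M) \<le> ennreal (4 * pdist T (mf C C' g (X (Suc k))) (mf C C' g (X k)))"
    using doob[OF mart_diff[OF JI(4) JI'(4)]] ito_diff_isometry[OF JI(3) JI'(3) T_mem] by (simp add: vdist_def)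
    have "(\<integral>\<^sup>+w. supn (%t w. X (Suc (Suc k)) t w - X (Suc k) t w) w \<partial>M) =
    (\<integral>\<^sup>+w. supn (%t w. (J t w - J' t w) + (I t w - I' t w)) w \<partial>M)"
    by (simp add: JI(5) JI'(5) supn_def algebra_simps)
    also have "\<dots> \<le> 2 * (\<integral>\<^sup>+w. supn (%t w. J t w - J' t w) w \<partial>M) + 2 * (\<integral>\<^sup>+w. supn (%t w. I t w - I' t w) w \<partial>M)"
    by (intro supn_add_integral ac_diff JI(1) JI'(1) martD(1)[OF JI(4)] martD(1)[OF JI'(4)])
    also have "\<dots> \<le> ennreal 2 * ennreal (T * (a * pdist T (X (Suc k)) (X k))) + ennreal 2 * ennreal (4 * (b * pdist T (X (Suc k)) (X k)))"
    proof -
    have 1: "T * pdist T (mf A A' f (X (Suc k))) (mf A A' f (X k)) \<le> T * (a * pdist T (X (Suc k)) (X k))"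
    using a(2)[OF XL XL] T_pos by (intro mult_left_mono) auto
    have 2: "4 * pdist T (mf C C' g (X (Suc k))) (mf C C' g (X k)) \<le> 4 * (b * pdist T (X (Suc k)) (X k))"
    using b(2)[OF XL XL] by (intro mult_left_mono) auto
    show ?thesis
    using order_trans[OF JJ ennreal_leI[OF 1]] order_trans[OF II ennreal_leI[OF 2]]
    by (intro add_mono) (simp_all add: mult_left_mono)
    qed
    also have "\<dots> = ennreal (2 * (T * (a * pdist T (X (Suc k)) (X k))) + 2 * (4 * (b * pdist T (X (Suc k)) (X k))))"
    using T_pos a(1) b(1) pdist_nonneg[of T "X (Suc k)" "X k"] by (simp add: ennreal_mult)
    also have "2 * (T * (a * pdist T (X (Suc k)) (X k))) + 2 * (4 * (b * pdist T (X (Suc k)) (X k))) = Q * pdist T (X (Suc k)) (X k)"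
    by (simp add: Q_def algebra_simps)
    finally show ?thesis .
  qed
  have "(%k. (4 * (K * T)) ^ k / fact k) \<longlonglongrightarrow> 0"
    by (rule summable_LIMSEQ_zero) (use summable_exp[of "4 * (K * T)"] in \<open>simp add: field_simps\<close>)
  then have "Bseq (%k. (4 * (K * T)) ^ k / fact k)" by (rule convergentI[THEN convergent_imp_Bseq])
  then obtain m where m: "0 < m" "\<And>k. norm ((4 * (K * T)) ^ k / fact k) \<le> m" unfolding Bseq_def by blast
  define e where "e = Q * (T * (c * m))"
  have e0: "0 \<le> e" using Q T_pos c m by (simp add: e_def)
  have "(\<integral>\<^sup>+w. supn (%t w. X (Suc (Suc k)) t w - X (Suc k) t w) w \<partial>M) \<le> ennreal (e * (1/4)^k)" for k
  proof (rule order_trans[OF sb ennreal_leI])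
    have "(K * T)^k / fact k = ((4 * (K * T)) ^ k / fact k) * (1/4)^k"
    by (simp add: power_mult_distrib power_divide)
    also have "\<dots> \<le> m * (1/4)^k" using order_trans[OF abs_ge_self m(2)[of k, unfolded real_norm_def]] by (intro mult_right_mono) simp_all
    finally have "T * (c * ((K * T)^k / fact k)) \<le> T * (c * (m * (1/4)^k))"
    using T_pos c(1) by (intro mult_left_mono) auto
    then have "pdist T (X (Suc k)) (X k) \<le> T * (c * (m * (1/4)^k))" using pb[of k] by simp
    then have "Q * pdist T (X (Suc k)) (X k) \<le> Q * (T * (c * (m * (1/4)^k)))" using Q by (rule mult_left_mono)
    then show "Q * pdist T (X (Suc k)) (X k) \<le> e * (1/4)^k" by (simp add: e_def mult_ac)
  qed
  from continuous_limit[OF acS this e0]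
  obtain Y where Y: "ac Y" "(%k. \<integral>\<^sup>+w. supn (%t w. X (Suc k) t w - Y t w) w \<partial>M) \<longlonglongrightarrow> 0" by blast
  have fin: "(\<integral>\<^sup>+w. supn (X (Suc k)) w \<partial>M) < \<infinity>" for k
    using XL[of "Suc k"] by (simp add: L2FC_def supn_def)
  have YL: "Y \<in> L2FC M T W"
    by (rule ac_L2FC[OF Y(1) supn_limit_finite[OF acS Y fin]])
  note YF = L2FC_L2F[OF YL]
  obtain Y' where okY: "ok Y Y'" using okE[OF YL] by blast
  have ipY: "ito_process x (mf A A' f Y) (mf C C' g Y) Y'" using okY unfolding ok_def by blast
  have Y'L: "Y' \<in> L2FC M T W" by (rule okL[OF okY])
  have p0: "(%k. pdist T (X (Suc k)) Y) \<longlonglongrightarrow> 0"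
  proof (rule ennreal_tendsto_0D)
    have "(%k. ennreal T * (\<integral>\<^sup>+w. supn (%t w. X (Suc k) t w - Y t w) w \<partial>M)) \<longlonglongrightarrow> ennreal T * 0"
    by (rule ennreal_tendsto_cmult[OF _ Y(2)]) simp
    then have l: "(%k. ennreal T * (\<integral>\<^sup>+w. supn (%t w. X (Suc k) t w - Y t w) w \<partial>M)) \<longlonglongrightarrow> 0" by simp
    show "(%k. ennreal (pdist T (X (Suc k)) Y)) \<longlonglongrightarrow> 0"
    proof (rule tendsto_sandwich[OF _ _ tendsto_const l])
    show "\<forall>\<^sub>F k in sequentially. ennreal (pdist T (X (Suc k)) Y) \<le> ennreal T * (\<integral>\<^sup>+w. supn (%t w. X (Suc k) t w - Y t w) w \<partial>M)"
    by (intro always_eventually allI pdist_supn XF YF acS Y(1))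
    qed simp
  qed (rule pdist_nonneg)
  have "indistinguishable M T Y Y'"
  proof (rule indistinguishableI[OF YL Y'L])
    fix t assume t: "t \<in> {0..T}"
    have le: "vdist Y Y' t \<le> 2 * vdist (X (Suc (Suc k))) Y t + 2 * vdist (X (Suc (Suc k))) Y' t" for k
    proof -
    note s = L2FC_sqi[OF XL[of "Suc (Suc k)"] t] L2FC_sqi[OF YL t] L2FC_sqi[OF Y'L t]
    note i = sqi_integrable[OF sqi_diff[OF s(1,2)]] sqi_integrable[OF sqi_diff[OF s(1,3)]]
    have "vdist Y Y' t \<le> (LINT w|M. 2 * (norm (X (Suc (Suc k)) t w - Y t w))\<^sup>2 + 2 * (norm (X (Suc (Suc k)) t w - Y' t w))\<^sup>2)"
    unfolding vdist_def
    proof (rule integral_mono[OF sqi_integrable[OF sqi_diff[OF s(2,3)]]])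
    fix w
    show "(norm (Y t w - Y' t w))\<^sup>2 \<le> 2 * (norm (X (Suc (Suc k)) t w - Y t w))\<^sup>2 + 2 * (norm (X (Suc (Suc k)) t w - Y' t w))\<^sup>2"
    using norm_diff_square_le[of "X (Suc (Suc k)) t w - Y' t w" "X (Suc (Suc k)) t w - Y t w"] by simp
    qed (use i in simp)
    also have "\<dots> = 2 * vdist (X (Suc (Suc k))) Y t + 2 * vdist (X (Suc (Suc k))) Y' t"
    unfolding vdist_def using i by simp
    finally show ?thesis .
    qed
    have l1: "(%k. vdist (X (Suc k)) Y t) \<longlonglongrightarrow> 0"
    proof (rule ennreal_tendsto_0D)
    show "(%k. ennreal (vdist (X (Suc k)) Y t)) \<longlonglongrightarrow> 0"
    unfolding vdist_def sqi_nn_integral[OF sqi_diff[OF L2FC_sqi[OF XL t] L2FC_sqi[OF YL t]], symmetric]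
    proof (rule tendsto_sandwich[OF _ _ tendsto_const Y(2)])
    show "\<forall>\<^sub>F k in sequentially. (\<integral>\<^sup>+w. ennreal ((norm (X (Suc k) t w - Y t w))\<^sup>2) \<partial>M) \<le> (\<integral>\<^sup>+w. supn (%t w. X (Suc k) t w - Y t w) w \<partial>M)"
    by (intro always_eventually allI nn_integral_mono supn_upper[OF t, of "%t w. X (Suc _) t w - Y t w"])
    qed simp
    qed (simp add: vdist_def)
    have l2: "(%k. vdist (X (Suc (Suc k))) Y' t) \<longlonglongrightarrow> 0"
    proof (rule tendsto_sandwich[OF _ _ tendsto_const tendsto_mult_right_zero[OF p0, of K]])
    show "\<forall>\<^sub>F k in sequentially. vdist (X (Suc (Suc k))) Y' t \<le> K * pdist T (X (Suc k)) Y"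
    proof (intro always_eventually allI)
    fix k
    show "vdist (X (Suc (Suc k))) Y' t \<le> K * pdist T (X (Suc k)) Y"
    by (rule order_trans[OF Kb[OF XL YL ip ipY t] mult_left_mono[OF pdist_mono[OF XF YF t] K]])
    qed
    qed (simp add: vdist_def)
    have "(%k. 2 * vdist (X (Suc (Suc k))) Y t + 2 * vdist (X (Suc (Suc k))) Y' t) \<longlonglongrightarrow> 2 * 0 + 2 * 0"
    by (intro tendsto_intros l2 LIMSEQ_Suc[OF l1])
    then have "vdist Y Y' t \<le> 2 * 0 + 2 * 0" by (rule LIMSEQ_le_const) (use le in blast)
    then show "AE w in M. Y t w = Y' t w" by (intro vdist_0_imp[OF YL Y'L t]) simp
  qed
  then have ae: "AE w in M. \<forall>t\<in>{0..T}. Y t w = Y' t w" by (simp add: indistinguishable_def)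
  obtain I where I: "has_ito_integral M T W (mf C C' g Y) I"
    "AE w in M. \<forall>t\<in>{0..T}. Y' t w = x + (LINT s:{0..t}|lborel. mf A A' f Y s w) + I t w"
    using ipY unfolding ito_process_def by blast
  have "AE w in M. \<forall>t\<in>{0..T}. Y t w = x + (LINT s:{0..t}|lborel. mf A A' f Y s w) + I t w"
    using ae I(2) by eventually_elim simp
  then show ?thesis unfolding solves_sde_def using YL I(1) by blast
qed

end

end

section \<open>Second moments\<close>

context bm_space
begin

lemma L2F_of_const_time:
  fixes Y :: "'w => 'a::euclidean_space"
  assumes Y: "sqi M Y"
  shows "sqi (PM t) (%z. Y (snd z))"
proof -
  interpret PM: pair_sigma_finite "lam t" M by (rule pair_sigma_finite_PM)
  have [measurable]: "Y \<in> borel_measurable M" by (rule sqi_measurable[OF Y])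
  have "(\<integral>\<^sup>+z. ennreal ((norm (Y (snd z)))\<^sup>2) \<partial>PM t) = (\<integral>\<^sup>+s. (\<integral>\<^sup>+h. ennreal ((norm (Y h))\<^sup>2) \<partial>M) \<partial>lam t)"
    by (subst nn_integral_fst[symmetric]) simp_all
  also have "\<dots> < \<infinity>"
    using Y emeasure_lborel_Icc_eq[of 0 t]
    by (simp add: sqi_nn_integral ennreal_mult_less_top space_restrict_space emeasure_restrict_space)
  finally show ?thesis by (simp add: sqi_nn_iff)
qed

lemma ito_mean_zero:
  fixes Z :: "real => 'w => 'a::euclidean_space"
  assumes I: "has_ito_integral M T W Z I" and t: "t \<in> {0..T}"
  shows "(LINT h|M. c \<bullet> I t h) = 0" "(LINT h|M. I t h) = 0"
proof -
  have z0: "0 \<in> {0..T}" using T_pos by simp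
  have "(LINT h|M. I 0 h \<bullet> I 0 h) = (LINT s:{0..0}|lborel. (LINT h|M. Z s h \<bullet> Z s h))"
    unfolding ito_isometry[OF I I bounded_linear_ident z0]
    by (rule integral_PM(1)[where F="%s h. Z s h \<bullet> Z s h"]) (intro integrable_inner_sqi L2F_sqi has_itoD(2)[OF I] z0)
  also have "\<dots> = 0"
    unfolding set_lebesgue_integral_def
    by (rule integral_eq_zero_AE) (use AE_lborel_singleton[of "0::real"] in \<open>eventually_elim, auto\<close>)
  finally have "AE h in M. I 0 h = 0"
    by (subst (asm) integral_nonneg_eq_0_iff_AE[OF integrable_inner_sqi[OF has_itoD(4)[OF I z0] has_itoD(4)[OF I z0]]]) auto
  then have I0: "(LINT h|M. c \<bullet> I 0 h) = 0" for c by (intro integral_eq_zero_AE) auto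
  show c: "(LINT h|M. c \<bullet> I t h) = 0" for c
    using ito_martingale[OF I, of 0 t "%_. c"] t I0[of c] by (simp add: sqi_const finite_measure_axioms)
  have "(LINT h|M. I t h) \<bullet> (LINT h|M. I t h) = 0"
    using c[of "\<integral>h. I t h \<partial>M"] sqi_integrable_finite[OF has_itoD(4)[OF I t]] by simp
  then show "(LINT h|M. I t h) = 0" by simp
qed

definition ito_repr :: "'a::euclidean_space => (real => 'w => 'a) => (real => 'w => 'a) => (real => 'w => 'a) => (real => 'w => 'a) => bool" where
  "ito_repr x b Z I X \<longleftrightarrow> b \<in> L2F M T W \<and> X \<in> L2F M T W \<and> (\<forall>t\<in>{0..T}. sqi M (X t)) \<and> has_ito_integral M T W Z I \<and>
    (AE h in M. \<forall>t\<in>{0..T}. X t h = x + (LINT s:{0..t}|lborel. b s h) + I t h)"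

lemma cross_moment:
  fixes N :: "real^'n^'n"
  assumes X: "ito_repr x b Z I X" and t: "t \<in> {0..T}"
  shows "(LINT h|M. (N *v (X t h - I t h)) \<bullet> I t h) = (LINT s:{0..t}|lborel. (LINT h|M. (N *v b s h) \<bullet> I s h))"
proof -
  have b: "b \<in> L2F M T W" and I: "has_ito_integral M T W Z I" and XL: "\<And>t. t \<in> {0..T} ==> sqi M (X t)"
    and ae: "AE h in M. \<forall>t\<in>{0..T}. X t h = x + (LINT s:{0..t}|lborel. b s h) + I t h"
    using X unfolding ito_repr_def by blast+
  note sI = has_itoD(4)[OF I]
  have Nb: "(%s h. N *v b s h) \<in> L2F M T W" by (rule L2F_matrix[OF continuous_on_const b])
  have i: "integrable (PM t) (%z. (N *v b (fst z) (snd z)) \<bullet> I t (snd z))"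
    by (rule integrable_inner_sqi[OF L2F_sqi[OF Nb t] L2F_of_const_time[OF sI[OF t]]])
  note f = integral_PM[where F="%s h. (N *v b s h) \<bullet> I t h", OF i]
  have iX: "integrable M (%h. (N *v (X t h - I t h)) \<bullet> I t h)"
    by (intro integrable_inner_sqi sqi_bounded_linear[OF mv.bounded_linear_right] sqi_diff XL sI t)
  have ic: "integrable M (%h. (N *v x) \<bullet> I t h)"
    by (rule integrable_inner_sqi[OF sqi_const sI[OF t]]) unfold_locales
  have "(LINT h|M. (N *v (X t h - I t h)) \<bullet> I t h) = (LINT h|M. (N *v x) \<bullet> I t h + (LINT s:{0..t}|lborel. (N *v b s h) \<bullet> I t h))"
  proof (rule integral_cong_AE)
    show "AE h in M. (N *v (X t h - I t h)) \<bullet> I t h = (N *v x) \<bullet> I t h + (LINT s:{0..t}|lborel. (N *v b s h) \<bullet> I t h)"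
    using ae L2F_set_integrable[OF b]
    proof eventually_elim
    case (elim h)
    have si: "set_integrable lborel {0..t} (%s. b s h)" using elim t by blast
    have "(LINT s:{0..t}|lborel. (N *v b s h) \<bullet> I t h) = (N *v (LINT s:{0..t}|lborel. b s h)) \<bullet> I t h"
    proof -
    have bl: "bounded_linear (%y. (N *v y) \<bullet> I t h)"
    by (rule bounded_linear_compose[OF bounded_linear_inner_left mv.bounded_linear_right])
    show ?thesis
    using integral_bounded_linear[OF bl, of lborel "%s. indicat_real {0..t} s *\<^sub>R b s h"] si
    by (simp add: set_lebesgue_integral_def set_integrable_def mv.scaleR_right)
    qed
    then show ?case using elim t by (simp add: mv.add_right inner_add_left)
    qed
  qed (use iX ic f(4) in \<open>auto dest: borel_measurable_integrable\<close>)
  also have "\<dots> = (LINT h|M. (LINT s:{0..t}|lborel. (N *v b s h) \<bullet> I t h))"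
    using ito_mean_zero(1)[OF I t] ic f(4) by simp
  also have "\<dots> = (LINT s:{0..t}|lborel. (LINT h|M. (N *v b s h) \<bullet> I t h))" using f(1,2) by simp
  also have "\<dots> = (LINT s:{0..t}|lborel. (LINT h|M. (N *v b s h) \<bullet> I s h))"
  proof -
    have "AE s in lam T. (LINT h|M. (N *v b s h) \<bullet> I (max s t) h) = (LINT h|M. (N *v b s h) \<bullet> I s h)"
    using L2F_AE_sqi(1)[OF Nb] AE_space
    proof eventually_elim
    case (elim s)
    then have s: "0 \<le> s" "s \<le> T" by (auto simp: space_restrict_space)
    show ?case
    by (rule ito_martingale[OF I s(1) _ _ progressiveD(3)[OF L2F_progressive[OF Nb]] elim(1)]) (use s t in auto)
    qed
    then have "AE s in lborel. s \<in> {0..T} \<longrightarrow> (LINT h|M. (N *v b s h) \<bullet> I (max s t) h) = (LINT h|M. (N *v b s h) \<bullet> I s h)"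
    by (subst (asm) AE_restrict_space_iff) auto
    then have "AE s in lborel. s \<in> {0..t} \<longrightarrow> (LINT h|M. (N *v b s h) \<bullet> I t h) = (LINT h|M. (N *v b s h) \<bullet> I s h)"
    by eventually_elim (use t in \<open>auto simp: max_def\<close>)
    moreover have "(%s. indicator {0..t} s *\<^sub>R (LINT h|M. (N *v b s h) \<bullet> I s h)) \<in> borel_measurable lborel"
    using integral_PM(3)[where F="%s h. (N *v b s h) \<bullet> I s h", of t]
    integrable_inner_sqi[OF L2F_sqi[OF Nb t] L2F_sqi[OF L2FC_L2F[OF has_itoD(3)[OF I]] t]]
    unfolding set_integrable_def by (auto dest: borel_measurable_integrable)
    moreover have "(%s. indicator {0..t} s *\<^sub>R (LINT h|M. (N *v b s h) \<bullet> I t h)) \<in> borel_measurable lborel"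
    using f(3) unfolding set_integrable_def by (auto dest: borel_measurable_integrable)
    ultimately show ?thesis
    unfolding set_lebesgue_integral_def by (intro integral_cong_AE) (auto elim!: eventually_mono simp: indicator_def)
  qed
  finally show ?thesis .
qed

lemma second_moment:
  fixes N :: "real^'n^'n"
  assumes X: "ito_repr x b Z I X" and t: "t \<in> {0..T}"
  shows "(LINT h|M. (N *v X t h) \<bullet> X t h) = (N *v x) \<bullet> x +
    (LINT s:{0..t}|lborel. (LINT h|M. (N *v b s h) \<bullet> X s h) + (LINT h|M. (N *v X s h) \<bullet> b s h) + (LINT h|M. (N *v Z s h) \<bullet> Z s h))"
proof -
  have b: "b \<in> L2F M T W" and XF: "X \<in> L2F M T W" and I: "has_ito_integral M T W Z I" and XL: "\<And>t. t \<in> {0..T} ==> sqi M (X t)"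
    and ae: "AE h in M. \<forall>t\<in>{0..T}. X t h = x + (LINT s:{0..t}|lborel. b s h) + I t h"
    using X unfolding ito_repr_def by blast+
  note sI = has_itoD(4)[OF I] and IF = L2FC_L2F[OF has_itoD(3)[OF I]] and ZF = has_itoD(2)[OF I]
  define U where "U s h = X s h - I s h" for s h
  have UF: "U \<in> L2F M T W" unfolding U_def[abs_def] by (rule L2F_diff[OF XF IF])
  have sU: "sqi M (U s)" if "s \<in> {0..T}" for s unfolding U_def[abs_def] by (intro sqi_diff XL sI that)
  have mat: "(%s h. N *v \<phi> s h) \<in> L2F M T W" if "\<phi> \<in> L2F M T W" for N :: "real^'n^'n" and \<phi> :: "real => 'w => real^'n"
    by (rule L2F_matrix[OF continuous_on_const that])
  have iP: "integrable (PM t) (%z. (N *v \<phi> (fst z) (snd z)) \<bullet> \<psi> (fst z) (snd z))"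
    if "\<phi> \<in> L2F M T W" "\<psi> \<in> L2F M T W" for N :: "real^'n^'n" and \<phi> \<psi> :: "real => 'w => real^'n"
    by (rule integrable_inner_sqi[OF L2F_sqi[OF mat[OF that(1)] t] L2F_sqi[OF that(2) t]])
  note f = integral_PM[where F="%s h. (N *v \<phi> s h) \<bullet> \<psi> s h" for N \<phi> \<psi>, OF iP]
  have iM: "integrable M (%h. (N *v Y h) \<bullet> Y' h)" if "sqi M Y" "sqi M Y'" for N :: "real^'n^'n" and Y Y' :: "'w => real^'n"
    by (intro integrable_inner_sqi sqi_bounded_linear[OF mv.bounded_linear_right] that)
  have UU: "AE h in M. (N *v U t h) \<bullet> U t h = (N *v x) \<bullet> x +
    ((LINT s:{0..t}|lborel. (N *v b s h) \<bullet> U s h) + (LINT s:{0..t}|lborel. (N *v U s h) \<bullet> b s h))"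
    using ae L2F_set_integrable[OF b]
  proof eventually_elim
    case (elim h)
    have si: "set_integrable lborel {0..s} (%s. b s h)" if "s \<in> {0..T}" for s using elim that by blast
    define F where "F s = (LINT r:{0..s}|lborel. b r h)" for s
    have Ueq: "U s h = x + F s" if "s \<in> {0..T}" for s using elim that by (simp add: U_def F_def)
    have NF: "(LINT r:{0..s}|lborel. N *v b r h) = N *v F s" "set_integrable lborel {0..s} (%s. N *v b s h)" if s: "s \<in> {0..T}" for s
    proof -
    show "set_integrable lborel {0..s} (%s. N *v b s h)"
    using integrable_bounded_linear[OF mv.bounded_linear_right[of N] si[OF s, unfolded set_integrable_def]]
    by (simp add: set_integrable_def mv.scaleR_right)
    show "(LINT r:{0..s}|lborel. N *v b r h) = N *v F s"
    using integral_bounded_linear[OF mv.bounded_linear_right[of N] si[OF s, unfolded set_integrable_def]]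
    by (simp add: set_lebesgue_integral_def F_def mv.scaleR_right)
    qed
    have tr1: "set_integrable lborel {0..t} (%s. (N *v b s h) \<bullet> F s)"
    using inner_integral_triangle(1)[OF NF(2)[OF t] si[OF t]] by (simp add: F_def)
    have tr1': "set_integrable lborel {0..t} (%s. b s h \<bullet> (LINT r:{0..s}|lborel. N *v b r h))"
    by (rule inner_integral_triangle(1)[OF si[OF t] NF(2)[OF t]])
    have tr2': "set_integrable lborel {0..t} (%s. (N *v F s) \<bullet> b s h)"
    proof (rule set_integrable_cong[THEN iffD1, OF refl refl _ tr1'])
    show "b s h \<bullet> (LINT r:{0..s}|lborel. N *v b r h) = (N *v F s) \<bullet> b s h" if "s \<in> {0..t}" for s
    using NF(1)[of s] that t by (simp add: inner_commute)
    qed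
    have c1: "set_integrable lborel {0..t} (%s. (N *v b s h) \<bullet> x)" "(LINT s:{0..t}|lborel. (N *v b s h) \<bullet> x) = (N *v F t) \<bullet> x"
    using NF[OF t] integral_bounded_linear[OF bounded_linear_inner_left[of x] NF(2)[OF t, unfolded set_integrable_def]]
    integrable_bounded_linear[OF bounded_linear_inner_left[of x] NF(2)[OF t, unfolded set_integrable_def]]
    by (simp_all add: set_lebesgue_integral_def set_integrable_def)
    have c2: "set_integrable lborel {0..t} (%s. (N *v x) \<bullet> b s h)" "(LINT s:{0..t}|lborel. (N *v x) \<bullet> b s h) = (N *v x) \<bullet> F t"
    using integral_bounded_linear[OF bounded_linear_inner_right[of "N *v x"] si[OF t, unfolded set_integrable_def]]
    integrable_bounded_linear[OF bounded_linear_inner_right[of "N *v x"] si[OF t, unfolded set_integrable_def]]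
    by (simp_all add: set_lebesgue_integral_def set_integrable_def F_def)
    have e1: "(LINT s:{0..t}|lborel. (N *v b s h) \<bullet> U s h) = (LINT s:{0..t}|lborel. (N *v b s h) \<bullet> x + (N *v b s h) \<bullet> F s)"
    by (rule set_lebesgue_integral_cong) (use Ueq t in \<open>auto simp: inner_add_right\<close>)
    have e2: "(LINT s:{0..t}|lborel. (N *v U s h) \<bullet> b s h) = (LINT s:{0..t}|lborel. (N *v x) \<bullet> b s h + (N *v F s) \<bullet> b s h)"
    by (rule set_lebesgue_integral_cong) (use Ueq t in \<open>auto simp: mv.add_right inner_add_left\<close>)
    have "(N *v F t) \<bullet> F t = (LINT s:{0..t}|lborel. (N *v b s h) \<bullet> F s + (LINT r:{0..s}|lborel. N *v b r h) \<bullet> b s h)"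
    using inner_integral_triangle(2)[OF NF(2)[OF t] si[OF t]] NF(1)[OF t] by (simp add: F_def)
    also have "\<dots> = (LINT s:{0..t}|lborel. (N *v b s h) \<bullet> F s + (N *v F s) \<bullet> b s h)"
    by (rule set_lebesgue_integral_cong) (use NF(1) t in auto)
    also have "\<dots> = (LINT s:{0..t}|lborel. (N *v b s h) \<bullet> F s) + (LINT s:{0..t}|lborel. (N *v F s) \<bullet> b s h)"
    by (rule set_integral_add(2)[OF tr1 tr2'])
    finally have FF: "(N *v F t) \<bullet> F t = (LINT s:{0..t}|lborel. (N *v b s h) \<bullet> F s) + (LINT s:{0..t}|lborel. (N *v F s) \<bullet> b s h)" .
    show ?case
    unfolding e1 e2 set_integral_add(2)[OF c1(1) tr1] set_integral_add(2)[OF c2(1) tr2'] c1(2) c2(2) Ueq[OF t]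
    using FF by (simp add: mv.add_right inner_add_left inner_add_right)
  qed
  have E1: "(LINT h|M. (N *v U t h) \<bullet> U t h) = (N *v x) \<bullet> x +
    ((LINT s:{0..t}|lborel. (LINT h|M. (N *v b s h) \<bullet> U s h)) + (LINT s:{0..t}|lborel. (LINT h|M. (N *v U s h) \<bullet> b s h)))"
  proof -
    have "(LINT h|M. (N *v U t h) \<bullet> U t h) = (LINT h|M. (N *v x) \<bullet> x +
    ((LINT s:{0..t}|lborel. (N *v b s h) \<bullet> U s h) + (LINT s:{0..t}|lborel. (N *v U s h) \<bullet> b s h)))"
    by (rule integral_cong_AE[OF _ _ UU])
    (use iM[OF sU[OF t] sU[OF t]] f(4)[OF b UF] f(4)[OF UF b] in \<open>auto dest: borel_measurable_integrable\<close>)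
    also have "\<dots> = (N *v x) \<bullet> x + ((LINT h|M. (LINT s:{0..t}|lborel. (N *v b s h) \<bullet> U s h)) + (LINT h|M. (LINT s:{0..t}|lborel. (N *v U s h) \<bullet> b s h)))"
    using f(4)[OF b UF, of N] f(4)[OF UF b, of N] by (simp add: prob_space)
    finally show ?thesis using f(1,2)[OF b UF, of N] f(1,2)[OF UF b, of N] by simp
  qed
  have E2: "(LINT h|M. (N *v U t h) \<bullet> I t h) = (LINT s:{0..t}|lborel. (LINT h|M. (N *v b s h) \<bullet> I s h))" for N
    unfolding U_def by (rule cross_moment[OF X t])
  have flip: "(N *v v) \<bullet> w = (transpose N *v w) \<bullet> v" for v w by (metis inner_commute inner_transpose)
  have E3: "(LINT h|M. (N *v I t h) \<bullet> U t h) = (LINT s:{0..t}|lborel. (LINT h|M. (N *v I s h) \<bullet> b s h))"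
    unfolding flip[of "I _ _"] by (rule E2)
  have E4: "(LINT h|M. (N *v I t h) \<bullet> I t h) = (LINT s:{0..t}|lborel. (LINT h|M. (N *v Z s h) \<bullet> Z s h))"
    unfolding ito_isometry[OF I I mv.bounded_linear_right t] using f(1)[OF ZF ZF, of N] .
  have "(LINT h|M. (N *v X t h) \<bullet> X t h) = (LINT h|M. (N *v U t h) \<bullet> U t h + (N *v U t h) \<bullet> I t h + (N *v I t h) \<bullet> U t h + (N *v I t h) \<bullet> I t h)"
    by (intro Bochner_Integration.integral_cong refl)
    (simp add: U_def mv.diff_right inner_diff_left inner_diff_right)
  also have "\<dots> = (LINT h|M. (N *v U t h) \<bullet> U t h) + (LINT h|M. (N *v U t h) \<bullet> I t h) + (LINT h|M. (N *v I t h) \<bullet> U t h) + (LINT h|M. (N *v I t h) \<bullet> I t h)"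
    using iM sU[OF t] sI[OF t] by simp
  also have "\<dots> = (N *v x) \<bullet> x +
    ((LINT s:{0..t}|lborel. (LINT h|M. (N *v b s h) \<bullet> U s h)) + (LINT s:{0..t}|lborel. (LINT h|M. (N *v b s h) \<bullet> I s h))) +
    ((LINT s:{0..t}|lborel. (LINT h|M. (N *v U s h) \<bullet> b s h)) + (LINT s:{0..t}|lborel. (LINT h|M. (N *v I s h) \<bullet> b s h))) +
    (LINT s:{0..t}|lborel. (LINT h|M. (N *v Z s h) \<bullet> Z s h))"
    unfolding E1 E2 E3 E4 by simp
  also have "(LINT s:{0..t}|lborel. (LINT h|M. (N *v b s h) \<bullet> U s h)) + (LINT s:{0..t}|lborel. (LINT h|M. (N *v b s h) \<bullet> I s h)) =
    (LINT s:{0..t}|lborel. (LINT h|M. (N *v b s h) \<bullet> X s h))"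
    unfolding f(1)[OF b UF, symmetric] f(1)[OF b IF, symmetric] f(1)[OF b XF, symmetric]
    by (subst Bochner_Integration.integral_add[symmetric, OF iP[OF b UF] iP[OF b IF]]) (simp add: U_def inner_diff_right)
  also have "(LINT s:{0..t}|lborel. (LINT h|M. (N *v U s h) \<bullet> b s h)) + (LINT s:{0..t}|lborel. (LINT h|M. (N *v I s h) \<bullet> b s h)) =
    (LINT s:{0..t}|lborel. (LINT h|M. (N *v X s h) \<bullet> b s h))"
    unfolding f(1)[OF UF b, symmetric] f(1)[OF IF b, symmetric] f(1)[OF XF b, symmetric]
    by (subst Bochner_Integration.integral_add[symmetric, OF iP[OF UF b] iP[OF IF b]]) (simp add: U_def mv.diff_right inner_diff_left)
  finally show ?thesis
    using f(3)[OF b XF, of N] f(3)[OF XF b, of N] f(3)[OF ZF ZF, of N] by (simp add: set_integral_add)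
qed

end

lemma LINT_vector_derivative:
  fixes f :: "real => 'a::euclidean_space"
  assumes d: "\<And>s. s \<in> {0..T} ==> (f has_vector_derivative f' s) (at s within {0..T})"
    and c: "continuous_on {0..T} f'" and t: "t \<in> {0..T}"
  shows "f t = f 0 + (LINT s:{0..t}|lborel. f' s)"
proof -
  have ct: "continuous_on {0..t} f'" using t by (auto intro: continuous_on_subset[OF c])
  have i: "set_integrable lborel {0..t} f'" by (rule borel_integrable_atLeastAtMost'[OF ct])
  have "(f' has_integral f t - f 0) {0..t}"
  proof (rule fundamental_theorem_of_calculus)
    show "(f has_vector_derivative f' s) (at s within {0..t})" if "s \<in> {0..t}" for s
    using that t by (intro has_vector_derivative_within_subset[OF d]) auto
  qed (use t in auto)
  then show ?thesis using set_borel_integral_eq_integral(2)[OF i] by (simp add: integral_unique)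
qed

context bm_space
begin

lemma integrable_PM_quadratic:
  fixes N :: "real => real^'n^'m"
  assumes "continuous_on {0..T} N" "\<phi> \<in> L2F M T W" "\<psi> \<in> L2F M T W"
  shows "integrable (PM T) (%z. (N (fst z) *v \<phi> (fst z) (snd z)) \<bullet> \<psi> (fst z) (snd z))"
proof -
  have TT: "T \<in> {0..T}" using T_pos by simp
  show ?thesis by (rule integrable_inner_sqi[OF L2F_sqi[OF L2F_matrix[OF assms(1,2)] TT] L2F_sqi[OF assms(3) TT]])
qed

lemma scaled_moment:
  fixes N :: "real^'n^'n" and p p' :: "real => real"
  assumes X: "ito_repr x b Z I X"
    and d: "\<And>s. s \<in> {0..T} ==> (p has_vector_derivative p' s) (at s within {0..T})"
    and c: "continuous_on {0..T} p'"
  shows "p T * (LINT h|M. (N *v X T h) \<bullet> X T h) = p 0 * ((N *v x) \<bullet> x) +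
    (LINT z|PM T. p' (fst z) * ((N *v X (fst z) (snd z)) \<bullet> X (fst z) (snd z)) + p (fst z) * ((N *v b (fst z) (snd z)) \<bullet> X (fst z) (snd z)
    + (N *v X (fst z) (snd z)) \<bullet> b (fst z) (snd z) + (N *v Z (fst z) (snd z)) \<bullet> Z (fst z) (snd z)))"
proof -
  have TT: "T \<in> {0..T}" using T_pos by simp
  have b: "b \<in> L2F M T W" and XF: "X \<in> L2F M T W" and I: "has_ito_integral M T W Z I" and XL: "\<And>t. t \<in> {0..T} ==> sqi M (X t)"
    using X unfolding ito_repr_def by auto
  note ZF = has_itoD(2)[OF I]
  define V where "V t = (LINT h|M. (N *v X t h) \<bullet> X t h)" for t
  define w where "w s = (LINT h|M. (N *v b s h) \<bullet> X s h) + (LINT h|M. (N *v X s h) \<bullet> b s h) + (LINT h|M. (N *v Z s h) \<bullet> Z s h)" for s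
  define a where "a = (N *v x) \<bullet> x"
  define F where "F s h = p' s * ((N *v X s h) \<bullet> X s h) + p s * ((N *v b s h) \<bullet> X s h
    + (N *v X s h) \<bullet> b s h + (N *v Z s h) \<bullet> Z s h)" for s h
  have Vt: "V t = a + (LINT s:{0..t}|lborel. w s)" if "t \<in> {0..T}" for t
    unfolding V_def w_def a_def by (rule second_moment[OF X that])
  have pt: "p t = p 0 + (LINT s:{0..t}|lborel. p' s)" if "t \<in> {0..T}" for t
    by (rule LINT_vector_derivative[OF d c that])
  have pc: "continuous_on {0..T} p"
    by (rule continuous_on_vector_derivative) (rule d)
  have iN: "integrable (PM T) (%z. (N *v \<phi> (fst z) (snd z)) \<bullet> \<psi> (fst z) (snd z))"
    if "\<phi> \<in> L2F M T W" "\<psi> \<in> L2F M T W" for \<phi> \<psi>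
    using integrable_PM_quadratic[OF continuous_on_const that] .
  have "set_integrable lborel {0..T} (%s. \<integral>h. (N *v \<phi> s h) \<bullet> \<psi> s h \<partial>M)"
    if "\<phi> \<in> L2F M T W" "\<psi> \<in> L2F M T W" for \<phi> \<psi>
    by (rule integral_PM(3)[where F="%s h. (N *v \<phi> s h) \<bullet> \<psi> s h", OF iN[OF that]])
  from this[OF b XF] this[OF XF b] this[OF ZF ZF]
  have iw: "set_integrable lborel {0..T} w" unfolding w_def by (intro set_integral_add)
  have ip: "set_integrable lborel {0..T} p'" by (rule borel_integrable_atLeastAtMost'[OF c])
  have iF: "integrable (PM T) (%z. F (fst z) (snd z))"
  proof -
    have s: "integrable (PM T) (%z. q (fst z) * ((N *v \<phi> (fst z) (snd z)) \<bullet> \<psi> (fst z) (snd z)))"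
    if q: "continuous_on {0..T} q" and "\<phi> \<in> L2F M T W" "\<psi> \<in> L2F M T W" for q \<phi> \<psi>
    proof -
    have "continuous_on {0..T} (%s. q s *\<^sub>R N)" using q by (intro continuous_intros)
    from integrable_PM_quadratic[OF this that(2,3)] show ?thesis by (simp add: scaleR_matrix_vector_assoc[symmetric])
    qed
    show ?thesis unfolding F_def distrib_left
    by (intro Bochner_Integration.integrable_add s c pc XF b ZF)
  qed
  have aeF: "AE s in lam T. p' s * V s + p s * w s = (LINT h|M. F s h)"
    using L2F_AE_sqi(1)[OF b] L2F_AE_sqi(1)[OF ZF] AE_space
  proof eventually_elim
    case (elim s)
    then have s: "s \<in> {0..T}" by (simp add: space_restrict_space)
    have j: "integrable M (%h. (N *v f h) \<bullet> g h)" if "sqi M f" "sqi M g" for f g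
    by (rule integrable_inner_sqi[OF sqi_bounded_linear[OF mv.bounded_linear_right that(1)] that(2)])
    note jj = j[OF XL[OF s] XL[OF s]] j[OF elim(1) XL[OF s]] j[OF XL[OF s] elim(1)] j[OF elim(2,2)]
    show ?case using jj by (simp add: V_def w_def F_def)
  qed
  have tri: "set_integrable lborel {0..T} (%s. p' s * (LINT r:{0..s}|lborel. w r))"
    "set_integrable lborel {0..T} (%s. (LINT r:{0..s}|lborel. p' r) * w s)"
    "(LINT s:{0..T}|lborel. p' s) * (LINT s:{0..T}|lborel. w s) =
    (LINT s:{0..T}|lborel. p' s * (LINT r:{0..s}|lborel. w r) + (LINT r:{0..s}|lborel. p' r) * w s)"
    using inner_integral_triangle(1)[OF ip iw] inner_integral_triangle(1)[OF iw ip] inner_integral_triangle(2)[OF ip iw]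
    by (simp_all add: mult.commute)
  have sm: "set_integrable lborel {0..T} (%s. p' s * a)" "set_integrable lborel {0..T} (%s. p 0 * w s)"
    using ip iw by simp_all
  have pw: "(p' s * a + p 0 * w s) + (p' s * (LINT r:{0..s}|lborel. w r) + (LINT r:{0..s}|lborel. p' r) * w s) = p' s * V s + p s * w s"
    if s: "s \<in> {0..T}" for s
    unfolding pt[OF s] Vt[OF s] by (simp add: algebra_simps)
  have "p T * V T = p 0 * a + ((LINT s:{0..T}|lborel. p' s * a) + (LINT s:{0..T}|lborel. p 0 * w s)
    + (LINT s:{0..T}|lborel. p' s) * (LINT s:{0..T}|lborel. w s))"
    unfolding pt[OF TT] Vt[OF TT] by (simp add: algebra_simps)
  also have "\<dots> = p 0 * a + (LINT s:{0..T}|lborel. (p' s * a + p 0 * w s) + (p' s * (LINT r:{0..s}|lborel. w r) + (LINT r:{0..s}|lborel. p' r) * w s))"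
    unfolding tri(3) using sm tri(1,2) by (simp add: set_integral_add)
  also have "(LINT s:{0..T}|lborel. (p' s * a + p 0 * w s) + (p' s * (LINT r:{0..s}|lborel. w r) + (LINT r:{0..s}|lborel. p' r) * w s))
    = (LINT s:{0..T}|lborel. p' s * V s + p s * w s)"
    by (rule set_lebesgue_integral_cong) (simp, intro allI impI, rule pw)
  also have "\<dots> = (LINT s|lam T. (LINT h|M. F s h))"
    unfolding set_integral_lam
  proof (rule integral_cong_AE[OF _ _ aeF])
    have "set_integrable lborel {0..T} (%s. (p' s * a + p 0 * w s) + (p' s * (LINT r:{0..s}|lborel. w r) + (LINT r:{0..s}|lborel. p' r) * w s))"
    using sm tri(1,2) by (intro set_integral_add(1))
    then have "set_integrable lborel {0..T} (%s. p' s * V s + p s * w s)"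
    unfolding set_integrable_def by (rule Bochner_Integration.integrable_cong[THEN iffD1, OF refl, rotated]) (simp add: indicator_def pw)
    then show "(%s. p' s * V s + p s * w s) \<in> borel_measurable (lam T)"
    by (simp add: set_integrable_lam borel_measurable_integrable)
    show "(%s. \<integral>h. F s h \<partial>M) \<in> borel_measurable (lam T)"
    using integral_PM(3)[OF iF] by (simp add: set_integrable_lam borel_measurable_integrable)
  qed
  also have "\<dots> = (LINT z|PM T. F (fst z) (snd z))"
    unfolding integral_PM(1)[OF iF] set_integral_lam ..
  finally show ?thesis unfolding V_def a_def F_def .
qed

lemma quad_formula:
  fixes P P' :: "real => real^'n^'n"
  assumes X: "ito_repr x b Z I X"
    and d: "\<And>s. s \<in> {0..T} ==> (P has_vector_derivative P' s) (at s within {0..T})"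
    and c: "continuous_on {0..T} P'"
  shows "(LINT h|M. (P T *v X T h) \<bullet> X T h) = (P 0 *v x) \<bullet> x +
    (LINT z|PM T. (P' (fst z) *v X (fst z) (snd z)) \<bullet> X (fst z) (snd z) + (P (fst z) *v b (fst z) (snd z)) \<bullet> X (fst z) (snd z)
    + (P (fst z) *v X (fst z) (snd z)) \<bullet> b (fst z) (snd z) + (P (fst z) *v Z (fst z) (snd z)) \<bullet> Z (fst z) (snd z))"
proof -
  have TT: "T \<in> {0..T}" using T_pos by simp
  have b: "b \<in> L2F M T W" and XF: "X \<in> L2F M T W" and I: "has_ito_integral M T W Z I" and XL: "sqi M (X T)"
    using X TT unfolding ito_repr_def by auto
  note ZF = has_itoD(2)[OF I]
  have ex: "(N *v v) \<bullet> w = (\<Sum>e\<in>Basis. (N \<bullet> e) * ((e *v v) \<bullet> w))" for N :: "real^'n^'n" and v w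
  proof -
    have "(N *v v) \<bullet> w = ((\<Sum>e\<in>Basis. (N \<bullet> e) *\<^sub>R e) *v v) \<bullet> w" by (simp add: euclidean_representation)
    then show ?thesis by (simp add: mv.sum_left inner_sum_left mv.scaleR_left)
  qed
  define F where "F e z = (P' (fst z) \<bullet> e) * ((e *v X (fst z) (snd z)) \<bullet> X (fst z) (snd z)) + (P (fst z) \<bullet> e) * ((e *v b (fst z) (snd z)) \<bullet> X (fst z) (snd z)
    + (e *v X (fst z) (snd z)) \<bullet> b (fst z) (snd z) + (e *v Z (fst z) (snd z)) \<bullet> Z (fst z) (snd z))" for e :: "real^'n^'n" and z
  have dc: "continuous_on {0..T} P" by (rule continuous_on_vector_derivative) (rule d)
  have s: "integrable (PM T) (%z. (Q (fst z) \<bullet> e) * ((e *v \<phi> (fst z) (snd z)) \<bullet> \<psi> (fst z) (snd z)))"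
    if q: "continuous_on {0..T} Q" and "\<phi> \<in> L2F M T W" "\<psi> \<in> L2F M T W" for Q and e :: "real^'n^'n" and \<phi> \<psi>
  proof -
    have "continuous_on {0..T} (%s. (Q s \<bullet> e) *\<^sub>R e)" using q by (intro continuous_intros)
    from integrable_PM_quadratic[OF this that(2,3)] show ?thesis by (simp add: scaleR_matrix_vector_assoc[symmetric])
  qed
  have iF: "integrable (PM T) (F e)" for e unfolding F_def distrib_left
    by (intro Bochner_Integration.integrable_add s c dc XF b ZF)
  have "(LINT h|M. (P T *v X T h) \<bullet> X T h) = (LINT h|M. (\<Sum>e\<in>Basis. (P T \<bullet> e) * ((e *v X T h) \<bullet> X T h)))"
    by (subst ex) simp
  also have "\<dots> = (\<Sum>e\<in>Basis. (P T \<bullet> e) * (LINT h|M. (e *v X T h) \<bullet> X T h))"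
    by (subst Bochner_Integration.integral_sum)
    (auto intro!: integrable_inner_sqi sqi_bounded_linear[OF mv.bounded_linear_right] XL)
  also have "\<dots> = (\<Sum>e\<in>Basis. (P 0 \<bullet> e) * ((e *v x) \<bullet> x) + (LINT z|PM T. F e z))"
  proof (rule sum.cong[OF refl])
    fix e :: "real^'n^'n"
    show "(P T \<bullet> e) * (LINT h|M. (e *v X T h) \<bullet> X T h) = (P 0 \<bullet> e) * ((e *v x) \<bullet> x) + (LINT z|PM T. F e z)"
    unfolding F_def
    proof (rule scaled_moment[OF X])
    show "((%s. P s \<bullet> e) has_vector_derivative P' s \<bullet> e) (at s within {0..T})" if "s \<in> {0..T}" for s
    using bounded_linear.has_vector_derivative[OF bounded_linear_inner_left d[OF that]] .
    show "continuous_on {0..T} (%s. P' s \<bullet> e)" using c by (intro continuous_intros)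
    qed
  qed
  also have "\<dots> = (P 0 *v x) \<bullet> x + (LINT z|PM T. (\<Sum>e\<in>Basis. F e z))"
    using iF by (simp add: sum.distrib ex[of "P 0"] Bochner_Integration.integral_sum)
  also have "(%z. \<Sum>e\<in>Basis. F e z) = (%z. (P' (fst z) *v X (fst z) (snd z)) \<bullet> X (fst z) (snd z) + (P (fst z) *v b (fst z) (snd z)) \<bullet> X (fst z) (snd z)
    + (P (fst z) *v X (fst z) (snd z)) \<bullet> b (fst z) (snd z) + (P (fst z) *v Z (fst z) (snd z)) \<bullet> Z (fst z) (snd z))"
    unfolding F_def ex[of "P' _"] ex[of "P _"] by (rule ext) (simp only: sum.distrib distrib_left add.assoc)
  finally show ?thesis .
qed

end

section \<open>The two Riccati equations of the mean-field problem\<close>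

lemma LamD:
  assumes H: "H \<in> Lam T" and T: "0 < T"
  shows "\<And>t. t \<in> {0..T} ==> (H has_vector_derivative Dt T H t) (at t within {0..T})"
    "continuous_on {0..T} (Dt T H)" "continuous_on {0..T} H" "\<And>t. t \<in> {0..T} ==> symm (H t)"
proof -
  obtain f where f: "Linf_symm T f" "\<And>t. t \<in> {0..T} ==> H t = H 0 + (LINT s:{0..t}|lborel. f s)"
    using H unfolding Lam_def by blast
  have c: "continuous_on {0..T} f" using f(1) by (simp add: Linf_symm_def Linf_def)
  have e: "H t = H 0 + integral {0..t} f" if t: "t \<in> {0..T}" for t
  proof -
    have "set_integrable lborel {0..t} f"
    by (rule borel_integrable_atLeastAtMost'[OF continuous_on_subset[OF c]]) (use t in auto)
    from set_borel_integral_eq_integral(2)[OF this] f(2)[OF t] show ?thesis by simp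
  qed
  have d: "(H has_vector_derivative f t) (at t within {0..T})" if t: "t \<in> {0..T}" for t
  proof (rule has_vector_derivative_transform[OF t e])
    show "((%t. H 0 + integral {0..t} f) has_vector_derivative f t) (at t within {0..T})"
    using has_vector_derivative_add[OF has_vector_derivative_const integral_has_vector_derivative[OF c t]] by simp
  qed
  have D: "Dt T H t = f t" if "t \<in> {0..T}" for t
    unfolding Dt_def using T d[OF that] that by (intro vector_derivative_within_closed_interval) auto
  show der: "(H has_vector_derivative Dt T H t) (at t within {0..T})" if "t \<in> {0..T}" for t
    using d[OF that] by (simp only: D[OF that])
  show "continuous_on {0..T} (Dt T H)" using c by (subst continuous_on_cong[OF refl D])
  show "continuous_on {0..T} H" by (rule continuous_on_vector_derivative[OF d])
  show "\<And>t. t \<in> {0..T} ==> symm (H t)" using H unfolding Lam_def by blast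
qed

definition join :: "real^'a => real^'b => real^('a + 'b)" where
  "join p q = (\<chi> i. case i of Inl a => p $ a | Inr b => q $ b)"

lemma sum_UNIV_Plus: "(\<Sum>i\<in>UNIV. f i) = (\<Sum>a\<in>UNIV. f (Inl a)) + (\<Sum>b\<in>UNIV. f (Inr b))"
  for f :: "'a::finite + 'b::finite => 'c::comm_monoid_add"
  unfolding UNIV_Plus_UNIV[symmetric] by (subst sum.Plus) (auto simp: comp_def)

lemma inner_join: "join p q \<bullet> join p' q' = p \<bullet> p' + q \<bullet> q'"
  by (simp add: inner_vec_def sum_UNIV_Plus join_def)

lemma block_mat_mult: "block_mat N1 N2 N3 N4 *v join p q = join (N1 *v p + N2 *v q) (N3 *v p + N4 *v q)"
  by (simp add: vec_eq_iff matrix_vector_mult_def sum_UNIV_Plus block_mat_def join_def split: sum.split)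

lemma inner_transpose_left: "(transpose N *v y) \<bullet> x = y \<bullet> (N *v x)" for N :: "real^'n^'m"
  by (simp only: inner_transpose transpose_transpose)

lemma block_mat_quadratic:
  "join p q \<bullet> (block_mat N1 N2 (transpose N2) N4 *v join p q) = p \<bullet> (N1 *v p) + 2 * (p \<bullet> (N2 *v q)) + q \<bullet> (N4 *v q)"
  by (simp add: block_mat_mult inner_join inner_add_right inner_transpose[symmetric] inner_transpose_left inner_commute del: transpose_matrix_vector)

lemma diag_block_inner: "join v w \<bullet> (diag_block N1 N2 *v join y z) = v \<bullet> (N1 *v y) + w \<bullet> (N2 *v z)"
  by (simp add: diag_block_def block_mat_mult inner_join)

locale mflq_data =
  fixes T :: real and c :: "('n::finite, 'm::finite) mflq"
  assumes T: "0 < T" and adm: "admissible_coeffs T c"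
begin

lemma coeff_cont:
  "continuous_on {0..T} (cA c)" "continuous_on {0..T} (cB c)" "continuous_on {0..T} (cC c)" "continuous_on {0..T} (cD c)"
  "continuous_on {0..T} (cQ c)" "continuous_on {0..T} (cS c)" "continuous_on {0..T} (cR c)"
  "continuous_on {0..T} (tA c)" "continuous_on {0..T} (tB c)" "continuous_on {0..T} (tC c)" "continuous_on {0..T} (tD c)"
  "continuous_on {0..T} (tQ c)" "continuous_on {0..T} (tS c)" "continuous_on {0..T} (tR c)"
  using adm by (auto simp: admissible_coeffs_def Linf_symm_def Linf_def)

lemma hat_cont:
  "continuous_on {0..T} (hA c)" "continuous_on {0..T} (hB c)" "continuous_on {0..T} (hC c)" "continuous_on {0..T} (hD c)"
  "continuous_on {0..T} (hQ c)" "continuous_on {0..T} (hS c)" "continuous_on {0..T} (hR c)"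
  unfolding hA_def[abs_def] hB_def[abs_def] hC_def[abs_def] hD_def[abs_def] hQ_def[abs_def] hS_def[abs_def] hR_def[abs_def]
  by (intro continuous_on_add coeff_cont)+

lemma coeff_symm:
  "\<And>t. t \<in> {0..T} ==> symm (cQ c t)" "\<And>t. t \<in> {0..T} ==> symm (cR c t)" "symm (cG c)"
  "\<And>t. t \<in> {0..T} ==> symm (hQ c t)" "\<And>t. t \<in> {0..T} ==> symm (hR c t)" "symm (hG c)"
  using adm by (auto simp: admissible_coeffs_def Linf_symm_def hQ_def hR_def hG_def symm_def transpose_add)

sublocale L1: lq_data T "cA c" "cC c" "cQ c" "cB c" "cD c" "cS c" "cR c" "cG c"
  by unfold_locales (use T in simp, (fact coeff_cont coeff_symm)+)

lemma riccati_P_iff: "riccati_P T c P \<longleftrightarrow> L1.riccati P"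
  by (simp only: riccati_P_def L1.riccati_def Gam_def L1.gain_def L1.RR_def L1.SS_def)

definition Q2 where "Q2 P t = transpose (hC c t) ** P t ** hC c t + hQ c t"
definition S2 where "S2 P t = transpose (hC c t) ** P t ** hD c t + hS c t"
definition R2 where "R2 P t = transpose (hD c t) ** P t ** hD c t + hR c t"

text \<open>Given \<open>P\<close>, the second Riccati equation is that of a deterministic problem: no diffusion.\<close>

lemma lq_data_hat:
  assumes "continuous_on {0..T} P" "\<And>t. t \<in> {0..T} ==> symm (P t)"
  shows "lq_data T (hA c) (%t. 0) (Q2 P) (hB c) (%t. 0) (S2 P) (R2 P) (hG c)"
proof
  show "continuous_on {0..T} (Q2 P)" "continuous_on {0..T} (S2 P)" "continuous_on {0..T} (R2 P)"
    unfolding Q2_def[abs_def] S2_def[abs_def] R2_def[abs_def]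
    by (intro continuous_on_add continuous_matrix_intros assms hat_cont)+
  show "symm (Q2 P t)" "symm (R2 P t)" if "t \<in> {0..T}" for t
    using coeff_symm(4,5)[OF that] assms(2)[OF that]
    by (simp_all add: Q2_def R2_def symm_def transpose_add matrix_transpose_mul matrix_mul_assoc)
qed (use T hat_cont coeff_symm in auto)

lemma hat_form:
  "v \<bullet> (Q2 P t *v v) + 2 * ((S2 P t *v y) \<bullet> v) + y \<bullet> (R2 P t *v y) =
    (hC c t *v v + hD c t *v y) \<bullet> (P t *v (hC c t *v v + hD c t *v y))
    + v \<bullet> (hQ c t *v v) + 2 * ((hS c t *v y) \<bullet> v) + y \<bullet> (hR c t *v y)"
  if "symm (P t)"
proof -
  have "(hC c t *v v) \<bullet> (P t *v (hD c t *v y)) = (hD c t *v y) \<bullet> (P t *v (hC c t *v v))"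
    using symm_inner[OF that] by (metis inner_commute)
  then show ?thesis
    by (simp add: Q2_def S2_def R2_def mv.add_left mv.add_right inner_add_left inner_add_right
    matrix_vector_mul_assoc[symmetric] inner_transpose[symmetric] inner_transpose_left inner_commute del: transpose_matrix_vector)
qed

context
  fixes P :: "real => real^'n^'n"
  assumes P: "continuous_on {0..T} P" "\<And>t. t \<in> {0..T} ==> symm (P t)"
begin

interpretation L2: lq_data T "hA c" "%t. 0" "Q2 P" "hB c" "%t. 0" "S2 P" "R2 P" "hG c"
  by (rule lq_data_hat[OF P])

lemma RR2: "lq_data.RR (%t. 0) (R2 P) t E = R2 P t" for E :: "real^'n^'n"
  by (simp add: L2.RR_def)

lemma gain2: "lq_data.gain (%t. 0) (hB c) (%t. 0) (S2 P) (R2 P) t E = hGam c t (P t) E"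
  by (simp add: hGam_def L2.gain_def RR2 L2.SS_def R2_def S2_def add.assoc)

lemma riccati_Ph_iff: "riccati_Ph T c P E \<longleftrightarrow> lq_data.riccati T (hA c) (%t. 0) (Q2 P) (hB c) (%t. 0) (S2 P) (R2 P) (hG c) E"
  unfolding riccati_Ph_def L2.riccati_def RR2 gain2 by (simp add: Q2_def R2_def[abs_def] add.assoc)

end

context
  fixes H K assumes rc: "relaxed_compensator T c H K"
begin

lemma compD:
  shows "\<And>t v y. t \<in> {0..T} ==> 0 \<le> v \<bullet> (Q_HK T c H t *v v) + 2 * (v \<bullet> (S_HK c H t *v y)) + y \<bullet> (R_HK c H t *v y)"
    and "\<And>t v y. t \<in> {0..T} ==> 0 \<le> v \<bullet> (hQ_HK T c H K t *v v) + 2 * (v \<bullet> (hS_HK c H K t *v y)) + y \<bullet> (hR_HK c H t *v y)"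
    and "\<exists>\<delta>>0. \<forall>t\<in>{0..T}. \<forall>y. \<delta> * (y \<bullet> y) \<le> y \<bullet> (R_HK c H t *v y) \<and> \<delta> * (y \<bullet> y) \<le> y \<bullet> (hR_HK c H t *v y)"
    and "\<And>v. v \<bullet> (H T *v v) \<le> v \<bullet> (cG c *v v)" "\<And>v. v \<bullet> (K T *v v) \<le> v \<bullet> (hG c *v v)"
proof -
  have Lam: "H \<in> Lam T" "K \<in> Lam T" and
    p1: "psd_on T (%t. block_mat (diag_block (Q_HK T c H t) (hQ_HK T c H K t)) (diag_block (S_HK c H t) (hS_HK c H K t))
    (transpose (diag_block (S_HK c H t) (hS_HK c H K t))) (diag_block (R_HK c H t) (hR_HK c H t)))" and
    p2: "uniformly_pd_on T (%t. diag_block (R_HK c H t) (hR_HK c H t))" and p3: "psd (diag_block (G_HK T c H) (hG_HK T c K))"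
    using rc unfolding relaxed_compensator_def by blast+
  note LH = LamD[OF Lam(1) T] and LK = LamD[OF Lam(2) T]
  have cc: "continuous_on {0..T} (Q_HK T c H)" "continuous_on {0..T} (hQ_HK T c H K)" "continuous_on {0..T} (S_HK c H)"
    "continuous_on {0..T} (hS_HK c H K)" "continuous_on {0..T} (R_HK c H)" "continuous_on {0..T} (hR_HK c H)"
    unfolding Q_HK_def[abs_def] hQ_HK_def[abs_def] S_HK_def[abs_def] hS_HK_def[abs_def] R_HK_def[abs_def] hR_HK_def[abs_def]
    by (intro continuous_on_add continuous_matrix_intros LH(2,3) LK(2,3) coeff_cont hat_cont)+
  have form: "0 \<le> (v \<bullet> (Q_HK T c H t *v v) + w \<bullet> (hQ_HK T c H K t *v w)) + 2 * (v \<bullet> (S_HK c H t *v y) + w \<bullet> (hS_HK c H K t *v z))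
    + (y \<bullet> (R_HK c H t *v y) + z \<bullet> (hR_HK c H t *v z))" if t: "t \<in> {0..T}" for t v w y z
  proof (rule AE_lborel_continuous_nonneg[OF T _ _ t])
    show "AE t in lborel. t \<in> {0..T} \<longrightarrow> 0 \<le> (v \<bullet> (Q_HK T c H t *v v) + w \<bullet> (hQ_HK T c H K t *v w)) + 2 * (v \<bullet> (S_HK c H t *v y) + w \<bullet> (hS_HK c H K t *v z))
    + (y \<bullet> (R_HK c H t *v y) + z \<bullet> (hR_HK c H t *v z))"
    using p1 unfolding psd_on_def
    proof eventually_elim
    case (elim t)
    then show ?case
    unfolding psd_def diag_block_inner[symmetric] block_mat_quadratic[symmetric] by blast
    qed
  qed (intro continuous_intros continuous_matrix_intros cc)
  show "0 \<le> v \<bullet> (Q_HK T c H t *v v) + 2 * (v \<bullet> (S_HK c H t *v y)) + y \<bullet> (R_HK c H t *v y)" if "t \<in> {0..T}" for t v y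
    using form[OF that, of v 0 y 0] by simp
  show "0 \<le> v \<bullet> (hQ_HK T c H K t *v v) + 2 * (v \<bullet> (hS_HK c H K t *v y)) + y \<bullet> (hR_HK c H t *v y)" if "t \<in> {0..T}" for t v y
    using form[OF that, of 0 v 0 y] by simp
  obtain \<delta> where \<delta>: "0 < \<delta>" "psd_on T (%t. diag_block (R_HK c H t) (hR_HK c H t) - mat \<delta>)"
    using p2 by (auto simp: uniformly_pd_on_def)
  have r: "0 \<le> (y \<bullet> (R_HK c H t *v y) + z \<bullet> (hR_HK c H t *v z)) - \<delta> * (y \<bullet> y + z \<bullet> z)" if t: "t \<in> {0..T}" for t y z
  proof (rule AE_lborel_continuous_nonneg[OF T _ _ t])
    show "AE t in lborel. t \<in> {0..T} \<longrightarrow> 0 \<le> (y \<bullet> (R_HK c H t *v y) + z \<bullet> (hR_HK c H t *v z)) - \<delta> * (y \<bullet> y + z \<bullet> z)"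
    using \<delta>(2) unfolding psd_on_def
    proof eventually_elim
    case (elim t)
    show ?case
    proof
    assume "t \<in> {0..T}"
    then have "0 \<le> join y z \<bullet> ((diag_block (R_HK c H t) (hR_HK c H t) - mat \<delta>) *v join y z)" using elim unfolding psd_def by blast
    then show "0 \<le> (y \<bullet> (R_HK c H t *v y) + z \<bullet> (hR_HK c H t *v z)) - \<delta> * (y \<bullet> y + z \<bullet> z)"
    by (simp add: mv.diff_left inner_diff_right diag_block_inner mat_vector_mult inner_join)
    qed
    qed
  qed (intro continuous_intros continuous_matrix_intros cc)
  show "\<exists>\<delta>>0. \<forall>t\<in>{0..T}. \<forall>y. \<delta> * (y \<bullet> y) \<le> y \<bullet> (R_HK c H t *v y) \<and> \<delta> * (y \<bullet> y) \<le> y \<bullet> (hR_HK c H t *v y)"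
  proof (intro exI conjI ballI allI)
    fix t y assume t: "t \<in> {0..T}"
    show "\<delta> * (y \<bullet> y) \<le> y \<bullet> (R_HK c H t *v y)" "\<delta> * (y \<bullet> y) \<le> y \<bullet> (hR_HK c H t *v y)"
    using r[OF t, of y 0] r[OF t, of 0 y] by simp_all
  qed (rule \<delta>(1))
  have g: "0 \<le> v \<bullet> (G_HK T c H *v v) + w \<bullet> (hG_HK T c K *v w)" for v w
    using p3 unfolding psd_def diag_block_inner[symmetric] by blast
  show "v \<bullet> (H T *v v) \<le> v \<bullet> (cG c *v v)" "v \<bullet> (K T *v v) \<le> v \<bullet> (hG c *v v)" for v
    using g[of v 0] g[of 0 v] by (simp_all add: G_HK_def hG_HK_def mv.diff_left inner_diff_right)
qed

lemma riccati_system_exists: "\<exists>P Ph. riccati_system T c P Ph"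
proof -
  have Lam: "H \<in> Lam T" "K \<in> Lam T" using rc unfolding relaxed_compensator_def by blast+
  note LH = LamD[OF Lam(1) T] and LK = LamD[OF Lam(2) T]
  have inn: "v \<bullet> (N *v (X *v v)) = (X *v v) \<bullet> (N *v v)" "v \<bullet> (transpose X *v (N *v v)) = (X *v v) \<bullet> (N *v v)" if "symm N" for N X :: "real^'n^'n" and v
    using symm_inner[OF that, of "X *v v" v] inner_transpose[of X v "N *v v"] by (simp_all add: inner_commute del: transpose_matrix_vector)
  obtain \<delta> where \<delta>: "0 < \<delta>" "\<And>t y. t \<in> {0..T} ==> \<delta> * (y \<bullet> y) \<le> y \<bullet> (R_HK c H t *v y)"
    "\<And>t y. t \<in> {0..T} ==> \<delta> * (y \<bullet> y) \<le> y \<bullet> (hR_HK c H t *v y)"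
    using compD(3) by blast
  have "L1.compensator H (Dt T H) \<delta>"
    unfolding L1.compensator_def
  proof (intro conjI ballI allI)
    fix t v y assume t: "t \<in> {0..T}"
    show "0 \<le> v \<bullet> (Dt T H t *v v) + L1.ham t (H t) v y"
    using compD(1)[OF t, of v y]
    by (simp add: L1.ham_expand[OF LH(4)[OF t]] Q_HK_def S_HK_def R_HK_def L1.SS_def L1.RR_def mv.add_left inner_add_right inner_add_left
    matrix_vector_mul_assoc[symmetric] inn[OF LH(4)[OF t]] inner_transpose[symmetric] inner_transpose_left inner_commute del: transpose_matrix_vector)
    show "\<delta> * (y \<bullet> y) \<le> y \<bullet> (L1.RR t (H t) *v y)" using \<delta>(2)[OF t] by (simp add: R_HK_def L1.RR_def)
  qed (fact \<delta>(1) LH(1,4) compD(4))+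
  from L1.riccati_exists[OF this T] obtain P where P: "L1.riccati P" and HP: "\<And>t v. t \<in> {0..T} ==> v \<bullet> (H t *v v) \<le> v \<bullet> (P t *v v)"
    by blast
  note PD = L1.riccatiD[OF P T]
  interpret L2: lq_data T "hA c" "%t. 0" "Q2 P" "hB c" "%t. 0" "S2 P" "R2 P" "hG c"
    by (rule lq_data_hat[OF PD(1,4)])
  have "L2.compensator K (Dt T K) \<delta>"
    unfolding L2.compensator_def
  proof (intro conjI ballI allI)
    fix t v y assume t: "t \<in> {0..T}"
    define q where "q = hC c t *v v + hD c t *v y"
    have "v \<bullet> (hQ_HK T c H K t *v v) + 2 * (v \<bullet> (hS_HK c H K t *v y)) + y \<bullet> (hR_HK c H t *v y) =
    v \<bullet> (Dt T K t *v v) + 2 * ((hA c t *v v + hB c t *v y) \<bullet> (K t *v v))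
    + (v \<bullet> (Q2 H t *v v) + 2 * ((S2 H t *v y) \<bullet> v) + y \<bullet> (R2 H t *v y))"
    using symm_inner[OF LK(4)[OF t], of "hB c t *v y" v]
    by (simp add: hQ_HK_def hS_HK_def hR_HK_def Q2_def S2_def R2_def mv.add_left inner_add_right inner_add_left
    matrix_vector_mul_assoc[symmetric] inn[OF LK(4)[OF t]] inner_commute del: transpose_matrix_vector)
    then show "0 \<le> v \<bullet> (Dt T K t *v v) + L2.ham t (K t) v y"
    using compD(2)[OF t, of v y] HP[OF t, of q] hat_form[where P=P and t=t and v=v and y=y, OF PD(4)[OF t]]
    by (simp add: L2.ham_def hat_form[where P=H and t=t, OF LH(4)[OF t]] q_def[symmetric])
    show "\<delta> * (y \<bullet> y) \<le> y \<bullet> (L2.RR t (K t) *v y)"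
    using \<delta>(3)[OF t, of y] HP[OF t, of "hD c t *v y"]
    by (simp add: L2.RR_def R2_def hR_HK_def mv.add_left inner_add_right matrix_vector_mul_assoc[symmetric] inner_transpose[symmetric] del: transpose_matrix_vector)
  qed (fact \<delta>(1) LK(1,4) compD(5))+
  from L2.riccati_exists[OF this T] obtain E where "L2.riccati E" by blast
  then show ?thesis
    unfolding riccati_system_def riccati_P_iff using P riccati_Ph_iff[OF PD(1,4)] by blast
qed

end

lemma riccati_system_unique:
  assumes 1: "riccati_system T c P Ph" and 2: "riccati_system T c P' Ph'" and t: "t \<in> {0..T}"
  shows "P' t = P t \<and> Ph' t = Ph t"
proof -
  have P: "L1.riccati P" "L1.riccati P'" using 1 2 by (auto simp: riccati_system_def riccati_P_iff)
  note PD = L1.riccatiD[OF P(1) T]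
  have eq: "P' t = P t" if "t \<in> {0..T}" for t by (rule L1.riccati_unique[OF P(2,1) T that])
  interpret L2: lq_data T "hA c" "%t. 0" "Q2 P" "hB c" "%t. 0" "S2 P" "R2 P" "hG c"
    by (rule lq_data_hat[OF PD(1,4)])
  have "psd_on T (%t. transpose (hD c t) ** P' t ** hD c t + hR c t - mat \<delta>) \<longleftrightarrow> psd_on T (%t. transpose (hD c t) ** P t ** hD c t + hR c t - mat \<delta>)" for \<delta>
    unfolding psd_on_def by (rule AE_cong) (simp add: eq)
  then have "riccati_Ph T c P Ph'"
    using 2 unfolding riccati_system_def riccati_Ph_def uniformly_pd_on_def by (simp add: eq)
  then have "L2.riccati Ph" "L2.riccati Ph'"
    using 1 riccati_Ph_iff[OF PD(1,4)] unfolding riccati_system_def by blast+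
  then show ?thesis using L2.riccati_unique[OF _ _ T t] eq[OF t] by blast
qed

end

section \<open>Completion of squares\<close>

context bm_space
begin

lemma AE_lam_PM:
  assumes "AE s in lam T. Q s"
  shows "AE z in PM T. Q (fst z)"
proof -
  obtain N where N: "{s \<in> space (lam T). \<not> Q s} \<subseteq> N" "emeasure (lam T) N = 0" "N \<in> sets (lam T)"
    using assms by (auto elim: AE_E)
  show ?thesis
  proof (rule AE_I)
    show "{z \<in> space (PM T). \<not> Q (fst z)} \<subseteq> N \<times> space M" using N(1) by (auto simp: space_pair_measure)
    show "emeasure (PM T) (N \<times> space M) = 0" using N by (simp add: emeasure_pair_measure_Times)
    show "N \<times> space M \<in> sets (PM T)" using N(3) by auto
  qed
qed

lemma L2FC_const: "(%t w. x) \<in> L2FC M T W" for x :: "'a::euclidean_space"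
  by (rule ac_L2FC[OF ac_const]) (use T_pos in \<open>simp add: supn_def emeasure_space_1\<close>)

lemma has_ito_integral_0: "has_ito_integral M T W (%t w. 0) (%t w. 0 :: 'a::euclidean_space)"
  unfolding has_ito_integral_def
proof (intro conjI exI)
  show "\<forall>k::nat. is_simple M T W ((%k. (0, %_. 0, %_ _. 0::'a)) k)" using T_pos by (simp add: is_simple_def)
qed (simp_all add: L2FC_const L2FC_L2F[OF L2FC_const] simple_val_def simple_integral_def)

lemma sqi_integrable_M: "sqi M f ==> integrable M f" for f :: "'w => 'a::euclidean_space"
  by (rule sqi_integrable_finite)

lemma L2F_integrable_PM: "\<phi> \<in> L2F M T W ==> t \<in> {0..T} ==> integrable (PM t) (%z. \<phi> (fst z) (snd z))"
  for \<phi> :: "real => 'w => 'a::euclidean_space"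
  by (rule finite_measure.sqi_integrable_finite[OF finite_measure_PM L2F_sqi])

lemma ito_repr_mean:
  assumes X: "ito_repr x b Z I X"
  shows "ito_repr x (%t w. mean M b t) (%t w. 0) (%t w. 0) (%t w. mean M X t)"
    and "ito_repr 0 (%t w. b t w - mean M b t) Z I (%t w. X t w - mean M X t)"
proof -
  have b: "b \<in> L2F M T W" and XF: "X \<in> L2F M T W" and I: "has_ito_integral M T W Z I" and XL: "\<And>t. t \<in> {0..T} ==> sqi M (X t)"
    and ae: "AE w in M. \<forall>t\<in>{0..T}. X t w = x + (LINT s:{0..t}|lborel. b s w) + I t w"
    using X unfolding ito_repr_def by auto
  have sc: "sqi M (%_. a)" for a :: 'a by (simp add: sqi_const finite_measure_axioms)
  have m: "mean M X t = x + (LINT s:{0..t}|lborel. mean M b s)" if t: "t \<in> {0..T}" for t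
  proof -
    note ib = L2F_integrable_PM[OF b t]
    note iB = integral_PM(4)[OF ib] and iI = sqi_integrable_M[OF has_itoD(4)[OF I t]]
    have "mean M X t = (LINT w|M. (x + (LINT s:{0..t}|lborel. b s w)) + I t w)"
    unfolding mean_def
    proof (rule integral_cong_AE)
    show "X t \<in> borel_measurable M" by (rule sqi_measurable[OF XL[OF t]])
    show "(%w. (x + (LINT s:{0..t}|lborel. b s w)) + I t w) \<in> borel_measurable M"
    by (intro borel_measurable_integrable Bochner_Integration.integrable_add iB iI) simp
    show "AE w in M. X t w = (x + (LINT s:{0..t}|lborel. b s w)) + I t w"
    using ae by eventually_elim (use t in blast)
    qed
    also have "\<dots> = x + (LINT w|M. (LINT s:{0..t}|lborel. b s w))"
    using iB iI ito_mean_zero(2)[OF I t] by (simp add: prob_space)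
    finally show ?thesis
    unfolding integral_PM(2)[OF ib, symmetric] integral_PM(1)[OF ib] mean_def .
  qed
  show "ito_repr x (%t w. mean M b t) (%t w. 0) (%t w. 0) (%t w. mean M X t)"
    unfolding ito_repr_def
  proof (intro conjI ballI)
    show "AE w in M. \<forall>t\<in>{0..T}. mean M X t = x + (LINT s:{0..t}|lborel. mean M b s) + 0"
    by (rule AE_I2) (simp add: m)
  qed (rule L2F_mean[OF b] L2F_mean[OF XF] has_ito_integral_0 sc)+
  show "ito_repr 0 (%t w. b t w - mean M b t) Z I (%t w. X t w - mean M X t)"
    unfolding ito_repr_def
  proof (intro conjI ballI)
    show "AE w in M. \<forall>t\<in>{0..T}. X t w - mean M X t = 0 + (LINT s:{0..t}|lborel. b s w - mean M b s) + I t w"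
    using ae L2F_set_integrable[OF b]
    proof eventually_elim
    case (elim w)
    show ?case
    proof
    fix t assume t: "t \<in> {0..T}"
    have "set_integrable lborel {0..t} (mean M b)"
    unfolding mean_def[abs_def] by (rule integral_PM(3)[OF L2F_integrable_PM[OF b t]])
    then show "X t w - mean M X t = 0 + (LINT s:{0..t}|lborel. b s w - mean M b s) + I t w"
    using elim t m[OF t] by (simp add: set_integral_diff)
    qed
    qed
  qed (rule L2F_diff[OF b L2F_mean[OF b]] L2F_diff[OF XF L2F_mean[OF XF]] I sqi_diff[OF XL sc] | assumption)+
qed

lemma centered_inner:
  fixes \<phi> :: "real => 'w => 'a::euclidean_space"
  assumes \<phi>: "\<phi> \<in> L2F M T W" and a: "(%t w. a t) \<in> L2F M T W"
  shows "integrable (PM T) (%z. (\<phi> (fst z) (snd z) - mean M \<phi> (fst z)) \<bullet> a (fst z))"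
    and "(LINT z|PM T. (\<phi> (fst z) (snd z) - mean M \<phi> (fst z)) \<bullet> a (fst z)) = 0"
proof -
  have TT: "T \<in> {0..T}" using T_pos by simp
  show i: "integrable (PM T) (%z. (\<phi> (fst z) (snd z) - mean M \<phi> (fst z)) \<bullet> a (fst z))"
    by (rule integrable_inner_sqi[OF L2F_sqi[OF L2F_diff[OF \<phi> L2F_mean[OF \<phi>]] TT] L2F_sqi[OF a TT]])
  show "(LINT z|PM T. (\<phi> (fst z) (snd z) - mean M \<phi> (fst z)) \<bullet> a (fst z)) = 0"
    unfolding integral_PM(1)[where F="%s w. (\<phi> s w - mean M \<phi> s) \<bullet> a s", OF i] set_integral_lam
  proof (rule integral_eq_zero_AE)
    show "AE s in lam T. (LINT w|M. (\<phi> s w - mean M \<phi> s) \<bullet> a s) = 0"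
    using L2F_AE_sqi(1)[OF \<phi>]
    proof eventually_elim
    case (elim s)
    have "integrable M (\<phi> s)" by (rule sqi_integrable_M[OF elim])
    then show ?case by (simp add: mean_def prob_space)
    qed
  qed
qed

end

context mflq_data
begin

lemma pointwise_identity:
  fixes P' Ph Ph' :: "real^'n^'n" and P :: "real => real^'n^'n" and p m :: "real^'n" and q v :: "real^'m"
  assumes t: "t \<in> {0..T}" and sym: "symm (P t)" "symm Ph"
  defines "k \<equiv> hC c t *v m + hD c t *v v"
  shows "((cQ c t *v (p + m)) \<bullet> (p + m) + (tQ c t *v m) \<bullet> m + 2 * ((cS c t *v (q + v)) \<bullet> (p + m)) + 2 * ((tS c t *v v) \<bullet> m)
    + (cR c t *v (q + v)) \<bullet> (q + v) + (tR c t *v v) \<bullet> v)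
    + ((P' *v p) \<bullet> p + (P t *v (cA c t *v p + cB c t *v q)) \<bullet> p + (P t *v p) \<bullet> (cA c t *v p + cB c t *v q)
    + (P t *v ((cC c t *v p + cD c t *v q) + k)) \<bullet> ((cC c t *v p + cD c t *v q) + k))
    + ((Ph' *v m) \<bullet> m + (Ph *v (hA c t *v m + hB c t *v v)) \<bullet> m + (Ph *v m) \<bullet> (hA c t *v m + hB c t *v v))
    = (p \<bullet> (P' *v p) + L1.ham t (P t) p q)
    + (m \<bullet> (Ph' *v m) + (2 * ((hA c t *v m + hB c t *v v) \<bullet> (Ph *v m)) + k \<bullet> (P t *v k) + m \<bullet> (hQ c t *v m) + 2 * ((hS c t *v v) \<bullet> m) + v \<bullet> (hR c t *v v)))
    + p \<bullet> (2 *\<^sub>R (transpose (cC c t) *v (P t *v k) + cQ c t *v m + cS c t *v v))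
    + q \<bullet> (2 *\<^sub>R (transpose (cD c t) *v (P t *v k) + transpose (cS c t) *v m + cR c t *v v))"
proof -
  have sq: "(N *v (a + b)) \<bullet> (a + b) = a \<bullet> (N *v a) + b \<bullet> (N *v b) + 2 * (a \<bullet> (N *v b))" if "symm N" for N :: "real^'k^'k" and a b
    using symm_inner[OF that, of a b] by (simp add: mv.add_right inner_add_left inner_add_right inner_commute)
  have lin: "(N *v b) \<bullet> a + (N *v a) \<bullet> b = 2 * (b \<bullet> (N *v a))" if "symm N" for N :: "real^'k^'k" and a b
    using symm_inner[OF that, of a b] by (simp add: inner_commute)
  define z where "z = cC c t *v p + cD c t *v q"
  have zk: "z \<bullet> (P t *v k) = p \<bullet> (transpose (cC c t) *v (P t *v k)) + q \<bullet> (transpose (cD c t) *v (P t *v k))"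
    unfolding z_def inner_add_left inner_transpose ..
  have S: "(cS c t *v (q + v)) \<bullet> (p + m) = (cS c t *v q) \<bullet> p + (cS c t *v v) \<bullet> m + p \<bullet> (cS c t *v v) + q \<bullet> (transpose (cS c t) *v m)"
    unfolding mv.add_right inner_add_left inner_add_right inner_transpose[symmetric] by (simp add: inner_commute)
  show ?thesis
    unfolding z_def[symmetric] sq[OF coeff_symm(1)[OF t]] sq[OF coeff_symm(2)[OF t]] sq[OF sym(1)] S
    L1.ham_def zk hQ_def hS_def hR_def
    using lin[OF sym(1), of "cA c t *v p + cB c t *v q" p] lin[OF sym(2), of "hA c t *v m + hB c t *v v" m]
    by (simp add: mv.add_left inner_add_left inner_add_right inner_scaleR_right inner_commute[of _ p] inner_commute[of _ m] inner_commute[of _ v] del: transpose_matrix_vector)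
qed

definition K1 where "K1 P t = transpose (cD c t) ** P t ** cD c t + cR c t"

lemma riccati_systemD:
  assumes "riccati_system T c P Ph"
  shows "continuous_on {0..T} P" "continuous_on {0..T} (Dt T P)" "continuous_on {0..T} Ph" "continuous_on {0..T} (Dt T Ph)"
    and "\<And>t. t \<in> {0..T} ==> (P has_vector_derivative Dt T P t) (at t within {0..T})"
    and "\<And>t. t \<in> {0..T} ==> (Ph has_vector_derivative Dt T Ph t) (at t within {0..T})"
    and "\<And>t. t \<in> {0..T} ==> symm (P t)" "\<And>t. t \<in> {0..T} ==> symm (Ph t)" "P T = cG c" "Ph T = hG c"
    and "continuous_on {0..T} (%t. Gam c t (P t))" "continuous_on {0..T} (%t. hGam c t (P t) (Ph t))"
    and "\<exists>\<delta>>0. \<forall>t\<in>{0..T}. \<forall>y. \<delta> * (y \<bullet> y) \<le> y \<bullet> (K1 P t *v y)" "\<exists>\<delta>>0. \<forall>t\<in>{0..T}. \<forall>y. \<delta> * (y \<bullet> y) \<le> y \<bullet> (R2 P t *v y)"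
    and "\<And>t v y. t \<in> {0..T} ==> v \<bullet> (Dt T P t *v v) + L1.ham t (P t) v y = (y - Gam c t (P t) *v v) \<bullet> (K1 P t *v (y - Gam c t (P t) *v v))"
    and "\<And>t v y. t \<in> {0..T} ==> v \<bullet> (Dt T Ph t *v v) + (2 * ((hA c t *v v + hB c t *v y) \<bullet> (Ph t *v v))
    + (hC c t *v v + hD c t *v y) \<bullet> (P t *v (hC c t *v v + hD c t *v y)) + v \<bullet> (hQ c t *v v) + 2 * ((hS c t *v y) \<bullet> v) + y \<bullet> (hR c t *v y))
    = (y - hGam c t (P t) (Ph t) *v v) \<bullet> (R2 P t *v (y - hGam c t (P t) (Ph t) *v v))"
proof -
  have P: "L1.riccati P" and Ph: "riccati_Ph T c P Ph" using assms by (auto simp: riccati_system_def riccati_P_iff)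
  note PD = L1.riccatiD[OF P T]
  interpret L2: lq_data T "hA c" "%t. 0" "Q2 P" "hB c" "%t. 0" "S2 P" "R2 P" "hG c"
    by (rule lq_data_hat[OF PD(1,4)])
  have "L2.riccati Ph" using Ph riccati_Ph_iff[OF PD(1,4)] by blast
  note ED = L2.riccatiD[OF this T]
  have K: "L1.RR t (P t) = K1 P t" "L1.gain t (P t) = Gam c t (P t)" for t
    by (simp_all only: L1.RR_def K1_def L1.gain_def L1.SS_def Gam_def)
  have R: "L2.RR t (Ph t) = R2 P t" for t by (simp add: L2.RR_def)
  have Gh: "L2.gain t (Ph t) = hGam c t (P t) (Ph t)" for t
    by (rule gain2[OF PD(1)]) (rule PD(4))
  show "\<exists>\<delta>>0. \<forall>t\<in>{0..T}. \<forall>y. \<delta> * (y \<bullet> y) \<le> y \<bullet> (K1 P t *v y)" using PD(6) unfolding K .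
  show "\<exists>\<delta>>0. \<forall>t\<in>{0..T}. \<forall>y. \<delta> * (y \<bullet> y) \<le> y \<bullet> (R2 P t *v y)" using ED(6) unfolding R .
  show "continuous_on {0..T} (%t. Gam c t (P t))" using PD(8) unfolding K .
  show "continuous_on {0..T} (%t. hGam c t (P t) (Ph t))" using ED(8) unfolding Gh .
  show "v \<bullet> (Dt T P t *v v) + L1.ham t (P t) v y = (y - Gam c t (P t) *v v) \<bullet> (K1 P t *v (y - Gam c t (P t) *v v))" if "t \<in> {0..T}" for t v y
    using PD(9)[OF that] unfolding K .
  show "v \<bullet> (Dt T Ph t *v v) + (2 * ((hA c t *v v + hB c t *v y) \<bullet> (Ph t *v v))
    + (hC c t *v v + hD c t *v y) \<bullet> (P t *v (hC c t *v v + hD c t *v y)) + v \<bullet> (hQ c t *v v) + 2 * ((hS c t *v y) \<bullet> v) + y \<bullet> (hR c t *v y))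
    = (y - hGam c t (P t) (Ph t) *v v) \<bullet> (R2 P t *v (y - hGam c t (P t) (Ph t) *v v))" if t: "t \<in> {0..T}" for t v y
    using ED(9)[OF t, of v y] hat_form[where P=P and t=t and v=v and y=y, OF PD(4)[OF t]]
    unfolding R Gh by (simp add: L2.ham_def)
  show "continuous_on {0..T} P" "continuous_on {0..T} (Dt T P)" "continuous_on {0..T} Ph" "continuous_on {0..T} (Dt T Ph)"
    "\<And>t. t \<in> {0..T} ==> (P has_vector_derivative Dt T P t) (at t within {0..T})"
    "\<And>t. t \<in> {0..T} ==> (Ph has_vector_derivative Dt T Ph t) (at t within {0..T})"
    "\<And>t. t \<in> {0..T} ==> symm (P t)" "\<And>t. t \<in> {0..T} ==> symm (Ph t)" "P T = cG c" "Ph T = hG c"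
    by (fact PD(1-5) ED(1-5))+
qed

end

locale mflq_bm = bm_space M T W + mflq_data T c
  for M :: "'w measure" and T W and c :: "('n::finite, 'm::finite) mflq"
begin

definition ctl :: "(real => real^'m^'n) => (real => real^'m^'n) => (real => 'w => real^'m) => real => 'w => real^'n" where
  "ctl N N' u t w = N t *v u t w + N' t *v mean M u t"

lemma ctl_L2F:
  assumes "u \<in> L2F M T W" "continuous_on {0..T} N" "continuous_on {0..T} N'"
  shows "ctl N N' u \<in> L2F M T W"
  unfolding ctl_def[abs_def] by (intro L2F_add L2F_matrix[OF assms(2)] L2F_matrix[OF assms(3)] L2F_mean assms(1))

lemma is_state_iff: "is_state M T W c x u X \<longleftrightarrow>
  solves_sde M T W x (mf (cA c) (tA c) (ctl (cB c) (tB c) u) X) (mf (cC c) (tC c) (ctl (cD c) (tD c) u) X) X"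
  unfolding is_state_def mf_def[abs_def] ctl_def by (simp only: add.assoc)

lemma state_is_state:
  assumes u: "u \<in> L2F M T W"
  shows "is_state M T W c x u (state M T W c x u)"
  unfolding state_def
proof (rule someI_ex[of "is_state M T W c x u"])
  show "\<exists>X. is_state M T W c x u X"
    unfolding is_state_iff
    by (rule mf_sde_exists[OF coeff_cont(1,8,3,10) ctl_L2F[OF u coeff_cont(2,9)] ctl_L2F[OF u coeff_cont(4,11)]])
qed

lemma state_unique:
  assumes u: "u \<in> L2F M T W" and "is_state M T W c x u X" "is_state M T W c x u Y"
  shows "indistinguishable M T X Y"
  using mf_sde_unique[OF coeff_cont(1,8,3,10) ctl_L2F[OF u coeff_cont(2,9)] ctl_L2F[OF u coeff_cont(2,9)]
    ctl_L2F[OF u coeff_cont(4,11)] ctl_L2F[OF u coeff_cont(4,11)] _ _ assms(2,3)[unfolded is_state_iff]]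
  by (simp add: eq_dtdP_def)

lemma integral_matrix:
  fixes N :: "real^'k^'l"
  assumes "sqi M \<phi>"
  shows "integrable M (%w. N *v \<phi> w)" "(LINT w|M. N *v \<phi> w) = N *v (LINT w|M. \<phi> w)"
  using integrable_bounded_linear[OF mv.bounded_linear_right sqi_integrable_M[OF assms]]
    integral_bounded_linear[OF mv.bounded_linear_right sqi_integrable_M[OF assms]] by auto

lemma mean_drift:
  assumes "sqi M (X t)" "sqi M (u t)"
  shows "mean M (mf A A' (ctl N N' u) X) t = (A t + A' t) *v mean M X t + (N t + N' t) *v mean M u t"
proof -
  note i = integral_matrix[OF assms(1), of "A t"] integral_matrix[OF assms(2), of "N t"]
  have "mean M (mf A A' (ctl N N' u) X) t
    = (LINT w|M. (A t *v X t w + N t *v u t w) + (A' t *v mean M X t + N' t *v mean M u t))"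
    unfolding mean_def[of M "mf A A' (ctl N N' u) X"] mf_def ctl_def by (simp only: add_ac)
  also have "\<dots> = (A t *v mean M X t + N t *v mean M u t) + (A' t *v mean M X t + N' t *v mean M u t)"
    using i by (simp add: prob_space mean_def[of M X] mean_def[of M u])
  finally show ?thesis by (simp add: mv.add_left add_ac)
qed

context
  fixes P Ph :: "real => real^'n^'n"
  assumes ric: "riccati_system T c P Ph"
begin

lemmas R = riccati_systemD[OF ric]

definition w1 :: "(real => 'w => real^'n) => (real => 'w => real^'m) => real => 'w => real^'m" where
  "w1 X u t w = (u t w - mean M u t) - Gam c t (P t) *v (X t w - mean M X t)"
definition w2 :: "(real => 'w => real^'n) => (real => 'w => real^'m) => real => 'w => real^'m" where
  "w2 X u t w = mean M u t - hGam c t (P t) (Ph t) *v mean M X t"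

lemma w_L2F:
  assumes u: "u \<in> L2F M T W" and X: "X \<in> L2F M T W"
  shows "w1 X u \<in> L2F M T W" "w2 X u \<in> L2F M T W"
  unfolding w1_def[abs_def] w2_def[abs_def]
  by (intro L2F_diff L2F_mean L2F_matrix[OF R(11)] L2F_matrix[OF R(12)] u X)+

definition defect :: "(real => 'w => real^'n) => (real => 'w => real^'m) => real \<times> 'w => real" where
  "defect X u z = w1 X u (fst z) (snd z) \<bullet> (K1 P (fst z) *v w1 X u (fst z) (snd z))
    + w2 X u (fst z) (snd z) \<bullet> (R2 P (fst z) *v w2 X u (fst z) (snd z))"

definition payoff :: "(real => 'w => real^'n) => (real => 'w => real^'m) => real => 'w => real" where
  "payoff X u t w = (cQ c t *v X t w) \<bullet> X t w + (tQ c t *v mean M X t) \<bullet> mean M X t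
    + 2 * ((cS c t *v u t w) \<bullet> X t w) + 2 * ((tS c t *v mean M u t) \<bullet> mean M X t)
    + (cR c t *v u t w) \<bullet> u t w + (tR c t *v mean M u t) \<bullet> mean M u t"

lemma continuous_K: "continuous_on {0..T} (K1 P)" "continuous_on {0..T} (R2 P)"
  unfolding K1_def[abs_def] R2_def[abs_def]
  by (intro continuous_on_add continuous_matrix_intros R(1) coeff_cont hat_cont)+

lemma defect_integrable:
  assumes "u \<in> L2F M T W" "X \<in> L2F M T W"
  shows "integrable (PM T) (defect X u)"
  using integrable_PM_quadratic[OF continuous_K(1) w_L2F(1)[OF assms] w_L2F(1)[OF assms]]
    integrable_PM_quadratic[OF continuous_K(2) w_L2F(2)[OF assms] w_L2F(2)[OF assms]]
  unfolding defect_def[abs_def] by (simp add: inner_commute)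

lemma payoff_integral:
  assumes u: "u \<in> L2F M T W" and st: "is_state M T W c x u X"
  shows "(LINT w|M. (LINT t:{0..T}|lborel. payoff X u t w) + (cG c *v X T w) \<bullet> X T w + (tG c *v mean M X T) \<bullet> mean M X T)
    = (Ph 0 *v x) \<bullet> x + (LINT z|PM T. defect X u z)"
proof -
  have TT: "T \<in> {0..T}" using T_pos by simp
  define b where "b = mf (cA c) (tA c) (ctl (cB c) (tB c) u) X"
  define Z where "Z = mf (cC c) (tC c) (ctl (cD c) (tD c) u) X"
  have XC: "X \<in> L2FC M T W" using st by (simp add: is_state_iff solves_sde_def)
  note X = L2FC_L2F[OF XC] and XL = L2FC_sqi[OF XC]
  have b: "b \<in> L2F M T W" unfolding b_def by (rule mf_L2F[OF coeff_cont(1,8) ctl_L2F[OF u coeff_cont(2,9)] X])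
  obtain I where rep: "ito_repr x b Z I X"
    using st b X XL unfolding is_state_iff b_def[symmetric] Z_def[symmetric] solves_sde_def ito_repr_def by blast
  have ZF: "Z \<in> L2F M T W" using rep by (auto simp: ito_repr_def dest: has_itoD(2))
  define m where "m t = mean M X t" for t
  define v where "v t = mean M u t" for t
  define \<beta> where "\<beta> t = mean M b t" for t
  define p where "p t w = X t w - m t" for t w
  define q where "q t w = u t w - v t" for t w
  define bt where "bt t w = b t w - \<beta> t" for t w
  have mF: "(%t w. m t) \<in> L2F M T W" and vF: "(%t w. v t) \<in> L2F M T W" and \<beta>F: "(%t w. \<beta> t) \<in> L2F M T W"
    unfolding m_def v_def \<beta>_def by (rule L2F_mean, fact)+
  have pF: "p \<in> L2F M T W" and qF: "q \<in> L2F M T W" and btF: "bt \<in> L2F M T W"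
    unfolding p_def[abs_def] q_def[abs_def] bt_def[abs_def] by (rule L2F_diff, fact, fact)+
  have rm: "ito_repr x (%t w. \<beta> t) (%t w. 0) (%t w. 0) (%t w. m t)" and rp: "ito_repr 0 bt Z I p"
    using ito_repr_mean[OF rep] unfolding m_def[symmetric] \<beta>_def[symmetric] p_def[abs_def] bt_def[abs_def] by blast+
  define k where "k t = hC c t *v m t + hD c t *v v t" for t
  define a1 where "a1 t = 2 *\<^sub>R (transpose (cC c t) *v (P t *v k t) + cQ c t *v m t + cS c t *v v t)" for t
  define a2 where "a2 t = 2 *\<^sub>R (transpose (cD c t) *v (P t *v k t) + transpose (cS c t) *v m t + cR c t *v v t)" for t
  have kF: "(%t w. k t) \<in> L2F M T W" unfolding k_def
    by (intro L2F_add L2F_matrix[OF hat_cont(3)] L2F_matrix[OF hat_cont(4)] mF vF)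
  have two: "(%t w. 2 *\<^sub>R \<phi> t) \<in> L2F M T W" if "(%t w. \<phi> t) \<in> L2F M T W" for \<phi> :: "real => real^'k"
    using L2F_add[OF that that] by (simp add: scaleR_2)
  note PkF = L2F_matrix[OF R(1) kF]
  have a1F: "(%t w. a1 t) \<in> L2F M T W" unfolding a1_def
    by (rule two, rule L2F_add, rule L2F_add)
    (rule L2F_matrix[OF continuous_on_transpose[OF coeff_cont(3)] PkF] L2F_matrix[OF coeff_cont(5) mF] L2F_matrix[OF coeff_cont(6) vF])+
  have a2F: "(%t w. a2 t) \<in> L2F M T W" unfolding a2_def
    by (rule two, rule L2F_add, rule L2F_add)
    (rule L2F_matrix[OF continuous_on_transpose[OF coeff_cont(4)] PkF] L2F_matrix[OF continuous_on_transpose[OF coeff_cont(6)] mF]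
    L2F_matrix[OF coeff_cont(7) vF])+
  define f1 where "f1 z = (Dt T P (fst z) *v p (fst z) (snd z)) \<bullet> p (fst z) (snd z) + (P (fst z) *v bt (fst z) (snd z)) \<bullet> p (fst z) (snd z)
    + (P (fst z) *v p (fst z) (snd z)) \<bullet> bt (fst z) (snd z) + (P (fst z) *v Z (fst z) (snd z)) \<bullet> Z (fst z) (snd z)" for z
  define f2 where "f2 z = (Dt T Ph (fst z) *v m (fst z)) \<bullet> m (fst z) + (Ph (fst z) *v \<beta> (fst z)) \<bullet> m (fst z)
    + (Ph (fst z) *v m (fst z)) \<bullet> \<beta> (fst z)" for z :: "real \<times> 'w"
  define cr where "cr z = p (fst z) (snd z) \<bullet> a1 (fst z) + q (fst z) (snd z) \<bullet> a2 (fst z)" for z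
  have e1: "(LINT w|M. (cG c *v p T w) \<bullet> p T w) = (LINT z|PM T. f1 z)"
    using quad_formula[OF rp R(5) R(2)] unfolding R(9) f1_def by simp
  have e2: "(hG c *v m T) \<bullet> m T = (Ph 0 *v x) \<bullet> x + (LINT z|PM T. f2 z)"
    using quad_formula[OF rm R(6) R(4)] unfolding R(10) f2_def by (simp add: prob_space)
  note iq = integrable_PM_quadratic
  have i1: "integrable (PM T) f1" unfolding f1_def
    by (intro Bochner_Integration.integrable_add iq[OF R(2) pF pF] iq[OF R(1) btF pF] iq[OF R(1) pF btF] iq[OF R(1) ZF ZF])
  have i2: "integrable (PM T) f2" unfolding f2_def
    by (intro Bochner_Integration.integrable_add iq[OF R(4) mF mF] iq[OF R(3) \<beta>F mF] iq[OF R(3) mF \<beta>F])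
  have i3: "integrable (PM T) (%z. payoff X u (fst z) (snd z))"
    unfolding payoff_def m_def[symmetric] v_def[symmetric]
    by (intro Bochner_Integration.integrable_add integrable_mult_right iq[OF coeff_cont(5) X X] iq[OF coeff_cont(12) mF mF] iq[OF coeff_cont(6) u X]
    iq[OF coeff_cont(13) vF mF] iq[OF coeff_cont(7) u u] iq[OF coeff_cont(14) vF vF])
  have icr: "integrable (PM T) cr" "(LINT z|PM T. cr z) = 0"
    using centered_inner[OF X a1F] centered_inner[OF u a2F] unfolding cr_def p_def q_def m_def v_def by simp_all
  have "AE z in PM T. payoff X u (fst z) (snd z) + f1 z + f2 z - cr z = defect X u z"
  proof -
    have "AE s in lam T. s \<in> {0..T} \<and> sqi M (u s)"
    using L2F_AE_sqi(1)[OF u] AE_space by eventually_elim (simp add: space_restrict_space)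
    from AE_lam_PM[OF this] show ?thesis
    proof eventually_elim
    case (elim z)
    define s where "s = fst z"
    define w where "w = snd z"
    have s: "s \<in> {0..T}" and us: "sqi M (u s)" using elim by (auto simp: s_def)
    have \<beta>: "\<beta> s = hA c s *v m s + hB c s *v v s"
    unfolding \<beta>_def b_def m_def v_def hA_def hB_def by (rule mean_drift[where X=X and u=u and t=s, OF XL[OF s] us])
    have bts: "bt s w = cA c s *v p s w + cB c s *v q s w"
    unfolding bt_def \<beta> b_def mf_def ctl_def hA_def hB_def p_def q_def m_def[symmetric] v_def[symmetric]
    by (simp add: mv.add_left mv.diff_right)
    have Zs: "Z s w = (cC c s *v p s w + cD c s *v q s w) + (hC c s *v m s + hD c s *v v s)"
    unfolding Z_def mf_def ctl_def hC_def hD_def p_def q_def m_def[symmetric] v_def[symmetric]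
    by (simp add: mv.add_left mv.diff_right)
    have Xs: "X s w = p s w + m s" and uu: "u s w = q s w + v s" by (simp_all add: p_def q_def)
    have d: "defect X u z = (q s w - Gam c s (P s) *v p s w) \<bullet> (K1 P s *v (q s w - Gam c s (P s) *v p s w))
    + (v s - hGam c s (P s) (Ph s) *v m s) \<bullet> (R2 P s *v (v s - hGam c s (P s) (Ph s) *v m s))"
    by (simp add: defect_def w1_def w2_def s_def w_def p_def q_def m_def v_def)
    have pay: "payoff X u s w = (cQ c s *v (p s w + m s)) \<bullet> (p s w + m s) + (tQ c s *v m s) \<bullet> m s + 2 * ((cS c s *v (q s w + v s)) \<bullet> (p s w + m s))
    + 2 * ((tS c s *v v s) \<bullet> m s) + (cR c s *v (q s w + v s)) \<bullet> (q s w + v s) + (tR c s *v v s) \<bullet> v s"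
    unfolding payoff_def m_def[symmetric] v_def[symmetric] Xs uu ..
    have "payoff X u s w + f1 z + f2 z = defect X u z + cr z"
    unfolding d R(15)[OF s, symmetric] R(16)[OF s, symmetric] f1_def f2_def cr_def s_def[symmetric] w_def[symmetric] a1_def a2_def k_def
    pay bts Zs \<beta>
    using pointwise_identity[where P=P and Ph="Ph s" and t=s, OF s R(7)[OF s] R(8)[OF s], where p="p s w" and q="q s w" and m="m s" and v="v s" and P'="Dt T P s" and Ph'="Dt T Ph s"]
    by linarith
    then show ?case by (simp add: s_def w_def)
    qed
  qed
  then have "(LINT z|PM T. defect X u z) = (LINT z|PM T. payoff X u (fst z) (snd z) + f1 z + f2 z - cr z)"
    using i1 i2 i3 icr(1) defect_integrable[OF u X] by (intro integral_cong_AE borel_measurable_integrable) auto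
  also have "\<dots> = (LINT z|PM T. payoff X u (fst z) (snd z)) + (LINT z|PM T. f1 z) + (LINT z|PM T. f2 z)"
    using i1 i2 i3 icr by simp
  finally have D: "(LINT z|PM T. defect X u z) = (LINT z|PM T. payoff X u (fst z) (snd z)) + (LINT z|PM T. f1 z) + (LINT z|PM T. f2 z)" .
  have jX: "integrable M (%w. (cG c *v f w) \<bullet> g w)" if "sqi M f" "sqi M g" for f g
    by (rule integrable_inner_sqi[OF sqi_bounded_linear[OF mv.bounded_linear_right that(1)] that(2)])
  have sm: "sqi M (%w. m T)" by (simp add: sqi_const finite_measure_axioms)
  have sp: "sqi M (p T)" unfolding p_def[abs_def] by (rule sqi_diff[OF XL[OF TT] sm])
  have p0: "(LINT w|M. p T w) = 0"
    using sqi_integrable_M[OF XL[OF TT]] by (simp add: p_def m_def mean_def prob_space)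
  have "(LINT w|M. (cG c *v X T w) \<bullet> X T w) = (LINT w|M. (cG c *v p T w) \<bullet> p T w + 2 * (p T w \<bullet> (cG c *v m T)) + (cG c *v m T) \<bullet> m T)"
  proof (intro Bochner_Integration.integral_cong refl)
    fix w
    have X: "X T w = p T w + m T" by (simp add: p_def)
    show "(cG c *v X T w) \<bullet> X T w = (cG c *v p T w) \<bullet> p T w + 2 * (p T w \<bullet> (cG c *v m T)) + (cG c *v m T) \<bullet> m T"
    unfolding X using symm_inner[OF coeff_symm(3), of "p T w" "m T"]
    by (simp add: mv.add_right inner_add_left inner_add_right inner_commute[of "p T w"])
  qed
  also have "\<dots> = (LINT w|M. (cG c *v p T w) \<bullet> p T w) + (cG c *v m T) \<bullet> m T"
    using jX[OF sp sp] sqi_integrable_M[OF sp] p0 by (simp add: prob_space)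
  finally have G: "(LINT w|M. (cG c *v X T w) \<bullet> X T w) = (LINT z|PM T. f1 z) + (cG c *v m T) \<bullet> m T" using e1 by simp
  have "(LINT w|M. (LINT t:{0..T}|lborel. payoff X u t w) + (cG c *v X T w) \<bullet> X T w + (tG c *v m T) \<bullet> m T)
    = (LINT w|M. (LINT t:{0..T}|lborel. payoff X u t w)) + (LINT w|M. (cG c *v X T w) \<bullet> X T w) + (tG c *v m T) \<bullet> m T"
    using integral_PM(4)[OF i3] jX[OF XL[OF TT] XL[OF TT]] by (simp add: prob_space)
  also have "\<dots> = (LINT z|PM T. payoff X u (fst z) (snd z)) + (LINT z|PM T. f1 z) + (hG c *v m T) \<bullet> m T"
    unfolding integral_PM(2)[OF i3] G hG_def by (simp add: mv.add_left inner_add_left)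
  also have "\<dots> = (Ph 0 *v x) \<bullet> x + (LINT z|PM T. defect X u z)"
    unfolding e2 D by simp
  finally show ?thesis unfolding m_def .
qed

lemma cost_eq:
  assumes u: "u \<in> L2F M T W"
  shows "cost M T W c x u = (Ph 0 *v x) \<bullet> x + (LINT z|PM T. defect (state M T W c x u) u z)"
  unfolding cost_def Let_def using payoff_integral[OF u state_is_state[OF u]] unfolding payoff_def .

lemma defect_nonneg: "AE z in PM T. 0 \<le> defect X u z \<and> (defect X u z = 0 \<longrightarrow> w1 X u (fst z) (snd z) = 0 \<and> w2 X u (fst z) (snd z) = 0)"
proof -
  obtain d1 where d1: "0 < d1" "\<And>t y. t \<in> {0..T} ==> d1 * (y \<bullet> y) \<le> y \<bullet> (K1 P t *v y)" using R(13) by blast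
  obtain d2 where d2: "0 < d2" "\<And>t y. t \<in> {0..T} ==> d2 * (y \<bullet> y) \<le> y \<bullet> (R2 P t *v y)" using R(14) by blast
  have "AE s in lam T. s \<in> {0..T}" using AE_space by eventually_elim (simp add: space_restrict_space)
  from AE_lam_PM[OF this] show ?thesis
  proof eventually_elim
    case (elim z)
    define y1 where "y1 = w1 X u (fst z) (snd z)"
    define y2 where "y2 = w2 X u (fst z) (snd z)"
    have le: "d1 * (y1 \<bullet> y1) + d2 * (y2 \<bullet> y2) \<le> defect X u z"
    using d1(2)[OF elim, of y1] d2(2)[OF elim, of y2] unfolding defect_def y1_def y2_def by linarith
    have n: "0 \<le> d1 * (y1 \<bullet> y1)" "0 \<le> d2 * (y2 \<bullet> y2)" using d1(1) d2(1) by simp_all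
    have "defect X u z = 0 \<longrightarrow> d1 * (y1 \<bullet> y1) = 0 \<and> d2 * (y2 \<bullet> y2) = 0" using le n by linarith
    moreover have "0 \<le> defect X u z" using le n by linarith
    ultimately show ?case using d1(1) d2(1) unfolding y1_def y2_def by simp
  qed
qed

end

end

section \<open>Optimality of the feedback\<close>

context bm_space
begin

lemma indistinguishable_mean:
  fixes X Y :: "real => 'w => 'a::euclidean_space"
  assumes L: "X \<in> L2FC M T W" "Y \<in> L2FC M T W" and XY: "indistinguishable M T X Y"
  shows "\<And>t. t \<in> {0..T} ==> mean M X t = mean M Y t" "eq_dtdP M T X Y"
proof -
  have ae: "AE h in M. X t h = Y t h" if "t \<in> {0..T}" for t
    using XY unfolding indistinguishable_def by eventually_elim (use that in blast)
  show "mean M X t = mean M Y t" if t: "t \<in> {0..T}" for t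
    unfolding mean_def
    by (rule integral_cong_AE[OF sqi_measurable[OF L2FC_sqi[OF L(1) t]] sqi_measurable[OF L2FC_sqi[OF L(2) t]] ae[OF t]])
  have D: "integrable (PM T) (%z. (norm (X (fst z) (snd z) - Y (fst z) (snd z)))\<^sup>2)"
    by (rule sqi_integrable[OF L2F_sqi_diff[OF L2FC_L2F[OF L(1)] L2FC_L2F[OF L(2)] T_mem]])
  have "pdist T X Y = (LINT s|lam T. (LINT h|M. (norm (X s h - Y s h))\<^sup>2))"
    unfolding pdist_def integral_PM(1)[where F="%s h. (norm (X s h - Y s h))\<^sup>2", OF D] set_integral_lam ..
  also have "\<dots> = 0"
  proof (rule integral_eq_zero_AE)
    show "AE s in lam T. (LINT h|M. (norm (X s h - Y s h))\<^sup>2) = 0"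
    using AE_space
    proof eventually_elim
    case (elim s)
    then have s: "s \<in> {0..T}" by (simp add: space_restrict_space)
    show ?case by (rule integral_eq_zero_AE) (use ae[OF s] in \<open>eventually_elim, simp\<close>)
    qed
  qed
  finally show "eq_dtdP M T X Y" using pdist_eq_0[OF L2FC_L2F[OF L(1)] L2FC_L2F[OF L(2)]] by blast
qed

lemma L2F_cong:
  fixes \<phi> \<psi> :: "real => 'w => 'a::euclidean_space"
  assumes \<phi>: "\<phi> \<in> L2F M T W" and eq: "\<And>t h. t \<in> {0..T} ==> \<phi> t h = \<psi> t h"
  shows "\<psi> \<in> L2F M T W"
  unfolding L2F_iff
proof
  show "progressive M T W \<psi>"
    unfolding progressive_def
  proof
    fix t assume t: "t \<in> {0..T}"
    have "(%(s, h). \<phi> s h) \<in> borel_measurable (restrict_space borel {0..t} \<Otimes>\<^sub>M filt M W t)"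
    using L2F_progressive[OF \<phi>] t unfolding progressive_def by blast
    then show "(%(s, h). \<psi> s h) \<in> borel_measurable (restrict_space borel {0..t} \<Otimes>\<^sub>M filt M W t)"
    by (rule measurable_cong[THEN iffD1, rotated]) (use t in \<open>auto simp: space_pair_measure space_restrict_space eq\<close>)
  qed
  have "sqi (PM T) (%z. \<phi> (fst z) (snd z))" using \<phi> by (simp add: L2F_iff)
  moreover have "\<phi> (fst z) (snd z) = \<psi> (fst z) (snd z)" if "z \<in> space (PM T)" for z
    using that by (intro eq) (auto simp: space_pair_measure space_restrict_space)
  ultimately show "sqi (PM T) (%z. \<psi> (fst z) (snd z))"
    unfolding sqi_def by (simp cong: measurable_cong Bochner_Integration.integrable_cong)
qed

lemma solves_sde_cong:
  fixes b b' Z Z' :: "real => 'w => real^'n"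
  assumes s: "solves_sde M T W x b Z X"
    and b: "\<And>t h. t \<in> {0..T} ==> b t h = b' t h" and Z: "\<And>t h. t \<in> {0..T} ==> Z t h = Z' t h"
  shows "solves_sde M T W x b' Z' X"
proof -
  obtain I where X: "X \<in> L2FC M T W" and I: "has_ito_integral M T W Z I"
    and ae: "AE h in M. \<forall>t\<in>{0..T}. X t h = x + (LINT s:{0..t}|lborel. b s h) + I t h"
    using s unfolding solves_sde_def by blast
  have Z': "Z' \<in> L2F M T W" by (rule L2F_cong[OF has_itoD(2)[OF I] Z])
  have n: "(\<integral>\<^sup>+h. (\<integral>\<^sup>+t\<in>{0..T}. ennreal ((norm (f t h - Z' t h))\<^sup>2) \<partial>lborel) \<partial>M)
    = (\<integral>\<^sup>+h. (\<integral>\<^sup>+t\<in>{0..T}. ennreal ((norm (f t h - Z t h))\<^sup>2) \<partial>lborel) \<partial>M)" for f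
    by (intro nn_integral_cong) (simp add: Z split: split_indicator)
  have "has_ito_integral M T W Z' I"
    using I Z' unfolding has_ito_integral_def n by simp
  moreover have "(LINT s:{0..t}|lborel. b' s h) = (LINT s:{0..t}|lborel. b s h)" if "t \<in> {0..T}" for t h
    by (rule set_lebesgue_integral_cong) (use that b in auto)
  ultimately show ?thesis using X ae unfolding solves_sde_def by auto
qed

lemma indistinguishable_trans:
  assumes "indistinguishable M T X Y" "indistinguishable M T Y Z"
  shows "indistinguishable M T X Z"
  using assms unfolding indistinguishable_def by eventually_elim simp

end

context mflq_bm
begin

context
  fixes P Ph :: "real => real^'n^'n"
  assumes ric: "riccati_system T c P Ph"
begin

lemmas R' = riccati_systemD[OF ric]

definition cl :: "(real => real^'n^'n) => (real => real^'m^'n) => real => real^'n^'n" where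
  "cl A N t = A t + N t ** Gam c t (P t)"
definition cl' :: "(real => real^'n^'n) => (real => real^'n^'n) => (real => real^'m^'n) => (real => real^'m^'n) => real => real^'n^'n" where
  "cl' A A' N N' t = (A t + A' t + (N t + N' t) ** hGam c t (P t) (Ph t)) - cl A N t"
definition err :: "(real => real^'m^'n) => (real => real^'m^'n) => (real => 'w => real^'n) => (real => 'w => real^'m) => real => 'w => real^'n" where
  "err N N' X u t h = N t *v (w1 P X u t h + w2 P Ph X u t h) + N' t *v w2 P Ph X u t h"
definition fb :: "(real => 'w => real^'n) => real => 'w => real^'m" where
  "fb X t h = Gam c t (P t) *v (X t h - mean M X t) + hGam c t (P t) (Ph t) *v mean M X t"

lemma fb_decomp: "u t h = w1 P X u t h + w2 P Ph X u t h + fb X t h"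
  by (simp add: w1_def[OF ric] w2_def[OF ric] fb_def)

lemma mf_closed: "mf A A' (ctl N N' u) X t h = mf (cl A N) (cl' A A' N N') (err N N' X u) X t h"
  by (simp add: mf_def ctl_def cl_def cl'_def err_def w1_def[OF ric] w2_def[OF ric] mv.add_left mv.add_right mv.diff_left mv.diff_right
    matrix_vector_mul_assoc[symmetric])

lemma cl_cont:
  assumes "continuous_on {0..T} A" "continuous_on {0..T} A'" "continuous_on {0..T} N" "continuous_on {0..T} N'"
  shows "continuous_on {0..T} (cl A N)" "continuous_on {0..T} (cl' A A' N N')"
  unfolding cl'_def[abs_def] cl_def[abs_def]
  by (intro continuous_on_add continuous_on_diff continuous_matrix_intros R'(11,12) assms)+

lemmas clA = cl_cont[OF coeff_cont(1,8,2,9)] and clC = cl_cont[OF coeff_cont(3,10,4,11)]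

lemma closed_loop_iff: "closed_loop_state M T W c P Ph x X \<longleftrightarrow>
  solves_sde M T W x (mf (cl (cA c) (cB c)) (cl' (cA c) (tA c) (cB c) (tB c)) (%_ _. 0) X)
    (mf (cl (cC c) (cD c)) (cl' (cC c) (tC c) (cD c) (tD c)) (%_ _. 0) X) X"
proof -
  have *: "mf (cl A N) (cl' A A' N N') (%_ _. 0) X = (%t h. (A t + N t ** Gam c t (P t)) *v (X t h - mean M X t)
    + (A t + A' t + (N t + N' t) ** hGam c t (P t) (Ph t)) *v mean M X t)" for A A' N N'
    by (intro ext) (simp add: mf_def cl_def cl'_def mv.add_left mv.diff_left mv.diff_right)
  show ?thesis unfolding closed_loop_state_def * hA_def hB_def hC_def hD_def ..
qed

lemma err_L2F:
  assumes "u \<in> L2F M T W" "X \<in> L2F M T W" "continuous_on {0..T} N" "continuous_on {0..T} N'"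
  shows "err N N' X u \<in> L2F M T W"
  unfolding err_def[abs_def]
  by (intro L2F_add L2F_matrix[OF assms(3)] L2F_matrix[OF assms(4)] w_L2F[OF ric assms(1,2)])

lemma fb_L2F: "X \<in> L2F M T W ==> fb X \<in> L2F M T W"
  unfolding fb_def[abs_def] by (intro L2F_add L2F_diff L2F_mean L2F_matrix[OF R'(11)] L2F_matrix[OF R'(12)])

lemma fb_defect:
  assumes X: "X \<in> L2FC M T W" and t: "t \<in> {0..T}"
  shows "w1 P X (fb X) t h = 0" "w2 P Ph X (fb X) t h = 0"
proof -
  have "mean M (fb X) t = (LINT h|M. Gam c t (P t) *v X t h + (hGam c t (P t) (Ph t) *v mean M X t - Gam c t (P t) *v mean M X t))"
    unfolding mean_def[of M "fb X"] fb_def by (simp add: mv.diff_right algebra_simps)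
  also have "\<dots> = hGam c t (P t) (Ph t) *v mean M X t"
    using integral_matrix[OF L2FC_sqi[OF X t], of "Gam c t (P t)"] by (simp add: prob_space mean_def[of M X])
  finally have "mean M (fb X) t = hGam c t (P t) (Ph t) *v mean M X t" .
  then show "w1 P X (fb X) t h = 0" "w2 P Ph X (fb X) t h = 0"
    by (simp_all add: w1_def[OF ric] w2_def[OF ric] fb_def)
qed

lemma closed_loop_unique:
  assumes X: "closed_loop_state M T W c P Ph x X" and u: "u \<in> L2F M T W" and Y: "is_state M T W c x u Y"
    and w: "AE z in PM T. w1 P Y u (fst z) (snd z) = 0 \<and> w2 P Ph Y u (fst z) (snd z) = 0"
  shows "indistinguishable M T Y X"
proof -
  have YF: "Y \<in> L2F M T W" using Y by (auto simp: is_state_def solves_sde_def intro: L2FC_L2F)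
  have e: "eq_dtdP M T (err N N' Y u) (%_ _. 0)" for N N'
    unfolding eq_dtdP_iff using w by eventually_elim (simp add: err_def)
  have Y': "solves_sde M T W x (mf (cl (cA c) (cB c)) (cl' (cA c) (tA c) (cB c) (tB c)) (err (cB c) (tB c) Y u) Y)
    (mf (cl (cC c) (cD c)) (cl' (cC c) (tC c) (cD c) (tD c)) (err (cD c) (tD c) Y u) Y) Y"
    using Y unfolding is_state_iff by (rule solves_sde_cong) (rule mf_closed)+
  show ?thesis
    by (rule mf_sde_unique[OF clA clC err_L2F[OF u YF coeff_cont(2,9)] L2FC_L2F[OF L2FC_const]
    err_L2F[OF u YF coeff_cont(4,11)] L2FC_L2F[OF L2FC_const] e e Y' X[unfolded closed_loop_iff]])
qed

lemma feedback_optimal: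
  "\<exists>X u. optimal_pair M T W c x X u \<and>
    (\<forall>X' u'. optimal_pair M T W c x X' u' \<longrightarrow> indistinguishable M T X' X \<and> eq_dtdP M T u' u) \<and>
    eq_dtdP M T u (%t h. Gam c t (P t) *v (X t h - mean M X t) + hGam c t (P t) (Ph t) *v mean M X t) \<and>
    closed_loop_state M T W c P Ph x X \<and>
    (\<forall>Y. closed_loop_state M T W c P Ph x Y \<longrightarrow> indistinguishable M T Y X)"
proof -
  note z0 = L2FC_L2F[OF L2FC_const[of "0 :: real^'n"]]
  obtain X where X: "closed_loop_state M T W c P Ph x X"
    using mf_sde_exists[OF clA clC z0 z0] unfolding closed_loop_iff by blast
  then have XC: "X \<in> L2FC M T W" by (simp add: closed_loop_iff solves_sde_def)
  note XF = L2FC_L2F[OF XC]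
  define u where "u = fb X"
  have uF: "u \<in> L2F M T W" unfolding u_def by (rule fb_L2F[OF XF])
  have st: "is_state M T W c x u X"
    using X unfolding closed_loop_iff is_state_iff
    by (rule solves_sde_cong) (simp_all add: mf_closed, simp_all add: mf_def err_def u_def fb_defect[OF XC])
  have clu: "indistinguishable M T Y X" if "closed_loop_state M T W c P Ph x Y" for Y
    by (rule mf_sde_unique[OF clA clC z0 z0 z0 z0 _ _ that[unfolded closed_loop_iff] X[unfolded closed_loop_iff]])
    (simp_all add: eq_dtdP_def)
  define q where "q = (Ph 0 *v x) \<bullet> x"
  have stL: "state M T W c x v \<in> L2FC M T W" if "v \<in> L2F M T W" for v
    using state_is_state[OF that, of x] by (simp add: is_state_def solves_sde_def)
  have cost: "cost M T W c x v = q + (LINT z|PM T. defect P Ph (state M T W c x v) v z)" if "v \<in> L2F M T W" for v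
    unfolding q_def by (rule cost_eq[OF ric that])
  have ge: "q \<le> cost M T W c x v" if "v \<in> L2F M T W" for v
    unfolding cost[OF that] using defect_nonneg[OF ric] by (simp add: integral_nonneg_AE)
  have cu: "cost M T W c x u = q"
  proof -
    define Y where "Y = state M T W c x u"
    have YC: "Y \<in> L2FC M T W" unfolding Y_def by (rule stL[OF uF])
    have i: "indistinguishable M T Y X"
    unfolding Y_def by (rule state_unique[OF uF state_is_state[OF uF] st])
    note m = indistinguishable_mean[OF YC XC i]
    have "AE s in lam T. s \<in> {0..T}" using AE_space by eventually_elim (simp add: space_restrict_space)
    from AE_lam_PM[OF this] m(2)[unfolded eq_dtdP_iff]
    have "AE z in PM T. defect P Ph Y u z = 0"
    proof eventually_elim
    case (elim z)
    have "w1 P Y u (fst z) (snd z) = w1 P X u (fst z) (snd z)" "w2 P Ph Y u (fst z) (snd z) = w2 P Ph X u (fst z) (snd z)"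
    using elim m(1)[OF elim(1)] by (simp_all add: w1_def[OF ric] w2_def[OF ric])
    then show ?case using fb_defect[OF XC elim(1)] by (simp add: defect_def[OF ric] u_def)
    qed
    then show ?thesis unfolding cost[OF uF] Y_def[symmetric] by (simp add: integral_eq_zero_AE)
  qed
  have bdd: "bdd_below (cost M T W c x ` L2F M T W)" by (rule bdd_belowI2[of _ q]) (rule ge)
  have inf: "(INF v\<in>L2F M T W. cost M T W c x v) = q"
    by (rule cInf_eq_minimum) (use uF cu ge in auto)
  have opt: "optimal_pair M T W c x X u"
    unfolding optimal_pair_def optimal_control_def using uF bdd inf cu st by simp
  have uni: "indistinguishable M T X' X \<and> eq_dtdP M T u' u" if o: "optimal_pair M T W c x X' u'" for X' u'
  proof -
    have u': "u' \<in> L2F M T W" and st': "is_state M T W c x u' X'" and c': "cost M T W c x u' = q"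
    using o inf by (auto simp: optimal_pair_def optimal_control_def)
    define Y where "Y = state M T W c x u'"
    have YC: "Y \<in> L2FC M T W" and Y: "is_state M T W c x u' Y" unfolding Y_def by (rule stL[OF u'] state_is_state[OF u'])+
    have i0: "(LINT z|PM T. defect P Ph Y u' z) = 0" using cost[OF u'] c' by (simp add: Y_def)
    have nn: "AE z in PM T. 0 \<le> defect P Ph Y u' z" using defect_nonneg[OF ric] by eventually_elim blast
    have "AE z in PM T. defect P Ph Y u' z = 0"
    using integral_nonneg_eq_0_iff_AE[OF defect_integrable[OF ric u' L2FC_L2F[OF YC]] nn] i0 by blast
    with defect_nonneg[OF ric, of Y u'] have w: "AE z in PM T. w1 P Y u' (fst z) (snd z) = 0 \<and> w2 P Ph Y u' (fst z) (snd z) = 0"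
    by eventually_elim blast
    have YX: "indistinguishable M T Y X" by (rule closed_loop_unique[OF X u' Y w])
    note m = indistinguishable_mean[OF YC XC YX]
    have "AE s in lam T. s \<in> {0..T}" using AE_space by eventually_elim (simp add: space_restrict_space)
    from AE_lam_PM[OF this] m(2)[unfolded eq_dtdP_iff] w
    have "AE z in PM T. u' (fst z) (snd z) = u (fst z) (snd z)"
    proof eventually_elim
    case (elim z)
    have "u' (fst z) (snd z) = fb Y (fst z) (snd z)" using fb_decomp[of u' "fst z" "snd z" Y] elim(3) by simp
    then show ?case using elim(2) m(1)[OF elim(1)] by (simp add: u_def fb_def)
    qed
    then have "eq_dtdP M T u' u" unfolding eq_dtdP_iff .
    moreover have "indistinguishable M T X' X"
    by (rule indistinguishable_trans[OF state_unique[OF u' st' Y] YX])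
    ultimately show ?thesis by blast
  qed
  have "eq_dtdP M T u (%t h. Gam c t (P t) *v (X t h - mean M X t) + hGam c t (P t) (Ph t) *v mean M X t)"
    by (simp add: eq_dtdP_def u_def fb_def)
  with opt uni X clu show ?thesis by blast
qed

end

end

theorem theorem4p5:
  fixes M :: "'w measure" and T :: real and W :: "real \<Rightarrow> 'w \<Rightarrow> real"
    and c :: "('n::finite, 'm::finite) mflq"
  assumes "prob_space M" and "complete_measure M" and "0 < T"
    and "brownian_motion M T W"
    and "admissible_coeffs T c"
    and "\<exists>H K. relaxed_compensator T c H K"
  shows "\<exists>P Ph. riccati_system T c P Ph \<and>
    (\<forall>P' Ph'. riccati_system T c P' Ph' \<longrightarrow> (\<forall>t\<in>{0..T}. P' t = P t \<and> Ph' t = Ph t)) \<and>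
    (\<forall>x. \<exists>X u. optimal_pair M T W c x X u \<and>
       (\<forall>X' u'. optimal_pair M T W c x X' u' \<longrightarrow>
          indistinguishable M T X' X \<and> eq_dtdP M T u' u) \<and>
       eq_dtdP M T u (\<lambda>t \<omega>. Gam c t (P t) *v (X t \<omega> - mean M X t)
                        + hGam c t (P t) (Ph t) *v mean M X t) \<and>
       closed_loop_state M T W c P Ph x X \<and>
       (\<forall>Y. closed_loop_state M T W c P Ph x Y \<longrightarrow> indistinguishable M T Y X))"
proof -
  interpret bm_space M T W using assms(1-4) by (simp add: bm_space_def bm_space_axioms_def)
  interpret mflq_bm M T W c
    by (intro mflq_bm.intro bm_space_axioms mflq_data.intro assms(3,5))
  obtain H K where "relaxed_compensator T c H K" using assms(6) by blast
  from riccati_system_exists[OF this] obtain P Ph where ric: "riccati_system T c P Ph" by blast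
  show ?thesis
    using ric riccati_system_unique[OF ric] feedback_optimal[OF ric] by blast
qed

end
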